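(* Fix $k>0$ and a known background $\rho\in L^\infty(\mathbb{R}^2)$ with $\rho-1$ compactly supported. For each $j=1,2$, let $(f^{(j)},\Sigma_j)$ be a polygonal source such that all boundary points of $\Sigma_j$ are admissible 1-split for $f^{(j)}$. If $(f^{(1)},\Sigma_1)$ and $(f^{(2)},\Sigma_2)$ produce the same far-field pattern, then any vertex $x'$ of $\Sigma_1$ (resp. of $\Sigma_2$) that lies on $\partial\Sigma_1\cup\partial\Sigma_2$ and connects to infinity in the exterior of $\Sigma_1\cup\Sigma_2$ must also be a vertex of $\Sigma_2$ (resp. of $\Sigma_1$). Moreover, the bisector angle $\beta_j$ and aperture $\omega_j$ of the corner of $\Sigma_j$ at $x'$, $j=1,2$, satisfy, for some $m\in\mathbb{Z}$, $$\beta_1=\beta_2+\frac{m\pi}{2}\qquad\text{and}\qquad p_1\sin\omega_1=(-1)^m p_2\sin\omega_2,$$ where $p_j$ is the limiting value of $f^{(j)}$ in the corner of $\Sigma_j$ at $x'$, $j=1,2$.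
   Context: Source scattering problem: $u_{\mathrm{sc}}\in H^1_{\mathrm{loc}}(\mathbb{R}^2)$ is the unique solution of $\Delta u_{\mathrm{sc}}+k^2\rho u_{\mathrm{sc}}=f$ in $\mathbb{R}^2$ satisfying the Sommerfeld radiation condition $\lim_{r\to\infty} r^{1/2}(\partial_r u_{\mathrm{sc}}-ik u_{\mathrm{sc}})=0$, $r=|x|$, uniformly in all directions $\hat x=x/r\in\mathbb{S}^1$. The far-field pattern $u_\infty$ is defined by $u_{\mathrm{sc}}(x)=|x|^{-1/2}e^{ik|x|}(u_\infty(\hat x)+O(|x|^{-1}))$ as $|x|\to\infty$. A source is a compactly supported real-valued $f\in L^2(\mathbb{R}^2)$, also written $(f,\Sigma)$ with $\Sigma=\mathrm{supp}_t f$. The total support is $\mathrm{supp}_t f:=\mathbb{R}^2\setminus G$, where $G$ is the unbounded connected component of $\mathbb{R}^2\setminus\mathrm{supp} f$. It is assumed for every source that $\overline{\Sigma^\circ}=\Sigma$, where $\Sigma^\circ$ is the interior of $\Sigma$. A source is polygonal if $\Sigma$ is a union of finitely many disjoint (possibly concave) polygons; vertices of $\Sigma$ are the vertices of these polygons. Circular wedge: for $R>0$ and $\theta_0,\theta_1\in[-\pi,\pi)$ with $0<\theta_1-\theta_0<2\pi$, in polar coordinates $\mathcal{K}_{\theta_0,\theta_1,R}:=\{x\in\mathbb{R}^2:\theta_0<\theta<\theta_1,\ 0<r<R\}$. A source $(f,\Sigma)$ has a corner $\mathcal{K}$ if, up to a rigid change of coordinates (placing the corner tip at $0$), $0\in\partial\Sigma^\circ$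 and $B_R(0)\cap\Sigma^\circ=\mathcal{K}=\mathcal{K}_{\theta_0,\theta_1,R}$ for some $R>0$; its aperture is $\omega=\theta_1-\theta_0$. The corner is 1-split for $f$ with limiting value $p\in\mathbb{R}$ if $|f(x)-p|\le C|x|^{\alpha}$ a.e. in $\mathcal{K}$ for some constants $C,\alpha>0$. A 1-split corner is admissible if its limiting value $p$ is nonzero and its aperture satisfies $\omega\neq\pi$. A boundary point of $\Sigma$ is admissible 1-split for $f$ if it is the tip of an admissible 1-split corner of $f$. The point $x'$ connects to infinity in the exterior of $\Sigma_1\cup\Sigma_2$ if it lies on the boundary of the unbounded connected component of $\mathbb{R}^2\setminus(\Sigma_1\cup\Sigma_2)$. Bisector angle: in common polar coordinates centered at $x'$, if the corner of $\Sigma_j$ at $x'$ is the sector $\theta_{j,0}<\theta<\theta_{j,1}$, then $\omega_j=\theta_{j,1}-\theta_{j,0}$ and $\beta_j=(\theta_{j,0}+\theta_{j,1})/2$. *)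

theory Defs
  imports "HOL-Analysis.Analysis" "HOL-Library.Landau_Symbols"
begin

section \<open>Function spaces\<close>

text \<open>Functions are honest functions on the plane standing for their classes modulo null sets,
  so the support is the essential one: the complement of the largest open set
  on which the function vanishes almost everywhere.\<close>

definition ess_support :: "(real^2 \<Rightarrow> 'b::zero) \<Rightarrow> (real^2) set" where
  "ess_support f = {x. \<forall>U. open U \<and> x \<in> U \<longrightarrow> \<not> (AE y in lebesgue. y \<in> U \<longrightarrow> f y = 0)}"

definition L2 :: "(real^2 \<Rightarrow> real) \<Rightarrow> bool" where
  "L2 f \<longleftrightarrow> f \<in> borel_measurable lebesgue \<and> integrable lebesgue (\<lambda>x. (f x)\<^sup>2)"

definition L2_loc :: "(real^2 \<Rightarrow> complex) \<Rightarrow> bool" where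
  "L2_loc u \<longleftrightarrow> u \<in> borel_measurable lebesgue \<and>
     (\<forall>K. compact K \<longrightarrow> set_integrable lebesgue K (\<lambda>x. (norm (u x))\<^sup>2))"

definition Linfty :: "(real^2 \<Rightarrow> complex) \<Rightarrow> bool" where
  "Linfty \<rho> \<longleftrightarrow> \<rho> \<in> borel_measurable lebesgue \<and> (\<exists>M. AE x in lebesgue. norm (\<rho> x) \<le> M)"

definition partial_deriv :: "2 \<Rightarrow> (real^2 \<Rightarrow> real) \<Rightarrow> real^2 \<Rightarrow> real" where
  "partial_deriv i \<phi> x = frechet_derivative \<phi> (at x) (axis i 1)"

primrec Ck :: "nat \<Rightarrow> (real^2 \<Rightarrow> real) \<Rightarrow> bool" where
  "Ck 0 \<phi> \<longleftrightarrow> continuous_on UNIV \<phi>"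
| "Ck (Suc n) \<phi> \<longleftrightarrow> (\<forall>x. \<phi> differentiable (at x)) \<and> (\<forall>i. Ck n (partial_deriv i \<phi>))"

text \<open>Real-valued test functions suffice, since the identities tested below are complex linear
  in the test function.\<close>

definition test_function :: "(real^2 \<Rightarrow> real) \<Rightarrow> bool" where
  "test_function \<phi> \<longleftrightarrow> (\<forall>n. Ck n \<phi>) \<and> compact (closure {x. \<phi> x \<noteq> 0})"

definition weak_gradient :: "(real^2 \<Rightarrow> complex) \<Rightarrow> (real^2 \<Rightarrow> complex^2) \<Rightarrow> bool" where
  "weak_gradient u G \<longleftrightarrow> (\<forall>\<phi> i. test_function \<phi> \<longrightarrow>
     (\<integral>x. u x * of_real (partial_deriv i \<phi> x) \<partial>lebesgue)
       = - (\<integral>x. G x $ i * of_real (\<phi> x) \<partial>lebesgue))"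

definition H1_loc_gradient :: "(real^2 \<Rightarrow> complex) \<Rightarrow> (real^2 \<Rightarrow> complex^2) \<Rightarrow> bool" where
  "H1_loc_gradient u G \<longleftrightarrow> L2_loc u \<and> (\<forall>i. L2_loc (\<lambda>x. G x $ i)) \<and> weak_gradient u G"


section \<open>The source scattering problem\<close>

text \<open>\<open>u\<close> is in \<open>H\<^sup>1\<^sub>l\<^sub>o\<^sub>c\<close> and \<open>\<Delta>u + k\<^sup>2\<rho>u = f\<close> weakly in the whole plane.\<close>

definition weak_solution ::
    "real \<Rightarrow> (real^2 \<Rightarrow> complex) \<Rightarrow> (real^2 \<Rightarrow> real) \<Rightarrow> (real^2 \<Rightarrow> complex) \<Rightarrow> bool" where
  "weak_solution k \<rho> f u \<longleftrightarrow> (\<exists>G. H1_loc_gradient u G \<and>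
     (\<forall>\<phi>. test_function \<phi> \<longrightarrow>
        - (\<integral>x. (\<Sum>i\<in>UNIV. G x $ i * of_real (partial_deriv i \<phi> x)) \<partial>lebesgue)
        + of_real (k\<^sup>2) * (\<integral>x. \<rho> x * u x * of_real (\<phi> x) \<partial>lebesgue)
        = of_real (\<integral>x. f x * \<phi> x \<partial>lebesgue)))"

definition radial_deriv :: "(real^2 \<Rightarrow> complex) \<Rightarrow> real^2 \<Rightarrow> complex" where
  "radial_deriv u x = frechet_derivative u (at x) (x /\<^sub>R norm x)"

text \<open>Outside a large disc a solution is smooth after modification on a null set; the condition
  selects that representative. The filter \<open>at_infinity\<close> gives uniformity in all directions.\<close>

definition sommerfeld_radiating :: "real \<Rightarrow> (real^2 \<Rightarrow> complex) \<Rightarrow> bool" where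
  "sommerfeld_radiating k u \<longleftrightarrow>
     (\<forall>\<^sub>F x in at_infinity. u differentiable (at x)) \<and>
     ((\<lambda>x. of_real (sqrt (norm x)) * (radial_deriv u x - \<i> * of_real k * u x)) \<longlongrightarrow> 0) at_infinity"

text \<open>Only the values of \<open>g\<close> on the unit circle are constrained.\<close>

definition far_field_pattern :: "real \<Rightarrow> (real^2 \<Rightarrow> complex) \<Rightarrow> (real^2 \<Rightarrow> complex) \<Rightarrow> bool" where
  "far_field_pattern k u g \<longleftrightarrow>
     (\<exists>h. h \<in> O[at_infinity](\<lambda>x. of_real (1 / norm x)) \<and>
        (\<forall>\<^sub>F x in at_infinity. u x =
           of_real (norm x powr (-1/2)) * exp (\<i> * of_real (k * norm x)) * (g (x /\<^sub>R norm x) + h x)))"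

definition produces_far_field ::
    "real \<Rightarrow> (real^2 \<Rightarrow> complex) \<Rightarrow> (real^2 \<Rightarrow> real) \<Rightarrow> (real^2 \<Rightarrow> complex) \<Rightarrow> bool" where
  "produces_far_field k \<rho> f g \<longleftrightarrow>
     (\<exists>u. weak_solution k \<rho> f u \<and> sommerfeld_radiating k u \<and> far_field_pattern k u g)"


section \<open>Sources\<close>

text \<open>For a bounded set \<open>S\<close> in the plane, \<open>outside S\<close> is the unbounded connected component of
  its complement.\<close>

definition total_support :: "(real^2 \<Rightarrow> real) \<Rightarrow> (real^2) set" where
  "total_support f = - outside (ess_support f)"

definition is_source :: "(real^2 \<Rightarrow> real) \<Rightarrow> bool" where
  "is_source f \<longleftrightarrow> L2 f \<and> compact (ess_support f) \<and>
     closure (interior (total_support f)) = total_support f"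

definition connects_to_infinity :: "real^2 \<Rightarrow> (real^2) set \<Rightarrow> bool" where
  "connects_to_infinity x S \<longleftrightarrow> x \<in> frontier (outside S)"


section \<open>Polygons\<close>

fun polygonal_path :: "(real^2) list \<Rightarrow> real \<Rightarrow> real^2" where
  "polygonal_path [] = linepath 0 0"
| "polygonal_path [a] = linepath a a"
| "polygonal_path [a, b] = linepath a b"
| "polygonal_path (a # b # c # vs) = linepath a b +++ polygonal_path (b # c # vs)"

definition polygon_boundary :: "(real^2) list \<Rightarrow> (real^2) set" where
  "polygon_boundary vs = path_image (polygonal_path (vs @ [hd vs]))"

definition polygon_region :: "(real^2) list \<Rightarrow> (real^2) set" where
  "polygon_region vs = polygon_boundary vs \<union> inside (polygon_boundary vs)"

text \<open>A polygon is given by the list of its vertices in cyclic order. Consecutive vertices are not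
  collinear, so straight angles do not count as vertices and the vertices are determined by the
  region.\<close>

definition is_polygon :: "(real^2) list \<Rightarrow> bool" where
  "is_polygon vs \<longleftrightarrow> 3 \<le> length vs \<and> simple_path (polygonal_path (vs @ [hd vs])) \<and>
     (\<forall>i < length vs. \<not> collinear
        {vs ! i, vs ! (Suc i mod length vs), vs ! (Suc (Suc i) mod length vs)})"

definition polygon_decomposition :: "(real^2) set \<Rightarrow> (real^2) list set \<Rightarrow> bool" where
  "polygon_decomposition S P \<longleftrightarrow> finite P \<and> (\<forall>vs\<in>P. is_polygon vs) \<and>
     disjoint_family_on polygon_region P \<and> S = (\<Union>vs\<in>P. polygon_region vs)"

definition polygonal :: "(real^2) set \<Rightarrow> bool" where
  "polygonal S \<longleftrightarrow> (\<exists>P. polygon_decomposition S P)"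

definition is_vertex :: "(real^2) set \<Rightarrow> real^2 \<Rightarrow> bool" where
  "is_vertex S x \<longleftrightarrow> (\<exists>P. polygon_decomposition S P \<and> (\<exists>vs\<in>P. x \<in> set vs))"


section \<open>Corners\<close>

text \<open>Polar coordinates are centred at the tip \<open>x\<close>. The angles are arbitrary reals with
  \<open>0 < \<theta>\<^sub>1 - \<theta>\<^sub>0 < 2\<pi>\<close>, not only numbers in \<open>[-\<pi>, \<pi>)\<close>: this absorbs the rigid change of coordinates
  (a sector may cross the branch cut), and lets two corners with the same tip be measured in common
  polar coordinates.\<close>

definition circular_wedge :: "real^2 \<Rightarrow> real \<Rightarrow> real \<Rightarrow> real \<Rightarrow> (real^2) set" where
  "circular_wedge x \<theta>\<^sub>0 \<theta>\<^sub>1 R =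
     {x + r *\<^sub>R vector [cos \<theta>, sin \<theta>] | r \<theta>. \<theta>\<^sub>0 < \<theta> \<and> \<theta> < \<theta>\<^sub>1 \<and> 0 < r \<and> r < R}"

definition is_corner :: "(real^2) set \<Rightarrow> real^2 \<Rightarrow> real \<Rightarrow> real \<Rightarrow> real \<Rightarrow> bool" where
  "is_corner S x \<theta>\<^sub>0 \<theta>\<^sub>1 R \<longleftrightarrow> 0 < R \<and> 0 < \<theta>\<^sub>1 - \<theta>\<^sub>0 \<and> \<theta>\<^sub>1 - \<theta>\<^sub>0 < 2 * pi \<and>
     x \<in> frontier (interior S) \<and> ball x R \<inter> interior S = circular_wedge x \<theta>\<^sub>0 \<theta>\<^sub>1 R"

definition aperture :: "real \<Rightarrow> real \<Rightarrow> real" where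
  "aperture \<theta>\<^sub>0 \<theta>\<^sub>1 = \<theta>\<^sub>1 - \<theta>\<^sub>0"

definition bisector_angle :: "real \<Rightarrow> real \<Rightarrow> real" where
  "bisector_angle \<theta>\<^sub>0 \<theta>\<^sub>1 = (\<theta>\<^sub>0 + \<theta>\<^sub>1) / 2"

definition one_split_corner ::
    "(real^2 \<Rightarrow> real) \<Rightarrow> real^2 \<Rightarrow> real \<Rightarrow> real \<Rightarrow> real \<Rightarrow> bool" where
  "one_split_corner f x \<theta>\<^sub>0 \<theta>\<^sub>1 p \<longleftrightarrow> (\<exists>R. is_corner (total_support f) x \<theta>\<^sub>0 \<theta>\<^sub>1 R \<and>
     (\<exists>C \<alpha>. 0 < C \<and> 0 < \<alpha> \<and>
        (AE y in lebesgue. y \<in> circular_wedge x \<theta>\<^sub>0 \<theta>\<^sub>1 R \<longrightarrow> \<bar>f y - p\<bar> \<le> C * norm (y - x) powr \<alpha>)))"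

definition one_split_point :: "(real^2 \<Rightarrow> real) \<Rightarrow> real^2 \<Rightarrow> bool" where
  "one_split_point f x \<longleftrightarrow> (\<exists>\<theta>\<^sub>0 \<theta>\<^sub>1 p. one_split_corner f x \<theta>\<^sub>0 \<theta>\<^sub>1 p)"

definition admissible_one_split_point :: "(real^2 \<Rightarrow> real) \<Rightarrow> real^2 \<Rightarrow> bool" where
  "admissible_one_split_point f x \<longleftrightarrow>
     (\<exists>\<theta>\<^sub>0 \<theta>\<^sub>1 p. one_split_corner f x \<theta>\<^sub>0 \<theta>\<^sub>1 p \<and> p \<noteq> 0 \<and> aperture \<theta>\<^sub>0 \<theta>\<^sub>1 \<noteq> pi)"

text \<open>A boundary point in the relative interior of an edge is the tip of a corner of aperture \<open>\<pi>\<close>,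
  so it can be 1-split but never admissible. Requiring admissibility at literally every boundary
  point would therefore exclude every nonempty polygonal set. The condition is read as: every
  boundary point is 1-split, and the corners at the vertices are admissible.\<close>

definition boundary_admissible_one_split :: "(real^2 \<Rightarrow> real) \<Rightarrow> bool" where
  "boundary_admissible_one_split f \<longleftrightarrow>
     (\<forall>x\<in>frontier (total_support f). one_split_point f x \<and>
        (is_vertex (total_support f) x \<longrightarrow> admissible_one_split_point f x))"

end

theory Submission
  imports Defs
begin

text \<open>The difference \<open>w\<close> of the two scattered fields is of order \<open>o(|x|\<^sup>-\<^sup>1\<^sup>/\<^sup>2)\<close>, so it vanishes far out by
  Rellich's lemma and, by unique continuation (a Carleman inequality), in the unbounded component
  of the complement of both supports. Near the point \<open>x'\<close> on its boundary \<open>w\<close> therefore vanishes in a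
  cone, which forces \<open>w = o(1)\<close> on average at \<open>x'\<close>. Testing \<open>\<Delta>w + k\<^sup>2\<rho>w = f\<^sub>1 - f\<^sub>2\<close> with truncations of
  \<open>(z - x')\<^sup>-\<^sup>2\<close>, whose pole is moved into the cone, only the homogeneous leading parts \<open>p\<^sub>j\<close> times the
  indicator of the sector survive: they have the same moment against \<open>(z - x')\<^sup>-\<^sup>2\<close> on an annulus. That
  moment is a common nonzero constant times \<open>p\<^sub>j sin \<omega>\<^sub>j exp (- 2 \<i> \<beta>\<^sub>j)\<close>, and it is \<open>0\<close> if \<open>x'\<close> is not
  in the support. At a vertex it is nonzero by admissibility, while at other boundary points
  \<open>\<omega>\<^sub>j = \<pi>\<close> makes it zero.\<close>

section \<open>Smooth functions on open subsets of the plane\<close>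

text \<open>The exponent -2 is forced by scaling. In the plane a source homogeneous of degree 0 has
  the same integral against a kernel of degree -2 over every dyadic annulus, so truncation at scale
  \<epsilon> adds up about ln (1 / \<epsilon>) copies of one number, while the pairing of the
  harmonic kernel with \<open>w\<close> stays bounded; hence that number is 0. It is the second
  angular Fourier coefficient of the sectors, which is why bisectors are compared modulo \<pi> / 2.
  The obstacle is regularity: \<open>w\<close> is only in H1_loc and has no value at x', yet k^2
  \<rho> w must be negligible against the logarithm. A Poincare inequality, from translating a small
  disc into the cone where \<open>w\<close> is 0, shows that the means of |w| over small discs tend
  to 0, and null means summed over the annuli are of lower order than their number. For the same
  reason the Carleman and Rellich arguments are made for smooth functions and transferred by
  mollification. As \<rho> is complex, real and imaginary parts are coupled; they are carried as a
  pair indexed by \<open>bool\<close>.\<close>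

lemma partial_deriv_eqI: "(f has_derivative f') (at x) \<Longrightarrow> partial_deriv i f x = f' (axis i 1)"
  by (metis frechet_derivative_at partial_deriv_def)

lemma partial_deriv_cong_open:
  assumes "open U" "x \<in> U" "\<And>y. y \<in> U \<Longrightarrow> f y = g y"
  shows "partial_deriv i f x = partial_deriv i g x"
    and "f differentiable (at x) \<longleftrightarrow> g differentiable (at x)"
proof -
  have *: "(f has_derivative D) (at x) \<longleftrightarrow> (g has_derivative D) (at x)" for D
    using assms has_derivative_transform_within_open by (metis (no_types, lifting))
  then show "partial_deriv i f x = partial_deriv i g x"
    by (simp add: partial_deriv_def frechet_derivative_def)
  show "f differentiable (at x) \<longleftrightarrow> g differentiable (at x)"
    by (simp add: differentiable_def *)
qed

lemma partial_deriv_const [simp]: "partial_deriv i (\<lambda>x. c) = (\<lambda>x. 0)"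
  by (rule ext, rule partial_deriv_eqI[THEN trans]) (auto intro!: derivative_eq_intros)

lemma partial_deriv_nth: "partial_deriv i (\<lambda>x. x $ j) = (\<lambda>x. if i = j then 1 else 0)"
  by (rule ext, subst partial_deriv_eqI[of _ "\<lambda>h. h $ j"])
     (auto simp: axis_def intro!: bounded_linear.has_derivative[OF bounded_linear_vec_nth] derivative_intros)

lemma partial_deriv_add:
  assumes "f differentiable (at x)" "g differentiable (at x)"
  shows "partial_deriv i (\<lambda>x. f x + g x) x = partial_deriv i f x + partial_deriv i g x"
  using partial_deriv_eqI[OF has_derivative_add[OF assms[unfolded frechet_derivative_works]]]
  by (simp add: partial_deriv_def algebra_simps)

lemma partial_deriv_diff:
  assumes "f differentiable (at x)" "g differentiable (at x)"
  shows "partial_deriv i (\<lambda>x. f x - g x) x = partial_deriv i f x - partial_deriv i g x"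
  using partial_deriv_eqI[OF has_derivative_diff[OF assms[unfolded frechet_derivative_works]]]
  by (simp add: partial_deriv_def algebra_simps)

lemma partial_deriv_mult:
  assumes "f differentiable (at x)" "g differentiable (at x)"
  shows "partial_deriv i (\<lambda>x. f x * g x) x = partial_deriv i f x * g x + f x * partial_deriv i g x"
  using partial_deriv_eqI[OF has_derivative_mult[OF assms[unfolded frechet_derivative_works]]]
  by (simp add: partial_deriv_def algebra_simps)

lemma partial_deriv_compose:
  assumes "(g has_real_derivative g') (at (f x))" "f differentiable (at x)"
  shows "partial_deriv i (\<lambda>x. g (f x)) x = g' * partial_deriv i f x"
    and "(\<lambda>x. g (f x)) differentiable (at x)"
proof -
  have "((\<lambda>x. g (f x)) has_derivative (\<lambda>h. g' * frechet_derivative f (at x) h)) (at x)"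
    using has_derivative_compose[of f "frechet_derivative f (at x)" x UNIV g "(*) g'"] assms
    unfolding frechet_derivative_works has_field_derivative_def by blast
  from partial_deriv_eqI[OF this] differentiableI[OF this]
  show "partial_deriv i (\<lambda>x. g (f x)) x = g' * partial_deriv i f x"
    and "(\<lambda>x. g (f x)) differentiable (at x)"
    unfolding partial_deriv_def[of i f] by this+
qed

lemma partial_deriv_affine:
  assumes "f differentiable (at (a + c *\<^sub>R x))"
  shows "partial_deriv i (\<lambda>x. f (a + c *\<^sub>R x)) x = c * partial_deriv i f (a + c *\<^sub>R x)"
    and "(\<lambda>x. f (a + c *\<^sub>R x)) differentiable (at x)"
proof -
  let ?F = "frechet_derivative f (at (a + c *\<^sub>R x))"
  have F: "(f has_derivative ?F) (at (a + c *\<^sub>R x))"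
    using assms frechet_derivative_works by blast
  have "((\<lambda>x. a + c *\<^sub>R x) has_derivative (\<lambda>h. c *\<^sub>R h)) (at x)"
    by (auto intro!: derivative_eq_intros)
  from has_derivative_compose[OF this F]
  have *: "((\<lambda>x. f (a + c *\<^sub>R x)) has_derivative (\<lambda>h. ?F (c *\<^sub>R h))) (at x)" .
  show "(\<lambda>x. f (a + c *\<^sub>R x)) differentiable (at x)"
    using * differentiable_def by blast
  have "linear ?F"
    using F has_derivative_linear by blast
  then show "partial_deriv i (\<lambda>x. f (a + c *\<^sub>R x)) x = c * partial_deriv i f (a + c *\<^sub>R x)"
    using partial_deriv_eqI[OF *] by (simp add: partial_deriv_def linear_scale)
qed

text \<open>Localised \<open>Ck\<close>: the Carleman weight and the poles below are smooth only off
  a point. Derivatives are full two-sided ones, so the notion is meant for open sets.\<close>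

primrec Ck_on :: "nat \<Rightarrow> (real^2) set \<Rightarrow> (real^2 \<Rightarrow> real) \<Rightarrow> bool" where
  "Ck_on 0 U f \<longleftrightarrow> continuous_on U f"
| "Ck_on (Suc n) U f \<longleftrightarrow> (\<forall>x\<in>U. f differentiable (at x)) \<and> (\<forall>i. Ck_on n U (partial_deriv i f))"

definition smooth_on :: "(real^2) set \<Rightarrow> (real^2 \<Rightarrow> real) \<Rightarrow> bool" where
  "smooth_on U f \<longleftrightarrow> (\<forall>n. Ck_on n U f)"

lemma Ck_on_UNIV: "Ck_on n UNIV f \<longleftrightarrow> Ck n f"
  by (induction n arbitrary: f) auto

lemma Ck_on_subset: "Ck_on n U f \<Longrightarrow> V \<subseteq> U \<Longrightarrow> Ck_on n V f"
  by (induction n arbitrary: f) (auto intro: continuous_on_subset)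

lemma Ck_on_SucD: "Ck_on (Suc n) U f \<Longrightarrow> Ck_on n U f"
proof (induction n arbitrary: f)
  case 0
  then show ?case
    by (auto simp: continuous_at_imp_continuous_on differentiable_imp_continuous_within)
next
  case (Suc n)
  then show ?case
    by (metis Ck_on.simps(2))
qed

lemma Ck_on_cong:
  assumes "open U" "\<And>x. x \<in> U \<Longrightarrow> f x = g x"
  shows "Ck_on n U f \<longleftrightarrow> Ck_on n U g"
  using assms(2)
proof (induction n arbitrary: f g)
  case 0
  then show ?case by (simp cong: continuous_on_cong)
next
  case (Suc n)
  have "Ck_on n U (partial_deriv i f) \<longleftrightarrow> Ck_on n U (partial_deriv i g)" for i
    using Suc.prems partial_deriv_cong_open(1)[OF assms(1)] by (intro Suc.IH) blast
  moreover have "f differentiable (at x) \<longleftrightarrow> g differentiable (at x)" if "x \<in> U" for x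
    using Suc.prems partial_deriv_cong_open(2)[OF assms(1) that] by blast
  ultimately show ?case by auto
qed

lemma Ck_on_Un:
  assumes "open U" "open V" "Ck_on n U f" "Ck_on n V f"
  shows "Ck_on n (U \<union> V) f"
  using assms(3,4) by (induction n arbitrary: f) (auto intro: continuous_on_open_Un assms)

lemma Ck_on_const: "Ck_on n U (\<lambda>x. c)"
  by (induction n arbitrary: c) auto

lemma Ck_on_nth: "Ck_on n U (\<lambda>x. x $ i)"
proof (cases n)
  case 0
  then show ?thesis by (auto intro!: continuous_intros)
next
  case (Suc m)
  have "Ck_on m U (\<lambda>x. if j = i then 1 else 0)" for j
    by (rule Ck_on_const)
  moreover have "(\<lambda>x::real^2. x $ i) differentiable (at x)" for x
    by (rule bounded_linear_imp_differentiable[OF bounded_linear_vec_nth])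
  ultimately show ?thesis
    by (simp add: partial_deriv_nth Suc)
qed

lemma Ck_on_add:
  assumes "open U" "Ck_on n U f" "Ck_on n U g"
  shows "Ck_on n U (\<lambda>x. f x + g x)"
  using assms(2,3)
proof (induction n arbitrary: f g)
  case (Suc n)
  have "Ck_on n U (partial_deriv i (\<lambda>x. f x + g x))" for i
    using Suc by (subst Ck_on_cong[OF \<open>open U\<close> partial_deriv_add]) auto
  then show ?case using Suc.prems by auto
qed (auto intro!: continuous_intros)

lemma Ck_on_mult:
  assumes "open U" "Ck_on n U f" "Ck_on n U g"
  shows "Ck_on n U (\<lambda>x. f x * g x)"
  using assms(2,3)
proof (induction n arbitrary: f g)
  case (Suc n)
  have "Ck_on n U (partial_deriv i (\<lambda>x. f x * g x))" for i
    using Suc.prems Suc.prems[THEN Ck_on_SucD]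
    by (subst Ck_on_cong[OF \<open>open U\<close> partial_deriv_mult])
       (auto intro!: Ck_on_add Suc.IH assms(1) simp del: Ck_on.simps(1))
  then show ?case using Suc.prems by auto
qed (auto intro!: continuous_intros)

text \<open>The chain rule replaces the outer function by its derivative, so the induction needs a
  whole family \<open>g\<close> closed under differentiation; \<open>d\<close> names the member that
  is the derivative.\<close>

lemma Ck_on_compose:
  fixes g :: "'p \<Rightarrow> real \<Rightarrow> real"
  assumes "open U" and g: "\<And>p t. t \<in> T \<Longrightarrow> (g p has_real_derivative g (d p) t) (at t)"
    and "f ` U \<subseteq> T" "Ck_on n U f"
  shows "Ck_on n U (\<lambda>x. g p (f x))"
  using assms(4)
proof (induction n arbitrary: p)
  case 0
  have "continuous_on T (g p)"
    using g by (meson DERIV_continuous continuous_at_imp_continuous_on)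
  then show ?case
    using 0 assms(3) continuous_on_compose2 by auto
next
  case (Suc n)
  have D: "(g p has_real_derivative g (d p) (f x)) (at (f x))" if "x \<in> U" for x
    using that assms(3) g by blast
  have df: "f differentiable (at x)" if "x \<in> U" for x
    using Suc.prems that by auto
  have "Ck_on n U (partial_deriv i (\<lambda>x. g p (f x)))" for i
    using Suc.prems Suc.prems[THEN Ck_on_SucD] partial_deriv_compose(1)[OF D df] assms(1)
    by (subst Ck_on_cong[where g = "\<lambda>x. g (d p) (f x) * partial_deriv i f x"])
       (auto intro!: Ck_on_mult Suc.IH)
  then show ?case
    using partial_deriv_compose(2)[OF D df] by auto
qed

lemma Ck_on_affine:
  assumes "open U" "\<And>x. x \<in> U \<Longrightarrow> a + c *\<^sub>R x \<in> V" "Ck_on n V f"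
  shows "Ck_on n U (\<lambda>x. f (a + c *\<^sub>R x))"
  using assms(3)
proof (induction n arbitrary: f)
  case 0
  then show ?case
    using assms(2) by (auto intro!: continuous_on_compose2[of V f] continuous_intros)
next
  case (Suc n)
  have df: "f differentiable (at (a + c *\<^sub>R x))" if "x \<in> U" for x
    using Suc.prems assms(2) that by auto
  have "Ck_on n U (partial_deriv i (\<lambda>x. f (a + c *\<^sub>R x)))" for i
    using Suc partial_deriv_affine(1)[OF df] assms(1)
    by (subst Ck_on_cong[where g = "\<lambda>x. c * partial_deriv i f (a + c *\<^sub>R x)"])
       (auto intro!: Ck_on_mult Ck_on_const)
  then show ?case
    using partial_deriv_affine(2)[OF df] by auto
qed

lemma smooth_on_subset: "smooth_on U f \<Longrightarrow> V \<subseteq> U \<Longrightarrow> smooth_on V f"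
  by (auto simp: smooth_on_def intro: Ck_on_subset)

lemma smooth_on_cong: "open U \<Longrightarrow> (\<And>x. x \<in> U \<Longrightarrow> f x = g x) \<Longrightarrow> smooth_on U f \<longleftrightarrow> smooth_on U g"
  unfolding smooth_on_def using Ck_on_cong by blast

lemma smooth_on_Un: "open U \<Longrightarrow> open V \<Longrightarrow> smooth_on U f \<Longrightarrow> smooth_on V f \<Longrightarrow> smooth_on (U \<union> V) f"
  by (auto simp: smooth_on_def intro: Ck_on_Un)

lemma smooth_on_const: "smooth_on U (\<lambda>x. c)"
  by (auto simp: smooth_on_def intro: Ck_on_const)

lemma smooth_on_nth: "smooth_on U (\<lambda>x. x $ i)"
  by (auto simp: smooth_on_def intro: Ck_on_nth)

lemma smooth_on_add: "open U \<Longrightarrow> smooth_on U f \<Longrightarrow> smooth_on U g \<Longrightarrow> smooth_on U (\<lambda>x. f x + g x)"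
  by (auto simp: smooth_on_def intro: Ck_on_add)

lemma smooth_on_mult: "open U \<Longrightarrow> smooth_on U f \<Longrightarrow> smooth_on U g \<Longrightarrow> smooth_on U (\<lambda>x. f x * g x)"
  by (auto simp: smooth_on_def intro: Ck_on_mult)

lemma smooth_on_uminus: "open U \<Longrightarrow> smooth_on U f \<Longrightarrow> smooth_on U (\<lambda>x. - f x)"
  using smooth_on_mult[of U "\<lambda>x. -1" f] by (simp add: smooth_on_const)

lemma smooth_on_diff: "open U \<Longrightarrow> smooth_on U f \<Longrightarrow> smooth_on U g \<Longrightarrow> smooth_on U (\<lambda>x. f x - g x)"
  using smooth_on_add[of U f "\<lambda>x. - g x"] by (simp add: smooth_on_uminus)

lemma smooth_on_power: "open U \<Longrightarrow> smooth_on U f \<Longrightarrow> smooth_on U (\<lambda>x. f x ^ n)"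
  by (induction n) (auto intro: smooth_on_const smooth_on_mult)

lemma smooth_on_compose:
  fixes g :: "'p \<Rightarrow> real \<Rightarrow> real"
  assumes "open U" "\<And>p t. t \<in> T \<Longrightarrow> (g p has_real_derivative g (d p) t) (at t)"
    and "f ` U \<subseteq> T" "smooth_on U f"
  shows "smooth_on U (\<lambda>x. g p (f x))"
  unfolding smooth_on_def
proof
  fix n
  show "Ck_on n U (\<lambda>x. g p (f x))"
    using assms(4) unfolding smooth_on_def
    by (intro Ck_on_compose[where g = g and d = d and T = T] assms(1-3)) auto
qed

lemma smooth_on_exp: "open U \<Longrightarrow> smooth_on U f \<Longrightarrow> smooth_on U (\<lambda>x. exp (f x))"
  by (rule smooth_on_compose[where g = "\<lambda>_::unit. exp" and d = id and T = UNIV])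
     (auto intro: DERIV_exp)

lemma smooth_on_inverse:
  assumes "open U" "smooth_on U f" "\<And>x. x \<in> U \<Longrightarrow> f x \<noteq> 0"
  shows "smooth_on U (\<lambda>x. inverse (f x))"
proof -
  \<comment> \<open>The multiples of powers of 1 / t form a family closed under differentiation that
    contains 1 / t itself.\<close>
  let ?g = "\<lambda>(c, m::nat) t. c * inverse t ^ m :: real"
  let ?d = "\<lambda>(c, m). (- (of_nat m * c), Suc m)"
  have "(?g p has_real_derivative ?g (?d p) t) (at t)" if "t \<in> - {0}" for p t
  proof (cases p)
    case (Pair c m)
    have "t \<noteq> 0" using that by auto
    then have "((\<lambda>t. c * inverse t ^ m) has_real_derivative
        c * (of_nat m * (- (inverse t ^ Suc (Suc 0)) * inverse t ^ (m - Suc 0)))) (at t)"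
      by (intro DERIV_cmult DERIV_power DERIV_inverse)
    moreover have "c * (of_nat m * (- (inverse t ^ Suc (Suc 0)) * inverse t ^ (m - Suc 0)))
        = - (of_nat m * c) * inverse t ^ Suc m"
      by (cases m) simp_all
    ultimately show ?thesis unfolding Pair by (simp only: prod.case)
  qed
  then have "smooth_on U (\<lambda>x. ?g (1, 1) (f x))"
    by (intro smooth_on_compose[where g = ?g and d = ?d and T = "- {0}"])
       (use assms in \<open>auto simp del: prod.case\<close>)
  then show ?thesis by simp
qed

lemma smooth_on_divide:
  "open U \<Longrightarrow> smooth_on U f \<Longrightarrow> smooth_on U g \<Longrightarrow> (\<And>x. x \<in> U \<Longrightarrow> g x \<noteq> 0)
    \<Longrightarrow> smooth_on U (\<lambda>x. f x / g x)"
  unfolding divide_inverse by (intro smooth_on_mult smooth_on_inverse)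

lemma smooth_on_affine:
  "open U \<Longrightarrow> smooth_on V f \<Longrightarrow> (\<And>x. x \<in> U \<Longrightarrow> a + c *\<^sub>R x \<in> V) \<Longrightarrow> smooth_on U (\<lambda>x. f (a + c *\<^sub>R x))"
  unfolding smooth_on_def by (blast intro: Ck_on_affine)

lemma power2_norm_eq_nth: "(norm (x::real^2))\<^sup>2 = (x $ 1)\<^sup>2 + (x $ 2)\<^sup>2"
  by (simp add: norm_eq_sqrt_inner inner_vec_def UNIV_2 power2_eq_square)

lemma smooth_on_power2_norm: "open U \<Longrightarrow> smooth_on U (\<lambda>x. (norm (x - a))\<^sup>2)"
  unfolding power2_norm_eq_nth vector_minus_component
  by (intro smooth_on_add smooth_on_power smooth_on_diff smooth_on_nth smooth_on_const)

lemma smooth_on_partial_deriv: "smooth_on U f \<Longrightarrow> smooth_on U (partial_deriv i f)"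
  unfolding smooth_on_def by (metis Ck_on.simps(2))

lemma smooth_on_imp_differentiable: "smooth_on U f \<Longrightarrow> x \<in> U \<Longrightarrow> f differentiable (at x)"
  unfolding smooth_on_def by (metis Ck_on.simps(2))

lemma smooth_on_imp_continuous_on: "smooth_on U f \<Longrightarrow> continuous_on U f"
  unfolding smooth_on_def by (metis Ck_on.simps(1))

lemmas smooth_on_intros = smooth_on_const smooth_on_nth smooth_on_add smooth_on_mult
  smooth_on_uminus smooth_on_diff smooth_on_power smooth_on_exp smooth_on_divide
  smooth_on_power2_norm smooth_on_partial_deriv

lemma partial_deriv_line:
  assumes "f differentiable (at (x + t *\<^sub>R axis i 1))"
  shows "((\<lambda>t. f (x + t *\<^sub>R axis i 1)) has_real_derivative partial_deriv i f (x + t *\<^sub>R axis i 1)) (at t)"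
proof -
  let ?F = "frechet_derivative f (at (x + t *\<^sub>R axis i 1))"
  have F: "(f has_derivative ?F) (at (x + t *\<^sub>R axis i 1))"
    using assms frechet_derivative_works by blast
  have "((\<lambda>t. x + t *\<^sub>R axis i 1) has_derivative (\<lambda>h. h *\<^sub>R axis i 1)) (at t)"
    by (auto intro!: derivative_eq_intros)
  from has_derivative_compose[OF this F]
  show ?thesis
    by (rule has_derivative_imp_has_field_derivative)
       (simp add: partial_deriv_def linear_scale[OF has_derivative_linear[OF F]])
qed

text \<open>The second difference \<open>S i j h\<close> over a square of side h is symmetric in i
  and j. Two mean value steps write it as h^2 times a mixed derivative at a point of the square, and
  continuity of that derivative identifies the limit of S / h^2 with either order of
  differentiation.\<close>

lemma partial_deriv_commute:
  assumes f: "smooth_on UNIV f"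
  shows "partial_deriv i (partial_deriv j f) x = partial_deriv j (partial_deriv i f) x"
proof -
  define p where "p = (\<lambda>i s j t. x + s *\<^sub>R axis i (1::real) + t *\<^sub>R axis j 1)"
  define S where "S = (\<lambda>i j h. f (p i h j h) - f (p i h j 0) - f (p i 0 j h) + f x)"
  have d: "f differentiable (at y)" "partial_deriv i f differentiable (at y)" for i y
    using f smooth_on_imp_differentiable smooth_on_partial_deriv by blast+
  have mvt: "\<exists>s\<in>{0<..<h}. \<exists>t\<in>{0<..<h}. S i j h = h\<^sup>2 * partial_deriv j (partial_deriv i f) (p i s j t)"
    if "h > 0" for i j h
  proof -
    have D1: "((\<lambda>s. f (p i s j t)) has_real_derivative partial_deriv i f (p i s j t)) (at s)" for s t
      using partial_deriv_line[where x = "x + t *\<^sub>R axis j 1" and i = i and t = s and f = f] d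
      by (simp add: p_def add_ac)
    have D2: "((\<lambda>t. partial_deriv i f (p i s j t)) has_real_derivative
        partial_deriv j (partial_deriv i f) (p i s j t)) (at t)" for s t
      unfolding p_def using partial_deriv_line d by blast
    have "((\<lambda>s. f (p i s j h) - f (p i s j 0)) has_real_derivative
        partial_deriv i f (p i s j h) - partial_deriv i f (p i s j 0)) (at s)" for s
      by (intro DERIV_diff D1)
    from MVT2[OF that, of "\<lambda>s. f (p i s j h) - f (p i s j 0)"
        "\<lambda>s. partial_deriv i f (p i s j h) - partial_deriv i f (p i s j 0)", OF this]
    obtain s where s: "0 < s" "s < h"
      "S i j h = h * (partial_deriv i f (p i s j h) - partial_deriv i f (p i s j 0))"
      by (auto simp: S_def p_def)
    from MVT2[OF that, of "\<lambda>t. partial_deriv i f (p i s j t)"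
        "\<lambda>t. partial_deriv j (partial_deriv i f) (p i s j t)", OF D2]
    obtain t where "0 < t" "t < h"
      "partial_deriv i f (p i s j h) - partial_deriv i f (p i s j 0)
        = h * partial_deriv j (partial_deriv i f) (p i s j t)"
      by auto
    with s show ?thesis
      by (intro bexI[of _ s] bexI[of _ t]) (auto simp: power2_eq_square)
  qed
  have lim: "((\<lambda>h. S i j h / h\<^sup>2) \<longlongrightarrow> partial_deriv j (partial_deriv i f) x) (at_right 0)" for i j
  proof (rule tendstoI)
    fix e :: real assume "e > 0"
    have "isCont (partial_deriv j (partial_deriv i f)) x"
      using f smooth_on_imp_differentiable smooth_on_partial_deriv differentiable_imp_continuous_within
      by blast
    then obtain \<delta> where \<delta>: "\<delta> > 0"
      "\<And>y. dist y x < \<delta> \<Longrightarrow> dist (partial_deriv j (partial_deriv i f) y) (partial_deriv j (partial_deriv i f) x) < e"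
      using \<open>e > 0\<close> unfolding continuous_at_eps_delta by blast
    have "dist (S i j h / h\<^sup>2) (partial_deriv j (partial_deriv i f) x) < e" if h: "0 < h" "h < \<delta> / 2" for h
    proof -
      obtain s t where st: "s \<in> {0<..<h}" "t \<in> {0<..<h}"
        "S i j h = h\<^sup>2 * partial_deriv j (partial_deriv i f) (p i s j t)"
        using mvt[OF h(1)] by blast
      have "dist (p i s j t) x = norm (s *\<^sub>R axis i (1::real) + t *\<^sub>R axis j 1)"
        by (simp add: p_def dist_norm add.assoc)
      also have "\<dots> \<le> norm (s *\<^sub>R axis i (1::real)) + norm (t *\<^sub>R axis j (1::real))"
        by (rule norm_triangle_ineq)
      also have "\<dots> < \<delta>"
        using st h by (simp add: norm_axis_1)
      finally show ?thesis using \<delta>(2) st(3) h by simp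
    qed
    then show "\<forall>\<^sub>F h in at_right 0. dist (S i j h / h\<^sup>2) (partial_deriv j (partial_deriv i f) x) < e"
      unfolding eventually_at_right[OF zero_less_one]
      using \<delta>(1) by (intro exI[of _ "\<delta> / 2"]) auto
  qed
  have "S i j h = S j i h" for h
    by (simp add: S_def p_def add_ac)
  then show ?thesis
    using tendsto_unique[OF _ lim[of i j] lim[of j i, folded \<open>\<And>h. S i j h = S j i h\<close>]]
    by simp
qed

section \<open>Test functions and cutoffs\<close>

lemma test_function_iff: "test_function f \<longleftrightarrow> smooth_on UNIV f \<and> bounded {x. f x \<noteq> 0}"
  by (simp add: test_function_def smooth_on_def Ck_on_UNIV compact_closure)

lemma test_functionI:
  assumes "smooth_on UNIV f" "bounded K" "\<And>x. x \<notin> K \<Longrightarrow> f x = 0"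
  shows "test_function f"
proof -
  have "{x. f x \<noteq> 0} \<subseteq> K" using assms(3) by blast
  then show ?thesis by (simp add: test_function_iff assms(1) bounded_subset[OF assms(2)])
qed

lemma test_function_bounded: "test_function f \<Longrightarrow> bounded {x. f x \<noteq> 0}"
  by (simp add: test_function_iff)

lemma test_function_smooth: "test_function f \<Longrightarrow> smooth_on UNIV f"
  by (simp add: test_function_iff)

lemma partial_deriv_eq_0:
  "open U \<Longrightarrow> x \<in> U \<Longrightarrow> (\<And>y. y \<in> U \<Longrightarrow> f y = c) \<Longrightarrow> partial_deriv i f x = 0"
  using partial_deriv_cong_open(1)[of U x f "\<lambda>x. c" i] by simp

lemma partial_deriv_nonzero_subset:
  "{x. partial_deriv i f x \<noteq> 0} \<subseteq> closure {x. f x \<noteq> 0}"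
proof
  fix x assume x: "x \<in> {x. partial_deriv i f x \<noteq> 0}"
  show "x \<in> closure {x. f x \<noteq> 0}"
  proof (rule ccontr)
    assume "x \<notin> closure {x. f x \<noteq> 0}"
    then have 1: "x \<in> - closure {x. f x \<noteq> 0}" by simp
    have 2: "f y = 0" if "y \<in> - closure {x. f x \<noteq> 0}" for y
      using that closure_subset[of "{x. f x \<noteq> 0}"] by blast
    have "partial_deriv i f x = 0"
      by (rule partial_deriv_eq_0[OF _ 1 2]) auto
    with x show False by simp
  qed
qed

lemma test_function_partial_deriv:
  assumes "test_function f"
  shows "test_function (partial_deriv i f)"
proof -
  have "bounded (closure {x. f x \<noteq> 0})"
    by (intro bounded_closure test_function_bounded assms)
  then have "bounded {x. partial_deriv i f x \<noteq> 0}"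
    by (rule bounded_subset[OF _ partial_deriv_nonzero_subset])
  then show ?thesis
    using assms by (simp add: test_function_iff smooth_on_partial_deriv)
qed

lemma test_function_mult:
  assumes "smooth_on UNIV f" "test_function g"
  shows "test_function (\<lambda>x. f x * g x)" "test_function (\<lambda>x. g x * f x)"
proof -
  show "test_function (\<lambda>x. f x * g x)"
    by (rule test_functionI[OF _ test_function_bounded[OF assms(2)]])
       (use assms in \<open>simp_all add: smooth_on_mult test_function_smooth\<close>)
  then show "test_function (\<lambda>x. g x * f x)"
    by (simp add: mult.commute)
qed

lemma test_function_add:
  assumes "test_function f" "test_function g"
  shows "test_function (\<lambda>x. f x + g x)"
proof (rule test_functionI)
  show "smooth_on UNIV (\<lambda>x. f x + g x)"
    using assms by (simp add: smooth_on_add test_function_smooth)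
  show "bounded ({x. f x \<noteq> 0} \<union> {x. g x \<noteq> 0})"
    using assms by (simp add: test_function_bounded)
qed auto

lemma test_function_affine:
  assumes "test_function f" "c \<noteq> 0"
  shows "test_function (\<lambda>x. f (a + c *\<^sub>R x))"
proof -
  obtain B where B: "\<And>x. f x \<noteq> 0 \<Longrightarrow> norm x \<le> B"
    using assms(1) by (auto simp: test_function_iff bounded_iff)
  have "norm x \<le> (B + norm a) / \<bar>c\<bar>" if "f (a + c *\<^sub>R x) \<noteq> 0" for x
  proof -
    have "\<bar>c\<bar> * norm x = norm ((a + c *\<^sub>R x) - a)" by simp
    also have "\<dots> \<le> norm (a + c *\<^sub>R x) + norm a" by (rule norm_triangle_ineq4)
    also have "\<dots> \<le> B + norm a" using B[OF that] by simp
    finally show ?thesis using assms(2) by (simp add: field_simps)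
  qed
  then have "bounded {x. f (a + c *\<^sub>R x) \<noteq> 0}"
    unfolding bounded_iff by blast
  then show ?thesis
    using assms(1) smooth_on_affine[of UNIV UNIV f a c] by (simp add: test_function_iff)
qed

text \<open>The polynomial factor makes the family closed under differentiation.\<close>

definition flat_exp :: "real poly \<Rightarrow> real \<Rightarrow> real" where
  "flat_exp p t = (if 0 < t then poly p (1 / t) * exp (- (1 / t)) else 0)"

lemma tendsto_poly_mult_exp_neg: "((\<lambda>s::real. poly p s * exp (- s)) \<longlongrightarrow> 0) at_top"
proof -
  have "((\<lambda>s::real. \<Sum>i\<le>degree p. coeff p i * (s ^ i / exp s)) \<longlongrightarrow> (\<Sum>i\<le>degree p. coeff p i * 0)) at_top"
    by (intro tendsto_intros tendsto_power_div_exp_0)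
  then show ?thesis
    by (simp add: poly_altdef sum_distrib_right exp_minus divide_inverse mult.assoc)
qed

text \<open>With s = 1 / t one has ds/dt = - s^2, so p(s) exp (- s) differentiates to s^2 (p -
  p')(s) exp (- s): that is the new polynomial. At t = 0 the difference quotient is a function of
  the same kind, with p multiplied by s, and the exponential wins.\<close>

lemma flat_exp_deriv:
  "(flat_exp p has_real_derivative flat_exp (monom 1 2 * (p - pderiv p)) t) (at t)"
proof -
  consider "t < 0" | "t > 0" | "t = 0" by linarith
  then show ?thesis
  proof cases
    case 1
    have "((\<lambda>s. 0) has_real_derivative 0) (at t)" by simp
    then have "(flat_exp p has_real_derivative 0) (at t)"
      by (rule DERIV_cong_ev[THEN iffD1, rotated -1])
         (use 1 in \<open>auto simp: flat_exp_def eventually_nhds intro!: exI[of _ "{..<0}"]\<close>)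
    then show ?thesis using 1 by (simp add: flat_exp_def)
  next
    case 2
    have "((\<lambda>s. poly p (1 / s) * exp (- (1 / s))) has_real_derivative
        flat_exp (monom 1 2 * (p - pderiv p)) t) (at t)"
      using 2 by (auto intro!: derivative_eq_intros DERIV_chain2[OF poly_DERIV]
          simp: flat_exp_def poly_monom field_simps power2_eq_square)
    then show ?thesis
      by (rule DERIV_cong_ev[THEN iffD1, rotated -1])
         (use 2 in \<open>auto simp: flat_exp_def eventually_nhds intro!: exI[of _ "{0<..}"]\<close>)
  next
    case 3
    have "((\<lambda>h. poly (pCons 0 p) (inverse h) * exp (- inverse h)) \<longlongrightarrow> 0) (at_right 0)"
      by (rule filterlim_compose[OF tendsto_poly_mult_exp_neg filterlim_inverse_at_top_right])
    then have "((\<lambda>h. flat_exp p h / h) \<longlongrightarrow> 0) (at_right 0)"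
      by (rule Lim_transform_eventually)
         (auto simp: flat_exp_def eventually_at_filter inverse_eq_divide)
    moreover have "((\<lambda>h. flat_exp p h / h) \<longlongrightarrow> 0) (at_left 0)"
      by (rule Lim_transform_eventually[of "\<lambda>h. 0"])
         (auto simp: flat_exp_def eventually_at_filter)
    ultimately show ?thesis
      using 3 by (simp add: DERIV_def filterlim_split_at flat_exp_def)
  qed
qed

lemma smooth_on_flat_exp: "open U \<Longrightarrow> smooth_on U f \<Longrightarrow> smooth_on U (\<lambda>x. flat_exp p (f x))"
  by (rule smooth_on_compose[where g = flat_exp and T = UNIV]) (auto intro: flat_exp_deriv)

lemma flat_exp_1: "0 < t \<Longrightarrow> 0 < flat_exp 1 t" "t \<le> 0 \<Longrightarrow> flat_exp 1 t = 0" "0 \<le> flat_exp 1 t"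
  by (auto simp: flat_exp_def)

text \<open>The quotient A / (A + B), with A positive exactly inside radius s and B positive exactly
  outside radius r. As r < s, one of them is always positive. Squared norms are used because the
  norm itself is not smooth at the centre.\<close>

lemma cutoff_exists:
  fixes y :: "real^2"
  assumes "0 \<le> r" "r < s"
  obtains h where "test_function h" "\<And>x. 0 \<le> h x \<and> h x \<le> 1"
    "\<And>x. x \<in> cball y r \<Longrightarrow> h x = 1" "\<And>x. x \<notin> ball y s \<Longrightarrow> h x = 0"
    "\<And>x. x \<in> ball y s \<Longrightarrow> 0 < h x"
proof -
  define A where "A = (\<lambda>x. flat_exp 1 (s\<^sup>2 - (norm (x - y))\<^sup>2))"
  define B where "B = (\<lambda>x. flat_exp 1 ((norm (x - y))\<^sup>2 - r\<^sup>2))"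
  have sm: "smooth_on UNIV A" "smooth_on UNIV B"
    unfolding A_def B_def
    by (auto intro!: smooth_on_flat_exp smooth_on_intros)
  have sq: "a\<^sup>2 < b\<^sup>2 \<longleftrightarrow> a < b" if "0 \<le> a" "0 \<le> b" for a b :: real
    using that power2_less_imp_less power_strict_mono pos2 by blast
  have "A x > 0 \<longleftrightarrow> (norm (x - y))\<^sup>2 < s\<^sup>2" for x
    using flat_exp_1[of "s\<^sup>2 - (norm (x - y))\<^sup>2"] unfolding A_def by linarith
  then have A: "A x > 0 \<longleftrightarrow> x \<in> ball y s" "A x \<ge> 0" for x
    using flat_exp_1(3) assms sq[of "norm (x - y)" s] by (auto simp: A_def dist_norm norm_minus_commute)
  have "B x > 0 \<longleftrightarrow> r\<^sup>2 < (norm (x - y))\<^sup>2" for x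
    using flat_exp_1[of "(norm (x - y))\<^sup>2 - r\<^sup>2"] unfolding B_def by linarith
  then have B: "B x > 0 \<longleftrightarrow> x \<notin> cball y r" "B x \<ge> 0" for x
    using flat_exp_1(3) assms sq[of r "norm (x - y)"] by (auto simp: B_def dist_norm norm_minus_commute)
  have pos: "A x + B x > 0" for x
  proof (cases "x \<in> ball y s")
    case True
    then show ?thesis using A[of x] B(2)[of x] by linarith
  next
    case False
    then have "x \<notin> cball y r" using assms(2) by auto
    then show ?thesis using A(2)[of x] B(1)[of x] by linarith
  qed
  show ?thesis
  proof
    show "test_function (\<lambda>x. A x / (A x + B x))"
      using sm pos A by (intro test_functionI[where K = "ball y s"] smooth_on_intros)
        (auto simp: less_le)
    show "0 \<le> A x / (A x + B x) \<and> A x / (A x + B x) \<le> 1" for x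
      using A(2)[of x] B(2)[of x] pos[of x] by (simp add: field_simps)
    show "A x / (A x + B x) = 1" if "x \<in> cball y r" for x
    proof -
      have "B x = 0" using B[of x] that by force
      then show ?thesis using pos[of x] by simp
    qed
    show "A x / (A x + B x) = 0" if "x \<notin> ball y s" for x
      using A[of x] that by force
    show "0 < A x / (A x + B x)" if "x \<in> ball y s" for x
      using A[of x] that pos[of x] by simp
  qed
qed

section \<open>Integration against test functions\<close>

lemma has_derivative_partials:
  assumes "f differentiable (at x)"
  shows "(f has_derivative (\<lambda>h. h $ 1 * partial_deriv 1 f x + h $ 2 * partial_deriv 2 f x)) (at x)"
proof -
  let ?F = "frechet_derivative f (at x)"
  have F: "(f has_derivative ?F) (at x)"
    using assms frechet_derivative_works by blast
  have "?F h = h $ 1 * partial_deriv 1 f x + h $ 2 * partial_deriv 2 f x" for h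
  proof -
    have "h = h $ 1 *\<^sub>R axis 1 1 + h $ 2 *\<^sub>R axis 2 1"
      by (simp add: vec_eq_iff forall_2 axis_def)
    then have "?F h = ?F (h $ 1 *\<^sub>R axis 1 1 + h $ 2 *\<^sub>R axis 2 1)" by simp
    also have "\<dots> = h $ 1 * ?F (axis 1 1) + h $ 2 * ?F (axis 2 1)"
      using has_derivative_linear[OF F] by (simp add: linear_add linear_scale)
    finally show ?thesis by (simp add: partial_deriv_def)
  qed
  then have "?F = (\<lambda>h. h $ 1 * partial_deriv 1 f x + h $ 2 * partial_deriv 2 f x)" by (rule ext)
  then show ?thesis using F by (simp only:)
qed

lemma abs_pairing_le:
  fixes h :: "real^2"
  assumes "\<bar>a\<bar> \<le> A" "\<bar>b\<bar> \<le> A"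
  shows "\<bar>h $ 1 * a + h $ 2 * b\<bar> \<le> 2 * A * norm h"
proof -
  have "\<bar>h $ 1 * a\<bar> \<le> norm h * A" "\<bar>h $ 2 * b\<bar> \<le> norm h * A"
    using assms component_le_norm_cart[of h] unfolding abs_mult by (intro mult_mono; simp)+
  then have "\<bar>h $ 1 * a + h $ 2 * b\<bar> \<le> norm h * A + norm h * A" by linarith
  then show ?thesis by (simp add: algebra_simps)
qed

lemma test_function_bounded_value:
  assumes "test_function f"
  obtains B where "B \<ge> 0" "\<And>x. \<bar>f x\<bar> \<le> B"
proof -
  have c: "compact (closure {x. f x \<noteq> 0})"
    using assms test_function_def by blast
  have "continuous_on (closure {x. f x \<noteq> 0}) f"
    using assms test_function_smooth smooth_on_imp_continuous_on continuous_on_subset by blast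
  then have "bounded (f ` closure {x. f x \<noteq> 0})"
    using c compact_continuous_image compact_imp_bounded by blast
  then obtain B where B: "B > 0" "\<And>x. x \<in> closure {x. f x \<noteq> 0} \<Longrightarrow> \<bar>f x\<bar> \<le> B"
    unfolding bounded_pos by (metis imageI real_norm_def)
  have "\<bar>f x\<bar> \<le> B" for x
    using B(2)[of x] B(1) closure_subset[of "{x. f x \<noteq> 0}"] by (cases "f x = 0") auto
  with B(1) that show ?thesis by (meson less_imp_le)
qed

lemma test_function_lipschitz:
  assumes "test_function f"
  obtains L where "L \<ge> 0" "\<And>x y. \<bar>f x - f y\<bar> \<le> L * norm (x - y)"
proof -
  obtain B1 where B1: "B1 \<ge> 0" "\<And>x. \<bar>partial_deriv 1 f x\<bar> \<le> B1"
    using test_function_bounded_value[OF test_function_partial_deriv[OF assms]] by metis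
  obtain B2 where B2: "B2 \<ge> 0" "\<And>x. \<bar>partial_deriv 2 f x\<bar> \<le> B2"
    using test_function_bounded_value[OF test_function_partial_deriv[OF assms]] by metis
  define B where "B = max B1 B2"
  have B: "\<bar>partial_deriv 1 f x\<bar> \<le> B" "\<bar>partial_deriv 2 f x\<bar> \<le> B" for x
    using B1(2)[of x] B2(2)[of x] by (auto simp: B_def)
  have "norm (f x - f y) \<le> (2 * B) * norm (x - y)" for x y
  proof (rule differentiable_bound[OF convex_UNIV])
    show "(f has_derivative (\<lambda>h. h $ 1 * partial_deriv 1 f x + h $ 2 * partial_deriv 2 f x)) (at x within UNIV)" for x
      using smooth_on_imp_differentiable[OF test_function_smooth[OF assms] UNIV_I]
      by (simp add: has_derivative_partials)
    show "onorm (\<lambda>h::real^2. h $ 1 * partial_deriv 1 f x + h $ 2 * partial_deriv 2 f x) \<le> 2 * B" for x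
      using abs_pairing_le[OF B(1)[of x] B(2)[of x]] by (intro onorm_le) simp
  qed auto
  then show ?thesis using that[of "2 * B"] B1 by (auto simp: B_def)
qed

text \<open>Mean value estimate for f minus its linear part at x on the ball of radius |h|, where
  the derivative of that difference is O(|h|). The constant is uniform in x, which is what
  differentiating a convolution requires.\<close>

lemma test_function_taylor:
  assumes "test_function f"
  obtains C where "C \<ge> 0"
    "\<And>x h. \<bar>f (x + h) - f x - (h $ 1 * partial_deriv 1 f x + h $ 2 * partial_deriv 2 f x)\<bar> \<le> C * (norm h)\<^sup>2"
proof -
  obtain L1 where L1: "L1 \<ge> 0" "\<And>x y. \<bar>partial_deriv 1 f x - partial_deriv 1 f y\<bar> \<le> L1 * norm (x - y)"
    using test_function_lipschitz[OF test_function_partial_deriv[OF assms]] by metis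
  obtain L2 where L2: "L2 \<ge> 0" "\<And>x y. \<bar>partial_deriv 2 f x - partial_deriv 2 f y\<bar> \<le> L2 * norm (x - y)"
    using test_function_lipschitz[OF test_function_partial_deriv[OF assms]] by metis
  define L where "L = max L1 L2"
  have L0: "L \<ge> 0" using L1 by (simp add: L_def)
  have L: "\<bar>partial_deriv i f x - partial_deriv i f y\<bar> \<le> L * norm (x - y)" for i x y
  proof -
    have "L1 * norm (x - y) \<le> L * norm (x - y)" "L2 * norm (x - y) \<le> L * norm (x - y)"
      by (auto simp: L_def intro!: mult_right_mono)
    then show ?thesis using L1(2)[of x y] L2(2)[of x y] exhaust_2[of i] by auto
  qed
  have "\<bar>f (x + h) - f x - (h $ 1 * partial_deriv 1 f x + h $ 2 * partial_deriv 2 f x)\<bar> \<le> (2 * L) * (norm h)\<^sup>2" for x h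
  proof -
    let ?D = "\<lambda>k::real^2. k $ 1 * partial_deriv 1 f x + k $ 2 * partial_deriv 2 f x"
    let ?g = "\<lambda>y. f y - ?D y"
    let ?g' = "\<lambda>y (k::real^2). k $ 1 * partial_deriv 1 f y + k $ 2 * partial_deriv 2 f y - ?D k"
    have "norm (?g (x + h) - ?g x) \<le> (2 * (L * norm h)) * norm (x + h - x)"
    proof (rule differentiable_bound[OF convex_cball[of x "norm h"]])
      fix y assume y: "y \<in> cball x (norm h)"
      have "linear ?D"
        by (auto intro!: linearI simp: algebra_simps)
      then have "(?D has_derivative ?D) (at y)"
        using bounded_linear_imp_has_derivative linear_conv_bounded_linear by blast
      moreover have "(f has_derivative (\<lambda>k. k $ 1 * partial_deriv 1 f y + k $ 2 * partial_deriv 2 f y)) (at y)"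
        using smooth_on_imp_differentiable[OF test_function_smooth[OF assms] UNIV_I]
        by (simp add: has_derivative_partials)
      ultimately show "(?g has_derivative ?g' y) (at y within cball x (norm h))"
        using has_derivative_diff has_derivative_at_withinI by blast
      have *: "\<bar>partial_deriv i f y - partial_deriv i f x\<bar> \<le> L * norm h" for i
      proof -
        have "L * norm (y - x) \<le> L * norm h"
          using y L0 by (intro mult_left_mono) (auto simp: dist_norm norm_minus_commute)
        then show ?thesis using L[of i y x] by linarith
      qed
      have "norm (?g' y k) \<le> 2 * (L * norm h) * norm k" for k
        using abs_pairing_le[OF *[of 1] *[of 2], of k] by (simp add: algebra_simps)
      then show "onorm (?g' y) \<le> 2 * (L * norm h)"
        by (intro onorm_le) simp
    qed (auto simp: dist_norm)
    then show ?thesis by (simp add: algebra_simps power2_eq_square)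
  qed
  then show ?thesis using that[of "2 * L"] L0 by auto
qed

section \<open>Integrals over the plane and local integrability classes\<close>

lemma integrable_continuous_bounded_support:
  fixes f :: "real^2 \<Rightarrow> real"
  assumes "continuous_on UNIV f" "bounded K" "\<And>x. x \<notin> K \<Longrightarrow> f x = 0"
  shows "integrable lborel f"
proof -
  have "integrable lborel (\<lambda>x. indicator (closure K) x *\<^sub>R f x)"
    using assms by (intro borel_integrable_compact) (auto simp: compact_closure intro: continuous_on_subset)
  moreover have "indicator (closure K) x *\<^sub>R f x = f x" for x
    using assms(3)[of x] closure_subset[of K] by (auto simp: indicator_def)
  ultimately show ?thesis by (simp only:)
qed

lemma test_function_integrable: "test_function f \<Longrightarrow> integrable lborel f"
  by (rule integrable_continuous_bounded_support[of f "{x. f x \<noteq> 0}"])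
     (auto simp: test_function_iff smooth_on_imp_continuous_on)

lemma test_function_continuous: "test_function f \<Longrightarrow> continuous_on S f"
  using test_function_smooth smooth_on_imp_continuous_on continuous_on_subset by blast

lemma test_function_measurable [measurable_dest]: "test_function f \<Longrightarrow> f \<in> borel_measurable borel"
  by (simp add: borel_measurable_continuous_onI test_function_continuous)

lemma lborel_integral_affine:
  fixes f :: "real^2 \<Rightarrow> real"
  assumes [measurable]: "f \<in> borel_measurable borel" and "c \<noteq> 0"
  shows "(LBINT x. f x) = c\<^sup>2 * (LBINT x. f (t + c *\<^sub>R x))"
proof -
  have "(LBINT x. f x) = (\<integral>x. f x \<partial>density (distr lborel borel (\<lambda>x. t + c *\<^sub>R x)) (\<lambda>_. ennreal (c\<^sup>2)))"
    using lborel_affine[OF assms(2), of t] by (simp add: ennreal_power[symmetric])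
  also have "\<dots> = (\<integral>x. c\<^sup>2 *\<^sub>R f x \<partial>distr lborel borel (\<lambda>x. t + c *\<^sub>R x))"
    by (rule integral_density) auto
  also have "\<dots> = (LBINT x. c\<^sup>2 *\<^sub>R f (t + c *\<^sub>R x))"
    by (rule integral_distr) auto
  finally show ?thesis by simp
qed

lemma lborel_integrable_affine:
  fixes f :: "real^2 \<Rightarrow> real"
  assumes f: "integrable lborel f" and "c \<noteq> 0"
  shows "integrable lborel (\<lambda>x. f (t + c *\<^sub>R x))"
proof -
  have [measurable]: "f \<in> borel_measurable borel" using f by auto
  have "integrable (density (distr lborel borel (\<lambda>x. t + c *\<^sub>R x)) (\<lambda>_. ennreal (c\<^sup>2))) f"
    using lborel_affine[OF assms(2), of t] f by (simp add: ennreal_power[symmetric])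
  then have "integrable (distr lborel borel (\<lambda>x. t + c *\<^sub>R x)) (\<lambda>x. c\<^sup>2 *\<^sub>R f x)"
    by (subst (asm) integrable_density) auto
  then have "integrable (distr lborel borel (\<lambda>x. t + c *\<^sub>R x)) f"
    using assms(2) by simp
  then show ?thesis by (subst (asm) integrable_distr_eq) auto
qed

text \<open>Translation invariance makes every difference quotient integrate to 0, and the quotients
  converge boundedly on a fixed ball. In this form integration by parts enters the Carleman
  estimates.\<close>

lemma integral_partial_deriv_eq_0:
  assumes f: "test_function f"
  shows "(LBINT x. partial_deriv i f x) = 0"
proof -
  define e :: "real^2" where "e = axis i 1"
  define t where "t = (\<lambda>n. 1 / real (Suc n))"
  have t: "t n > 0" "t n \<le> 1" for n by (auto simp: t_def)
  then have tn: "t n \<noteq> 0" for n by (metis less_irrefl)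
  have t0: "t \<longlonglongrightarrow> 0" unfolding t_def by (rule LIMSEQ_inverse_real_of_nat[unfolded inverse_eq_divide])
  have [measurable]: "f \<in> borel_measurable borel" "partial_deriv i f \<in> borel_measurable borel"
    using f test_function_partial_deriv by measurable
  have fi: "integrable lborel f" using f by (rule test_function_integrable)
  have shift: "integrable lborel (\<lambda>x. f (x + s *\<^sub>R e))"
    "(LBINT x. f (x + s *\<^sub>R e)) = (LBINT x. f x)" for s
    using lborel_integrable_affine[OF fi, of 1 "s *\<^sub>R e"] lborel_integral_affine[of f 1 "s *\<^sub>R e"]
    by (simp_all add: add.commute)
  obtain L where L: "L \<ge> 0" "\<And>x y. \<bar>f x - f y\<bar> \<le> L * norm (x - y)"
    using test_function_lipschitz[OF f] by metis
  obtain R where R: "\<And>x. f x \<noteq> 0 \<Longrightarrow> norm x \<le> R"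
    using test_function_bounded[OF f] by (auto simp: bounded_iff)
  let ?q = "\<lambda>n x. (f (x + t n *\<^sub>R e) - f x) / t n"
  \<comment> \<open>The steps \<open>t n\<close> are at most 1, so all quotients live in the support
    enlarged by 1, where the Lipschitz constant L dominates them.\<close>
  have "(\<lambda>n. \<integral>x. ?q n x \<partial>lborel) \<longlonglongrightarrow> (LBINT x. partial_deriv i f x)"
  proof (rule integral_dominated_convergence[where w = "\<lambda>x. indicator (cball 0 (R + 1)) x *\<^sub>R L"])
    show "AE x in lborel. (\<lambda>n. ?q n x) \<longlonglongrightarrow> partial_deriv i f x"
    proof (rule AE_I2)
      fix x
      have "((\<lambda>t. f (x + t *\<^sub>R e)) has_real_derivative partial_deriv i f x) (at 0)"
        using partial_deriv_line[of f x 0 i] smooth_on_imp_differentiable[OF test_function_smooth[OF f]]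
        by (simp add: e_def)
      then have "((\<lambda>h. (f (x + h *\<^sub>R e) - f x) / h) \<longlongrightarrow> partial_deriv i f x) (at 0)"
        by (simp add: DERIV_def)
      then show "(\<lambda>n. ?q n x) \<longlonglongrightarrow> partial_deriv i f x"
        by (rule filterlim_compose) (simp add: filterlim_at t0 tn)
    qed
    show "AE x in lborel. norm (?q n x) \<le> indicator (cball 0 (R + 1)) x *\<^sub>R L" for n
    proof (rule AE_I2)
      fix x
      show "norm (?q n x) \<le> indicator (cball 0 (R + 1)) x *\<^sub>R L"
      proof (cases "x \<in> cball 0 (R + 1)")
        case True
        have "\<bar>f (x + t n *\<^sub>R e) - f x\<bar> \<le> L * t n"
          using L(2)[of "x + t n *\<^sub>R e" x] t[of n] by (simp add: e_def norm_axis_1)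
        then show ?thesis using True t[of n] by (simp add: field_simps)
      next
        case False
        then have "norm x > R + 1" by simp
        moreover have "norm x \<le> norm (x + t n *\<^sub>R e) + t n"
          using norm_triangle_ineq4[of "x + t n *\<^sub>R e" "t n *\<^sub>R e"] t[of n] by (simp add: e_def norm_axis_1)
        ultimately have "f x = 0" "f (x + t n *\<^sub>R e) = 0"
          using R[of x] R[of "x + t n *\<^sub>R e"] t(2)[of n] by linarith+
        then show ?thesis using L by simp
      qed
    qed
    show "integrable lborel (\<lambda>x. indicator (cball 0 (R + 1)) x *\<^sub>R L)"
      by (intro borel_integrable_compact) auto
  qed auto
  moreover have "(LBINT x. ?q n x) = 0" for n
    using shift[of "t n"] fi by simp
  ultimately have "0 = (LBINT x. partial_deriv i f x)"
    by (simp only: LIMSEQ_const_iff)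
  then show ?thesis by simp
qed

text \<open>Borel functions over \<open>lborel\<close> instead of Lebesgue measurable ones, so that
  translates remain measurable and Fubini applies on the product; the Lebesgue data of the problem
  is replaced by Borel representatives later.\<close>

definition locally_integrable :: "(real^2 \<Rightarrow> real) \<Rightarrow> bool" where
  "locally_integrable f \<longleftrightarrow> f \<in> borel_measurable borel \<and> (\<forall>r. set_integrable lborel (cball 0 r) f)"

definition locally_L2 :: "(real^2 \<Rightarrow> real) \<Rightarrow> bool" where
  "locally_L2 f \<longleftrightarrow> f \<in> borel_measurable borel \<and> (\<forall>r. set_integrable lborel (cball 0 r) (\<lambda>x. (f x)\<^sup>2))"

lemma locally_integrable_measurable [measurable_dest]: "locally_integrable f \<Longrightarrow> f \<in> borel_measurable borel"
  by (simp add: locally_integrable_def)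

lemma locally_L2_measurable [measurable_dest]: "locally_L2 f \<Longrightarrow> f \<in> borel_measurable borel"
  by (simp add: locally_L2_def)

lemma integrable_mult_bounded_support:
  assumes f: "locally_integrable f" and [measurable]: "g \<in> borel_measurable borel"
    and B: "\<And>x. \<bar>g x\<bar> \<le> B" and R: "\<And>x. g x \<noteq> 0 \<Longrightarrow> norm x \<le> R"
  shows "integrable lborel (\<lambda>x. f x * g x)"
proof (rule Bochner_Integration.integrable_bound)
  show "integrable lborel (\<lambda>x. B * (indicator (cball 0 R) x *\<^sub>R f x))"
    using f unfolding locally_integrable_def set_integrable_def by auto
  show "(\<lambda>x. f x * g x) \<in> borel_measurable lborel"
    using f by measurable
  show "AE x in lborel. norm (f x * g x) \<le> norm (B * (indicator (cball 0 R) x *\<^sub>R f x))"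
  proof (rule AE_I2)
    fix x
    have "\<bar>f x\<bar> * \<bar>g x\<bar> \<le> \<bar>f x\<bar> * \<bar>B\<bar>" using B[of x] by (intro mult_left_mono) auto
    then show "norm (f x * g x) \<le> norm (B * (indicator (cball 0 R) x *\<^sub>R f x))"
      using R[of x] by (cases "g x = 0") (auto simp: indicator_def abs_mult mult.commute)
  qed
qed

lemma integrable_mult_test_function:
  assumes f: "locally_integrable f" and g: "test_function g"
  shows "integrable lborel (\<lambda>x. f x * g x)"
proof -
  obtain B where "\<And>x. \<bar>g x\<bar> \<le> B" using test_function_bounded_value[OF g] by metis
  moreover obtain R where "\<And>x. g x \<noteq> 0 \<Longrightarrow> norm x \<le> R"
    using test_function_bounded[OF g] by (auto simp: bounded_iff)
  ultimately show ?thesis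
    using f g by (intro integrable_mult_bounded_support) auto
qed

lemma locally_L2_imp_locally_integrable:
  assumes f: "locally_L2 f"
  shows "locally_integrable f"
  unfolding locally_integrable_def set_integrable_def
proof (intro conjI allI)
  show m [measurable]: "f \<in> borel_measurable borel" using f by measurable
  fix r
  show "integrable lborel (\<lambda>x. indicator (cball 0 r) x *\<^sub>R f x)"
  proof (rule Bochner_Integration.integrable_bound)
    show "integrable lborel (\<lambda>x. indicator (cball 0 r) x *\<^sub>R (1::real) + indicator (cball 0 r) x *\<^sub>R (f x)\<^sup>2)"
      using f borel_integrable_compact[of "cball 0 r" "\<lambda>x. 1 :: real"]
      unfolding locally_L2_def set_integrable_def by auto
    have "\<bar>a\<bar> \<le> 1 + a\<^sup>2" for a :: real
      using sum_squares_bound[of 1 "\<bar>a\<bar>"] by (simp add: power2_eq_square)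
    then show "AE x in lborel. norm (indicator (cball 0 r) x *\<^sub>R f x)
        \<le> norm (indicator (cball 0 r) x *\<^sub>R (1::real) + indicator (cball 0 r) x *\<^sub>R (f x)\<^sup>2)"
      by (auto simp: indicator_def)
  qed (intro borel_measurable_scaleR borel_measurable_indicator; simp add: m)
qed

lemma locally_L2_mult:
  assumes f: "locally_L2 f" and [measurable]: "g \<in> borel_measurable borel" and B: "\<And>x. \<bar>g x\<bar> \<le> B"
  shows "locally_L2 (\<lambda>x. g x * f x)"
  unfolding locally_L2_def set_integrable_def
proof (intro conjI allI)
  have [measurable]: "f \<in> borel_measurable borel" using f by measurable
  show m: "(\<lambda>x. g x * f x) \<in> borel_measurable borel" by measurable
  fix r
  show "integrable lborel (\<lambda>x. indicator (cball 0 r) x *\<^sub>R (g x * f x)\<^sup>2)"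
  proof (rule Bochner_Integration.integrable_bound)
    show "integrable lborel (\<lambda>x. B\<^sup>2 * (indicator (cball 0 r) x *\<^sub>R (f x)\<^sup>2))"
      using f unfolding locally_L2_def set_integrable_def by auto
    have "(g x)\<^sup>2 * (f x)\<^sup>2 \<le> B\<^sup>2 * (f x)\<^sup>2" for x
      using B[of x] by (intro mult_right_mono) (auto simp: abs_le_square_iff[symmetric])
    then show "AE x in lborel. norm (indicator (cball 0 r) x *\<^sub>R (g x * f x)\<^sup>2)
        \<le> norm (B\<^sup>2 * (indicator (cball 0 r) x *\<^sub>R (f x)\<^sup>2))"
      by (auto simp: indicator_def power_mult_distrib)
  qed (intro borel_measurable_scaleR borel_measurable_indicator; simp add: m)
qed

lemma locally_L2_add:
  assumes f: "locally_L2 f" and g: "locally_L2 g"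
  shows "locally_L2 (\<lambda>x. f x + g x)"
  unfolding locally_L2_def set_integrable_def
proof (intro conjI allI)
  have [measurable]: "f \<in> borel_measurable borel" "g \<in> borel_measurable borel" using f g by measurable
  show m: "(\<lambda>x. f x + g x) \<in> borel_measurable borel" by measurable
  fix r
  show "integrable lborel (\<lambda>x. indicator (cball 0 r) x *\<^sub>R (f x + g x)\<^sup>2)"
  proof (rule Bochner_Integration.integrable_bound)
    show "integrable lborel (\<lambda>x. 2 * (indicator (cball 0 r) x *\<^sub>R (f x)\<^sup>2) + 2 * (indicator (cball 0 r) x *\<^sub>R (g x)\<^sup>2))"
      using f g unfolding locally_L2_def set_integrable_def by auto
    have "(a + b)\<^sup>2 \<le> 2 * a\<^sup>2 + 2 * b\<^sup>2" for a b :: real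
      using sum_squares_bound[of a b] by (simp add: power2_sum)
    then show "AE x in lborel. norm (indicator (cball 0 r) x *\<^sub>R (f x + g x)\<^sup>2)
        \<le> norm (2 * (indicator (cball 0 r) x *\<^sub>R (f x)\<^sup>2) + 2 * (indicator (cball 0 r) x *\<^sub>R (g x)\<^sup>2))"
      by (auto simp: indicator_def)
  qed (intro borel_measurable_scaleR borel_measurable_indicator; simp add: m)
qed

section \<open>Mollification\<close>

definition mollify :: "(real^2 \<Rightarrow> real) \<Rightarrow> (real^2 \<Rightarrow> real) \<Rightarrow> real^2 \<Rightarrow> real" where
  "mollify f \<eta> x = (LBINT y. f y * \<eta> (x - y))"

text \<open>\<delta> only bounds the support and is no scaling parameter. A kernel of small width
  thus counts for every larger width, which lets one kernel serve several approximations at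
  once.\<close>

definition is_mollifier :: "(real^2 \<Rightarrow> real) \<Rightarrow> real \<Rightarrow> bool" where
  "is_mollifier \<eta> \<delta> \<longleftrightarrow> test_function \<eta> \<and> (\<forall>x. 0 \<le> \<eta> x) \<and> (LBINT x. \<eta> x) = 1 \<and>
     (\<forall>x. \<eta> x \<noteq> 0 \<longrightarrow> norm x < \<delta>)"

definition laplacian :: "(real^2 \<Rightarrow> real) \<Rightarrow> real^2 \<Rightarrow> real" where
  "laplacian f x = partial_deriv 1 (partial_deriv 1 f) x + partial_deriv 2 (partial_deriv 2 f) x"

lemma test_function_laplacian: "test_function f \<Longrightarrow> test_function (laplacian f)"
  unfolding laplacian_def[abs_def] by (intro test_function_add test_function_partial_deriv)

lemma test_function_reflect: "test_function \<eta> \<Longrightarrow> test_function (\<lambda>y. \<eta> (x - y))"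
  using test_function_affine[of \<eta> "-1" x] by simp

lemma partial_deriv_reflect:
  "test_function \<eta> \<Longrightarrow> partial_deriv i (\<lambda>y. \<eta> (x - y)) = (\<lambda>y. - partial_deriv i \<eta> (x - y))"
  using partial_deriv_affine(1)[of \<eta> x "-1"] smooth_on_imp_differentiable[OF test_function_smooth]
  by (intro ext) simp

lemma partial_deriv_uminus:
  "f differentiable (at x) \<Longrightarrow> partial_deriv i (\<lambda>x. - f x) x = - partial_deriv i f x"
  using partial_deriv_diff[of "\<lambda>x. 0" x f i] by simp

lemma laplacian_reflect:
  assumes "test_function \<eta>"
  shows "laplacian (\<lambda>y. \<eta> (x - y)) = (\<lambda>y. laplacian \<eta> (x - y))"
proof (rule ext)
  fix y
  have "partial_deriv i (partial_deriv i (\<lambda>y. \<eta> (x - y))) y = partial_deriv i (partial_deriv i \<eta>) (x - y)" for i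
  proof -
    have t: "test_function (partial_deriv i \<eta>)" by (rule test_function_partial_deriv[OF assms])
    have "partial_deriv i (partial_deriv i (\<lambda>y. \<eta> (x - y))) y
        = - partial_deriv i (\<lambda>y. partial_deriv i \<eta> (x - y)) y"
      unfolding partial_deriv_reflect[OF assms]
      using smooth_on_imp_differentiable[OF test_function_smooth[OF test_function_reflect[OF t]] UNIV_I]
      by (rule partial_deriv_uminus)
    then show ?thesis by (simp add: partial_deriv_reflect[OF t])
  qed
  then show "laplacian (\<lambda>y. \<eta> (x - y)) y = laplacian \<eta> (x - y)"
    by (simp add: laplacian_def)
qed

text \<open>The second-order Taylor remainder of the kernel, at most C |h|^2 uniformly, is
  integrated against |f|; so the derivative falls on the kernel and f may be as rough as local
  integrability allows.\<close>

lemma mollify_has_derivative: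
  assumes f: "locally_integrable f" and \<eta>: "test_function \<eta>"
  shows "(mollify f \<eta> has_derivative
    (\<lambda>h. h $ 1 * mollify f (partial_deriv 1 \<eta>) x + h $ 2 * mollify f (partial_deriv 2 \<eta>) x)) (at x)"
proof -
  have f_meas [measurable]: "f \<in> borel_measurable borel" using f by measurable
  obtain C where C: "C \<ge> 0" "\<And>x h. \<bar>\<eta> (x + h) - \<eta> x
      - (h $ 1 * partial_deriv 1 \<eta> x + h $ 2 * partial_deriv 2 \<eta> x)\<bar> \<le> C * (norm h)\<^sup>2"
    using test_function_taylor[OF \<eta>] by metis
  obtain R where R: "\<And>x. \<eta> x \<noteq> 0 \<Longrightarrow> norm x \<le> R"
    using test_function_bounded[OF \<eta>] by (auto simp: bounded_iff)
  have dR: "norm z \<le> R" if "partial_deriv i \<eta> z \<noteq> 0" for i z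
  proof -
    have "closure {x. \<eta> x \<noteq> 0} \<subseteq> cball 0 R"
      by (rule closure_minimal) (use R in auto)
    then show ?thesis using partial_deriv_nonzero_subset[of i \<eta>] that by (auto simp: subset_iff)
  qed
  \<comment> \<open>For |h| \<le> 1 the ball of radius |x| + R + 1 contains the supports of y
    \<mapsto> \<eta>(x + h - y), of y \<mapsto> \<eta>(x - y) and of the derivative terms.\<close>
  define I where "I = (LBINT y. norm (indicator (cball 0 (norm x + R + 1)) y *\<^sub>R f y))"
  have fi: "integrable lborel (\<lambda>y. norm (indicator (cball 0 (norm x + R + 1)) y *\<^sub>R f y))"
    using f unfolding locally_integrable_def set_integrable_def by (intro integrable_norm) auto
  let ?r = "\<lambda>h y. \<eta> (x + h - y) - \<eta> (x - y)
      - (h $ 1 * partial_deriv 1 \<eta> (x - y) + h $ 2 * partial_deriv 2 \<eta> (x - y))"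
  let ?L = "\<lambda>h. h $ 1 * mollify f (partial_deriv 1 \<eta>) x + h $ 2 * mollify f (partial_deriv 2 \<eta>) x"
  have ints: "integrable lborel (\<lambda>y. f y * \<eta> (z - y))"
    "integrable lborel (\<lambda>y. f y * partial_deriv i \<eta> (z - y))" for z i
    by (intro integrable_mult_test_function[OF f] test_function_reflect test_function_partial_deriv \<eta>)+
  have r: "f y * ?r h y = f y * \<eta> (x + h - y) - f y * \<eta> (x - y)
      - (h $ 1 * (f y * partial_deriv 1 \<eta> (x - y)) + h $ 2 * (f y * partial_deriv 2 \<eta> (x - y)))" for h y
    by (simp add: algebra_simps)
  have eq: "mollify f \<eta> (x + h) - mollify f \<eta> x - ?L h = (LBINT y. f y * ?r h y)" for h
    unfolding r mollify_def using ints by simp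
  have bound: "\<bar>mollify f \<eta> (x + h) - mollify f \<eta> x - ?L h\<bar> \<le> C * I * (norm h)\<^sup>2" if "norm h \<le> 1" for h
  proof -
    have "norm (LBINT y. f y * ?r h y)
        \<le> (LBINT y. C * (norm h)\<^sup>2 * norm (indicator (cball 0 (norm x + R + 1)) y *\<^sub>R f y))"
    proof (rule Bochner_Integration.integral_norm_bound_integral)
      show "integrable lborel (\<lambda>y. f y * ?r h y)"
        unfolding r using ints by simp
      show "integrable lborel (\<lambda>y. C * (norm h)\<^sup>2 * norm (indicator (cball 0 (norm x + R + 1)) y *\<^sub>R f y))"
        using fi by simp
      fix y
      show "norm (f y * ?r h y) \<le> C * (norm h)\<^sup>2 * norm (indicator (cball 0 (norm x + R + 1)) y *\<^sub>R f y)"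
      proof (cases "norm y \<le> norm x + R + 1")
        case True
        have "\<bar>?r h y\<bar> \<le> C * (norm h)\<^sup>2"
          using C(2)[of "x - y" h] by (simp add: algebra_simps)
        then have "\<bar>f y\<bar> * \<bar>?r h y\<bar> \<le> \<bar>f y\<bar> * (C * (norm h)\<^sup>2)"
          by (intro mult_left_mono) auto
        then show ?thesis using True by (simp add: abs_mult mult.commute)
      next
        case False
        have "norm (x + h - y) > R" "norm (x - y) > R"
          using False that norm_triangle_ineq2[of y "x + h"] norm_triangle_ineq2[of y x]
            norm_triangle_ineq[of x h] norm_minus_commute[of y "x + h"] norm_minus_commute[of y x]
          by linarith+
        then have "\<eta> (x + h - y) = 0" "\<eta> (x - y) = 0" "partial_deriv i \<eta> (x - y) = 0" for i
          using R[of "x + h - y"] R[of "x - y"] dR[of i "x - y"] by linarith+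
        then have "?r h y = 0" by simp
        then show ?thesis using C by simp
      qed
    qed
    also have "\<dots> = C * (norm h)\<^sup>2 * I"
      unfolding I_def by (rule integral_mult_right_zero)
    finally show ?thesis unfolding eq by (simp add: mult.commute mult.left_commute)
  qed
  show ?thesis
  proof (rule has_derivativeI_sandwich[of 1])
    have "linear ?L" by (auto intro!: linearI simp: algebra_simps)
    then show "bounded_linear ?L" by (simp add: linear_conv_bounded_linear)
    show "((\<lambda>y. C * I * norm (y - x)) \<longlongrightarrow> 0) (at x within UNIV)"
      by (rule tendsto_eq_intros refl | simp)+
    fix y assume y: "y \<noteq> x" "dist y x < 1"
    then have "\<bar>mollify f \<eta> y - mollify f \<eta> x - ?L (y - x)\<bar> \<le> C * I * (norm (y - x))\<^sup>2"
      using bound[of "y - x"] by (simp add: dist_norm)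
    then show "norm ((mollify f \<eta> y - mollify f \<eta> x) - ?L (y - x)) / norm (y - x) \<le> C * I * norm (y - x)"
      using y by (simp add: divide_le_eq power2_eq_square mult.assoc)
  qed auto
qed

lemma partial_deriv_mollify:
  assumes "locally_integrable f" "test_function \<eta>"
  shows "partial_deriv i (mollify f \<eta>) = mollify f (partial_deriv i \<eta>)"
proof
  fix x
  show "partial_deriv i (mollify f \<eta>) x = mollify f (partial_deriv i \<eta>) x"
    using partial_deriv_eqI[OF mollify_has_derivative[OF assms, of x], of i] exhaust_2[of i]
    by (auto simp: axis_def)
qed

lemma smooth_on_mollify:
  assumes f: "locally_integrable f" and "test_function \<eta>"
  shows "smooth_on UNIV (mollify f \<eta>)"
proof -
  have "Ck_on n UNIV (mollify f \<eta>)" for n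
    using assms(2)
  proof (induction n arbitrary: \<eta>)
    case 0
    then show ?case
      by (auto simp: continuous_on_eq_continuous_within
          intro!: has_derivative_continuous[OF mollify_has_derivative[OF f]])
  next
    case (Suc n)
    then show ?case
      using mollify_has_derivative[OF f Suc.prems] partial_deriv_mollify[OF f Suc.prems]
        test_function_partial_deriv[OF Suc.prems]
      by (auto simp: differentiable_def)
  qed
  then show ?thesis by (simp add: smooth_on_def)
qed

lemma laplacian_mollify:
  assumes "locally_integrable f" "test_function \<eta>"
  shows "laplacian (mollify f \<eta>) x = mollify f (laplacian \<eta>) x"
proof -
  have "integrable lborel (\<lambda>y. f y * partial_deriv i (partial_deriv i \<eta>) (x - y))" for i
    by (intro integrable_mult_test_function assms test_function_reflect test_function_partial_deriv)
  then show ?thesis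
    unfolding laplacian_def partial_deriv_mollify[OF assms]
      partial_deriv_mollify[OF assms(1) test_function_partial_deriv[OF assms(2)]]
    by (simp add: mollify_def laplacian_def algebra_simps)
qed

text \<open>The weak identity tested with the reflected kernel y \<mapsto> \<eta>(x - y); the
  reflection supplies the sign that cancels the minus sign of weak differentiation.\<close>

lemma mollify_weak_partial_deriv:
  assumes "\<And>\<phi>. test_function \<phi> \<Longrightarrow> (LBINT x. f x * partial_deriv i \<phi> x) = - (LBINT x. g x * \<phi> x)"
    and "test_function \<eta>"
  shows "mollify f (partial_deriv i \<eta>) x = mollify g \<eta> x"
  using assms(1)[OF test_function_reflect[OF assms(2), of x]]
  by (simp add: mollify_def partial_deriv_reflect[OF assms(2)])

lemma mollify_weak_laplacian:
  assumes "\<And>\<phi>. test_function \<phi> \<Longrightarrow> (LBINT x. f x * laplacian \<phi> x) = (LBINT x. g x * \<phi> x)"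
    and "test_function \<eta>"
  shows "mollify f (laplacian \<eta>) x = mollify g \<eta> x"
  using assms(1)[OF test_function_reflect[OF assms(2), of x]]
  by (simp add: mollify_def laplacian_reflect[OF assms(2)])

lemma is_mollifier_exists:
  assumes "\<delta> > 0"
  shows "\<exists>\<eta>. is_mollifier \<eta> \<delta>"
proof -
  obtain h :: "real^2 \<Rightarrow> real" where h: "test_function h" "\<And>x. 0 \<le> h x \<and> h x \<le> 1"
    "\<And>x. x \<in> cball 0 (\<delta> / 2) \<Longrightarrow> h x = 1" "\<And>x. x \<notin> ball 0 \<delta> \<Longrightarrow> h x = 0"
    using cutoff_exists[of "\<delta> / 2" \<delta> 0] assms by (metis half_gt_zero_iff field_sum_of_halves less_add_same_cancel1 less_eq_real_def)
  have hi: "integrable lborel h" using h(1) by (rule test_function_integrable)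
  have "0 < measure lborel (cball (0::real^2) (\<delta> / 2))"
    using assms content_cball_pos[of "\<delta> / 2" "0::real^2"] by simp
  also have "\<dots> = (LBINT x. indicator (cball (0::real^2) (\<delta> / 2)) x)"
    by simp
  also have "\<dots> \<le> (LBINT x. h x)"
    using borel_integrable_compact[of "cball (0::real^2) (\<delta> / 2)" "\<lambda>x. 1 :: real"] h
    by (intro integral_mono hi) (auto simp: indicator_def)
  finally have pos: "(LBINT x. h x) > 0" .
  have "is_mollifier (\<lambda>x. inverse (LBINT x. h x) * h x) \<delta>"
    unfolding is_mollifier_def
  proof (intro conjI allI impI)
    show "test_function (\<lambda>x. inverse (LBINT x. h x) * h x)"
      by (rule test_function_mult(1)[OF smooth_on_const h(1)])
    show "norm x < \<delta>" if "inverse (LBINT x. h x) * h x \<noteq> 0" for x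
      using that h(4)[of x] by force
  qed (use pos h(2) in auto)
  then show ?thesis by blast
qed

lemma is_mollifier_mono: "is_mollifier \<eta> \<delta> \<Longrightarrow> \<delta> \<le> \<delta>' \<Longrightarrow> is_mollifier \<eta> \<delta>'"
  unfolding is_mollifier_def by force

lemma mollifier_integral:
  assumes "is_mollifier \<eta> \<delta>"
  shows "(LBINT y. \<eta> (x - y)) = 1" "integrable lborel (\<lambda>y. \<eta> (x - y))"
    "(LBINT x. \<eta> (x - y)) = 1" "integrable lborel (\<lambda>x. \<eta> (x - y))"
proof -
  have \<eta>: "test_function \<eta>" "(LBINT x. \<eta> x) = 1" using assms by (auto simp: is_mollifier_def)
  have [measurable]: "\<eta> \<in> borel_measurable borel" using \<eta>(1) by measurable
  show "(LBINT y. \<eta> (x - y)) = 1"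
    using lborel_integral_affine[of \<eta> "-1" x] \<eta> by simp
  show "integrable lborel (\<lambda>y. \<eta> (x - y))"
    using \<eta> test_function_integrable test_function_reflect by blast
  show "(LBINT x. \<eta> (x - y)) = 1"
    using lborel_integral_affine[of \<eta> 1 "-y"] \<eta> by simp
  show "integrable lborel (\<lambda>x. \<eta> (x - y))"
    using lborel_integrable_affine[of \<eta> 1 "-y"] test_function_integrable[OF \<eta>(1)] by simp
qed

text \<open>Jensen's inequality for the probability density y \<mapsto> \<eta>(x - y): expand the
  nonnegative variance about the mean m.\<close>

lemma mollify_power2_le:
  assumes f: "locally_L2 f" and \<eta>: "is_mollifier \<eta> \<delta>"
  shows "(mollify f \<eta> x)\<^sup>2 \<le> (LBINT y. (f y)\<^sup>2 * \<eta> (x - y))"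
proof -
  have t: "test_function \<eta>" "\<And>x. 0 \<le> \<eta> x" using \<eta> by (auto simp: is_mollifier_def)
  have [measurable]: "f \<in> borel_measurable borel" using f by measurable
  define m where "m = mollify f \<eta> x"
  have f2: "locally_integrable (\<lambda>x. (f x)\<^sup>2)"
    using f unfolding locally_L2_def locally_integrable_def by simp
  have i1: "integrable lborel (\<lambda>y. f y * \<eta> (x - y))" "integrable lborel (\<lambda>y. (f y)\<^sup>2 * \<eta> (x - y))"
    using t f2 locally_L2_imp_locally_integrable[OF f]
    by (auto intro!: integrable_mult_test_function test_function_reflect)
  have "0 \<le> (LBINT y. (f y - m)\<^sup>2 * \<eta> (x - y))"
    using t by (intro Bochner_Integration.integral_nonneg) auto
  also have "\<dots> = (LBINT y. (f y)\<^sup>2 * \<eta> (x - y) - 2 * m * (f y * \<eta> (x - y)) + m\<^sup>2 * \<eta> (x - y))"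
    by (rule Bochner_Integration.integral_cong) (auto simp: power2_eq_square algebra_simps)
  also have "\<dots> = (LBINT y. (f y)\<^sup>2 * \<eta> (x - y)) - 2 * m * (LBINT y. f y * \<eta> (x - y))
      + m\<^sup>2 * (LBINT y. \<eta> (x - y))"
    using i1 mollifier_integral[OF \<eta>] by simp
  also have "\<dots> = (LBINT y. (f y)\<^sup>2 * \<eta> (x - y)) - m\<^sup>2"
    using mollifier_integral[OF \<eta>] by (simp add: m_def mollify_def power2_eq_square)
  finally show ?thesis by (simp add: m_def)
qed

section \<open>Convergence of mollifications in the square mean\<close>

lemma integrable_imp_locally_L2:
  assumes [measurable]: "f \<in> borel_measurable borel" and "integrable lborel (\<lambda>x. (f x)\<^sup>2)"
  shows "locally_L2 f"
  unfolding locally_L2_def set_integrable_def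
  by (intro conjI allI integrable_mult_indicator assms) auto

lemma mollify_measurable: "locally_integrable f \<Longrightarrow> test_function \<eta> \<Longrightarrow> mollify f \<eta> \<in> borel_measurable borel"
  by (intro borel_measurable_continuous_onI smooth_on_imp_continuous_on smooth_on_mollify)

text \<open>Jensen pointwise, then Tonelli: as a function of x the kernel \<eta>(x - y) has total
  mass 1 for every y.\<close>

lemma mollify_L2_contraction:
  assumes fm [measurable]: "f \<in> borel_measurable borel" and fi: "integrable lborel (\<lambda>x. (f x)\<^sup>2)"
    and \<eta>: "is_mollifier \<eta> \<delta>"
  shows "integrable lborel (\<lambda>x. (mollify f \<eta> x)\<^sup>2)"
    "(LBINT x. (mollify f \<eta> x)\<^sup>2) \<le> (LBINT x. (f x)\<^sup>2)"
proof -
  have t: "test_function \<eta>" "\<And>x. 0 \<le> \<eta> x" using \<eta> by (auto simp: is_mollifier_def)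
  have [measurable]: "\<eta> \<in> borel_measurable borel" using t(1) by measurable
  have f: "locally_L2 f" by (rule integrable_imp_locally_L2[OF fm fi])
  have [measurable]: "mollify f \<eta> \<in> borel_measurable borel"
    by (rule mollify_measurable[OF locally_L2_imp_locally_integrable[OF f] t(1)])
  have f2: "locally_integrable (\<lambda>x. (f x)\<^sup>2)"
    using f unfolding locally_L2_def locally_integrable_def by simp
  have i2: "integrable lborel (\<lambda>y. (f y)\<^sup>2 * \<eta> (x - y))" for x
    by (intro integrable_mult_test_function[OF f2] test_function_reflect t(1))
  have le: "(\<integral>\<^sup>+x. ennreal ((mollify f \<eta> x)\<^sup>2) \<partial>lborel) \<le> ennreal (LBINT x. (f x)\<^sup>2)"
  proof -
    have "(\<integral>\<^sup>+x. ennreal ((mollify f \<eta> x)\<^sup>2) \<partial>lborel)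
        \<le> (\<integral>\<^sup>+x. ennreal (LBINT y. (f y)\<^sup>2 * \<eta> (x - y)) \<partial>lborel)"
      by (intro nn_integral_mono ennreal_leI mollify_power2_le[OF f \<eta>])
    also have "\<dots> = (\<integral>\<^sup>+x. (\<integral>\<^sup>+y. ennreal ((f y)\<^sup>2 * \<eta> (x - y)) \<partial>lborel) \<partial>lborel)"
      using t by (intro nn_integral_cong nn_integral_eq_integral[symmetric] i2) auto
    also have "\<dots> = (\<integral>\<^sup>+y. (\<integral>\<^sup>+x. ennreal ((f y)\<^sup>2 * \<eta> (x - y)) \<partial>lborel) \<partial>lborel)"
      by (rule lborel_pair.Fubini'[symmetric]) measurable
    also have "\<dots> = (\<integral>\<^sup>+y. ennreal ((f y)\<^sup>2) \<partial>lborel)"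
    proof (rule nn_integral_cong)
      fix y
      have "(\<integral>\<^sup>+x. ennreal ((f y)\<^sup>2 * \<eta> (x - y)) \<partial>lborel) = ennreal (LBINT x. (f y)\<^sup>2 * \<eta> (x - y))"
        using t mollifier_integral[OF \<eta>] by (intro nn_integral_eq_integral) auto
      then show "(\<integral>\<^sup>+x. ennreal ((f y)\<^sup>2 * \<eta> (x - y)) \<partial>lborel) = ennreal ((f y)\<^sup>2)"
        using mollifier_integral[OF \<eta>] by simp
    qed
    also have "\<dots> = ennreal (LBINT x. (f x)\<^sup>2)"
      by (rule nn_integral_eq_integral[OF fi]) auto
    finally show ?thesis .
  qed
  show i: "integrable lborel (\<lambda>x. (mollify f \<eta> x)\<^sup>2)"
  proof (rule integrableI_bounded)
    show "(\<integral>\<^sup>+x. ennreal (norm ((mollify f \<eta> x)\<^sup>2)) \<partial>lborel) < \<infinity>"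
      using le by (simp add: le_less_trans)
  qed measurable
  have "ennreal (LBINT x. (mollify f \<eta> x)\<^sup>2) \<le> ennreal (LBINT x. (f x)\<^sup>2)"
    using le nn_integral_eq_integral[OF i] by simp
  then show "(LBINT x. (mollify f \<eta> x)\<^sup>2) \<le> (LBINT x. (f x)\<^sup>2)"
    by (simp add: Bochner_Integration.integral_nonneg)
qed

text \<open>First f is clamped in value and in support, which costs little by dominated convergence.
  The clamped function is an almost everywhere limit of continuous ones; clamping these to the same
  range makes dominated convergence applicable a second time.\<close>

lemma L2_continuous_approx:
  assumes fm [measurable]: "f \<in> borel_measurable borel" and fi: "integrable lborel (\<lambda>x. (f x)\<^sup>2)"
    and "e > 0"
  obtains g :: "real^2 \<Rightarrow> real" and R where "continuous_on UNIV g" "\<And>x. norm x > R \<Longrightarrow> g x = 0"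
    "integrable lborel (\<lambda>x. (f x - g x)\<^sup>2)" "(LBINT x. (f x - g x)\<^sup>2) < e"
proof -
  define clamp where "clamp = (\<lambda>n t. max (- real n) (min (real n) t))"
  have clamp_cont: "continuous_on UNIV (clamp n)" for n
    unfolding clamp_def by (intro continuous_intros)
  have cm [measurable]: "clamp n \<in> borel_measurable borel" for n
    using clamp_cont by (rule borel_measurable_continuous_onI)
  define F where "F = (\<lambda>n x. indicator (cball 0 (real n)) x * clamp n (f x))"
  have Fm [measurable]: "F n \<in> borel_measurable borel" for n
    unfolding F_def
    by (intro borel_measurable_times borel_measurable_indicator measurable_compose[OF fm cm]) simp
  have dom: "(f x - F n x)\<^sup>2 \<le> (f x)\<^sup>2" for n x
  proof -
    have "\<bar>f x - F n x\<bar> \<le> \<bar>f x\<bar>" by (auto simp: F_def clamp_def indicator_def)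
    then show ?thesis by (simp add: abs_le_square_iff)
  qed
  have Fi: "integrable lborel (\<lambda>x. (f x - F n x)\<^sup>2)" for n
    using dom by (intro Bochner_Integration.integrable_bound[OF fi]) auto
  have "(\<lambda>n. \<integral>x. (f x - F n x)\<^sup>2 \<partial>lborel) \<longlonglongrightarrow> (\<integral>x. 0 \<partial>(lborel :: (real^2) measure))"
  proof (rule integral_dominated_convergence[where w = "\<lambda>x. (f x)\<^sup>2"])
    show "AE x in lborel. (\<lambda>n. (f x - F n x)\<^sup>2) \<longlonglongrightarrow> 0"
    proof (rule AE_I2)
      fix x
      obtain N where N: "real N \<ge> max (norm x) \<bar>f x\<bar>" using real_arch_simple by blast
      have "(f x - F n x)\<^sup>2 = 0" if "n \<ge> N" for n
        using N that by (auto simp: F_def clamp_def indicator_def)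
      then show "(\<lambda>n. (f x - F n x)\<^sup>2) \<longlonglongrightarrow> 0"
        by (intro tendsto_eventually) (auto simp: eventually_sequentially)
    qed
  qed (use fi dom in auto)
  then have "\<forall>\<^sub>F n in sequentially. (LBINT x. (f x - F n x)\<^sup>2) < e / 4"
    using \<open>e > 0\<close> by (intro order_tendstoD) auto
  then obtain n where n: "(LBINT x. (f x - F n x)\<^sup>2) < e / 4"
    by (auto simp: eventually_sequentially)
  have "F n measurable_on UNIV"
    by (rule lebesgue_measurable_imp_measurable_on_real) (use measurable_completion[of "F n" lborel borel] Fm in auto)
  then obtain N g where N: "negligible N" and g: "\<And>k. continuous_on UNIV (g k)"
    and lim: "\<And>x. x \<notin> N \<Longrightarrow> (\<lambda>k. g k x) \<longlonglongrightarrow> F n x"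
    unfolding measurable_on_UNIV measurable_on_def by auto
  \<comment> \<open>A continuous cutoff equal to 1 wherever \<open>F n\<close> is nonzero: it gives
    the approximants bounded support without changing their limit.\<close>
  define \<kappa> where "\<kappa> = (\<lambda>x::real^2. max 0 (min 1 (real n + 1 - norm x)))"
  define G where "G = (\<lambda>k x. \<kappa> x * clamp n (g k x))"
  have G_cont: "continuous_on UNIV (G k)" for k
    unfolding G_def \<kappa>_def
    by (intro continuous_intros continuous_on_compose2[OF clamp_cont g]) auto
  have [measurable]: "G k \<in> borel_measurable borel" for k
    using G_cont by (rule borel_measurable_continuous_onI)
  have bnd: "(F n x - G k x)\<^sup>2 \<le> indicator (cball 0 (real n + 1)) x *\<^sub>R (2 * real n)\<^sup>2" for k x
  proof (cases "norm x \<le> real n + 1")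
    case True
    have c: "\<bar>clamp n t\<bar> \<le> real n" for t by (auto simp: clamp_def)
    have "\<bar>F n x\<bar> \<le> real n" using c by (auto simp: F_def indicator_def)
    moreover have "\<bar>G k x\<bar> \<le> 1 * real n"
      unfolding G_def abs_mult using c by (intro mult_mono) (auto simp: \<kappa>_def)
    ultimately have "\<bar>F n x - G k x\<bar> \<le> \<bar>2 * real n\<bar>" by linarith
    then have "(F n x - G k x)\<^sup>2 \<le> (2 * real n)\<^sup>2" by (simp only: abs_le_square_iff)
    then show ?thesis using True by simp
  next
    case False
    then show ?thesis by (simp add: F_def G_def \<kappa>_def)
  qed
  have bi: "integrable lborel (\<lambda>x::real^2. indicator (cball 0 (real n + 1)) x *\<^sub>R (2 * real n)\<^sup>2)"
    by (intro borel_integrable_compact) auto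
  have Gi: "integrable lborel (\<lambda>x. (F n x - G k x)\<^sup>2)" for k
    using bnd by (intro Bochner_Integration.integrable_bound[OF bi]) auto
  have "(\<lambda>k. \<integral>x. (F n x - G k x)\<^sup>2 \<partial>lborel) \<longlonglongrightarrow> (\<integral>x. 0 \<partial>(lborel :: (real^2) measure))"
  proof (rule integral_dominated_convergence[where w = "\<lambda>x. indicator (cball 0 (real n + 1)) x *\<^sub>R (2 * real n)\<^sup>2"])
    have "AE x in lborel. x \<notin> N"
      using N AE_not_in[of N lebesgue] by (simp add: negligible_iff_null_sets AE_completion_iff)
    then show "AE x in lborel. (\<lambda>k. (F n x - G k x)\<^sup>2) \<longlonglongrightarrow> 0"
    proof eventually_elim
      case (elim x)
      have "(\<lambda>k. clamp n (g k x)) \<longlonglongrightarrow> clamp n (F n x)"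
        using lim[OF elim] clamp_cont[of n] by (intro continuous_on_tendsto_compose[OF clamp_cont]) auto
      moreover have "clamp n (F n x) = F n x" by (auto simp: F_def clamp_def indicator_def)
      moreover have "\<kappa> x * F n x = F n x" by (auto simp: F_def \<kappa>_def indicator_def)
      ultimately have "(\<lambda>k. G k x) \<longlonglongrightarrow> F n x"
        unfolding G_def using tendsto_mult_left[of "\<lambda>k. clamp n (g k x)" "F n x" sequentially "\<kappa> x"]
        by (simp only:)
      then have "(\<lambda>k. (F n x - G k x)\<^sup>2) \<longlonglongrightarrow> (F n x - F n x)\<^sup>2"
        by (intro tendsto_intros)
      then show ?case by simp
    qed
  qed (use bi bnd in auto)
  then have "\<forall>\<^sub>F k in sequentially. (LBINT x. (F n x - G k x)\<^sup>2) < e / 4"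
    using \<open>e > 0\<close> by (intro order_tendstoD) auto
  then obtain k where k: "(LBINT x. (F n x - G k x)\<^sup>2) < e / 4"
    by (auto simp: eventually_sequentially)
  have le: "(f x - G k x)\<^sup>2 \<le> 2 * (f x - F n x)\<^sup>2 + 2 * (F n x - G k x)\<^sup>2" for x
    using sum_squares_bound[of "f x - F n x" "F n x - G k x"]
      power2_sum[of "f x - F n x" "F n x - G k x"] by simp
  have ii: "integrable lborel (\<lambda>x. 2 * (f x - F n x)\<^sup>2 + 2 * (F n x - G k x)\<^sup>2)"
    using Fi Gi by auto
  have i: "integrable lborel (\<lambda>x. (f x - G k x)\<^sup>2)"
    by (rule Bochner_Integration.integrable_bound[OF ii]) (use le in \<open>auto intro!: AE_I2\<close>)
  have "(LBINT x. (f x - G k x)\<^sup>2) \<le> (LBINT x. 2 * (f x - F n x)\<^sup>2 + 2 * (F n x - G k x)\<^sup>2)"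
    by (rule integral_mono[OF i ii le])
  also have "\<dots> = 2 * (LBINT x. (f x - F n x)\<^sup>2) + 2 * (LBINT x. (F n x - G k x)\<^sup>2)"
    using Fi Gi by simp
  also have "\<dots> < e" using n k by linarith
  finally have "(LBINT x. (f x - G k x)\<^sup>2) < e" .
  moreover have "G k x = 0" if "norm x > real n + 1" for x
    using that by (simp add: G_def \<kappa>_def)
  ultimately show ?thesis
    using that[OF G_cont[of k], of "real n + 1"] i by blast
qed

lemma power2_sum_le: "(a + b)\<^sup>2 \<le> 2 * a\<^sup>2 + 2 * (b::real)\<^sup>2"
  using sum_squares_bound[of a b] by (simp add: power2_sum)

lemma integrable_power2_sum:
  assumes [measurable]: "f \<in> borel_measurable lborel" "g \<in> borel_measurable lborel"
    and "integrable lborel (\<lambda>x. (f x)\<^sup>2)" "integrable lborel (\<lambda>x. (g x)\<^sup>2)"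
  shows "integrable lborel (\<lambda>x. (f x + g x)\<^sup>2 :: real)"
    "(LBINT x. (f x + g x)\<^sup>2) \<le> 2 * (LBINT x. (f x)\<^sup>2) + 2 * (LBINT x. (g x)\<^sup>2)"
proof -
  have ii: "integrable lborel (\<lambda>x. 2 * (f x)\<^sup>2 + 2 * (g x)\<^sup>2)" using assms by simp
  show i: "integrable lborel (\<lambda>x. (f x + g x)\<^sup>2)"
    by (rule Bochner_Integration.integrable_bound[OF ii]) (use power2_sum_le in \<open>auto intro!: AE_I2\<close>)
  have "(LBINT x. (f x + g x)\<^sup>2) \<le> (LBINT x. 2 * (f x)\<^sup>2 + 2 * (g x)\<^sup>2)"
    by (rule integral_mono[OF i ii power2_sum_le])
  then show "(LBINT x. (f x + g x)\<^sup>2) \<le> 2 * (LBINT x. (f x)\<^sup>2) + 2 * (LBINT x. (g x)\<^sup>2)"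
    using assms by simp
qed

lemma mollify_diff:
  assumes "locally_integrable f" "locally_integrable g" "test_function \<eta>"
  shows "mollify (\<lambda>x. f x - g x) \<eta> x = mollify f \<eta> x - mollify g \<eta> x"
proof -
  have "integrable lborel (\<lambda>y. f y * \<eta> (x - y))" "integrable lborel (\<lambda>y. g y * \<eta> (x - y))"
    by (intro integrable_mult_test_function assms test_function_reflect)+
  then show ?thesis by (simp add: mollify_def left_diff_distrib)
qed

lemma continuous_locally_integrable:
  assumes "continuous_on UNIV f"
  shows "locally_integrable f"
  unfolding locally_integrable_def set_integrable_def
proof (intro conjI allI)
  show "integrable lborel (\<lambda>x. indicator (cball 0 r) x *\<^sub>R f x)" for r
    using assms by (intro borel_integrable_compact) (auto intro: continuous_on_subset)
qed (rule borel_measurable_continuous_onI[OF assms])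

text \<open>A mollification is a weighted mean of values at distance less than \<delta>, and a mean
  of numbers within e of \<open>g x\<close> is within e of it.\<close>

lemma mollify_continuous_close:
  assumes g: "continuous_on UNIV g" and \<eta>: "is_mollifier \<eta> \<delta>"
    and close: "\<And>y. norm (x - y) < \<delta> \<Longrightarrow> \<bar>g y - g x\<bar> \<le> e"
  shows "\<bar>mollify g \<eta> x - g x\<bar> \<le> e"
proof -
  have t: "test_function \<eta>" "\<And>x. 0 \<le> \<eta> x" "\<And>z. \<eta> z \<noteq> 0 \<Longrightarrow> norm z < \<delta>"
    using \<eta> by (auto simp: is_mollifier_def)
  have i: "integrable lborel (\<lambda>y. g y * \<eta> (x - y))"
    by (intro integrable_mult_test_function continuous_locally_integrable g test_function_reflect t)
  note m = mollifier_integral[OF \<eta>]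
  have "mollify g \<eta> x - g x = (LBINT y. g y * \<eta> (x - y) - g x * \<eta> (x - y))"
    using i m by (simp add: mollify_def)
  moreover have "\<bar>\<integral>y. g y * \<eta> (x - y) - g x * \<eta> (x - y) \<partial>lborel\<bar> \<le> (LBINT y. e * \<eta> (x - y))"
  proof (rule integral_abs_bound_integral)
    fix y
    have "\<bar>g y - g x\<bar> * \<eta> (x - y) \<le> e * \<eta> (x - y)"
      using close[of y] t(2,3)[of "x - y"] by (cases "\<eta> (x - y) = 0") (auto intro!: mult_right_mono)
    then show "\<bar>g y * \<eta> (x - y) - g x * \<eta> (x - y)\<bar> \<le> e * \<eta> (x - y)"
      using t(2)[of "x - y"] by (simp add: left_diff_distrib[symmetric] abs_mult)
  qed (use i m in auto)
  ultimately show ?thesis using m by simp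
qed

text \<open>For a continuous g of bounded support the convergence is uniform; the error f - g is
  handled by the contraction property. The bound holds for every mollifier of width \<delta>, so
  that a common one can later be chosen for several functions.\<close>

lemma mollify_L2_approx:
  assumes fm [measurable]: "f \<in> borel_measurable borel" and fi: "integrable lborel (\<lambda>x. (f x)\<^sup>2)"
    and "e > 0"
  obtains \<delta> where "\<delta> > 0" "\<delta> \<le> 1" "\<And>\<eta>. is_mollifier \<eta> \<delta> \<Longrightarrow> integrable lborel (\<lambda>x. (mollify f \<eta> x - f x)\<^sup>2)"
    "\<And>\<eta>. is_mollifier \<eta> \<delta> \<Longrightarrow> (LBINT x. (mollify f \<eta> x - f x)\<^sup>2) < e"
proof -
  \<comment> \<open>Two uses of (a + b)^2 \<le> 2 a^2 + 2 b^2 turn three errors of at most e / 12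
    into at most 5 e / 6.\<close>
  obtain g :: "real^2 \<Rightarrow> real" and R where g: "continuous_on UNIV g" "\<And>x. norm x > R \<Longrightarrow> g x = 0"
    and fgi: "integrable lborel (\<lambda>x. (f x - g x)\<^sup>2)" and fg: "(LBINT x. (f x - g x)\<^sup>2) < e / 12"
    using L2_continuous_approx[OF fm fi, of "e / 12"] \<open>e > 0\<close> by auto
  have gm [measurable]: "g \<in> borel_measurable borel" using g(1) by (rule borel_measurable_continuous_onI)
  define V where "V = measure lborel (cball (0::real^2) (R + 1))"
  have V: "V \<ge> 0" by (simp add: V_def)
  define e0 where "e0 = sqrt (e / (12 * (V + 1)))"
  have e0: "e0 > 0" "e0\<^sup>2 * V < e / 12" using \<open>e > 0\<close> V by (auto simp: e0_def field_simps)
  have "uniformly_continuous_on (cball 0 (R + 2)) g"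
    using g(1) by (intro compact_uniformly_continuous) (auto intro: continuous_on_subset)
  then obtain d where d: "d > 0" "\<And>x y. x \<in> cball 0 (R + 2) \<Longrightarrow> y \<in> cball 0 (R + 2) \<Longrightarrow> dist y x < d \<Longrightarrow> \<bar>g y - g x\<bar> < e0"
    unfolding uniformly_continuous_on_def dist_real_def using e0(1) by metis
  define \<delta> where "\<delta> = min 1 d"
  have \<delta>: "\<delta> > 0" "\<delta> \<le> 1" using d by (auto simp: \<delta>_def)
  have fL: "locally_L2 f" by (rule integrable_imp_locally_L2[OF fm fi])
  have "integrable lborel (\<lambda>x. (mollify f \<eta> x - f x)\<^sup>2) \<and> (LBINT x. (mollify f \<eta> x - f x)\<^sup>2) < e"
    if \<eta>: "is_mollifier \<eta> \<delta>" for \<eta>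
  proof -
    have t: "test_function \<eta>" using \<eta> by (auto simp: is_mollifier_def)
    have gl: "locally_integrable g" by (rule continuous_locally_integrable[OF g(1)])
    have fl: "locally_integrable f" by (rule locally_L2_imp_locally_integrable[OF fL])
    have mf: "mollify f \<eta> \<in> borel_measurable borel" and mg: "mollify g \<eta> \<in> borel_measurable borel"
      by (intro mollify_measurable fl gl t)+
    have close: "(mollify g \<eta> x - g x)\<^sup>2 \<le> indicator (cball 0 (R + 1)) x *\<^sub>R e0\<^sup>2" for x
    proof (cases "norm x \<le> R + 1")
      case True
      have "\<bar>mollify g \<eta> x - g x\<bar> \<le> e0"
      proof (rule mollify_continuous_close[OF g(1) \<eta>])
        fix y assume "norm (x - y) < \<delta>"
        then have "dist y x < d" "norm y \<le> R + 2"
          using True norm_triangle_ineq2[of y x] \<delta> by (auto simp: \<delta>_def dist_norm norm_minus_commute)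
        then show "\<bar>g y - g x\<bar> \<le> e0" using d(2)[of x y] True by simp
      qed
      then have "(mollify g \<eta> x - g x)\<^sup>2 \<le> e0\<^sup>2"
        using e0(1) by (simp add: abs_le_square_iff[symmetric])
      then show ?thesis using True by simp
    next
      case False
      have "\<bar>mollify g \<eta> x - g x\<bar> \<le> 0"
      proof (rule mollify_continuous_close[OF g(1) \<eta>])
        fix y assume "norm (x - y) < \<delta>"
        then have "norm y > R"
          using False norm_triangle_ineq2[of x y] \<delta> by linarith
        then show "\<bar>g y - g x\<bar> \<le> 0" using g(2)[of x] g(2)[of y] False by simp
      qed
      then show ?thesis using False by simp
    qed
    have bi: "integrable lborel (\<lambda>x::real^2. indicator (cball 0 (R + 1)) x *\<^sub>R e0\<^sup>2)"
      by (intro borel_integrable_compact) auto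
    have gi: "integrable lborel (\<lambda>x. (mollify g \<eta> x - g x)\<^sup>2)"
      using close mg by (intro Bochner_Integration.integrable_bound[OF bi]) auto
    have "(LBINT x. (mollify g \<eta> x - g x)\<^sup>2) \<le> (LBINT x. indicator (cball (0::real^2) (R + 1)) x *\<^sub>R e0\<^sup>2)"
      by (rule integral_mono[OF gi bi close])
    also have "\<dots> = e0\<^sup>2 * V"
      by (simp add: V_def)
    finally have 1: "(LBINT x. (mollify g \<eta> x - g x)\<^sup>2) < e / 12" using e0(2) by linarith
    define a where "a = mollify (\<lambda>x. f x - g x) \<eta>"
    have a: "integrable lborel (\<lambda>x. (a x)\<^sup>2)" "(LBINT x. (a x)\<^sup>2) \<le> (LBINT x. (f x - g x)\<^sup>2)"
      unfolding a_def using mollify_L2_contraction[OF _ fgi \<eta>] by auto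
    have aeq: "a x = mollify f \<eta> x - mollify g \<eta> x" for x
      unfolding a_def by (rule mollify_diff[OF fl gl t])
    have am: "a \<in> borel_measurable lborel" using mf mg unfolding aeq[abs_def] by simp
    have bm: "(\<lambda>x. mollify g \<eta> x - g x) \<in> borel_measurable lborel" using mg by simp
    have b: "integrable lborel (\<lambda>x. (g x - f x)\<^sup>2)" "(LBINT x. (g x - f x)\<^sup>2) < e / 12"
      using fgi fg by (simp_all add: power2_commute[of "g _" "f _"])
    note s1 = integrable_power2_sum[OF am bm a(1) gi]
    have "(\<lambda>x. a x + (mollify g \<eta> x - g x)) \<in> borel_measurable lborel" "(\<lambda>x. g x - f x) \<in> borel_measurable lborel"
      using am bm by auto
    note s2 = integrable_power2_sum[OF this s1(1) b(1)]
    have eq: "a x + (mollify g \<eta> x - g x) + (g x - f x) = mollify f \<eta> x - f x" for x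
      by (simp add: aeq)
    have "(LBINT x. (mollify f \<eta> x - f x)\<^sup>2) < e"
      using s1(2) s2(2) a(2) fg b(2) 1 \<open>e > 0\<close> unfolding eq by linarith
    then show ?thesis using s2(1) unfolding eq by blast
  qed
  then show ?thesis using that \<delta> by blast
qed

lemma locally_L2_indicator:
  assumes f: "locally_L2 f" and S: "S \<in> sets borel" "S \<subseteq> cball 0 R"
  shows "(\<lambda>x. indicator S x * f x) \<in> borel_measurable borel"
    "integrable lborel (\<lambda>x. (indicator S x * f x)\<^sup>2)"
proof -
  have [measurable]: "f \<in> borel_measurable borel" using f by measurable
  show m: "(\<lambda>x. indicator S x * f x) \<in> borel_measurable borel"
    using S by measurable
  have "integrable lborel (\<lambda>x. indicator (cball 0 R) x *\<^sub>R (f x)\<^sup>2)"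
    using f unfolding locally_L2_def set_integrable_def by blast
  then show "integrable lborel (\<lambda>x. (indicator S x * f x)\<^sup>2)"
    by (rule Bochner_Integration.integrable_bound) (use m S(2) in \<open>auto intro!: AE_I2 simp: indicator_def subset_iff\<close>)
qed

lemma mollify_cong:
  assumes \<eta>: "is_mollifier \<eta> \<delta>" and fg: "AE y in lborel. norm (x - y) < \<delta> \<longrightarrow> f y = g y"
    and [measurable]: "f \<in> borel_measurable borel" "g \<in> borel_measurable borel"
  shows "mollify f \<eta> x = mollify g \<eta> x"
proof -
  have t: "test_function \<eta>" "\<And>z. \<eta> z \<noteq> 0 \<Longrightarrow> norm z < \<delta>"
    using \<eta> by (auto simp: is_mollifier_def)
  have [measurable]: "\<eta> \<in> borel_measurable borel" using t(1) by measurable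
  have "AE y in lborel. f y * \<eta> (x - y) = g y * \<eta> (x - y)"
    using fg by eventually_elim (use t(2) in auto)
  then show ?thesis unfolding mollify_def by (intro integral_cong_AE) auto
qed

text \<open>From the ball of radius R a mollifier of width at most 1 sees only the ball of radius R
  + 1. Outside the latter f may be set to 0, which makes it globally square integrable.\<close>

lemma mollify_locally_L2_approx:
  assumes f: "locally_L2 f" and "e > 0"
  obtains \<delta> where "\<delta> > 0" "\<delta> \<le> 1"
    "\<And>\<eta>. is_mollifier \<eta> \<delta> \<Longrightarrow> (LBINT x. indicator (cball 0 R) x * (mollify f \<eta> x - f x)\<^sup>2) < e"
    "\<And>\<eta>. is_mollifier \<eta> \<delta> \<Longrightarrow> integrable lborel (\<lambda>x. indicator (cball 0 R) x * (mollify f \<eta> x - f x)\<^sup>2)"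
proof -
  define F where "F = (\<lambda>x. indicator (cball 0 (R + 1)) x * f x)"
  have F: "F \<in> borel_measurable borel" "integrable lborel (\<lambda>x. (F x)\<^sup>2)"
    unfolding F_def using locally_L2_indicator[OF f, of "cball 0 (R + 1)" "R + 1"] by auto
  obtain \<delta> where \<delta>: "\<delta> > 0" "\<delta> \<le> 1" "\<And>\<eta>. is_mollifier \<eta> \<delta> \<Longrightarrow> integrable lborel (\<lambda>x. (mollify F \<eta> x - F x)\<^sup>2)"
    "\<And>\<eta>. is_mollifier \<eta> \<delta> \<Longrightarrow> (LBINT x. (mollify F \<eta> x - F x)\<^sup>2) < e"
    by (rule mollify_L2_approx[OF F \<open>e > 0\<close>], rule that; blast)
  have main: "(LBINT x. indicator (cball 0 R) x * (mollify f \<eta> x - f x)\<^sup>2) < e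
      \<and> integrable lborel (\<lambda>x. indicator (cball 0 R) x * (mollify f \<eta> x - f x)\<^sup>2)" if \<eta>: "is_mollifier \<eta> \<delta>" for \<eta>
  proof -
    have t: "test_function \<eta>" using \<eta> by (auto simp: is_mollifier_def)
    have [measurable]: "f \<in> borel_measurable borel" "mollify f \<eta> \<in> borel_measurable borel"
      using f mollify_measurable[OF locally_L2_imp_locally_integrable[OF f] t] by auto
    have eq: "mollify f \<eta> x = mollify F \<eta> x \<and> f x = F x" if "norm x \<le> R" for x
    proof
      show "mollify f \<eta> x = mollify F \<eta> x"
      proof (rule mollify_cong[OF \<eta> AE_I2])
        fix y
        show "norm (x - y) < \<delta> \<longrightarrow> f y = F y"
          using that \<delta>(2) norm_triangle_ineq2[of y x] by (auto simp: F_def norm_minus_commute)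
      qed (use F in auto)
    qed (use that in \<open>auto simp: F_def\<close>)
    have le: "indicator (cball 0 R) x * (mollify f \<eta> x - f x)\<^sup>2 \<le> (mollify F \<eta> x - F x)\<^sup>2" for x
      using eq[of x] by (auto simp: indicator_def)
    have m: "(\<lambda>x. indicator (cball 0 R) x * (mollify f \<eta> x - f x)\<^sup>2) \<in> borel_measurable lborel"
      by (intro borel_measurable_times borel_measurable_indicator) auto
    have i: "integrable lborel (\<lambda>x. indicator (cball 0 R) x * (mollify f \<eta> x - f x)\<^sup>2)"
      by (rule Bochner_Integration.integrable_bound[OF \<delta>(3)[OF \<eta>] m])
        (use le in \<open>auto intro!: AE_I2 simp: abs_mult\<close>)
    then show ?thesis
      using integral_mono[OF i \<delta>(3)[OF \<eta>] le] \<delta>(4)[OF \<eta>] by simp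
  qed
  show ?thesis
    by (rule that[OF \<delta>(1,2)]) (use main in blast)+
qed

section \<open>A Carleman inequality\<close>

text \<open>Differentiability of explicit functions comes from the closure rules for smoothness; the
  value of the derivative is then found by one-variable calculus on a coordinate line.\<close>

lemma partial_deriv_eq_lineI:
  assumes "f differentiable (at x)"
    and "((\<lambda>t. f (x + t *\<^sub>R axis i 1)) has_real_derivative D) (at 0)"
  shows "partial_deriv i f x = D"
  using partial_deriv_line[of f x 0 i] assms DERIV_unique by force

lemma smooth_on_lineD:
  assumes "smooth_on U f" "x \<in> U"
  shows "((\<lambda>t. f (x + t *\<^sub>R axis i 1)) has_real_derivative partial_deriv i f x) (at 0)"
  using partial_deriv_line[of f x 0 i] smooth_on_imp_differentiable[OF assms] by simp

text \<open>The zero function near a and the product away from a glue to a smooth function. This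
  admits Carleman weights and poles as factors of test functions that vanish near the
  singularity.\<close>

lemma smooth_mult_vanishing:
  assumes s: "smooth_on (- {a}) s" and h: "test_function h" and "r > 0" "\<And>x. x \<in> ball a r \<Longrightarrow> h x = 0"
  shows "test_function (\<lambda>x. s x * h x)"
proof (rule test_functionI[OF _ test_function_bounded[OF h]])
  have "smooth_on (ball a r) (\<lambda>x. s x * h x) \<longleftrightarrow> smooth_on (ball a r) (\<lambda>x. 0)"
    using assms(4) by (intro smooth_on_cong) auto
  moreover have "smooth_on (- {a}) (\<lambda>x. s x * h x)"
    by (rule smooth_on_mult[OF _ s smooth_on_subset[OF test_function_smooth[OF h]]]) auto
  ultimately have "smooth_on (ball a r \<union> - {a}) (\<lambda>x. s x * h x)"
    by (intro smooth_on_Un) (auto simp: smooth_on_const)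
  moreover have "ball a r \<union> - {a} = UNIV" using \<open>r > 0\<close> by auto
  ultimately show "smooth_on UNIV (\<lambda>x. s x * h x)" by simp
qed auto

text \<open>The weight is \<open>exp \<phi>\<close> with \<open>\<phi> x = - n ln |x|\<^sup>2 + c |x|\<^sup>2 / 4\<close>, so that \<open>\<Delta>\<phi> = c\<close>
  independently of \<open>n\<close>; \<open>carleman_grad\<close> is the gradient of \<open>\<phi>\<close>.\<close>

definition carleman_weight :: "real \<Rightarrow> nat \<Rightarrow> real^2 \<Rightarrow> real" where
  "carleman_weight c n x = exp (c / 4 * (norm x)\<^sup>2) * inverse ((norm x)\<^sup>2) ^ n"

definition carleman_grad :: "real \<Rightarrow> nat \<Rightarrow> 2 \<Rightarrow> real^2 \<Rightarrow> real" where
  "carleman_grad c n i x = c / 2 * x $ i - 2 * real n * (x $ i * inverse ((norm x)\<^sup>2))"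

lemma smooth_on_power2_norm0: "open U \<Longrightarrow> smooth_on U (\<lambda>x. (norm x)\<^sup>2)"
  using smooth_on_power2_norm[of U 0] by simp

lemma smooth_on_carleman:
  "smooth_on (- {0}) (carleman_weight c n)" "smooth_on (- {0}) (carleman_grad c n i)"
proof -
  have op: "open (- {0 :: real^2})" by auto
  have q: "smooth_on (- {0}) (\<lambda>x. (norm x)\<^sup>2)" by (rule smooth_on_power2_norm0[OF op])
  have J: "smooth_on (- {0}) (\<lambda>x. inverse ((norm x)\<^sup>2))" by (rule smooth_on_inverse[OF op q]) auto
  show "smooth_on (- {0}) (carleman_weight c n)"
    unfolding carleman_weight_def[abs_def]
    by (rule smooth_on_mult[OF op smooth_on_exp[OF op smooth_on_mult[OF op smooth_on_const q]] smooth_on_power[OF op J]])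
  show "smooth_on (- {0}) (carleman_grad c n i)"
    unfolding carleman_grad_def[abs_def]
    by (intro smooth_on_diff smooth_on_mult smooth_on_const smooth_on_nth J op)
qed

lemma line_power2_norm:
  "((\<lambda>t. (norm (x + t *\<^sub>R axis i 1))\<^sup>2) has_real_derivative 2 * x $ i) (at 0)" for x :: "real^2"
  unfolding power2_norm_eq_nth using exhaust_2[of i]
  by (auto intro!: derivative_eq_intros simp: axis_def)

lemma line_inverse_power2_norm:
  fixes x :: "real^2"
  assumes "x \<noteq> 0"
  shows "((\<lambda>t. inverse ((norm (x + t *\<^sub>R axis i 1))\<^sup>2)) has_real_derivative
    - (2 * x $ i) * (inverse ((norm x)\<^sup>2))\<^sup>2) (at 0)"
  using DERIV_inverse'[OF line_power2_norm[of x i]] assms by (simp add: power2_eq_square mult_ac)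

lemma partial_deriv_carleman_weight:
  assumes "x \<noteq> 0"
  shows "partial_deriv i (carleman_weight c n) x = carleman_grad c n i x * carleman_weight c n x"
proof (rule partial_deriv_eq_lineI)
  show "carleman_weight c n differentiable (at x)"
    using smooth_on_imp_differentiable[OF smooth_on_carleman(1)] assms by simp
  let ?J = "inverse ((norm x)\<^sup>2)"
  have 1: "((\<lambda>t. inverse ((norm (x + t *\<^sub>R axis i 1))\<^sup>2) ^ n) has_real_derivative
      - (2 * real n * x $ i * ?J * ?J ^ n)) (at 0)"
    using DERIV_power[OF line_inverse_power2_norm[OF assms, of i], of n]
    by (cases n) (simp_all add: power2_eq_square algebra_simps)
  have 2: "((\<lambda>t. exp (c / 4 * (norm (x + t *\<^sub>R axis i 1))\<^sup>2)) has_real_derivative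
      exp (c / 4 * (norm x)\<^sup>2) * (c / 2 * x $ i)) (at 0)"
    using DERIV_fun_exp[OF DERIV_cmult[OF line_power2_norm[of x i], of "c / 4"]] by (simp add: mult_ac)
  show "((\<lambda>t. carleman_weight c n (x + t *\<^sub>R axis i 1)) has_real_derivative
      carleman_grad c n i x * carleman_weight c n x) (at 0)"
    unfolding carleman_weight_def carleman_grad_def
    using DERIV_mult[OF 2 1] by (simp add: algebra_simps)
qed

lemma div_carleman_grad:
  assumes "x \<noteq> 0"
  shows "partial_deriv 1 (carleman_grad c n 1) x + partial_deriv 2 (carleman_grad c n 2) x = c"
proof -
  let ?J = "inverse ((norm x)\<^sup>2)"
  have "partial_deriv i (carleman_grad c n i) x = c / 2 - 2 * real n * (?J - 2 * (x $ i)\<^sup>2 * ?J\<^sup>2)" for i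
  proof (rule partial_deriv_eq_lineI)
    show "carleman_grad c n i differentiable (at x)"
      using smooth_on_imp_differentiable[OF smooth_on_carleman(2)] assms by simp
    have "((\<lambda>t. (x + t *\<^sub>R axis i 1) $ i) has_real_derivative 1) (at 0)"
      by (auto intro!: derivative_eq_intros simp: axis_def)
    note d = this DERIV_mult[OF this line_inverse_power2_norm[OF assms, of i]]
    show "((\<lambda>t. carleman_grad c n i (x + t *\<^sub>R axis i 1)) has_real_derivative
        c / 2 - 2 * real n * (?J - 2 * (x $ i)\<^sup>2 * ?J\<^sup>2)) (at 0)"
      unfolding carleman_grad_def
      using DERIV_diff[OF DERIV_cmult[OF d(1), of "c / 2"] DERIV_cmult[OF d(2), of "2 * real n"]]
      by (simp add: algebra_simps power2_eq_square)
  qed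
  from this[of 1] this[of 2]
  have "partial_deriv 1 (carleman_grad c n 1) x + partial_deriv 2 (carleman_grad c n 2) x
      = c - 2 * real n * (2 * ?J - 2 * (((x $ 1)\<^sup>2 + (x $ 2)\<^sup>2) * ?J\<^sup>2))"
    by (simp add: algebra_simps)
  moreover have "((x $ 1)\<^sup>2 + (x $ 2)\<^sup>2) * ?J\<^sup>2 = (norm x)\<^sup>2 * ?J\<^sup>2"
    by (simp only: power2_norm_eq_nth)
  moreover have "(norm x)\<^sup>2 * ?J\<^sup>2 = ?J"
    using assms by (simp add: power2_eq_square field_simps)
  ultimately show ?thesis by simp
qed

lemma carleman_weight_nonneg: "0 \<le> carleman_weight c n x"
  by (simp add: carleman_weight_def)

text \<open>Completing the square. With E = exp \<phi> and F = E v^2 grad \<phi>, E |grad v|^2 + div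
  F - (\<Delta>\<phi>) E v^2 = E |grad v + v grad \<phi>|^2 \<ge> 0, and div F integrates to
  0.\<close>

lemma carleman_first_order:
  assumes v: "test_function v" and "r > 0" and v0: "\<And>x. x \<in> ball 0 r \<Longrightarrow> v x = 0"
  shows "c * (LBINT x. carleman_weight c n x * (v x)\<^sup>2)
    \<le> (LBINT x. carleman_weight c n x * ((partial_deriv 1 v x)\<^sup>2 + (partial_deriv 2 v x)\<^sup>2))"
proof -
  define E where "E = carleman_weight c n"
  define P where "P = carleman_grad c n"
  have d0: "partial_deriv i v x = 0" if "x \<in> ball 0 r" for i x
    using partial_deriv_eq_0[OF open_ball that v0] .
  have tf: "test_function (\<lambda>x. v x * v x)" "test_function (\<lambda>x. (v x)\<^sup>2)"
    "test_function (\<lambda>x. (partial_deriv 1 v x)\<^sup>2 + (partial_deriv 2 v x)\<^sup>2)"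
    unfolding power2_eq_square
    by (intro test_function_add test_function_mult(1) test_function_partial_deriv test_function_smooth v)+
  define F where "F = (\<lambda>i x. (E x * P i x) * (v x * v x))"
  have Fsm: "smooth_on (- {0}) (\<lambda>x. E x * P i x)" for i
    unfolding E_def P_def by (intro smooth_on_mult smooth_on_carleman) auto
  have F: "test_function (F i)" for i
    unfolding F_def by (rule smooth_mult_vanishing[OF Fsm tf(1) \<open>r > 0\<close>]) (simp add: v0)
  have Esm: "smooth_on (- {0}) E" unfolding E_def by (rule smooth_on_carleman)
  have t1: "test_function (\<lambda>x. E x * (v x)\<^sup>2)"
    by (rule smooth_mult_vanishing[OF Esm tf(2) \<open>r > 0\<close>]) (simp add: v0)
  have t2: "test_function (\<lambda>x. E x * ((partial_deriv 1 v x)\<^sup>2 + (partial_deriv 2 v x)\<^sup>2))"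
    by (rule smooth_mult_vanishing[OF Esm tf(3) \<open>r > 0\<close>]) (simp add: d0)
  have ineq: "c * (E x * (v x)\<^sup>2) \<le> E x * ((partial_deriv 1 v x)\<^sup>2 + (partial_deriv 2 v x)\<^sup>2)
      + (partial_deriv 1 (F 1) x + partial_deriv 2 (F 2) x)" for x
  proof (cases "x = 0")
    case True
    then have x: "x \<in> ball 0 r" using \<open>r > 0\<close> by simp
    have "partial_deriv i (F i) x = 0" for i
      by (rule partial_deriv_eq_0[OF open_ball x]) (simp add: F_def v0)
    then show ?thesis using v0[OF x] d0[OF x] by simp
  next
    case False
    have x: "x \<in> - {0}" using False by simp
    define a where "a = partial_deriv 1 v x"
    define b where "b = partial_deriv 2 v x"
    define p where "p = (\<lambda>i. partial_deriv i (P i) x)"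
    have dE: "((\<lambda>t. E (x + t *\<^sub>R axis i 1)) has_real_derivative P i x * E x) (at 0)" for i
      using smooth_on_lineD[OF smooth_on_carleman(1) x] partial_deriv_carleman_weight[OF False]
      by (simp add: E_def P_def)
    have dP: "((\<lambda>t. P i (x + t *\<^sub>R axis i 1)) has_real_derivative p i) (at 0)" for i
      using smooth_on_lineD[OF smooth_on_carleman(2) x] by (simp add: P_def p_def)
    have dv: "((\<lambda>t. v (x + t *\<^sub>R axis i 1)) has_real_derivative partial_deriv i v x) (at 0)" for i
      using smooth_on_lineD[OF test_function_smooth[OF v] UNIV_I] .
    have "partial_deriv i (F i) x = 2 * E x * P i x * v x * partial_deriv i v x
        + (v x)\<^sup>2 * E x * ((P i x)\<^sup>2 + p i)" for i
    proof (rule partial_deriv_eq_lineI)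
      show "F i differentiable (at x)"
        using smooth_on_imp_differentiable[OF test_function_smooth[OF F] UNIV_I] .
      show "((\<lambda>t. F i (x + t *\<^sub>R axis i 1)) has_real_derivative 2 * E x * P i x * v x * partial_deriv i v x
          + (v x)\<^sup>2 * E x * ((P i x)\<^sup>2 + p i)) (at 0)"
        unfolding F_def
        by (rule DERIV_cong, rule DERIV_mult[OF DERIV_mult[OF dE dP] DERIV_mult[OF dv dv]])
           (simp add: algebra_simps power2_eq_square)
    qed
    note dF = this[of 1] this[of 2]
    have "p 1 + p 2 = c" using div_carleman_grad[OF False] by (simp add: p_def P_def)
    with dF have "E x * (a\<^sup>2 + b\<^sup>2) + (partial_deriv 1 (F 1) x + partial_deriv 2 (F 2) x) - c * (E x * (v x)\<^sup>2)
        = E x * ((a + v x * P 1 x)\<^sup>2 + (b + v x * P 2 x)\<^sup>2)"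
      unfolding a_def b_def by algebra
    moreover have "\<dots> \<ge> 0" using carleman_weight_nonneg by (simp add: E_def)
    ultimately show ?thesis unfolding a_def b_def by linarith
  qed
  have "(LBINT x. c * (E x * (v x)\<^sup>2)) \<le> (LBINT x. E x * ((partial_deriv 1 v x)\<^sup>2 + (partial_deriv 2 v x)\<^sup>2)
      + (partial_deriv 1 (F 1) x + partial_deriv 2 (F 2) x))"
    by (intro integral_mono ineq Bochner_Integration.integrable_add integrable_mult_right
        test_function_integrable t1 t2 test_function_partial_deriv F)
  also have "\<dots> = (LBINT x. E x * ((partial_deriv 1 v x)\<^sup>2 + (partial_deriv 2 v x)\<^sup>2))"
    using F t2 by (simp add: integral_partial_deriv_eq_0 test_function_integrable test_function_partial_deriv)
  finally show ?thesis by (simp add: E_def)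
qed

text \<open>Here (a, b) = grad v, (P, Q) = grad \<phi>, p and q are the pure second derivatives of
  \<phi>, and \<open>ay\<close> stands for both mixed derivatives of v. Put g = a - \<i> b, so that
  2 dbar g = \<Delta>v. With d = (\<partial>_x - \<i> \<partial>_y) / 2 the right-hand side is 4 e
  |d g + g d\<phi>|^2: this is Hoermander's weighted identity for dbar, in which the commutator of
  the two operators produces \<Delta>\<phi> = p + q.\<close>

lemma carleman_identity:
  fixes e P Q p q a b ax ay bb ayy axy :: real
  shows "e * (ax + bb)\<^sup>2
    - (P * e * (2 * (a * bb - b * ay)) + 2 * (ax * bb + a * ayy - ay * ay - b * axy) * e
        - (P\<^sup>2 + p) * e * (a * a + b * b) - e * P * (2 * a * ax + 2 * b * ay)
      + (- Q * e * (2 * (a * ay - b * ax)) - 2 * (ay * ay + a * ayy - bb * ax - b * axy) * e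
        - (Q\<^sup>2 + q) * e * (a * a + b * b) - e * Q * (2 * a * ay + 2 * b * bb)))
    - (p + q) * (e * (a\<^sup>2 + b\<^sup>2))
    = e * ((ax - bb + a * P - b * Q)\<^sup>2 + (2 * ay + a * Q + b * P)\<^sup>2)"
  by algebra

text \<open>The first-order argument one derivative up: by \<open>carleman_identity\<close> the
  difference of the two integrands is a square up to a divergence.\<close>

lemma carleman_second_order:
  assumes v: "test_function v" and "r > 0" and v0: "\<And>x. x \<in> ball 0 r \<Longrightarrow> v x = 0"
  shows "c * (LBINT x. carleman_weight c n x * ((partial_deriv 1 v x)\<^sup>2 + (partial_deriv 2 v x)\<^sup>2))
    \<le> (LBINT x. carleman_weight c n x * (laplacian v x)\<^sup>2)"
proof -
  define E where "E = carleman_weight c n"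
  define P where "P = carleman_grad c n"
  define a where "a = partial_deriv 1 v"
  define b where "b = partial_deriv 2 v"
  have ab: "test_function a" "test_function b"
    unfolding a_def b_def by (intro test_function_partial_deriv v)+
  have d0: "a x = 0" "b x = 0" if "x \<in> ball 0 r" for x
    using partial_deriv_eq_0[OF open_ball that v0] by (auto simp: a_def b_def)
  have dd0: "partial_deriv i a x = 0" "partial_deriv i b x = 0" if "x \<in> ball 0 r" for i x
    using partial_deriv_eq_0[OF open_ball that] d0 by blast+
  have comm: "partial_deriv 1 b x = partial_deriv 2 a x" for x
    unfolding a_def b_def by (rule partial_deriv_commute[OF test_function_smooth[OF v]])
  have commd: "partial_deriv 1 (partial_deriv 2 a) x = partial_deriv 2 (partial_deriv 1 a) x"
    "partial_deriv 1 (partial_deriv 2 b) x = partial_deriv 2 (partial_deriv 1 b) x" for x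
    by (rule partial_deriv_commute[OF test_function_smooth] ab)+
  have lap: "laplacian v x = partial_deriv 1 a x + partial_deriv 2 b x" for x
    by (simp add: laplacian_def a_def b_def)
  define g where "g = (\<lambda>x. a x * a x + b x * b x)"
  define h where "h = (\<lambda>i x. 2 * (a x * partial_deriv i b x - b x * partial_deriv i a x))"
  have sm: "smooth_on UNIV a" "smooth_on UNIV b"
    using ab test_function_smooth by auto
  have tg: "test_function g"
    unfolding g_def by (intro test_function_add test_function_mult(1) ab sm)
  have th: "test_function (h i)" for i
    unfolding h_def diff_conv_add_uminus minus_mult_left
    by (intro test_function_add test_function_mult(1) smooth_on_const ab sm smooth_on_uminus
        test_function_partial_deriv open_UNIV)
  \<comment> \<open>The field (F, G) is 2 E (a grad b - b grad a), rotated by a right angle, minus E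
    |grad v|^2 grad \<phi>. Its divergence collects all terms that integrate to 0.\<close>
  define F where "F = (\<lambda>x. E x * h 2 x + (E x * P 1 x) * - g x)"
  define G where "G = (\<lambda>x. E x * - h 1 x + (E x * P 2 x) * - g x)"
  have EP: "smooth_on (- {0}) (\<lambda>x. E x * P i x)" for i
    unfolding E_def P_def by (intro smooth_on_mult smooth_on_carleman) auto
  have E: "smooth_on (- {0}) E" unfolding E_def by (rule smooth_on_carleman)
  have tneg: "test_function (\<lambda>x. - f x)" if "test_function f" for f
    using test_function_mult(1)[OF smooth_on_const that, of "-1"] by simp
  have F: "test_function F" "test_function G"
    unfolding F_def G_def
    by (intro test_function_add smooth_mult_vanishing[OF E _ \<open>r > 0\<close>] smooth_mult_vanishing[OF EP _ \<open>r > 0\<close>]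
        tneg tg th; simp add: g_def h_def d0 dd0)+
  have t1: "test_function (\<lambda>x. E x * ((a x)\<^sup>2 + (b x)\<^sup>2))"
    using smooth_mult_vanishing[OF E tg \<open>r > 0\<close>] d0 by (simp add: g_def power2_eq_square)
  have t2: "test_function (\<lambda>x. E x * (laplacian v x)\<^sup>2)"
    unfolding power2_eq_square
  proof (rule smooth_mult_vanishing[OF E _ \<open>r > 0\<close>])
    show "test_function (\<lambda>x. laplacian v x * laplacian v x)"
      by (intro test_function_mult(1) test_function_smooth test_function_laplacian v)
  qed (simp add: lap dd0)
  have ineq: "c * (E x * ((a x)\<^sup>2 + (b x)\<^sup>2)) \<le> E x * (laplacian v x)\<^sup>2
      + - (partial_deriv 1 F x + partial_deriv 2 G x)" for x
  proof (cases "x = 0")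
    case True
    then have x: "x \<in> ball 0 r" using \<open>r > 0\<close> by simp
    have "partial_deriv i F x = 0" "partial_deriv i G x = 0" for i
      by (rule partial_deriv_eq_0[OF open_ball x]; simp add: F_def G_def g_def h_def d0 dd0)+
    then show ?thesis using d0[OF x] dd0[OF x] by (simp add: lap)
  next
    case False
    have x: "x \<in> - {0}" using False by simp
    define p where "p = (\<lambda>i. partial_deriv i (P i) x)"
    have dE: "((\<lambda>t. E (x + t *\<^sub>R axis i 1)) has_real_derivative P i x * E x) (at 0)" for i
      using smooth_on_lineD[OF smooth_on_carleman(1) x] partial_deriv_carleman_weight[OF False]
      by (simp add: E_def P_def)
    have dP: "((\<lambda>t. P i (x + t *\<^sub>R axis i 1)) has_real_derivative p i) (at 0)" for i
      using smooth_on_lineD[OF smooth_on_carleman(2) x] by (simp add: P_def p_def)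
    have dt: "((\<lambda>t. f (x + t *\<^sub>R axis i 1)) has_real_derivative partial_deriv i f x) (at 0)"
      if "test_function f" for f i
      using smooth_on_lineD[OF test_function_smooth[OF that] UNIV_I] .
    have dF: "partial_deriv 1 F x = P 1 x * E x * h 2 x + partial_deriv 1 (h 2) x * E x
        - ((P 1 x)\<^sup>2 + p 1) * E x * g x - E x * P 1 x * partial_deriv 1 g x"
    proof (rule partial_deriv_eq_lineI)
      show "F differentiable (at x)"
        using smooth_on_imp_differentiable[OF test_function_smooth[OF F(1)] UNIV_I] .
      show "((\<lambda>t. F (x + t *\<^sub>R axis 1 1)) has_real_derivative P 1 x * E x * h 2 x + partial_deriv 1 (h 2) x * E x
        - ((P 1 x)\<^sup>2 + p 1) * E x * g x - E x * P 1 x * partial_deriv 1 g x) (at 0)"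
        unfolding F_def
        by (rule DERIV_cong, rule DERIV_add[OF DERIV_mult[OF dE dt[OF th]]
            DERIV_mult[OF DERIV_mult[OF dE dP] DERIV_minus[OF dt[OF tg]]]])
           (simp add: algebra_simps power2_eq_square)
    qed
    have dG: "partial_deriv 2 G x = - P 2 x * E x * h 1 x - partial_deriv 2 (h 1) x * E x
        - ((P 2 x)\<^sup>2 + p 2) * E x * g x - E x * P 2 x * partial_deriv 2 g x"
    proof (rule partial_deriv_eq_lineI)
      show "G differentiable (at x)"
        using smooth_on_imp_differentiable[OF test_function_smooth[OF F(2)] UNIV_I] .
      show "((\<lambda>t. G (x + t *\<^sub>R axis 2 1)) has_real_derivative - P 2 x * E x * h 1 x - partial_deriv 2 (h 1) x * E x
        - ((P 2 x)\<^sup>2 + p 2) * E x * g x - E x * P 2 x * partial_deriv 2 g x) (at 0)"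
        unfolding G_def
        by (rule DERIV_cong, rule DERIV_add[OF DERIV_mult[OF dE DERIV_minus[OF dt[OF th]]]
            DERIV_mult[OF DERIV_mult[OF dE dP] DERIV_minus[OF dt[OF tg]]]])
           (simp add: algebra_simps power2_eq_square)
    qed
    have dg: "partial_deriv i g x = 2 * a x * partial_deriv i a x + 2 * b x * partial_deriv i b x" for i
    proof (rule partial_deriv_eq_lineI)
      show "g differentiable (at x)"
        using smooth_on_imp_differentiable[OF test_function_smooth[OF tg] UNIV_I] .
      show "((\<lambda>t. g (x + t *\<^sub>R axis i 1)) has_real_derivative
          2 * a x * partial_deriv i a x + 2 * b x * partial_deriv i b x) (at 0)"
        unfolding g_def
        by (rule DERIV_cong, rule DERIV_add[OF DERIV_mult[OF dt[OF ab(1)] dt[OF ab(1)]]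
            DERIV_mult[OF dt[OF ab(2)] dt[OF ab(2)]]]) simp
    qed
    have dh: "partial_deriv j (h i) x = 2 * (partial_deriv j a x * partial_deriv i b x
        + a x * partial_deriv j (partial_deriv i b) x
        - partial_deriv j b x * partial_deriv i a x - b x * partial_deriv j (partial_deriv i a) x)" for i j
    proof (rule partial_deriv_eq_lineI)
      show "h i differentiable (at x)"
        using smooth_on_imp_differentiable[OF test_function_smooth[OF th] UNIV_I] .
      note t = test_function_partial_deriv[OF ab(1), of i] test_function_partial_deriv[OF ab(2), of i]
      show "((\<lambda>t. h i (x + t *\<^sub>R axis j 1)) has_real_derivative 2 * (partial_deriv j a x * partial_deriv i b x
        + a x * partial_deriv j (partial_deriv i b) x
        - partial_deriv j b x * partial_deriv i a x - b x * partial_deriv j (partial_deriv i a) x)) (at 0)"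
        unfolding h_def
        by (rule DERIV_cong, rule DERIV_cmult[OF DERIV_diff[OF DERIV_mult[OF dt[OF ab(1)] dt[OF t(2)]]
            DERIV_mult[OF dt[OF ab(2)] dt[OF t(1)]]]]) (simp add: algebra_simps)
    qed
    have c: "c = p 1 + p 2" using div_carleman_grad[OF False] by (simp add: p_def P_def)
    have "E x * (partial_deriv 1 a x + partial_deriv 2 b x)\<^sup>2 - (partial_deriv 1 F x + partial_deriv 2 G x)
        - c * (E x * ((a x)\<^sup>2 + (b x)\<^sup>2))
        = E x * ((partial_deriv 1 a x - partial_deriv 2 b x + a x * P 1 x - b x * P 2 x)\<^sup>2
          + (2 * partial_deriv 2 a x + a x * P 2 x + b x * P 1 x)\<^sup>2)"
      unfolding dF dG unfolding dg dh unfolding h_def g_def comm commd c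
      by (rule carleman_identity)
    moreover have "\<dots> \<ge> 0" using carleman_weight_nonneg by (simp add: E_def)
    ultimately show ?thesis unfolding lap by linarith
  qed
  have "(LBINT x. c * (E x * ((a x)\<^sup>2 + (b x)\<^sup>2)))
      \<le> (LBINT x. E x * (laplacian v x)\<^sup>2 + - (partial_deriv 1 F x + partial_deriv 2 G x))"
    by (intro integral_mono ineq Bochner_Integration.integrable_add integrable_mult_right integrable_minus
        test_function_integrable t1 t2 test_function_partial_deriv F)
  also have "\<dots> = (LBINT x. E x * (laplacian v x)\<^sup>2)"
    using F t2 by (simp add: integral_partial_deriv_eq_0 test_function_integrable test_function_partial_deriv)
  finally show ?thesis by (simp add: E_def a_def b_def)
qed

text \<open>The constant c^2 does not depend on n: a large c absorbs a bounded potential while n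
  stays free to tend to infinity.\<close>

lemma carleman_smooth:
  assumes "test_function v" "r > 0" "\<And>x. x \<in> ball 0 r \<Longrightarrow> v x = 0" "c \<ge> 0"
  shows "c\<^sup>2 * (LBINT x. carleman_weight c n x * (v x)\<^sup>2)
    \<le> (LBINT x. carleman_weight c n x * (laplacian v x)\<^sup>2)"
proof -
  have "c * (c * (LBINT x. carleman_weight c n x * (v x)\<^sup>2))
      \<le> c * (LBINT x. carleman_weight c n x * ((partial_deriv 1 v x)\<^sup>2 + (partial_deriv 2 v x)\<^sup>2))"
    using carleman_first_order[OF assms(1-3)] assms(4) by (intro mult_left_mono) auto
  then show ?thesis
    using carleman_second_order[OF assms(1-3), of c n] by (simp add: power2_eq_square mult.assoc)
qed

section \<open>Unique continuation\<close>

text \<open>By Lindeloef countably many of the neighbourhoods suffice, so the exceptional null sets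
  can be united.\<close>

lemma AE_locally:
  fixes P :: "real^2 \<Rightarrow> bool"
  assumes "\<And>x. x \<in> U \<Longrightarrow> \<exists>V. open V \<and> x \<in> V \<and> (AE y in M. y \<in> V \<longrightarrow> P y)"
  shows "AE y in M. y \<in> U \<longrightarrow> P y"
proof -
  define \<F> where "\<F> = {V. open V \<and> (AE y in M. y \<in> V \<longrightarrow> P y)}"
  obtain \<G> where G: "\<G> \<subseteq> \<F>" "countable \<G>" "\<Union>\<G> = \<Union>\<F>"
    using Lindelof[of \<F>] by (auto simp: \<F>_def)
  have "AE y in M. \<forall>V\<in>\<G>. y \<in> V \<longrightarrow> P y"
    using G(1,2) by (subst AE_ball_countable) (auto simp: \<F>_def)
  then show ?thesis
  proof eventually_elim
    case (elim y)
    show ?case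
    proof
      assume "y \<in> U"
      then have "y \<in> \<Union>\<F>" using assms[of y] by (auto simp: \<F>_def)
      then show "P y" using elim G(3) by auto
    qed
  qed
qed

lemma integral_affine_1:
  fixes f :: "real^2 \<Rightarrow> real"
  assumes "f \<in> borel_measurable borel"
  shows "(LBINT x. f (a + x)) = (LBINT x. f x)"
  using lborel_integral_affine[OF assms, of 1 a] by simp

lemma integrable_affine_1:
  fixes f :: "real^2 \<Rightarrow> real"
  shows "integrable lborel f \<Longrightarrow> integrable lborel (\<lambda>x. f (a + x))"
  using lborel_integrable_affine[of f 1 a] by simp

lemma AE_lborel_translate:
  fixes P :: "real^2 \<Rightarrow> bool"
  assumes "AE x in lborel. P x"
  shows "AE x in lborel. P (a + x)"
proof -
  have "AE x in distr lborel borel ((+) a). P x"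
    unfolding lborel_distr_plus by (rule assms)
  then show ?thesis by (rule AE_distrD[rotated]) simp
qed

lemma carleman_weight_continuous:
  "0 < r \<Longrightarrow> continuous_on {x. r \<le> norm x \<and> norm x \<le> R} (carleman_weight c n)"
  by (rule continuous_on_subset[OF smooth_on_imp_continuous_on[OF smooth_on_carleman(1)]]) auto

lemma carleman_weight_measurable [measurable]: "carleman_weight c n \<in> borel_measurable borel"
  unfolding carleman_weight_def[abs_def] by measurable

lemma carleman_weight_bounded:
  assumes "0 < r"
  shows "\<exists>B>0. \<forall>x. r \<le> norm x \<longrightarrow> norm x \<le> R \<longrightarrow> carleman_weight c n x \<le> B"
proof -
  have "{x::real^2. r \<le> norm x \<and> norm x \<le> R} = cball 0 R - ball 0 r" by auto
  then have "compact {x::real^2. r \<le> norm x \<and> norm x \<le> R}"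
    by (simp add: compact_diff)
  then have "bounded (carleman_weight c n ` {x. r \<le> norm x \<and> norm x \<le> R})"
    using carleman_weight_continuous[OF assms] compact_continuous_image compact_imp_bounded by blast
  then obtain B where "B > 0" "\<forall>x\<in>{x. r \<le> norm x \<and> norm x \<le> R}. norm (carleman_weight c n x) \<le> B"
    unfolding bounded_pos by auto
  then show ?thesis by (intro exI[of _ B]) auto
qed

text \<open>The mollifications of v and g still vanish for |x| < r / 2 and for |x| > R + 1, and in
  between the weight is bounded by some B, so unweighted convergence suffices. The factor 4 pays for
  using (a + b)^2 \<le> 2 a^2 + 2 b^2 once on each side.\<close>

lemma carleman_weak:
  assumes v: "locally_L2 v" and g: "locally_L2 g" and "r > 0" and "c \<ge> 0"
    and v0: "AE x in lborel. norm x < r \<or> R < norm x \<longrightarrow> v x = 0"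
    and g0: "AE x in lborel. norm x < r \<or> R < norm x \<longrightarrow> g x = 0"
    and weak: "\<And>\<phi>. test_function \<phi> \<Longrightarrow> (LBINT x. v x * laplacian \<phi> x) = (LBINT x. g x * \<phi> x)"
  shows "integrable lborel (\<lambda>x. carleman_weight c n x * (v x)\<^sup>2)"
    and "integrable lborel (\<lambda>x. carleman_weight c n x * (g x)\<^sup>2)"
    and "c\<^sup>2 * (LBINT x. carleman_weight c n x * (v x)\<^sup>2)
      \<le> 4 * (LBINT x. carleman_weight c n x * (g x)\<^sup>2)"
proof -
  define E where "E = carleman_weight c n"
  have E0: "E x \<ge> 0" for x by (simp add: E_def carleman_weight_nonneg)
  have [measurable]: "E \<in> borel_measurable borel" by (simp add: E_def)
  have [measurable]: "v \<in> borel_measurable borel" "g \<in> borel_measurable borel" using v g by auto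
  obtain B where B: "B > 0" "\<And>x. r / 2 \<le> norm x \<Longrightarrow> norm x \<le> R + 1 \<Longrightarrow> E x \<le> B"
    using carleman_weight_bounded[of "r / 2" "R + 1" c n] \<open>r > 0\<close> unfolding E_def half_gt_zero_iff by blast
  have int_E: "integrable lborel (\<lambda>x. E x * (f x)\<^sup>2)"
    if f: "locally_L2 f" "AE x in lborel. norm x < r \<or> R < norm x \<longrightarrow> f x = 0" for f
  proof -
    have [measurable]: "f \<in> borel_measurable borel" using f by auto
    have "integrable lborel (\<lambda>x. B * (indicator (cball 0 R) x *\<^sub>R (f x)\<^sup>2))"
      using f(1) unfolding locally_L2_def set_integrable_def by auto
    then show ?thesis
    proof (rule Bochner_Integration.integrable_bound)
      show "AE x in lborel. norm (E x * (f x)\<^sup>2) \<le> norm (B * (indicator (cball 0 R) x *\<^sub>R (f x)\<^sup>2))"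
        using f(2)
      proof eventually_elim
        case (elim x)
        show ?case
        proof (cases "norm x < r \<or> R < norm x")
          case False
          then have "E x * (f x)\<^sup>2 \<le> B * (f x)\<^sup>2"
            using B(2)[of x] \<open>r > 0\<close> by (intro mult_right_mono) auto
          then show ?thesis using False B(1) E0[of x] by simp
        qed (use elim in simp)
      qed
    qed simp
  qed
  show i: "integrable lborel (\<lambda>x. carleman_weight c n x * (v x)\<^sup>2)"
    "integrable lborel (\<lambda>x. carleman_weight c n x * (g x)\<^sup>2)"
    using int_E[OF v v0] int_E[OF g g0] by (simp_all add: E_def)
  have key: "c\<^sup>2 * (LBINT x. E x * (v x)\<^sup>2) \<le> 4 * (LBINT x. E x * (g x)\<^sup>2) + (4 + 2 * c\<^sup>2) * B * e"
    if "e > 0" for e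
  proof -
    obtain d1 where d1: "d1 > 0" "d1 \<le> 1"
      "\<And>\<eta>. is_mollifier \<eta> d1 \<Longrightarrow> (LBINT x. indicator (cball 0 (R + 1)) x * (mollify v \<eta> x - v x)\<^sup>2) < e"
      "\<And>\<eta>. is_mollifier \<eta> d1 \<Longrightarrow> integrable lborel (\<lambda>x. indicator (cball 0 (R + 1)) x * (mollify v \<eta> x - v x)\<^sup>2)"
      by (rule mollify_locally_L2_approx[OF v \<open>e > 0\<close>, of "R + 1"], rule that; blast)
    obtain d2 where d2: "d2 > 0" "d2 \<le> 1"
      "\<And>\<eta>. is_mollifier \<eta> d2 \<Longrightarrow> (LBINT x. indicator (cball 0 (R + 1)) x * (mollify g \<eta> x - g x)\<^sup>2) < e"
      "\<And>\<eta>. is_mollifier \<eta> d2 \<Longrightarrow> integrable lborel (\<lambda>x. indicator (cball 0 (R + 1)) x * (mollify g \<eta> x - g x)\<^sup>2)"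
      by (rule mollify_locally_L2_approx[OF g \<open>e > 0\<close>, of "R + 1"], rule that; blast)
    define d where "d = Min {d1, d2, r / 2}"
    have d: "d > 0" "d \<le> 1" "d \<le> d1" "d \<le> d2" "d \<le> r / 2"
      using d1 d2 \<open>r > 0\<close> by (auto simp: d_def)
    obtain \<eta> where \<eta>: "is_mollifier \<eta> d" using is_mollifier_exists[OF d(1)] by blast
    then have t: "test_function \<eta>" by (simp add: is_mollifier_def)
    have \<eta>12: "is_mollifier \<eta> d1" "is_mollifier \<eta> d2" using is_mollifier_mono[OF \<eta>] d by auto
    have vl: "locally_integrable v" "locally_integrable g" by (intro locally_L2_imp_locally_integrable v g)+
    have zero: "mollify f \<eta> x = 0"
      if f: "AE x in lborel. norm x < r \<or> R < norm x \<longrightarrow> f x = 0" and [measurable]: "f \<in> borel_measurable borel"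
        and x: "norm x < r / 2 \<or> norm x > R + 1" for f x
    proof -
      have "mollify f \<eta> x = mollify (\<lambda>x. 0) \<eta> x"
      proof (rule mollify_cong[OF \<eta>])
        show "AE y in lborel. norm (x - y) < d \<longrightarrow> f y = 0"
          using f
        proof eventually_elim
          case (elim y)
          show ?case
            using elim x d norm_triangle_ineq2[of x y] norm_triangle_ineq2[of y x] norm_minus_commute[of x y]
            by linarith
        qed
      qed auto
      then show ?thesis by (simp add: mollify_def)
    qed
    define V where "V = mollify v \<eta>"
    define G where "G = mollify g \<eta>"
    have V: "test_function V"
      unfolding V_def
    proof (rule test_functionI[OF smooth_on_mollify[OF vl(1) t], of "cball 0 (R + 1)"])
      show "mollify v \<eta> x = 0" if "x \<notin> cball 0 (R + 1)" for x
        by (rule zero[OF v0]) (use that in auto)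
    qed auto
    have Vm [measurable]: "V \<in> borel_measurable borel" "G \<in> borel_measurable borel"
      unfolding V_def G_def by (intro mollify_measurable vl t)+
    have V0: "V x = 0" if "x \<in> ball 0 (r / 2)" for x
      unfolding V_def by (rule zero[OF v0]) (use that in auto)
    have lapV: "laplacian V x = G x" for x
      unfolding V_def G_def laplacian_mollify[OF vl(1) t] by (rule mollify_weak_laplacian[OF weak t])
    have C: "c\<^sup>2 * (LBINT x. E x * (V x)\<^sup>2) \<le> (LBINT x. E x * (G x)\<^sup>2)"
      unfolding E_def lapV[symmetric]
      by (rule carleman_smooth[where r = "r / 2", OF V _ V0 \<open>c \<ge> 0\<close>]) (use \<open>r > 0\<close> in auto)
    have intG: "test_function G"
      unfolding G_def
    proof (rule test_functionI[OF smooth_on_mollify[OF vl(2) t], of "cball 0 (R + 1)"])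
      show "mollify g \<eta> x = 0" if "x \<notin> cball 0 (R + 1)" for x
        by (rule zero[OF g0]) (use that in auto)
    qed auto
    have G0: "G x = 0" if "x \<in> ball 0 (r / 2)" for x
      unfolding G_def by (rule zero[OF g0]) (use that in auto)
    have iE: "integrable lborel (\<lambda>x. E x * (f x)\<^sup>2)"
      if "test_function f" "\<And>x. x \<in> ball 0 (r / 2) \<Longrightarrow> f x = 0" for f
    proof -
      have "test_function (\<lambda>x. E x * (f x * f x))"
        unfolding E_def
        by (rule smooth_mult_vanishing[OF smooth_on_carleman(1)
              test_function_mult(1)[OF test_function_smooth[OF that(1)] that(1)], of "r / 2"])
           (use that(2) \<open>r > 0\<close> in auto)
      then show ?thesis by (simp add: power2_eq_square test_function_integrable)
    qed
    \<comment> \<open>Off the enlarged annulus the left-hand side is 0; on it the weight of the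
      perturbation \<open>w\<close> is at most B.\<close>
    have pt: "E x * (a x)\<^sup>2 \<le> 2 * (E x * (b x)\<^sup>2) + 2 * (B * (indicator (cball 0 (R + 1)) x * (w x)\<^sup>2))"
      if "a x = b x + w x" "norm x < r / 2 \<or> R + 1 < norm x \<longrightarrow> a x = 0" for a b w :: "real^2 \<Rightarrow> real" and x
    proof (cases "norm x < r / 2 \<or> R + 1 < norm x")
      case True
      then show ?thesis using that(2) E0[of x] B(1) by simp
    next
      case False
      have "E x * (a x)\<^sup>2 \<le> E x * (2 * (b x)\<^sup>2 + 2 * (w x)\<^sup>2)"
        unfolding that(1) by (intro mult_left_mono power2_sum_le E0)
      moreover have "E x * (w x)\<^sup>2 \<le> B * (w x)\<^sup>2"
        using False B(2)[of x] by (intro mult_right_mono) auto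
      ultimately show ?thesis using False by (simp add: algebra_simps)
    qed
    have "(LBINT x. E x * (v x)\<^sup>2) \<le>
        (LBINT x. 2 * (E x * (V x)\<^sup>2) + 2 * (B * (indicator (cball 0 (R + 1)) x * (V x - v x)\<^sup>2)))"
    proof (rule integral_mono_AE)
      show "AE x in lborel. E x * (v x)\<^sup>2 \<le> 2 * (E x * (V x)\<^sup>2) + 2 * (B * (indicator (cball 0 (R + 1)) x * (V x - v x)\<^sup>2))"
        using v0
      proof eventually_elim
        case (elim x)
        have "norm x < r / 2 \<or> R + 1 < norm x \<longrightarrow> v x = 0" using elim \<open>r > 0\<close> by auto
        then show ?case
          using pt[of v x V "\<lambda>x. v x - V x"] by (simp add: power2_commute[of "V x"])
      qed
      show "integrable lborel (\<lambda>x. 2 * (E x * (V x)\<^sup>2) + 2 * (B * (indicator (cball 0 (R + 1)) x * (V x - v x)\<^sup>2)))"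
        using iE[OF V V0] d1(4)[OF \<eta>12(1)] unfolding V_def by auto
    qed (rule int_E[OF v v0])
    also have "\<dots> = 2 * (LBINT x. E x * (V x)\<^sup>2) + 2 * (B * (LBINT x. indicator (cball 0 (R + 1)) x * (V x - v x)\<^sup>2))"
      using iE[OF V V0] d1(4)[OF \<eta>12(1)] unfolding V_def by simp
    also have "\<dots> \<le> 2 * (LBINT x. E x * (V x)\<^sup>2) + 2 * (B * e)"
      using d1(3)[OF \<eta>12(1)] B(1) unfolding V_def by simp
    finally have 1: "(LBINT x. E x * (v x)\<^sup>2) \<le> 2 * (LBINT x. E x * (V x)\<^sup>2) + 2 * (B * e)" .
    have "(LBINT x. E x * (G x)\<^sup>2) \<le>
        (LBINT x. 2 * (E x * (g x)\<^sup>2) + 2 * (B * (indicator (cball 0 (R + 1)) x * (G x - g x)\<^sup>2)))"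
    proof (rule integral_mono)
      show "E x * (G x)\<^sup>2 \<le> 2 * (E x * (g x)\<^sup>2) + 2 * (B * (indicator (cball 0 (R + 1)) x * (G x - g x)\<^sup>2))" for x
        using zero[OF g0, of x] by (intro pt) (auto simp: G_def)
      show "integrable lborel (\<lambda>x. 2 * (E x * (g x)\<^sup>2) + 2 * (B * (indicator (cball 0 (R + 1)) x * (G x - g x)\<^sup>2)))"
        using int_E[OF g g0] d2(4)[OF \<eta>12(2)] unfolding G_def by auto
    qed (rule iE[OF intG G0])
    also have "\<dots> = 2 * (LBINT x. E x * (g x)\<^sup>2) + 2 * (B * (LBINT x. indicator (cball 0 (R + 1)) x * (G x - g x)\<^sup>2))"
      using int_E[OF g g0] d2(4)[OF \<eta>12(2)] unfolding G_def by simp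
    also have "\<dots> \<le> 2 * (LBINT x. E x * (g x)\<^sup>2) + 2 * (B * e)"
      using d2(3)[OF \<eta>12(2)] B(1) unfolding G_def by simp
    finally have 2: "(LBINT x. E x * (G x)\<^sup>2) \<le> 2 * (LBINT x. E x * (g x)\<^sup>2) + 2 * (B * e)" .
    have "c\<^sup>2 * (LBINT x. E x * (v x)\<^sup>2) \<le> 2 * (c\<^sup>2 * (LBINT x. E x * (V x)\<^sup>2)) + 2 * c\<^sup>2 * (B * e)"
      using mult_left_mono[OF 1, of "c\<^sup>2"] by (simp add: algebra_simps)
    then show ?thesis using C 2 by (simp add: algebra_simps)
  qed
  have "c\<^sup>2 * (LBINT x. E x * (v x)\<^sup>2) \<le> 4 * (LBINT x. E x * (g x)\<^sup>2)"
  proof (rule field_le_epsilon)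
    fix e :: real assume "e > 0"
    have p: "(4 + 2 * c\<^sup>2) * B > 0" using B(1) by (intro mult_pos_pos) (auto intro: add_pos_nonneg)
    show "c\<^sup>2 * (LBINT x. E x * (v x)\<^sup>2) \<le> 4 * (LBINT x. E x * (g x)\<^sup>2) + e"
    proof -
      have "(4 + 2 * c\<^sup>2) * B * (e / ((4 + 2 * c\<^sup>2) * B)) = e"
        using p unfolding times_divide_eq_right by (intro nonzero_mult_div_cancel_left) linarith
      moreover have "e / ((4 + 2 * c\<^sup>2) * B) > 0" using p \<open>e > 0\<close> by (rule divide_pos_pos[rotated])
      ultimately show ?thesis using key[of "e / ((4 + 2 * c\<^sup>2) * B)"] by (simp only:)
    qed
  qed
  then show "c\<^sup>2 * (LBINT x. carleman_weight c n x * (v x)\<^sup>2)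
      \<le> 4 * (LBINT x. carleman_weight c n x * (g x)\<^sup>2)"
    by (simp add: E_def)
qed

section \<open>Weak derivatives, localisation and unique continuation\<close>

definition weak_partial :: "2 \<Rightarrow> (real^2 \<Rightarrow> real) \<Rightarrow> (real^2 \<Rightarrow> real) \<Rightarrow> bool" where
  "weak_partial i w g \<longleftrightarrow> (\<forall>\<phi>. test_function \<phi> \<longrightarrow>
     (LBINT x. w x * partial_deriv i \<phi> x) = - (LBINT x. g x * \<phi> x))"

definition weak_laplacian :: "(real^2 \<Rightarrow> real) \<Rightarrow> (real^2 \<Rightarrow> real) \<Rightarrow> bool" where
  "weak_laplacian w F \<longleftrightarrow> (\<forall>\<phi>. test_function \<phi> \<longrightarrow>
     (LBINT x. w x * laplacian \<phi> x) = (LBINT x. F x * \<phi> x))"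

lemma weak_laplacian_cutoff:
  assumes w: "locally_L2 w" and G: "\<And>i. locally_L2 (G i)" "\<And>i. weak_partial i w (G i)"
    and F: "locally_L2 F" "weak_laplacian w F" and h: "test_function h"
  shows "weak_laplacian (\<lambda>x. h x * w x)
    (\<lambda>x. h x * F x + 2 * (partial_deriv 1 h x * G 1 x + partial_deriv 2 h x * G 2 x) + laplacian h x * w x)"
  unfolding weak_laplacian_def
proof (intro allI impI)
  fix \<phi> :: "real^2 \<Rightarrow> real" assume \<phi>: "test_function \<phi>"
  have sm: "smooth_on UNIV h" "smooth_on UNIV \<phi>" using h \<phi> test_function_smooth by auto
  have li: "locally_integrable w" "locally_integrable F" "\<And>i. locally_integrable (G i)"
    by (intro locally_L2_imp_locally_integrable w F G)+
  have dh: "test_function (partial_deriv i h)" "test_function (partial_deriv i \<phi>)" for i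
    by (intro test_function_partial_deriv h \<phi>)+
  have d: "f differentiable (at x)" if "test_function f" for f x
    using smooth_on_imp_differentiable[OF test_function_smooth[OF that] UNIV_I] .
  have pd: "partial_deriv i (\<lambda>x. f x * g x) x = partial_deriv i f x * g x + f x * partial_deriv i g x"
    if "test_function f" "test_function g" for f g i x
    by (rule partial_deriv_mult[OF d[OF that(1)] d[OF that(2)]])
  have t1: "test_function (\<lambda>x. h x * \<phi> x)" by (rule test_function_mult(1)[OF sm(1) \<phi>])
  have t2: "test_function (\<lambda>x. partial_deriv i h x * \<phi> x)" for i
    by (rule test_function_mult(1)[OF test_function_smooth[OF dh(1)] \<phi>])
  have t3: "test_function (\<lambda>x. laplacian h x * \<phi> x)"
    by (rule test_function_mult(1)[OF test_function_smooth[OF test_function_laplacian[OF h]] \<phi>])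
  have lap: "laplacian (\<lambda>x. h x * \<phi> x) x = laplacian h x * \<phi> x
      + 2 * (partial_deriv 1 h x * partial_deriv 1 \<phi> x + partial_deriv 2 h x * partial_deriv 2 \<phi> x)
      + h x * laplacian \<phi> x" for x
  proof -
    have "partial_deriv i (partial_deriv i (\<lambda>x. h x * \<phi> x)) x = partial_deriv i (partial_deriv i h) x * \<phi> x
        + 2 * (partial_deriv i h x * partial_deriv i \<phi> x) + h x * partial_deriv i (partial_deriv i \<phi>) x" for i
    proof -
      have "partial_deriv i (\<lambda>x. h x * \<phi> x) = (\<lambda>x. partial_deriv i h x * \<phi> x + h x * partial_deriv i \<phi> x)"
        using pd[OF h \<phi>] by (rule ext)
      then have "partial_deriv i (partial_deriv i (\<lambda>x. h x * \<phi> x)) x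
          = partial_deriv i (\<lambda>x. partial_deriv i h x * \<phi> x + h x * partial_deriv i \<phi> x) x" by simp
      also have "\<dots> = partial_deriv i (\<lambda>x. partial_deriv i h x * \<phi> x) x + partial_deriv i (\<lambda>x. h x * partial_deriv i \<phi> x) x"
        by (rule partial_deriv_add[OF d[OF t2] d[OF test_function_mult(1)[OF sm(1) dh(2)]]])
      finally show ?thesis using pd[OF dh(1) \<phi>] pd[OF h dh(2)] by simp
    qed
    then show ?thesis by (simp add: laplacian_def algebra_simps)
  qed
  have pd2: "partial_deriv i (\<lambda>x. partial_deriv i h x * \<phi> x) x
      = partial_deriv i (partial_deriv i h) x * \<phi> x + partial_deriv i h x * partial_deriv i \<phi> x" for i x
    by (rule pd[OF dh(1) \<phi>])
  \<comment> \<open>This is h \<Delta>\<phi> = \<Delta>(h \<phi>) - 2 div (\<phi> grad h) + \<phi>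
    \<Delta>h. Every derivative on the right falls on h alone or on a whole test function, so the
    weak equation and the weak gradient apply term by term.\<close>
  have "h x * w x * laplacian \<phi> x = w x * laplacian (\<lambda>x. h x * \<phi> x) x
      - 2 * (w x * partial_deriv 1 (\<lambda>x. partial_deriv 1 h x * \<phi> x) x
        + w x * partial_deriv 2 (\<lambda>x. partial_deriv 2 h x * \<phi> x) x)
      + w x * (laplacian h x * \<phi> x)" for x
    unfolding lap pd2 by (simp add: laplacian_def algebra_simps)
  then have "(LBINT x. h x * w x * laplacian \<phi> x)
      = (LBINT x. w x * laplacian (\<lambda>x. h x * \<phi> x) x)
      - 2 * ((LBINT x. w x * partial_deriv 1 (\<lambda>x. partial_deriv 1 h x * \<phi> x) x)
        + (LBINT x. w x * partial_deriv 2 (\<lambda>x. partial_deriv 2 h x * \<phi> x) x))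
      + (LBINT x. w x * (laplacian h x * \<phi> x))"
    using integrable_mult_test_function[OF li(1) test_function_laplacian[OF t1]]
      integrable_mult_test_function[OF li(1) test_function_partial_deriv[OF t2[of 1]], of 1]
      integrable_mult_test_function[OF li(1) test_function_partial_deriv[OF t2[of 2]], of 2]
      integrable_mult_test_function[OF li(1) t3]
    by simp
  also have "\<dots> = (LBINT x. F x * (h x * \<phi> x))
      + 2 * ((LBINT x. G 1 x * (partial_deriv 1 h x * \<phi> x))
        + (LBINT x. G 2 x * (partial_deriv 2 h x * \<phi> x)))
      + (LBINT x. w x * (laplacian h x * \<phi> x))"
    using F(2) G(2)[of 1] G(2)[of 2] t1 t2[of 1] t2[of 2] unfolding weak_laplacian_def weak_partial_def by simp
  also have "\<dots> = (LBINT x. F x * (h x * \<phi> x) + 2 * (G 1 x * (partial_deriv 1 h x * \<phi> x)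
        + G 2 x * (partial_deriv 2 h x * \<phi> x)) + w x * (laplacian h x * \<phi> x))"
    using integrable_mult_test_function[OF li(2) t1]
      integrable_mult_test_function[OF li(3) t2[of 1], of 1]
      integrable_mult_test_function[OF li(3) t2[of 2], of 2]
      integrable_mult_test_function[OF li(1) t3]
    by simp
  also have "\<dots> = (LBINT x. (h x * F x + 2 * (partial_deriv 1 h x * G 1 x + partial_deriv 2 h x * G 2 x)
      + laplacian h x * w x) * \<phi> x)"
    by (rule Bochner_Integration.integral_cong) (auto simp: algebra_simps)
  finally show "(LBINT x. h x * w x * laplacian \<phi> x) = \<dots>" .
qed

lemma locally_L2_mult_test:
  assumes "locally_L2 f" "test_function h"
  shows "locally_L2 (\<lambda>x. h x * f x)"
proof -
  obtain B where "\<And>x. \<bar>h x\<bar> \<le> B" using test_function_bounded_value[OF assms(2)] by metis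
  then show ?thesis using assms by (intro locally_L2_mult) auto
qed

lemma locally_L2_integrable_bounded:
  assumes f: "locally_L2 f" and f0: "AE x in lborel. R < norm x \<longrightarrow> f x = 0"
  shows "integrable lborel (\<lambda>x. (f x)\<^sup>2)"
proof -
  have [measurable]: "f \<in> borel_measurable borel" using f by auto
  have "integrable lborel (\<lambda>x. indicator (cball 0 R) x *\<^sub>R (f x)\<^sup>2)"
    using f unfolding locally_L2_def set_integrable_def by blast
  then show ?thesis
    by (rule Bochner_Integration.integrable_bound)
       (use f0 in \<open>auto elim!: eventually_mono simp: indicator_def\<close>)
qed

lemma locally_L2_translate:
  assumes f: "locally_L2 f"
  shows "locally_L2 (\<lambda>x. f (a + x))"
  unfolding locally_L2_def set_integrable_def
proof (intro conjI allI)
  have [measurable]: "f \<in> borel_measurable borel" using f by auto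
  show m: "(\<lambda>x. f (a + x)) \<in> borel_measurable borel" by measurable
  fix r
  have "integrable lborel (\<lambda>x. indicator (cball 0 (norm a + r)) x *\<^sub>R (f x)\<^sup>2)"
    using f unfolding locally_L2_def set_integrable_def by blast
  then have "integrable lborel (\<lambda>x. indicator (cball 0 (norm a + r)) (a + x) *\<^sub>R (f (a + x))\<^sup>2)"
    by (rule integrable_affine_1)
  then show "integrable lborel (\<lambda>x. indicator (cball 0 r) x *\<^sub>R (f (a + x))\<^sup>2)"
  proof (rule Bochner_Integration.integrable_bound)
    have "norm (a + x) \<le> norm a + r" if "norm x \<le> r" for x
      using norm_triangle_ineq[of a x] that by linarith
    then show "AE x in lborel. norm (indicator (cball 0 r) x *\<^sub>R (f (a + x))\<^sup>2)
        \<le> norm (indicator (cball 0 (norm a + r)) (a + x) *\<^sub>R (f (a + x))\<^sup>2)"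
      by (auto simp: indicator_def)
    show "(\<lambda>x. indicator (cball 0 r) x *\<^sub>R (f (a + x))\<^sup>2) \<in> borel_measurable lborel"
      by (intro borel_measurable_scaleR borel_measurable_indicator; simp)
  qed
qed

lemma weak_laplacian_translate:
  assumes w: "locally_L2 w" and F: "locally_L2 F" and lap: "weak_laplacian w F"
  shows "weak_laplacian (\<lambda>x. w (a + x)) (\<lambda>x. F (a + x))"
  unfolding weak_laplacian_def
proof (intro allI impI)
  fix \<phi> :: "real^2 \<Rightarrow> real" assume \<phi>: "test_function \<phi>"
  have [measurable]: "w \<in> borel_measurable borel" "F \<in> borel_measurable borel" using w F by auto
  define \<psi> where "\<psi> = (\<lambda>x. \<phi> (- a + 1 *\<^sub>R x))"
  have \<psi>: "test_function \<psi>" unfolding \<psi>_def by (rule test_function_affine[OF \<phi>]) simp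
  have d: "f differentiable (at x)" if "test_function f" for f x
    using smooth_on_imp_differentiable[OF test_function_smooth[OF that] UNIV_I] .
  have pd: "partial_deriv i (\<lambda>x. f (- a + 1 *\<^sub>R x)) = (\<lambda>x. partial_deriv i f (- a + 1 *\<^sub>R x))"
    if "test_function f" for f i
    using partial_deriv_affine(1)[OF d[OF that], of i "-a" 1] by (intro ext) simp
  have lap\<psi>: "laplacian \<psi> x = laplacian \<phi> (- a + 1 *\<^sub>R x)" for x
    unfolding laplacian_def \<psi>_def pd[OF \<phi>] pd[OF test_function_partial_deriv[OF \<phi>]] ..
  have [measurable]: "\<psi> \<in> borel_measurable borel" "laplacian \<psi> \<in> borel_measurable borel"
    using \<psi> test_function_laplacian[OF \<psi>] by auto
  have mm: "(\<lambda>x. w x * laplacian \<psi> x) \<in> borel_measurable borel" "(\<lambda>x. F x * \<psi> x) \<in> borel_measurable borel"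
    by measurable
  have "(LBINT x. w (a + x) * laplacian \<phi> x) = (LBINT x. w x * laplacian \<psi> x)"
    using integral_affine_1[of "\<lambda>x. w x * laplacian \<psi> x" a, OF mm(1)] by (simp add: lap\<psi>)
  also have "\<dots> = (LBINT x. F x * \<psi> x)"
    using lap \<psi> by (simp add: weak_laplacian_def)
  also have "\<dots> = (LBINT x. F (a + x) * \<phi> x)"
    using integral_affine_1[of "\<lambda>x. F x * \<psi> x" a, OF mm(2)] by (simp add: \<psi>_def)
  finally show "(LBINT x. w (a + x) * laplacian \<phi> x) = (LBINT x. F (a + x) * \<phi> x)" .
qed

lemma locally_L2_set_integrable:
  assumes f: "locally_L2 f" and S: "S \<in> sets borel" "S \<subseteq> cball 0 R"
  shows "integrable lborel (\<lambda>x. indicator S x * (f x)\<^sup>2)"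
proof -
  have "(indicator S x * f x)\<^sup>2 = indicator S x * (f x)\<^sup>2" for x
    by (auto simp: indicator_def)
  then show ?thesis using locally_L2_indicator(2)[OF f S] by simp
qed

lemma AE_zero_of_integral_power2_le_0:
  assumes f: "locally_L2 f" and S: "S \<in> sets borel" "S \<subseteq> cball 0 R"
    and "(LBINT x. indicator S x * (f x)\<^sup>2) \<le> 0"
  shows "AE x in lborel. x \<in> S \<longrightarrow> f x = 0"
proof -
  have "(LBINT x. indicator S x * (f x)\<^sup>2) = 0"
    using assms(4) Bochner_Integration.integral_nonneg[of lborel "\<lambda>x. indicator S x * (f x)\<^sup>2"]
    by (intro antisym) auto
  then have "AE x in lborel. indicator S x * (f x)\<^sup>2 = 0"
    by (subst (asm) integral_nonneg_eq_0_iff_AE[OF locally_L2_set_integrable[OF f S]]) auto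
  then show ?thesis by eventually_elim (auto simp: indicator_def)
qed

text \<open>Both components of a complex solution are needed at once, since a complex coefficient couples
  them. The cutoff error lives in \<open>|x| \<ge> s'\<close>, where the weight is smaller by \<open>(t / s')\<^sup>2\<^sup>n\<close> than on
  the ball of radius \<open>t\<close>; so letting \<open>n\<close> tend to infinity gives vanishing on the latter.\<close>

lemma unique_continuation_origin:
  fixes w F :: "bool \<Rightarrow> real^2 \<Rightarrow> real"
  assumes w: "\<And>j. locally_L2 (w j)" and F: "\<And>j. locally_L2 (F j)" "\<And>j. weak_laplacian (w j) (F j)"
    and G: "\<And>j i. locally_L2 (G j i)" "\<And>j i. weak_partial i (w j) (G j i)"
    and bound: "AE x in lborel. norm x < s \<longrightarrow> (F True x)\<^sup>2 + (F False x)\<^sup>2 \<le> M * ((w True x)\<^sup>2 + (w False x)\<^sup>2)"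
    and "M \<ge> 0" "r > 0" and w0: "\<And>j. AE x in lborel. norm x < r \<longrightarrow> w j x = 0"
    and "0 < t" "t < s'" "s' < s" "r < s'"
  shows "AE x in lborel. norm x < t \<longrightarrow> w j x = 0"
proof -
  obtain h :: "real^2 \<Rightarrow> real" where h: "test_function h" "\<And>x. 0 \<le> h x \<and> h x \<le> 1"
    "\<And>x. x \<in> cball 0 s' \<Longrightarrow> h x = 1" "\<And>x. x \<notin> ball 0 s \<Longrightarrow> h x = 0"
    by (rule cutoff_exists[OF _ \<open>s' < s\<close>, of 0]) (use assms in \<open>auto intro: that\<close>)
  define v where "v = (\<lambda>j x. h x * w j x)"
  define g where "g = (\<lambda>j x. h x * F j x + 2 * (partial_deriv 1 h x * G j 1 x + partial_deriv 2 h x * G j 2 x)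
    + laplacian h x * w j x)"
  have v: "locally_L2 (v j)" for j
    unfolding v_def by (rule locally_L2_mult_test[OF w h(1)])
  have "g j = (\<lambda>x. (h x * F j x + ((2 * partial_deriv 1 h x) * G j 1 x + (2 * partial_deriv 2 h x) * G j 2 x))
    + laplacian h x * w j x)" for j
    by (rule ext) (simp add: g_def algebra_simps)
  moreover have "test_function (\<lambda>x. 2 * partial_deriv i h x)" for i
    by (rule test_function_mult(1)[OF smooth_on_const test_function_partial_deriv[OF h(1)]])
  ultimately have g: "locally_L2 (g j)" for j
    by (simp only:) (intro locally_L2_add locally_L2_mult_test w F G h(1) test_function_laplacian)
  have weak: "weak_laplacian (v j) (g j)" for j
    unfolding v_def g_def by (rule weak_laplacian_cutoff[OF w G F h(1)])
  have dh: "partial_deriv i h x = 0" if "x \<in> ball 0 s'" for i x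
    by (rule partial_deriv_eq_0[OF open_ball that, of _ 1]) (use h(3) in auto)
  have ddh: "partial_deriv i (partial_deriv i h) x = 0" if "x \<in> ball 0 s'" for i x
    by (rule partial_deriv_eq_0[OF open_ball that, of _ 0]) (use dh in auto)
  have g_in: "g j x = F j x" if "norm x < s'" for j x
    using that dh[of x] ddh[of x] h(3)[of x] by (simp add: g_def laplacian_def)
  have out: "partial_deriv i h x = 0" if "x \<in> - cball 0 s" for i x
    by (rule partial_deriv_eq_0[OF _ that, of _ 0]) (use h(4) in auto)
  have out2: "partial_deriv i (partial_deriv i h) x = 0" if "x \<in> - cball 0 s" for i x
    by (rule partial_deriv_eq_0[OF _ that, of _ 0]) (use out in auto)
  have g_out: "g j x = 0" if "norm x > s" for j x
    using that out[of x] out2[of x] h(4)[of x] by (simp add: g_def laplacian_def)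
  have v0: "AE x in lborel. norm x < r \<or> s < norm x \<longrightarrow> v j x = 0" for j
    using w0[of j] by eventually_elim (use h(4) in \<open>auto simp: v_def\<close>)
  have "AE x in lborel. norm x < r \<longrightarrow> F j x = 0" for j
    using bound w0[of True] w0[of False]
  proof eventually_elim
    case (elim x)
    show ?case
    proof
      assume x: "norm x < r"
      then have "(F True x)\<^sup>2 + (F False x)\<^sup>2 \<le> 0" using elim assms by simp
      then show "F j x = 0" by (cases j) (simp_all add: sum_power2_le_zero_iff)
    qed
  qed
  then have g0: "AE x in lborel. norm x < r \<or> s < norm x \<longrightarrow> g j x = 0" for j
  proof -
    show ?thesis
      using \<open>AE x in lborel. norm x < r \<longrightarrow> F j x = 0\<close>
      by eventually_elim (use g_in[of _ j] g_out[of _ j] \<open>r < s'\<close> in force)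
  qed
  \<comment> \<open>The Carleman estimate for the potential costs 4 M copies of the weighted
    integral of v^2; with c^2 = 4 M + 1 one copy survives the absorption.\<close>
  define c where "c = sqrt (4 * M + 1)"
  have c: "c \<ge> 0" "c\<^sup>2 = 4 * M + 1" using \<open>M \<ge> 0\<close> by (auto simp: c_def)
  have carl: "integrable lborel (\<lambda>x. carleman_weight c n x * (v j x)\<^sup>2)"
    "integrable lborel (\<lambda>x. carleman_weight c n x * (g j x)\<^sup>2)"
    "c\<^sup>2 * (LBINT x. carleman_weight c n x * (v j x)\<^sup>2) \<le> 4 * (LBINT x. carleman_weight c n x * (g j x)\<^sup>2)"
    for n j
    by (rule carleman_weak[OF v[of j] g[of j] \<open>r > 0\<close> c(1) v0 g0]; use weak[of j] in \<open>simp add: weak_laplacian_def\<close>)+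
  have gi: "integrable lborel (\<lambda>x. (g j x)\<^sup>2)" for j
    by (rule locally_L2_integrable_bounded[OF g, of s]) (use g_out in auto)
  define \<Gamma> where "\<Gamma> = 4 * exp (c / 4 * s\<^sup>2) * (LBINT x. (g True x)\<^sup>2 + (g False x)\<^sup>2)"
  define W where "W = (LBINT x. indicator (ball 0 t) x * ((w True x)\<^sup>2 + (w False x)\<^sup>2))"
  have Wi: "integrable lborel (\<lambda>x. indicator (ball 0 t) x * (w j x)\<^sup>2)" for j
    by (rule locally_L2_set_integrable[OF w, of _ t]) auto
  have key: "W \<le> \<Gamma> * ((t / s')\<^sup>2) ^ n" for n
  proof -
    define E where "E = carleman_weight c n"
    have E0: "E x \<ge> 0" for x by (simp add: E_def carleman_weight_nonneg)
    let ?I = "inverse (t\<^sup>2) ^ n" and ?J = "inverse (s'\<^sup>2) ^ n"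
    have IJ: "?I > 0" "?J > 0" using assms by auto
    have low: "?I \<le> E x" if "norm x < t" "x \<noteq> 0" for x
    proof -
      have "inverse (t\<^sup>2) \<le> inverse ((norm x)\<^sup>2)"
        using that by (intro le_imp_inverse_le power_mono) auto
      then have "?I \<le> inverse ((norm x)\<^sup>2) ^ n" by (intro power_mono) auto
      moreover have "1 \<le> exp (c / 4 * (norm x)\<^sup>2)" using c by simp
      ultimately have "1 * ?I \<le> exp (c / 4 * (norm x)\<^sup>2) * inverse ((norm x)\<^sup>2) ^ n"
        using IJ by (intro mult_mono) auto
      then show ?thesis by (simp add: E_def carleman_weight_def)
    qed
    have up: "E x \<le> exp (c / 4 * s\<^sup>2) * ?J" if "s' \<le> norm x" "norm x \<le> s" for x
    proof -
      have "inverse ((norm x)\<^sup>2) \<le> inverse (s'\<^sup>2)"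
        using that assms by (intro le_imp_inverse_le power_mono) auto
      then have "inverse ((norm x)\<^sup>2) ^ n \<le> ?J" by (intro power_mono) auto
      moreover have "c / 4 * (norm x)\<^sup>2 \<le> c / 4 * s\<^sup>2"
        using that c by (intro mult_left_mono power_mono) auto
      ultimately show ?thesis unfolding E_def carleman_weight_def by (intro mult_mono) auto
    qed
    have Ei: "integrable lborel (\<lambda>x. E x * (v j x)\<^sup>2)" "integrable lborel (\<lambda>x. E x * (g j x)\<^sup>2)" for j
      using carl unfolding E_def by auto
    have pt: "AE x in lborel. E x * (g True x)\<^sup>2 + E x * (g False x)\<^sup>2
        \<le> M * (E x * (v True x)\<^sup>2 + E x * (v False x)\<^sup>2)
          + exp (c / 4 * s\<^sup>2) * ?J * ((g True x)\<^sup>2 + (g False x)\<^sup>2)"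
      using bound
    proof eventually_elim
      case (elim x)
      show ?case
      proof (cases "norm x < s'")
        case True
        then have "(g True x)\<^sup>2 + (g False x)\<^sup>2 \<le> M * ((v True x)\<^sup>2 + (v False x)\<^sup>2)"
          using elim \<open>s' < s\<close> g_in[OF True] h(3)[of x] by (simp add: v_def)
        from mult_left_mono[OF this E0[of x]]
        have "E x * (g True x)\<^sup>2 + E x * (g False x)\<^sup>2 \<le> M * (E x * (v True x)\<^sup>2 + E x * (v False x)\<^sup>2)"
          by (simp add: algebra_simps)
        moreover have "0 \<le> exp (c / 4 * s\<^sup>2) * ?J * ((g True x)\<^sup>2 + (g False x)\<^sup>2)" by simp
        ultimately show ?thesis by linarith
      next
        case False
        have "E x * ((g True x)\<^sup>2 + (g False x)\<^sup>2) \<le> exp (c / 4 * s\<^sup>2) * ?J * ((g True x)\<^sup>2 + (g False x)\<^sup>2)"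
        proof (cases "norm x \<le> s")
          case True
          then show ?thesis using up[of x] False by (intro mult_right_mono) auto
        qed (use g_out[of x] in simp)
        moreover have "0 \<le> M * (E x * (v True x)\<^sup>2 + E x * (v False x)\<^sup>2)"
          using \<open>M \<ge> 0\<close> E0[of x] by simp
        ultimately show ?thesis by (simp add: algebra_simps)
      qed
    qed
    let ?V = "\<integral>x. E x * (v True x)\<^sup>2 + E x * (v False x)\<^sup>2 \<partial>lborel"
    let ?G = "\<integral>x. E x * (g True x)\<^sup>2 + E x * (g False x)\<^sup>2 \<partial>lborel"
    have "c\<^sup>2 * ?V \<le> 4 * ?G"
      using carl(3)[of n True] carl(3)[of n False] Ei by (simp add: E_def[symmetric] distrib_left)
    moreover have "?G \<le> M * ?V + exp (c / 4 * s\<^sup>2) * ?J * (LBINT x. (g True x)\<^sup>2 + (g False x)\<^sup>2)"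
    proof -
      have "?G \<le> (LBINT x. M * (E x * (v True x)\<^sup>2 + E x * (v False x)\<^sup>2)
          + exp (c / 4 * s\<^sup>2) * ?J * ((g True x)\<^sup>2 + (g False x)\<^sup>2))"
        using Ei gi by (intro integral_mono_AE pt) auto
      also have "\<dots> = M * ?V + exp (c / 4 * s\<^sup>2) * ?J * (LBINT x. (g True x)\<^sup>2 + (g False x)\<^sup>2)"
        using Ei gi by (subst Bochner_Integration.integral_add) (auto simp del: mult_eq_0_iff)
      finally show ?thesis .
    qed
    ultimately have V: "?V \<le> \<Gamma> * ?J"
      unfolding c(2) \<Gamma>_def by (simp add: algebra_simps)
    have "AE x in lborel. ?I * (indicator (ball 0 t) x * ((w True x)\<^sup>2 + (w False x)\<^sup>2))
        \<le> E x * (v True x)\<^sup>2 + E x * (v False x)\<^sup>2"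
      using AE_lborel_singleton[of 0]
    proof eventually_elim
      case (elim x)
      show ?case
      proof (cases "norm x < t")
        case True
        have "?I * ((w True x)\<^sup>2 + (w False x)\<^sup>2) \<le> E x * ((w True x)\<^sup>2 + (w False x)\<^sup>2)"
          using low[OF True elim] by (intro mult_right_mono) auto
        then show ?thesis
          using True h(3)[of x] \<open>t < s'\<close> by (simp add: v_def algebra_simps)
      qed (use E0[of x] in simp)
    qed
    then have "(LBINT x. ?I * (indicator (ball 0 t) x * ((w True x)\<^sup>2 + (w False x)\<^sup>2))) \<le> ?V"
      using Ei Wi by (intro integral_mono_AE) (auto simp: distrib_left)
    then have "?I * W \<le> ?V" unfolding W_def by (simp only: integral_mult_right_zero)
    then have "?I * W \<le> \<Gamma> * ?J" using V by linarith
    then have "W \<le> \<Gamma> * ?J / ?I" using IJ by (simp add: le_divide_eq mult.commute)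
    also have "\<Gamma> * ?J / ?I = \<Gamma> * ((t / s')\<^sup>2) ^ n"
      using assms by (simp add: power_divide power_inverse field_simps)
    finally show ?thesis .
  qed
  have "(\<lambda>n. \<Gamma> * ((t / s')\<^sup>2) ^ n) \<longlonglongrightarrow> \<Gamma> * 0"
    using assms by (intro tendsto_mult_left LIMSEQ_realpow_zero) (auto simp: power_less_one_iff abs_square_less_1)
  then have "W \<le> \<Gamma> * 0"
    by (rule Lim_bounded2) (use key in auto)
  moreover have "W = (LBINT x. indicator (ball 0 t) x * (w True x)\<^sup>2) + (LBINT x. indicator (ball 0 t) x * (w False x)\<^sup>2)"
    unfolding W_def using Wi by (simp add: distrib_left)
  moreover have nn: "(LBINT x. indicator (ball 0 t) x * (w j x)\<^sup>2) \<ge> 0" for j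
    by (intro Bochner_Integration.integral_nonneg) auto
  note nn[of True] nn[of False]
  ultimately have "(LBINT x. indicator (ball 0 t) x * (w True x)\<^sup>2) \<le> 0"
    "(LBINT x. indicator (ball 0 t) x * (w False x)\<^sup>2) \<le> 0"
    by linarith+
  then have "(LBINT x. indicator (ball 0 t) x * (w j x)\<^sup>2) \<le> 0"
    by (cases j) simp_all
  then have "AE x in lborel. x \<in> ball 0 t \<longrightarrow> w j x = 0"
    by (intro AE_zero_of_integral_power2_le_0[OF w, of _ t]) auto
  then show ?thesis by simp
qed

lemma weak_partial_translate:
  assumes w: "locally_L2 w" and g: "locally_L2 g" and wg: "weak_partial i w g"
  shows "weak_partial i (\<lambda>x. w (a + x)) (\<lambda>x. g (a + x))"
  unfolding weak_partial_def
proof (intro allI impI)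
  fix \<phi> :: "real^2 \<Rightarrow> real" assume \<phi>: "test_function \<phi>"
  have [measurable]: "w \<in> borel_measurable borel" "g \<in> borel_measurable borel" using w g by auto
  define \<psi> where "\<psi> = (\<lambda>x. \<phi> (- a + 1 *\<^sub>R x))"
  have \<psi>: "test_function \<psi>" unfolding \<psi>_def by (rule test_function_affine[OF \<phi>]) simp
  have d\<psi>: "partial_deriv i \<psi> x = partial_deriv i \<phi> (- a + 1 *\<^sub>R x)" for x
    unfolding \<psi>_def
    using partial_deriv_affine(1)[OF smooth_on_imp_differentiable[OF test_function_smooth[OF \<phi>] UNIV_I], of i "-a" 1]
    by simp
  have [measurable]: "\<psi> \<in> borel_measurable borel" "partial_deriv i \<psi> \<in> borel_measurable borel"
    using \<psi> test_function_partial_deriv[OF \<psi>] by auto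
  have mm: "(\<lambda>x. w x * partial_deriv i \<psi> x) \<in> borel_measurable borel" "(\<lambda>x. g x * \<psi> x) \<in> borel_measurable borel"
    by measurable
  have "(LBINT x. w (a + x) * partial_deriv i \<phi> x) = (LBINT x. w x * partial_deriv i \<psi> x)"
    using integral_affine_1[of "\<lambda>x. w x * partial_deriv i \<psi> x" a, OF mm(1)] by (simp add: d\<psi>)
  also have "\<dots> = - (LBINT x. g x * \<psi> x)"
    using wg \<psi> by (simp add: weak_partial_def)
  also have "(LBINT x. g x * \<psi> x) = (LBINT x. g (a + x) * \<phi> x)"
    using integral_affine_1[of "\<lambda>x. g x * \<psi> x" a, OF mm(2)] by (simp add: \<psi>_def)
  finally show "(LBINT x. w (a + x) * partial_deriv i \<phi> x) = - (LBINT x. g (a + x) * \<phi> x)" .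
qed

lemma AE_translate_ball:
  fixes a :: "real^2"
  shows "(AE x in lborel. norm x < r \<longrightarrow> P (a + x)) \<longleftrightarrow> (AE x in lborel. x \<in> ball a r \<longrightarrow> P x)"
proof
  assume *: "AE x in lborel. norm x < r \<longrightarrow> P (a + x)"
  show "AE x in lborel. x \<in> ball a r \<longrightarrow> P x"
    using AE_lborel_translate[OF *, of "- a"] by (simp add: dist_norm norm_minus_commute)
next
  assume *: "AE x in lborel. x \<in> ball a r \<longrightarrow> P x"
  show "AE x in lborel. norm x < r \<longrightarrow> P (a + x)"
    using AE_lborel_translate[OF *, of a] by (simp add: dist_norm)
qed

lemma unique_continuation_ball:
  fixes w F :: "bool \<Rightarrow> real^2 \<Rightarrow> real"
  assumes w: "\<And>j. locally_L2 (w j)" and F: "\<And>j. locally_L2 (F j)" "\<And>j. weak_laplacian (w j) (F j)"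
    and G: "\<And>j i. locally_L2 (G j i)" "\<And>j i. weak_partial i (w j) (G j i)"
    and bound: "AE x in lborel. x \<in> ball a s \<longrightarrow> (F True x)\<^sup>2 + (F False x)\<^sup>2 \<le> M * ((w True x)\<^sup>2 + (w False x)\<^sup>2)"
    and "M \<ge> 0" "r > 0" and w0: "\<And>j. AE x in lborel. x \<in> ball a r \<longrightarrow> w j x = 0"
    and "0 < t" "t < s"
  shows "AE x in lborel. x \<in> ball a t \<longrightarrow> w j x = 0"
proof -
  \<comment> \<open>The ball of known vanishing may be shrunk: r' \<le> t < s', as the centred
    version requires.\<close>
  define r' where "r' = min r t"
  have r': "r' > 0" "r' \<le> t" using assms by (auto simp: r'_def)
  obtain s' where s': "t < s'" "s' < s" using dense[OF \<open>t < s\<close>] by blast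
  have "AE x in lborel. norm x < t \<longrightarrow> w j (a + x) = 0"
  proof (rule unique_continuation_origin[where w = "\<lambda>j x. w j (a + x)" and F = "\<lambda>j x. F j (a + x)"
        and G = "\<lambda>j i x. G j i (a + x)" and r = r' and s = s and s' = s' and M = M])
    show "AE x in lborel. norm x < s \<longrightarrow> (F True (a + x))\<^sup>2 + (F False (a + x))\<^sup>2
        \<le> M * ((w True (a + x))\<^sup>2 + (w False (a + x))\<^sup>2)"
      using bound by (subst AE_translate_ball)
    show "AE x in lborel. norm x < r' \<longrightarrow> w j (a + x) = 0" for j
    proof (subst AE_translate_ball)
      show "AE x in lborel. x \<in> ball a r' \<longrightarrow> w j x = 0"
        using w0[of j] by eventually_elim (auto simp: r'_def)
    qed
  qed (use assms r' s' in \<open>auto intro: locally_L2_translate weak_laplacian_translate weak_partial_translate\<close>)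
  then show ?thesis by (subst (asm) AE_translate_ball)
qed

text \<open>The points near which both parts vanish form an open set. It is also relatively closed
  in \<Omega>: a ball of vanishing about y, however small, grows to radius 3 e / 2 about y, and so
  reaches any x with |x - y| < e whose ball of radius 3 e lies in \<Omega>.\<close>

theorem unique_continuation:
  fixes w F :: "bool \<Rightarrow> real^2 \<Rightarrow> real"
  assumes w: "\<And>j. locally_L2 (w j)" and F: "\<And>j. locally_L2 (F j)" "\<And>j. weak_laplacian (w j) (F j)"
    and G: "\<And>j i. locally_L2 (G j i)" "\<And>j i. weak_partial i (w j) (G j i)"
    and \<Omega>: "open \<Omega>" "connected \<Omega>"
    and bound: "AE x in lborel. x \<in> \<Omega> \<longrightarrow> (F True x)\<^sup>2 + (F False x)\<^sup>2 \<le> M * ((w True x)\<^sup>2 + (w False x)\<^sup>2)"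
    and "M \<ge> 0" and V: "open V" "V \<inter> \<Omega> \<noteq> {}" and w0: "\<And>j. AE x in lborel. x \<in> V \<longrightarrow> w j x = 0"
  shows "AE x in lborel. x \<in> \<Omega> \<longrightarrow> w j x = 0"
proof -
  define N where "N = (\<lambda>x. \<exists>r>0. \<forall>j. AE y in lborel. y \<in> ball x r \<longrightarrow> w j y = 0)"
  have N_near: "N y" if N: "\<forall>j. AE z in lborel. z \<in> ball x r \<longrightarrow> w j z = 0" and y: "y \<in> ball x r" for x y r
  proof -
    obtain e where e: "e > 0" "ball y e \<subseteq> ball x r"
      by (rule openE[OF open_ball y])
    have "AE z in lborel. z \<in> ball y e \<longrightarrow> w j z = 0" for j
      using spec[OF N, of j] by eventually_elim (use e(2) in blast)
    then show ?thesis unfolding N_def using e(1) by blast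
  qed
  have "open {x \<in> \<Omega>. N x}"
  proof (subst open_subopen, intro ballI)
    fix x assume "x \<in> {x \<in> \<Omega>. N x}"
    then obtain r where r: "r > 0" "\<forall>j. AE y in lborel. y \<in> ball x r \<longrightarrow> w j y = 0" "x \<in> \<Omega>"
      by (auto simp: N_def)
    then show "\<exists>T. open T \<and> x \<in> T \<and> T \<subseteq> {x \<in> \<Omega>. N x}"
      using \<Omega>(1) by (intro exI[of _ "ball x r \<inter> \<Omega>"]) (auto intro!: N_near)
  qed
  moreover have "open {x \<in> \<Omega>. \<not> N x}"
  proof (subst open_subopen, intro ballI)
    fix x assume x: "x \<in> {x \<in> \<Omega>. \<not> N x}"
    then obtain e' where "e' > 0" "ball x e' \<subseteq> \<Omega>"
      using \<Omega>(1) open_contains_ball by blast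
    then obtain e where e: "e > 0" "ball x (3 * e) \<subseteq> \<Omega>"
      using that[of "e' / 3"] by auto
    have "\<not> N y" if y: "y \<in> ball x e" for y
    proof
      assume "N y"
      then obtain r where r: "r > 0" "\<And>j. AE z in lborel. z \<in> ball y r \<longrightarrow> w j z = 0"
        by (auto simp: N_def)
      have sub: "ball y (2 * e) \<subseteq> \<Omega>"
      proof
        fix z assume "z \<in> ball y (2 * e)"
        then have "dist x z < 3 * e" using y dist_triangle[of x z y] by simp
        then show "z \<in> \<Omega>" using e(2) by auto
      qed
      have "AE z in lborel. z \<in> ball y (2 * e)
          \<longrightarrow> (F True z)\<^sup>2 + (F False z)\<^sup>2 \<le> M * ((w True z)\<^sup>2 + (w False z)\<^sup>2)"
        using bound by eventually_elim (use sub in blast)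
      from unique_continuation_ball[OF w F G this \<open>M \<ge> 0\<close> r, of "3 / 2 * e"]
      have "\<forall>j. AE z in lborel. z \<in> ball y (3 / 2 * e) \<longrightarrow> w j z = 0"
        using e(1) by auto
      then have "N x" by (rule N_near) (use y e(1) in \<open>auto simp: dist_commute\<close>)
      with x show False by simp
    qed
    then show "\<exists>T. open T \<and> x \<in> T \<and> T \<subseteq> {x \<in> \<Omega>. \<not> N x}"
      using e by (intro exI[of _ "ball x e"]) (auto intro: subsetD[OF e(2)])
  qed
  ultimately have "{x \<in> \<Omega>. N x} \<inter> \<Omega> = {} \<or> {x \<in> \<Omega>. \<not> N x} \<inter> \<Omega> = {}"
    using \<Omega>(2) by (intro connectedD) auto
  moreover obtain x where x: "x \<in> V" "x \<in> \<Omega>" using V(2) by blast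
  have "N x"
  proof -
    obtain e where e: "e > 0" "ball x e \<subseteq> V" using V(1) x(1) open_contains_ball by blast
    have "AE z in lborel. z \<in> ball x e \<longrightarrow> w j z = 0" for j
      using w0[of j] by eventually_elim (use e(2) in blast)
    then show ?thesis unfolding N_def using e(1) by blast
  qed
  ultimately have all: "N x" if "x \<in> \<Omega>" for x using x(2) that by blast
  show ?thesis
  proof (rule AE_locally)
    fix x assume "x \<in> \<Omega>"
    then obtain r where "r > 0" "AE y in lborel. y \<in> ball x r \<longrightarrow> w j y = 0"
      using all[of x] by (auto simp: N_def)
    then show "\<exists>V. open V \<and> x \<in> V \<and> (AE y in lborel. y \<in> V \<longrightarrow> w j y = 0)"
      by (intro exI[of _ "ball x r"]) auto
  qed
qed

section \<open>Rellich's lemma\<close>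

text \<open>For a solution of Bessel's equation, \<open>r (a'\<^sup>2 + k\<^sup>2 a\<^sup>2) + a a'\<close> is constant up to a factor that
  stays bounded as \<open>r\<close> tends to infinity.\<close>

lemma bessel_decay_imp_zero:
  fixes a a' a'' :: "real \<Rightarrow> real"
  assumes "k > 0" "m \<ge> 0" "r0 \<ge> 1" "r0 \<ge> 1 / k"
    and da: "\<And>r. r > r0 \<Longrightarrow> (a has_real_derivative a' r) (at r)"
    and da': "\<And>r. r > r0 \<Longrightarrow> (a' has_real_derivative a'' r) (at r)"
    and ode: "\<And>r. r > r0 \<Longrightarrow> a'' r = - a' r / r + m * a r / r\<^sup>2 - k\<^sup>2 * a r"
    and decay: "\<And>r. r > r0 \<Longrightarrow> \<bar>a r\<bar> \<le> C / r" "\<And>r. r > r0 \<Longrightarrow> \<bar>a' r\<bar> \<le> C / r"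
    and "r > r0"
  shows "a r = 0"
proof -
  define S where "S = (\<lambda>r. (a' r)\<^sup>2 + k\<^sup>2 * (a r)\<^sup>2)"
  \<comment> \<open>By the equation the derivative of r S contains k^2 a^2 - a'^2, which is of the
    order of S; adding a a' cancels it. What remains is of order S / r, that is E / r^2, and 1 / r^2
    is integrable at infinity.\<close>
  define E where "E = (\<lambda>r. r * S r + a r * a' r)"
  define K where "K = (2 * m + 1) / k + 2 * m / k\<^sup>2"
  have K: "K \<ge> 0" using assms by (simp add: K_def)
  have S0: "S r \<ge> 0" for r by (simp add: S_def)
  have aa': "\<bar>a r * a' r\<bar> \<le> S r / (2 * k)" for r
  proof -
    have "2 * k * (\<bar>a r\<bar> * \<bar>a' r\<bar>) \<le> S r"
      using sum_squares_bound[of "k * \<bar>a r\<bar>" "\<bar>a' r\<bar>"] by (simp add: S_def power_mult_distrib mult_ac)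
    then show ?thesis using \<open>k > 0\<close> by (simp add: abs_mult field_simps)
  qed
  have lower: "r * S r / 2 \<le> E r" if "r > r0" for r
  proof -
    have "1 / k \<le> r" using that assms by linarith
    then have "S r / (2 * k) \<le> r * S r / 2"
      using mult_right_mono[OF _ S0[of r], of "1 / k" r] by (simp add: field_simps)
    then show ?thesis using aa'[of r] unfolding E_def by linarith
  qed
  have dE: "(E has_real_derivative (2 * m - 1) * (a r * a' r) / r + m * (a r)\<^sup>2 / r\<^sup>2) (at r)" if r: "r > r0" for r
  proof -
    have "(E has_real_derivative S r + r * (2 * a' r * a'' r + k\<^sup>2 * (2 * a r * a' r)) + (a' r * a' r + a r * a'' r)) (at r)"
      unfolding E_def S_def
      by (rule derivative_eq_intros da[OF r] da'[OF r] refl)+ (simp add: algebra_simps)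
    moreover have "S r + r * (2 * a' r * a'' r + k\<^sup>2 * (2 * a r * a' r)) + (a' r * a' r + a r * a'' r)
        = (2 * m - 1) * (a r * a' r) / r + m * (a r)\<^sup>2 / r\<^sup>2"
      using r assms(3) unfolding S_def ode[OF r] by (simp add: field_simps power2_eq_square)
    ultimately show ?thesis by simp
  qed
  have dE_low: "- (K / r\<^sup>2 * E r) \<le> (2 * m - 1) * (a r * a' r) / r + m * (a r)\<^sup>2 / r\<^sup>2" if r: "r > r0" for r
  proof -
    have r1: "r > 1" using r assms by linarith
    have "\<bar>(2 * m - 1) * (a r * a' r)\<bar> \<le> (2 * m + 1) * (S r / (2 * k))"
      unfolding abs_mult[of "2 * m - 1"] using aa'[of r] assms(2) by (intro mult_mono) auto
    then have "\<bar>(2 * m - 1) * (a r * a' r)\<bar> / r \<le> (2 * m + 1) * (S r / (2 * k)) / r"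
      by (rule divide_right_mono) (use r1 in simp)
    then have "\<bar>(2 * m - 1) * (a r * a' r) / r\<bar> \<le> (2 * m + 1) * (S r / (2 * k)) / r"
      unfolding abs_divide using r1 by (simp only: abs_of_pos[of r] less_trans[OF zero_less_one])
    then have "- ((2 * m - 1) * (a r * a' r) / r) \<le> (2 * m + 1) * (S r / (2 * k)) / r"
      by (rule abs_le_D2)
    moreover have "m * (a r)\<^sup>2 / r\<^sup>2 \<ge> 0" using assms(2) by simp
    moreover have "(2 * m + 1) * (S r / (2 * k)) / r \<le> K / r\<^sup>2 * E r"
    proof -
      have "(2 * m + 1) * (S r / (2 * k)) / r = (2 * m + 1) / k / r\<^sup>2 * (r * S r / 2)"
        using r1 \<open>k > 0\<close> by (simp add: field_simps power2_eq_square)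
      also have "\<dots> \<le> K / r\<^sup>2 * E r"
        using lower[OF r] assms r1 S0[of r] by (intro mult_mono divide_right_mono) (auto simp: K_def)
      finally show ?thesis .
    qed
    ultimately show ?thesis by linarith
  qed
  \<comment> \<open>exp (- K / r) is the integrating factor for E' \<ge> - (K / r^2) E, so H is
    nondecreasing. The decay of a and a' bounds H by a multiple of 1 / r; a nondecreasing function
    with such a bound is at most 0.\<close>
  define H where "H = (\<lambda>r. E r * exp (- (K / r)))"
  have mono: "H r \<le> H s" if "r > r0" "r \<le> s" for r s
  proof (rule DERIV_nonneg_imp_nondecreasing[OF that(2)])
    fix x assume x: "r \<le> x" "x \<le> s"
    then have x0: "x > r0" "x > 0" using that assms by linarith+
    let ?d = "(2 * m - 1) * (a x * a' x) / x + m * (a x)\<^sup>2 / x\<^sup>2"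
    have "((\<lambda>r. exp (- (K / r))) has_real_derivative exp (- (K / x)) * (K / x\<^sup>2)) (at x)"
      using x0 by (auto intro!: derivative_eq_intros simp: power2_eq_square field_simps)
    from DERIV_mult[OF dE[OF x0(1)] this]
    have "(H has_real_derivative exp (- (K / x)) * (?d + K / x\<^sup>2 * E x)) (at x)"
      unfolding H_def by (simp add: algebra_simps)
    moreover have "exp (- (K / x)) * (?d + K / x\<^sup>2 * E x) \<ge> 0"
      using dE_low[OF x0(1)] by simp
    ultimately show "\<exists>y. (H has_real_derivative y) (at x) \<and> 0 \<le> y" by blast
  qed
  define B where "B = C\<^sup>2 * (2 + k\<^sup>2)"
  have up: "H s \<le> B / s" if s: "s > r0" for s
  proof -
    have s1: "s > 1" using s assms by linarith
    have sq: "(a s)\<^sup>2 \<le> (C / s)\<^sup>2" "(a' s)\<^sup>2 \<le> (C / s)\<^sup>2"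
      using power_mono[OF decay(1)[OF s] abs_ge_zero, of 2] power_mono[OF decay(2)[OF s] abs_ge_zero, of 2] by simp_all
    have "a s * a' s \<le> (C / s)\<^sup>2"
      using sum_squares_bound[of "a s" "a' s"] sq by linarith
    moreover have "S s \<le> (C / s)\<^sup>2 + k\<^sup>2 * (C / s)\<^sup>2"
      unfolding S_def using sq by (intro add_mono mult_left_mono) auto
    then have "s * S s \<le> s * ((C / s)\<^sup>2 + k\<^sup>2 * (C / s)\<^sup>2)"
      using s1 by (intro mult_left_mono) auto
    moreover have "(C / s)\<^sup>2 \<le> s * (C / s)\<^sup>2"
      using s1 mult_right_mono[of 1 s "(C / s)\<^sup>2"] by simp
    ultimately have "E s \<le> s * ((C / s)\<^sup>2 + k\<^sup>2 * (C / s)\<^sup>2) + s * (C / s)\<^sup>2"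
      unfolding E_def by linarith
    also have "\<dots> = B / s"
      using s1 by (simp add: B_def field_simps power2_eq_square)
    finally have EB: "E s \<le> B / s" .
    have "0 \<le> s * S s / 2" using s1 S0[of s] by simp
    then have "E s \<ge> 0" using lower[OF s] by linarith
    moreover have "exp (- (K / s)) \<le> 1" using K s1 by simp
    ultimately have "H s \<le> E s" unfolding H_def using mult_left_mono[of "exp (- (K / s))" 1 "E s"] by simp
    then show ?thesis using EB by linarith
  qed
  have "H r \<le> 0"
  proof (rule ccontr)
    assume neg: "\<not> H r \<le> 0"
    define s where "s = max r (B / H r + 1)"
    have s: "s > r0" "r \<le> s" "s > 0" "s > B / H r" using \<open>r > r0\<close> assms(3) by (auto simp: s_def)
    have "H r \<le> B / s" using mono[OF \<open>r > r0\<close> s(2)] up[OF s(1)] by linarith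
    then have "s \<le> B / H r" using neg s(3) by (simp add: field_simps)
    then show False using s(4) by simp
  qed
  then have "E r \<le> 0" by (simp add: H_def mult_le_0_iff)
  then have "r * S r \<le> 0" using lower[OF \<open>r > r0\<close>] by linarith
  then have "S r \<le> 0" using \<open>r > r0\<close> assms(3) by (simp add: mult_le_0_iff)
  then have "k\<^sup>2 * (a r)\<^sup>2 \<le> 0" unfolding S_def using zero_le_power2[of "a' r"] by linarith
  then show "a r = 0" using \<open>k > 0\<close> by (simp add: mult_le_0_iff)
qed

section \<open>Angular Fourier modes in polar coordinates\<close>

definition circle_point :: "real \<Rightarrow> real^2" where
  "circle_point \<theta> = vector [cos \<theta>, sin \<theta>]"

lemma circle_point_nth [simp]: "circle_point \<theta> $ 1 = cos \<theta>" "circle_point \<theta> $ 2 = sin \<theta>"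
  by (simp_all add: circle_point_def vector_2)

lemma norm_circle_point [simp]: "norm (circle_point \<theta>) = 1"
  using power2_norm_eq_nth[of "circle_point \<theta>"] by (simp add: power2_eq_1_iff) (smt (verit) norm_ge_zero)

lemma circle_point_eq: "circle_point \<theta> = cos \<theta> *\<^sub>R axis 1 1 + sin \<theta> *\<^sub>R axis 2 1"
  by (simp add: vec_eq_iff forall_2 axis_def)

lemma circle_point_2pi [simp]: "circle_point (2 * pi) = circle_point 0"
  by (simp add: circle_point_def)

lemma continuous_on_circle_point:
  fixes S :: "'a::t2_space set"
  shows "continuous_on S f \<Longrightarrow> continuous_on S (\<lambda>x. circle_point (f x))"
  unfolding circle_point_eq by (auto intro!: continuous_intros)

lemma polar_decomposition: "\<exists>\<theta>\<in>{0..2*pi}. x = norm x *\<^sub>R circle_point \<theta>" for x :: "real^2"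
proof (cases "x = 0")
  case False
  have "(x $ 1 / norm x)\<^sup>2 + (x $ 2 / norm x)\<^sup>2 = 1"
    unfolding power_divide add_divide_distrib[symmetric] power2_norm_eq_nth[symmetric] using False by simp
  then obtain t where t: "0 \<le> t" "t < 2 * pi" "x $ 1 / norm x = cos t" "x $ 2 / norm x = sin t"
    by (rule sincos_total_2pi)
  have "norm x * cos t = x $ 1" "norm x * sin t = x $ 2"
    using False unfolding t(3,4)[symmetric] by simp_all
  then have "x = norm x *\<^sub>R circle_point t"
    by (simp add: vec_eq_iff forall_2)
  then show ?thesis using t(1,2) by (intro bexI[of _ t]) simp_all
next
  case True
  then show ?thesis by (intro bexI[of _ 0]) simp_all
qed

lemma deriv_radial:
  assumes "smooth_on UNIV v"
  shows "((\<lambda>r. v (r *\<^sub>R circle_point \<theta>)) has_real_derivative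
    cos \<theta> * partial_deriv 1 v (r *\<^sub>R circle_point \<theta>) + sin \<theta> * partial_deriv 2 v (r *\<^sub>R circle_point \<theta>)) (at r)"
proof -
  have 1: "((\<lambda>r. r *\<^sub>R circle_point \<theta>) has_derivative (\<lambda>h. h *\<^sub>R circle_point \<theta>)) (at r)"
    by (auto intro!: derivative_eq_intros)
  show ?thesis
    by (rule has_derivative_imp_has_field_derivative[OF has_derivative_compose[OF 1
          has_derivative_partials[OF smooth_on_imp_differentiable[OF assms UNIV_I]]]])
       (simp add: algebra_simps)
qed

lemma deriv_angular:
  assumes "smooth_on UNIV v"
  shows "((\<lambda>\<theta>. v (r *\<^sub>R circle_point \<theta>)) has_real_derivative
    - (r * sin \<theta>) * partial_deriv 1 v (r *\<^sub>R circle_point \<theta>)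
    + r * cos \<theta> * partial_deriv 2 v (r *\<^sub>R circle_point \<theta>)) (at \<theta>)"
proof -
  have "(circle_point has_vector_derivative (- sin \<theta>) *\<^sub>R axis 1 1 + cos \<theta> *\<^sub>R axis 2 1) (at \<theta>)"
    unfolding circle_point_eq[abs_def]
    by (auto intro!: derivative_eq_intros simp: has_vector_derivative_def scaleR_diff_right)
  then have 1: "((\<lambda>\<theta>. r *\<^sub>R circle_point \<theta>) has_derivative
      (\<lambda>h. r *\<^sub>R (h *\<^sub>R ((- sin \<theta>) *\<^sub>R axis 1 1 + cos \<theta> *\<^sub>R axis 2 1)))) (at \<theta>)"
    unfolding has_vector_derivative_def by (rule has_derivative_scaleR_right)
  show ?thesis
    by (rule has_derivative_imp_has_field_derivative[OF has_derivative_compose[OF 1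
          has_derivative_partials[OF smooth_on_imp_differentiable[OF assms UNIV_I]]]])
       (simp add: algebra_simps axis_def)
qed

lemma continuous_on_polar:
  assumes "smooth_on UNIV v"
  shows "continuous_on S (\<lambda>p. v (fst p *\<^sub>R circle_point (snd p)))"
    "continuous_on T (\<lambda>\<theta>. v (r *\<^sub>R circle_point \<theta>))"
proof -
  have c: "continuous_on UNIV v" by (rule smooth_on_imp_continuous_on[OF assms])
  show "continuous_on S (\<lambda>p. v (fst p *\<^sub>R circle_point (snd p)))"
    by (rule continuous_on_compose2[OF c]) (auto intro!: continuous_intros continuous_on_circle_point)
  show "continuous_on T (\<lambda>\<theta>. v (r *\<^sub>R circle_point \<theta>))"
    by (rule continuous_on_compose2[OF c]) (auto intro!: continuous_intros continuous_on_circle_point)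
qed

text \<open>As a function of r the mode solves Bessel's equation, with m the square of the angular
  frequency. The decay of u and of its gradient passes to the mode and its derivative, so
  \<open>bessel_decay_imp_zero\<close> applies.\<close>

lemma angular_mode_zero:
  fixes T T' :: "real \<Rightarrow> real"
  assumes u: "smooth_on UNIV u" and "k > 0" "R \<ge> 1" "R \<ge> 1 / k"
    and helm: "\<And>x. norm x > R \<Longrightarrow> laplacian u x = - (k\<^sup>2 * u x)"
    and decay: "\<And>x. norm x > R \<Longrightarrow> \<bar>u x\<bar> \<le> C / norm x" "\<And>i x. norm x > R \<Longrightarrow> \<bar>partial_deriv i u x\<bar> \<le> C / norm x"
    and T: "\<And>\<theta>. (T has_real_derivative T' \<theta>) (at \<theta>)" "\<And>\<theta>. (T' has_real_derivative - m * T \<theta>) (at \<theta>)"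
      "T (2 * pi) = T 0" "T' (2 * pi) = T' 0" "\<And>\<theta>. \<bar>T \<theta>\<bar> \<le> 1" "m \<ge> 0"
    and "r > R"
  shows "integral {0..2*pi} (\<lambda>\<theta>. u (r *\<^sub>R circle_point \<theta>) * T \<theta>) = 0"
proof -
  define I where "I = (\<lambda>v r. integral {0..2*pi} (\<lambda>\<theta>. v (r *\<^sub>R circle_point \<theta>) * T \<theta>))"
  define D where "D = (\<lambda>v r \<theta>. cos \<theta> * partial_deriv 1 v (r *\<^sub>R circle_point \<theta>) + sin \<theta> * partial_deriv 2 v (r *\<^sub>R circle_point \<theta>))"
  define a where "a = (\<lambda>r. integral {0..2*pi} (\<lambda>\<theta>. u (r *\<^sub>R circle_point \<theta>) * T \<theta>))"
  define a' where "a' = (\<lambda>r. integral {0..2*pi} (\<lambda>\<theta>. D u r \<theta> * T \<theta>))"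
  have D_app: "D v r \<theta> = cos \<theta> * partial_deriv 1 v (r *\<^sub>R circle_point \<theta>)
      + sin \<theta> * partial_deriv 2 v (r *\<^sub>R circle_point \<theta>)" for v r \<theta>
    by (simp add: D_def)
  define D2 where "D2 = (\<lambda>r \<theta>. cos \<theta> * D (partial_deriv 1 u) r \<theta> + sin \<theta> * D (partial_deriv 2 u) r \<theta>)"
  define a'' where "a'' = (\<lambda>r. integral {0..2*pi} (\<lambda>\<theta>. D2 r \<theta> * T \<theta>))"
  have du: "smooth_on UNIV (partial_deriv i u)" "smooth_on UNIV (partial_deriv i (partial_deriv j u))" for i j
    by (intro smooth_on_partial_deriv u)+
  have Tc: "continuous_on S T" "continuous_on S T'" for S
    using T(1,2) by (meson DERIV_continuous continuous_at_imp_continuous_on)+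
  have Tc2: "continuous_on S (\<lambda>p. T (snd p))" for S :: "(real \<times> real) set"
    by (rule continuous_on_compose2[OF Tc(1)[of UNIV]]) (auto intro!: continuous_intros)
  have dD: "((\<lambda>r. v (r *\<^sub>R circle_point \<theta>)) has_real_derivative D v r \<theta>) (at r)" if "smooth_on UNIV v" for v r \<theta>
    unfolding D_def by (rule deriv_radial[OF that])
  have Dc: "continuous_on S (\<lambda>p. D v (fst p) (snd p))" if "smooth_on UNIV v" for v and S :: "(real \<times> real) set"
    unfolding D_def by (intro continuous_intros continuous_on_polar(1) smooth_on_partial_deriv that)
  have Dc1: "continuous_on S (D v r)" if "smooth_on UNIV v" for v r S
    unfolding D_def[abs_def] by (intro continuous_intros continuous_on_polar(2) smooth_on_partial_deriv that)
  have D2c: "continuous_on S (\<lambda>p. D2 (fst p) (snd p))" for S :: "(real \<times> real) set"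
    unfolding D2_def by (intro continuous_intros Dc du)
  have D2c1: "continuous_on S (D2 r)" for r S
    unfolding D2_def[abs_def] by (intro continuous_intros Dc1 du)
  have da: "(a has_real_derivative a' r) (at r)" for r
  proof -
    have "((\<lambda>r. integral (cbox 0 (2*pi)) (\<lambda>\<theta>. u (r *\<^sub>R circle_point \<theta>) * T \<theta>)) has_field_derivative
        integral (cbox 0 (2*pi)) (\<lambda>\<theta>. D u r \<theta> * T \<theta>)) (at r within UNIV)"
    proof (rule leibniz_rule_field_derivative)
      show "((\<lambda>r. u (r *\<^sub>R circle_point \<theta>) * T \<theta>) has_real_derivative D u x \<theta> * T \<theta>) (at x within UNIV)" for x \<theta>
        using DERIV_cmult_right[OF dD[OF u]] .
      show "(\<lambda>\<theta>. u (x *\<^sub>R circle_point \<theta>) * T \<theta>) integrable_on cbox 0 (2 * pi)" for x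
        by (intro integrable_continuous continuous_intros continuous_on_polar(2)[OF u] Tc)
      show "continuous_on (UNIV \<times> cbox 0 (2 * pi)) (\<lambda>(x, \<theta>). D u x \<theta> * T \<theta>)"
        unfolding case_prod_beta by (intro continuous_intros Dc[OF u] Tc2)
    qed auto
    then show ?thesis by (simp add: a_def a'_def)
  qed
  have da': "(a' has_real_derivative a'' r) (at r)" for r
  proof -
    have "((\<lambda>r. integral (cbox 0 (2*pi)) (\<lambda>\<theta>. D u r \<theta> * T \<theta>)) has_field_derivative
        integral (cbox 0 (2*pi)) (\<lambda>\<theta>. D2 r \<theta> * T \<theta>)) (at r within UNIV)"
    proof (rule leibniz_rule_field_derivative)
      show "((\<lambda>r. D u r \<theta> * T \<theta>) has_real_derivative D2 x \<theta> * T \<theta>) (at x within UNIV)" for x \<theta>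
        unfolding D2_def D_app[of u]
        by (intro DERIV_cmult_right DERIV_add DERIV_cmult dD du)
      show "(\<lambda>\<theta>. D u x \<theta> * T \<theta>) integrable_on cbox 0 (2 * pi)" for x
        by (intro integrable_continuous continuous_intros Dc1[OF u] Tc)
      show "continuous_on (UNIV \<times> cbox 0 (2 * pi)) (\<lambda>(x, \<theta>). D2 x \<theta> * T \<theta>)"
        unfolding case_prod_beta by (intro continuous_intros D2c Tc2)
    qed auto
    then show ?thesis by (simp add: a'_def a''_def)
  qed
  have ode: "a'' r = - a' r / r + m * a r / r\<^sup>2 - k\<^sup>2 * a r" if r: "r > R" for r
  proof -
    have r0: "r > 0" using r assms(3) by linarith
    let ?p = "\<lambda>\<theta>. r *\<^sub>R circle_point \<theta>"
    define W where "W = (\<lambda>\<theta>. - (r * sin \<theta>) * partial_deriv 1 u (?p \<theta>) + r * cos \<theta> * partial_deriv 2 u (?p \<theta>))"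
    \<comment> \<open>The second angular derivative of u, read off from the polar form u_rr + u_r /
      r + u_\<theta>\<theta> / r^2 of \<Delta>u = - k^2 u.\<close>
    define W2 where "W2 = (\<lambda>\<theta>. - (r\<^sup>2) * (k\<^sup>2 * u (?p \<theta>) + D2 r \<theta>) - r * D u r \<theta>)"
    have dW: "(W has_real_derivative W2 \<theta>) (at \<theta>)" for \<theta>
    proof -
      let ?u11 = "partial_deriv 1 (partial_deriv 1 u) (?p \<theta>)" and ?u22 = "partial_deriv 2 (partial_deriv 2 u) (?p \<theta>)"
      let ?u12 = "partial_deriv 1 (partial_deriv 2 u) (?p \<theta>)" and ?u21 = "partial_deriv 2 (partial_deriv 1 u) (?p \<theta>)"
      have c: "?u21 = ?u12" by (rule partial_deriv_commute[OF u])
      have l: "?u11 + ?u22 = - (k\<^sup>2 * u (?p \<theta>))" using helm[of "?p \<theta>"] r r0 by (simp add: laplacian_def)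
      let ?e = "(- (r * cos \<theta>) * partial_deriv 1 u (?p \<theta>) + - (r * sin \<theta>) * (- (r * sin \<theta>) * ?u11 + r * cos \<theta> * ?u21))
         + (- (r * sin \<theta>) * partial_deriv 2 u (?p \<theta>) + r * cos \<theta> * (- (r * sin \<theta>) * ?u12 + r * cos \<theta> * ?u22))"
      have "(W has_real_derivative ?e) (at \<theta>)"
        unfolding W_def
        by (rule derivative_eq_intros deriv_angular du refl)+ (simp add: algebra_simps)
      moreover have "?e = W2 \<theta>"
      proof -
        have cs: "(cos \<theta>)\<^sup>2 = 1 - (sin \<theta>)\<^sup>2" using sin_cos_squared_add[of \<theta>] by linarith
        have k2: "k\<^sup>2 * u (?p \<theta>) = - ?u11 - ?u22" using l by linarith
        show ?thesis
          unfolding W2_def k2 D2_def D_app c using cs by algebra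
      qed
      ultimately show ?thesis by (simp only:)
    qed
    have dU: "((\<lambda>\<theta>. u (?p \<theta>)) has_real_derivative W \<theta>) (at \<theta>)" for \<theta>
      unfolding W_def by (rule deriv_angular[OF u])
    \<comment> \<open>An antiderivative of Wronskian type: its increment over the full circle is 0
      by periodicity, which amounts to two integrations by parts at once.\<close>
    have "((\<lambda>\<theta>. W \<theta> * T \<theta> - u (?p \<theta>) * T' \<theta>) has_real_derivative (W2 \<theta> * T \<theta> + m * (u (?p \<theta>) * T \<theta>))) (at \<theta>)" for \<theta>
      by (rule derivative_eq_intros dW dU T(1,2) refl)+ (simp add: algebra_simps)
    then have "((\<lambda>\<theta>. W2 \<theta> * T \<theta> + m * (u (?p \<theta>) * T \<theta>)) has_integral
        (W (2*pi) * T (2*pi) - u (?p (2*pi)) * T' (2*pi)) - (W 0 * T 0 - u (?p 0) * T' 0)) {0..2*pi}"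
      by (intro fundamental_theorem_of_calculus)
         (auto simp: has_real_derivative_iff_has_vector_derivative[symmetric] intro: has_field_derivative_at_within)
    then have int0: "integral {0..2*pi} (\<lambda>\<theta>. W2 \<theta> * T \<theta> + m * (u (?p \<theta>) * T \<theta>)) = 0"
      using T(3,4) by (simp add: W_def integral_unique)
    have i1: "(\<lambda>\<theta>. u (?p \<theta>) * T \<theta>) integrable_on {0..2*pi}"
      by (intro integrable_continuous_real continuous_intros continuous_on_polar(2)[OF u] Tc)
    have i2: "(\<lambda>\<theta>. D u r \<theta> * T \<theta>) integrable_on {0..2*pi}"
      by (intro integrable_continuous_real continuous_intros Dc1[OF u] Tc)
    have i3: "(\<lambda>\<theta>. D2 r \<theta> * T \<theta>) integrable_on {0..2*pi}"
      by (intro integrable_continuous_real continuous_intros D2c1 Tc)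
    have "W2 \<theta> * T \<theta> + m * (u (?p \<theta>) * T \<theta>) = (m - r\<^sup>2 * k\<^sup>2) * (u (?p \<theta>) * T \<theta>)
        - r\<^sup>2 * (D2 r \<theta> * T \<theta>) - r * (D u r \<theta> * T \<theta>)" for \<theta>
      by (simp add: W2_def algebra_simps)
    then have "0 = integral {0..2*pi} (\<lambda>\<theta>. (m - r\<^sup>2 * k\<^sup>2) * (u (?p \<theta>) * T \<theta>)
        - r\<^sup>2 * (D2 r \<theta> * T \<theta>) - r * (D u r \<theta> * T \<theta>))"
      using int0 by simp
    also have "\<dots> = integral {0..2*pi} (\<lambda>\<theta>. (m - r\<^sup>2 * k\<^sup>2) * (u (?p \<theta>) * T \<theta>) - r\<^sup>2 * (D2 r \<theta> * T \<theta>))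
        - integral {0..2*pi} (\<lambda>\<theta>. r * (D u r \<theta> * T \<theta>))"
      by (intro integral_diff integrable_diff integrable_on_mult_right i1 i2 i3)
    also have "integral {0..2*pi} (\<lambda>\<theta>. (m - r\<^sup>2 * k\<^sup>2) * (u (?p \<theta>) * T \<theta>) - r\<^sup>2 * (D2 r \<theta> * T \<theta>))
        = integral {0..2*pi} (\<lambda>\<theta>. (m - r\<^sup>2 * k\<^sup>2) * (u (?p \<theta>) * T \<theta>)) - integral {0..2*pi} (\<lambda>\<theta>. r\<^sup>2 * (D2 r \<theta> * T \<theta>))"
      by (intro integral_diff integrable_on_mult_right i1 i3)
    finally have "(m - r\<^sup>2 * k\<^sup>2) * a r - r\<^sup>2 * a'' r - r * a' r = 0"
      by (simp add: a_def a'_def a''_def)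
    then show ?thesis using r0 by (simp add: field_simps power2_eq_square)
  qed
  have bnd: "\<bar>integral {0..2*pi} f\<bar> \<le> 2 * pi * (2 * C / r)"
    if "continuous_on {0..2*pi} f" "\<And>\<theta>. \<bar>f \<theta>\<bar> \<le> 2 * C / r" for f r
    using integral_bound[of 0 "2 * pi" f "2 * C / r"] that by (simp add: mult.commute)
  have C0: "C / r \<ge> 0" if "r > R" for r
    using decay(1)[of "r *\<^sub>R circle_point 0"] that assms(3) by simp
  have trig_le: "\<bar>f \<theta> * T \<theta>\<bar> \<le> B" if "\<bar>f \<theta>\<bar> \<le> B" for f \<theta> B
    using mult_mono[OF that T(5)[of \<theta>]] that by (simp add: abs_mult)
  have b1: "\<bar>a r\<bar> \<le> (4 * pi * C) / r" if r: "r > R" for r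
  proof -
    have n: "norm (r *\<^sub>R circle_point \<theta>) = r" for \<theta> using r assms(3) by simp
    have "\<bar>u (r *\<^sub>R circle_point \<theta>) * T \<theta>\<bar> \<le> 2 * C / r" for \<theta>
    proof (rule trig_le)
      show "\<bar>u (r *\<^sub>R circle_point \<theta>)\<bar> \<le> 2 * C / r"
        using decay(1)[of "r *\<^sub>R circle_point \<theta>"] C0[OF r] r unfolding n by simp
    qed
    then show ?thesis
      unfolding a_def using bnd[of "\<lambda>\<theta>. u (r *\<^sub>R circle_point \<theta>) * T \<theta>" r]
      by (simp add: continuous_on_mult continuous_on_polar(2)[OF u] Tc)
  qed
  have b2: "\<bar>a' r\<bar> \<le> (4 * pi * C) / r" if r: "r > R" for r
  proof -
    have n: "norm (r *\<^sub>R circle_point \<theta>) = r" for \<theta> using r assms(3) by simp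
    have "\<bar>D u r \<theta> * T \<theta>\<bar> \<le> 2 * C / r" for \<theta>
    proof (rule trig_le)
      have "\<bar>cos \<theta> * partial_deriv 1 u (r *\<^sub>R circle_point \<theta>)\<bar> \<le> 1 * (C / r)"
        "\<bar>sin \<theta> * partial_deriv 2 u (r *\<^sub>R circle_point \<theta>)\<bar> \<le> 1 * (C / r)"
        using decay(2)[of "r *\<^sub>R circle_point \<theta>"] C0[OF r] r unfolding abs_mult n by (intro mult_mono; simp)+
      then show "\<bar>D u r \<theta>\<bar> \<le> 2 * C / r" unfolding D_def by simp
    qed
    then show ?thesis
      unfolding a'_def using bnd[of "\<lambda>\<theta>. D u r \<theta> * T \<theta>" r]
      by (simp add: continuous_on_mult Dc1[OF u] Tc)
  qed
  have "a r = 0"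
    by (rule bessel_decay_imp_zero[OF \<open>k > 0\<close> \<open>m \<ge> 0\<close> \<open>R \<ge> 1\<close> \<open>R \<ge> 1 / k\<close> da da' ode b1 b2 \<open>r > R\<close>])
  then show ?thesis by (simp add: a_def)
qed

text \<open>The orthogonality to all trigonometric functions is inherited by products with polynomials
  in \<open>cos\<close> and \<open>sin\<close>; this formulation avoids expanding such products.\<close>

definition trig_orthogonal :: "(real \<Rightarrow> real) \<Rightarrow> bool" where
  "trig_orthogonal f \<longleftrightarrow> continuous_on {0..2*pi} f \<and>
     (\<forall>n::int. integral {0..2*pi} (\<lambda>\<theta>. f \<theta> * cos (of_int n * \<theta>)) = 0 \<and>
       integral {0..2*pi} (\<lambda>\<theta>. f \<theta> * sin (of_int n * \<theta>)) = 0)"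

lemma trig_orthogonal_add:
  assumes "trig_orthogonal f" "trig_orthogonal g"
  shows "trig_orthogonal (\<lambda>\<theta>. f \<theta> + g \<theta>)"
proof -
  have "(\<lambda>\<theta>. f \<theta> * h \<theta>) integrable_on {0..2*pi}" "(\<lambda>\<theta>. g \<theta> * h \<theta>) integrable_on {0..2*pi}"
    if "continuous_on {0..2*pi} h" for h
    using assms that by (auto simp: trig_orthogonal_def intro!: integrable_continuous_real continuous_intros)
  then have "integral {0..2*pi} (\<lambda>\<theta>. (f \<theta> + g \<theta>) * h \<theta>) = integral {0..2*pi} (\<lambda>\<theta>. f \<theta> * h \<theta>) + integral {0..2*pi} (\<lambda>\<theta>. g \<theta> * h \<theta>)"
    if "continuous_on {0..2*pi} h" for h
    using that by (simp add: distrib_right integral_add)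
  moreover have "continuous_on {0..2*pi} (\<lambda>\<theta>. cos (of_int n * \<theta>))" "continuous_on {0..2*pi} (\<lambda>\<theta>. sin (of_int n * \<theta>))" for n :: int
    by (intro continuous_intros)+
  ultimately show ?thesis
    using assms by (simp add: trig_orthogonal_def continuous_on_add)
qed

lemma trig_orthogonal_cmult: "trig_orthogonal f \<Longrightarrow> trig_orthogonal (\<lambda>\<theta>. c * f \<theta>)"
  by (simp add: trig_orthogonal_def continuous_on_mult_left mult.assoc)

text \<open>Product-to-sum formulas. Frequencies range over all integers, so n + 1 and n - 1 stay
  admissible and n = 0 is no special case.\<close>

lemma trig_orthogonal_cos_sin:
  assumes f: "trig_orthogonal f"
  shows "trig_orthogonal (\<lambda>\<theta>. cos \<theta> * f \<theta>)" "trig_orthogonal (\<lambda>\<theta>. sin \<theta> * f \<theta>)"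
proof -
  have fc: "continuous_on {0..2*pi} f" using f by (simp add: trig_orthogonal_def)
  have c0: "((\<lambda>\<theta>. f \<theta> * cos (of_int n * \<theta>)) has_integral 0) {0..2*pi}"
    and s0: "((\<lambda>\<theta>. f \<theta> * sin (of_int n * \<theta>)) has_integral 0) {0..2*pi}" for n :: int
    using f unfolding trig_orthogonal_def
    by (auto simp: has_integral_iff intro!: integrable_continuous_real continuous_intros)
  have comb: "integral {0..2*pi} h = 0"
    if "\<And>\<theta>. h \<theta> = (g1 \<theta> + g2 \<theta>) / 2" "(g1 has_integral 0) {0..2*pi}" "(g2 has_integral 0) {0..2*pi}" for h g1 g2 :: "real \<Rightarrow> real"
  proof -
    have "((\<lambda>\<theta>. (g1 \<theta> + g2 \<theta>) / 2) has_integral (0 + 0) / 2) {0..2*pi}"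
      by (intro has_integral_divide has_integral_add that)
    moreover have "h = (\<lambda>\<theta>. (g1 \<theta> + g2 \<theta>) / 2)" by (rule ext) (rule that(1))
    ultimately have "(h has_integral (0 + 0) / 2) {0..2*pi}" by (simp only:)
    then show ?thesis by (simp add: integral_unique)
  qed
  have neg: "((\<lambda>\<theta>. - (f \<theta> * cos (of_int n * \<theta>))) has_integral 0) {0..2*pi}"
    "((\<lambda>\<theta>. - (f \<theta> * sin (of_int n * \<theta>))) has_integral 0) {0..2*pi}" for n :: int
    using has_integral_neg[OF c0[of n]] has_integral_neg[OF s0[of n]] by simp_all
  have "integral {0..2*pi} (\<lambda>\<theta>. cos \<theta> * f \<theta> * cos (of_int n * \<theta>)) = 0" for n :: int
    by (rule comb[OF _ c0[of "n + 1"] c0[of "n - 1"]]) (simp add: distrib_right left_diff_distrib cos_add cos_diff algebra_simps)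
  moreover have "integral {0..2*pi} (\<lambda>\<theta>. cos \<theta> * f \<theta> * sin (of_int n * \<theta>)) = 0" for n :: int
    by (rule comb[OF _ s0[of "n + 1"] s0[of "n - 1"]]) (simp add: distrib_right left_diff_distrib sin_add sin_diff algebra_simps)
  moreover have "integral {0..2*pi} (\<lambda>\<theta>. sin \<theta> * f \<theta> * cos (of_int n * \<theta>)) = 0" for n :: int
    by (rule comb[OF _ s0[of "n + 1"] neg(2)[of "n - 1"]]) (simp add: distrib_right left_diff_distrib sin_add sin_diff algebra_simps)
  moreover have "integral {0..2*pi} (\<lambda>\<theta>. sin \<theta> * f \<theta> * sin (of_int n * \<theta>)) = 0" for n :: int
    by (rule comb[OF _ c0[of "n - 1"] neg(1)[of "n + 1"]]) (simp add: distrib_right left_diff_distrib cos_add cos_diff algebra_simps)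
  ultimately show "trig_orthogonal (\<lambda>\<theta>. cos \<theta> * f \<theta>)" "trig_orthogonal (\<lambda>\<theta>. sin \<theta> * f \<theta>)"
    using fc by (auto simp: trig_orthogonal_def intro!: continuous_intros)
qed

lemma trig_orthogonal_polynomial:
  fixes P :: "real^2 \<Rightarrow> real"
  assumes "real_polynomial_function P" "trig_orthogonal f"
  shows "trig_orthogonal (\<lambda>\<theta>. P (circle_point \<theta>) * f \<theta>)"
  using assms
proof (induction P arbitrary: f rule: real_polynomial_function.induct)
  case (linear P)
  then have lin: "linear P" by (simp add: bounded_linear.linear)
  have "P (circle_point \<theta>) * f \<theta> = P (axis 1 1) * (cos \<theta> * f \<theta>) + P (axis 2 1) * (sin \<theta> * f \<theta>)" for \<theta>
    unfolding circle_point_eq using lin by (simp add: linear_add linear_scale algebra_simps)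
  then show ?case
    using linear.prems by (simp add: trig_orthogonal_add trig_orthogonal_cmult trig_orthogonal_cos_sin)
next
  case (const c)
  then show ?case by (simp add: trig_orthogonal_cmult)
next
  case (add P Q)
  then show ?case by (simp add: distrib_right trig_orthogonal_add)
next
  case (mult P Q)
  then show ?case by (simp add: mult.assoc)
qed

text \<open>By Stone-Weierstrass take a polynomial P within e of g on the circle. Orthogonality to P
  makes the integral of g^2 equal to that of (g - P) g, hence at most e times the integral of |g|.
  Continuity turns the zero integral of g^2 into pointwise vanishing.\<close>

lemma trig_complete:
  assumes g: "continuous_on UNIV g" and orth: "trig_orthogonal (\<lambda>\<theta>. g (circle_point \<theta>))"
    and "\<theta> \<in> {0..2*pi}"
  shows "g (circle_point \<theta>) = (0::real)"
proof -
  define f where "f = (\<lambda>\<theta>. g (circle_point \<theta>))"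
  have fc: "continuous_on {0..2*pi} f" using orth by (simp add: trig_orthogonal_def f_def)
  have i2: "(\<lambda>\<theta>. (f \<theta>)\<^sup>2) integrable_on {0..2*pi}" and iabs: "(\<lambda>\<theta>. \<bar>f \<theta>\<bar>) integrable_on {0..2*pi}"
    by (intro integrable_continuous_real continuous_intros fc)+
  have "integral {0..2*pi} (\<lambda>\<theta>. (f \<theta>)\<^sup>2) \<le> e * (integral {0..2*pi} (\<lambda>\<theta>. \<bar>f \<theta>\<bar>) + 1)" if "e > 0" for e
  proof -
    obtain P where P: "real_polynomial_function P" "\<And>x. x \<in> sphere 0 1 \<Longrightarrow> \<bar>g x - P x\<bar> < e"
      by (rule Stone_Weierstrass_real_polynomial_function[of "sphere 0 1" g e])
         (use g \<open>e > 0\<close> in \<open>auto intro: continuous_on_subset\<close>)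
    have Pc: "continuous_on {0..2*pi} (\<lambda>\<theta>. P (circle_point \<theta>))"
      by (rule continuous_on_compose2[OF continuous_on_polymonial_function[OF P(1)[unfolded real_polynomial_function_eq], of UNIV]])
         (auto intro!: continuous_on_circle_point continuous_intros)
    have iP: "(\<lambda>\<theta>. P (circle_point \<theta>) * f \<theta>) integrable_on {0..2*pi}"
      by (intro integrable_continuous_real continuous_intros fc Pc)
    have "integral {0..2*pi} (\<lambda>\<theta>. P (circle_point \<theta>) * f \<theta>) = 0"
      using trig_orthogonal_polynomial[OF P(1) orth] unfolding trig_orthogonal_def f_def
      by (auto dest!: spec[of _ 0])
    then have "integral {0..2*pi} (\<lambda>\<theta>. (f \<theta>)\<^sup>2) = integral {0..2*pi} (\<lambda>\<theta>. (f \<theta>)\<^sup>2 - P (circle_point \<theta>) * f \<theta>)"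
      using integral_diff[OF i2 iP] by simp
    also have "\<dots> \<le> integral {0..2*pi} (\<lambda>\<theta>. e * \<bar>f \<theta>\<bar>)"
    proof (rule integral_le)
      show "(\<lambda>\<theta>. (f \<theta>)\<^sup>2 - P (circle_point \<theta>) * f \<theta>) integrable_on {0..2*pi}"
        by (intro integrable_diff i2 iP)
      show "(\<lambda>\<theta>. e * \<bar>f \<theta>\<bar>) integrable_on {0..2*pi}"
        by (intro integrable_on_mult_right iabs)
      fix \<theta>
      have "(f \<theta>)\<^sup>2 - P (circle_point \<theta>) * f \<theta> = (f \<theta> - P (circle_point \<theta>)) * f \<theta>"
        by (simp add: power2_eq_square algebra_simps)
      also have "\<dots> \<le> \<bar>f \<theta> - P (circle_point \<theta>)\<bar> * \<bar>f \<theta>\<bar>"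
        using abs_ge_self[of "(f \<theta> - P (circle_point \<theta>)) * f \<theta>"] by (simp add: abs_mult)
      also have "\<dots> \<le> e * \<bar>f \<theta>\<bar>"
        using P(2)[of "circle_point \<theta>"] by (intro mult_right_mono) (auto simp: f_def)
      finally show "(f \<theta>)\<^sup>2 - P (circle_point \<theta>) * f \<theta> \<le> e * \<bar>f \<theta>\<bar>" .
    qed
    also have "\<dots> = e * integral {0..2*pi} (\<lambda>\<theta>. \<bar>f \<theta>\<bar>)" by simp
    also have "\<dots> \<le> e * (integral {0..2*pi} (\<lambda>\<theta>. \<bar>f \<theta>\<bar>) + 1)" using \<open>e > 0\<close> by simp
    finally show ?thesis .
  qed
  note le = this
  have J: "integral {0..2*pi} (\<lambda>\<theta>. \<bar>f \<theta>\<bar>) \<ge> 0" by (rule integral_nonneg[OF iabs]) auto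
  have "integral {0..2*pi} (\<lambda>\<theta>. (f \<theta>)\<^sup>2) \<le> 0"
  proof (rule field_le_epsilon)
    fix e :: real assume "e > 0"
    then show "integral {0..2*pi} (\<lambda>\<theta>. (f \<theta>)\<^sup>2) \<le> 0 + e"
      using le[of "e / (integral {0..2*pi} (\<lambda>\<theta>. \<bar>f \<theta>\<bar>) + 1)"] J by simp
  qed
  then have "integral {0..2*pi} (\<lambda>\<theta>. (f \<theta>)\<^sup>2) = 0"
    using integral_nonneg[OF i2] by (intro antisym) auto
  then have "((\<lambda>\<theta>. (f \<theta>)\<^sup>2) has_integral 0) (cbox 0 (2*pi))"
    using i2 by (simp add: has_integral_iff)
  then have "(f \<theta>)\<^sup>2 = 0"
    by (rule has_integral_0_cbox_imp_0[rotated 2]) (use fc \<open>\<theta> \<in> _\<close> pi_gt_zero in \<open>auto intro!: continuous_intros simp: not_le\<close>)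
  then show ?thesis by (simp add: f_def)
qed

text \<open>On each circle beyond R the cosine and sine modes of every integer frequency vanish, so
  completeness of the trigonometric system applies to the restriction of u.\<close>

lemma rellich_smooth:
  assumes u: "smooth_on UNIV u" and "k > 0" "R \<ge> 1" "R \<ge> 1 / k"
    and helm: "\<And>x. norm x > R \<Longrightarrow> laplacian u x = - (k\<^sup>2 * u x)"
    and decay: "\<And>x. norm x > R \<Longrightarrow> \<bar>u x\<bar> \<le> C / norm x" "\<And>i x. norm x > R \<Longrightarrow> \<bar>partial_deriv i u x\<bar> \<le> C / norm x"
    and x: "norm x > R"
  shows "u x = 0"
proof -
  obtain \<theta> where \<theta>: "\<theta> \<in> {0..2*pi}" "x = norm x *\<^sub>R circle_point \<theta>" using polar_decomposition by blast
  define g where "g = (\<lambda>y. u (norm x *\<^sub>R y))"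
  have g: "continuous_on UNIV g"
    unfolding g_def
    by (rule continuous_on_compose2[OF smooth_on_imp_continuous_on[OF u]]) (auto intro!: continuous_intros)
  have "trig_orthogonal (\<lambda>\<theta>. g (circle_point \<theta>))"
    unfolding trig_orthogonal_def
  proof (intro conjI allI)
    show "continuous_on {0..2 * pi} (\<lambda>\<theta>. g (circle_point \<theta>))"
      unfolding g_def by (rule continuous_on_polar(2)[OF u])
    fix n :: int
    have per: "cos (of_int n * (2 * pi)) = (1::real)" "sin (of_int n * (2 * pi)) = (0::real)"
      using cos_int_2pin[of n] sin_int_2pin[of n] by (simp_all add: mult.commute)
    show "integral {0..2 * pi} (\<lambda>\<theta>. g (circle_point \<theta>) * cos (of_int n * \<theta>)) = 0"
      unfolding g_def
      by (rule angular_mode_zero[OF u assms(2-4) helm decay, where T' = "\<lambda>\<theta>. - (of_int n * sin (of_int n * \<theta>))" and m = "(of_int n)\<^sup>2"])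
         (auto intro!: derivative_eq_intros simp: per x power2_eq_square)
    show "integral {0..2 * pi} (\<lambda>\<theta>. g (circle_point \<theta>) * sin (of_int n * \<theta>)) = 0"
      unfolding g_def
      by (rule angular_mode_zero[OF u assms(2-4) helm decay, where T' = "\<lambda>\<theta>. of_int n * cos (of_int n * \<theta>)" and m = "(of_int n)\<^sup>2"])
         (auto intro!: derivative_eq_intros simp: per x power2_eq_square)
  qed
  then have "g (circle_point \<theta>) = 0" by (rule trig_complete[OF g _ \<theta>(1)])
  then show ?thesis using \<theta>(2) by (simp add: g_def)
qed

text \<open>Far out a mollification of w is a smooth Helmholtz solution. Its derivatives are
  mollifications with differentiated kernels, so they inherit O(1 / |x|) from the bound on w alone.
  All mollifications of width at most 1 vanish beyond one common radius, hence so does their limit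
  in the square mean.\<close>

theorem rellich:
  assumes w: "locally_L2 w" and F: "locally_L2 F" "weak_laplacian w F" and "k > 0"
    and helm: "AE x in lborel. norm x > R \<longrightarrow> F x = - (k\<^sup>2 * w x)"
    and decay: "AE x in lborel. norm x > R \<longrightarrow> \<bar>w x\<bar> \<le> C / norm x"
  obtains R' where "AE x in lborel. norm x > R' \<longrightarrow> w x = 0"
proof -
  \<comment> \<open>R + 1 keeps points at distance 1 in the region where equation and decay hold, 2
    gives |x| - 1 \<ge> |x| / 2, and 1 / k is the threshold of the Bessel argument.\<close>
  define R1 where "R1 = max (max (R + 1) 2) (1 / k)"
  have R1: "R1 \<ge> R + 1" "R1 \<ge> 2" "R1 \<ge> 1 / k" by (auto simp: R1_def)
  have [measurable]: "w \<in> borel_measurable borel" "F \<in> borel_measurable borel" using w F by auto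
  have li: "locally_integrable w" "locally_integrable F" by (intro locally_L2_imp_locally_integrable w F)+
  have zero: "mollify w \<eta> x = 0" if \<eta>: "is_mollifier \<eta> \<delta>" "\<delta> \<le> 1" and x: "norm x > R1" for \<eta> \<delta> x
  proof -
    have \<eta>1: "is_mollifier \<eta> 1" using is_mollifier_mono[OF \<eta>] .
    then have t: "test_function \<eta>" "\<And>z. \<eta> z \<noteq> 0 \<Longrightarrow> norm z < 1" by (auto simp: is_mollifier_def)
    have dz: "norm z \<le> 1" if "partial_deriv i \<eta> z \<noteq> 0" for i z
    proof -
      have "closure {x. \<eta> x \<noteq> 0} \<subseteq> cball 0 1"
        by (rule closure_minimal) (use t(2) in \<open>auto simp: less_imp_le\<close>)
      then show ?thesis using partial_deriv_nonzero_subset[of i \<eta>] that by (auto simp: subset_iff)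
    qed
    have bound: "\<exists>K. \<forall>x. norm x > R1 \<longrightarrow> \<bar>mollify w \<zeta> x\<bar> \<le> K / norm x"
      if \<zeta>: "test_function \<zeta>" "\<And>z. \<zeta> z \<noteq> 0 \<Longrightarrow> norm z \<le> 1" for \<zeta>
    proof -
      have \<zeta>i: "integrable lborel (\<lambda>y. \<bar>\<zeta> (x - y)\<bar>)" for x
        using test_function_integrable[OF test_function_reflect[OF \<zeta>(1)]] by (rule integrable_abs)
      define J where "J = (LBINT y. \<bar>\<zeta> y\<bar>)"
      have [measurable]: "\<zeta> \<in> borel_measurable borel" using \<zeta>(1) by auto
      have J: "(LBINT y. \<bar>\<zeta> (x - y)\<bar>) = J" for x
        using lborel_integral_affine[of "\<lambda>y. \<bar>\<zeta> y\<bar>" "-1" x] by (simp add: J_def)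
      have "\<bar>mollify w \<zeta> x\<bar> \<le> (2 * \<bar>C\<bar> * J) / norm x" if x: "norm x > R1" for x
      proof -
        have iw: "integrable lborel (\<lambda>y. w y * \<zeta> (x - y))"
          by (intro integrable_mult_test_function li test_function_reflect \<zeta>)
        have "\<bar>mollify w \<zeta> x\<bar> \<le> (LBINT y. \<bar>w y * \<zeta> (x - y)\<bar>)"
          unfolding mollify_def by (rule integral_abs_bound)
        also have "\<dots> \<le> (LBINT y. (2 * \<bar>C\<bar> / norm x) * \<bar>\<zeta> (x - y)\<bar>)"
        proof (rule integral_mono_AE)
          show "AE y in lborel. \<bar>w y * \<zeta> (x - y)\<bar> \<le> (2 * \<bar>C\<bar> / norm x) * \<bar>\<zeta> (x - y)\<bar>"
            using decay
          proof eventually_elim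
            case (elim y)
            show ?case
            proof (cases "\<zeta> (x - y) = 0")
              case False
              then have "norm (x - y) \<le> 1" by (rule \<zeta>(2))
              then have y: "norm y \<ge> norm x - 1" using norm_triangle_ineq2[of x y] by linarith
              then have y2: "norm y > R" "norm y \<ge> norm x / 2" "norm x > 0" using x R1 by linarith+
              have "C / norm y \<le> \<bar>C\<bar> / (norm x / 2)"
                using y2 by (intro frac_le) auto
              also have "\<dots> = 2 * \<bar>C\<bar> / norm x" by simp
              finally have "\<bar>w y\<bar> \<le> 2 * \<bar>C\<bar> / norm x" using elim y2(1) by linarith
              then show ?thesis unfolding abs_mult by (intro mult_right_mono) auto
            qed simp
          qed
        qed (use iw \<zeta>i in auto)
        also have "\<dots> = (2 * \<bar>C\<bar> * J) / norm x" by (simp add: J)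
        finally show ?thesis .
      qed
      then show ?thesis by blast
    qed
    obtain K0 where K0: "\<And>x. norm x > R1 \<Longrightarrow> \<bar>mollify w \<eta> x\<bar> \<le> K0 / norm x"
      using bound[OF t(1)] t(2) by (meson less_imp_le)
    obtain K1 where K1: "\<And>x. norm x > R1 \<Longrightarrow> \<bar>mollify w (partial_deriv 1 \<eta>) x\<bar> \<le> K1 / norm x"
      using bound[of "partial_deriv 1 \<eta>", OF test_function_partial_deriv[OF t(1)] dz[of 1]] by blast
    obtain K2 where K2: "\<And>x. norm x > R1 \<Longrightarrow> \<bar>mollify w (partial_deriv 2 \<eta>) x\<bar> \<le> K2 / norm x"
      using bound[of "partial_deriv 2 \<eta>", OF test_function_partial_deriv[OF t(1)] dz[of 2]] by blast
    define K where "K = max K0 (max K1 K2)"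
    have KK: "K0 / norm x \<le> K / norm x" "K1 / norm x \<le> K / norm x" "K2 / norm x \<le> K / norm x" for x :: "real^2"
      by (auto simp: K_def intro!: divide_right_mono)
    show ?thesis
    proof (rule rellich_smooth[OF smooth_on_mollify[OF li(1) t(1)] \<open>k > 0\<close> _ R1(3) _ _ _ x])
      show "\<bar>mollify w \<eta> x\<bar> \<le> K / norm x" if "norm x > R1" for x
        using K0[OF that] KK[of x] by linarith
      show "\<bar>partial_deriv i (mollify w \<eta>) x\<bar> \<le> K / norm x" if "norm x > R1" for i x
        unfolding partial_deriv_mollify[OF li(1) t(1)]
        using K1[OF that] K2[OF that] KK[of x] exhaust_2[of i] by auto
      show "laplacian (mollify w \<eta>) x = - (k\<^sup>2 * mollify w \<eta> x)" if x: "norm x > R1" for x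
      proof -
        have "laplacian (mollify w \<eta>) x = mollify w (laplacian \<eta>) x"
          by (rule laplacian_mollify[OF li(1) t(1)])
        also have "\<dots> = mollify F \<eta> x"
          by (rule mollify_weak_laplacian) (use F(2) t(1) in \<open>auto simp: weak_laplacian_def\<close>)
        also have "\<dots> = mollify (\<lambda>y. - (k\<^sup>2 * w y)) \<eta> x"
        proof (rule mollify_cong[OF \<eta>1])
          show "AE y in lborel. norm (x - y) < 1 \<longrightarrow> F y = - (k\<^sup>2 * w y)"
            using helm
          proof eventually_elim
            case (elim y)
            then show ?case using x R1(1) norm_triangle_ineq2[of x y] by auto
          qed
        qed auto
        also have "\<dots> = - (k\<^sup>2 * mollify w \<eta> x)" by (simp add: mollify_def mult.assoc)
        finally show ?thesis .
      qed
    qed (use R1 in auto)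
  qed
  have "AE x in lborel. x \<in> cball 0 n - cball 0 R1 \<longrightarrow> w x = 0" for n
  proof (rule AE_zero_of_integral_power2_le_0[OF w, of _ n])
    have i: "integrable lborel (\<lambda>x. indicator (cball 0 n - cball 0 R1) x * (w x)\<^sup>2)"
      by (rule locally_L2_set_integrable[OF w]) auto
    show "(LBINT x. indicator (cball 0 n - cball 0 R1) x * (w x)\<^sup>2) \<le> 0"
    proof (rule field_le_epsilon)
      fix e :: real assume "e > 0"
      obtain d where d: "d > 0" "d \<le> 1"
        "\<And>\<eta>. is_mollifier \<eta> d \<Longrightarrow> (LBINT x. indicator (cball 0 n) x * (mollify w \<eta> x - w x)\<^sup>2) < e"
        "\<And>\<eta>. is_mollifier \<eta> d \<Longrightarrow> integrable lborel (\<lambda>x. indicator (cball 0 n) x * (mollify w \<eta> x - w x)\<^sup>2)"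
        by (rule mollify_locally_L2_approx[OF w \<open>e > 0\<close>, of n], rule that; blast)
      obtain \<eta> where \<eta>: "is_mollifier \<eta> d" using is_mollifier_exists[OF d(1)] by blast
      have "(LBINT x. indicator (cball 0 n - cball 0 R1) x * (w x)\<^sup>2)
          \<le> (LBINT x. indicator (cball 0 n) x * (mollify w \<eta> x - w x)\<^sup>2)"
        by (rule integral_mono[OF i d(4)[OF \<eta>]]) (use zero[OF \<eta> d(2)] in \<open>auto simp: indicator_def\<close>)
      then show "(LBINT x. indicator (cball 0 n - cball 0 R1) x * (w x)\<^sup>2) \<le> 0 + e"
        using d(3)[OF \<eta>] by simp
    qed
  qed auto
  then have "AE x in lborel. \<forall>n::nat. x \<in> cball 0 (real n) - cball 0 R1 \<longrightarrow> w x = 0"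
    by (subst AE_all_countable) auto
  then have "AE x in lborel. norm x > R1 \<longrightarrow> w x = 0"
  proof eventually_elim
    case (elim x)
    obtain n where "norm x \<le> real n" using real_arch_simple by blast
    then show ?case using elim by auto
  qed
  then show ?thesis by (rule that)
qed

section \<open>Solutions vanishing on a cone\<close>

text \<open>The truncated open cone of directions within chord distance \<kappa> of e, when e is a
  unit vector; written without division and without angles.\<close>

definition cone_sector :: "real^2 \<Rightarrow> real \<Rightarrow> real \<Rightarrow> (real^2) set" where
  "cone_sector e \<kappa> \<rho> = {z. 0 < norm z \<and> norm z < \<rho> \<and> norm (z - norm z *\<^sub>R e) < \<kappa> * norm z}"

lemma integrable_unit_interval:
  fixes g :: "real \<Rightarrow> real"
  assumes "continuous_on UNIV g"
  shows "integrable lborel (\<lambda>t. g t * indicator {0..1} t)"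
proof -
  have "integrable lborel (\<lambda>t. indicator {0..1} t *\<^sub>R g t)"
    using assms by (intro borel_integrable_compact) (auto intro: continuous_on_subset)
  then show ?thesis by (simp add: mult.commute)
qed

lemma integrable_indicator_ball: "integrable lborel (\<lambda>x. indicator (ball a r) x :: real)" for a :: "real^2"
  using emeasure_lborel_ball_finite[of a r] by (intro integrable_real_indicator) auto

text \<open>The displacement from s e and the resulting change of norm are at most \<kappa> s / 4
  each, so z is within \<kappa> s / 2 of |z| e; this is below \<kappa> |z| since |z| \<ge> 3 s /
  4.\<close>

lemma cball_subset_cone_sector:
  assumes "norm e = 1" "0 < \<kappa>" "\<kappa> \<le> 1" "0 < s" "2 * s \<le> \<rho>" and z: "norm (z - s *\<^sub>R e) \<le> \<kappa> / 4 * s"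
  shows "z \<in> cone_sector e \<kappa> \<rho>"
proof -
  have ks: "\<kappa> / 4 * s \<le> s / 4" using assms by simp
  have n: "\<bar>norm z - s\<bar> \<le> \<kappa> / 4 * s"
    using norm_triangle_ineq3[of z "s *\<^sub>R e"] z assms by simp
  have lo: "norm z \<ge> 3 / 4 * s" using n ks by linarith
  have "norm (z - norm z *\<^sub>R e) \<le> norm (z - s *\<^sub>R e) + norm ((s - norm z) *\<^sub>R e)"
    using norm_triangle_ineq[of "z - s *\<^sub>R e" "(s - norm z) *\<^sub>R e"] by (simp add: algebra_simps)
  also have "\<dots> \<le> \<kappa> / 4 * s + \<kappa> / 4 * s"
    using z n assms(1) by (simp add: abs_minus_commute[of s])
  also have "\<dots> < \<kappa> * (3 / 4 * s)" using assms by simp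
  also have "\<dots> \<le> \<kappa> * norm z" using lo assms by (intro mult_left_mono) auto
  finally have "norm (z - norm z *\<^sub>R e) < \<kappa> * norm z" .
  moreover have "0 < norm z" "norm z < \<rho>" using lo n ks assms by linarith+
  ultimately show ?thesis by (simp add: cone_sector_def)
qed

text \<open>Cauchy-Schwarz on the unit interval, again as nonnegativity of a variance.\<close>

lemma square_integral_le:
  fixes f :: "real \<Rightarrow> real"
  assumes "continuous_on UNIV f"
  shows "(LBINT t. f t * indicator {0..1::real} t)\<^sup>2 \<le> (LBINT t. (f t)\<^sup>2 * indicator {0..1::real} t)"
proof -
  define m where "m = (LBINT t. f t * indicator {0..1::real} t)"
  note i = integrable_unit_interval
  have "0 \<le> (LBINT t. (f t - m)\<^sup>2 * indicator {0..1::real} t)"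
    by (intro Bochner_Integration.integral_nonneg) auto
  also have "\<dots> = (LBINT t. (f t)\<^sup>2 * indicator {0..1::real} t - 2 * m * (f t * indicator {0..1::real} t) + m\<^sup>2 * (1 * indicator {0..1::real} t))"
    by (rule Bochner_Integration.integral_cong) (auto simp: power2_eq_square algebra_simps)
  also have "\<dots> = (LBINT t. (f t)\<^sup>2 * indicator {0..1::real} t) - 2 * m * m + m\<^sup>2 * (LBINT t. 1 * indicator {0..1::real} t)"
    using i[of f] i[of "\<lambda>t. (f t)\<^sup>2"] i[of "\<lambda>t. 1"] assms
    by (simp add: continuous_on_power m_def[symmetric])
  also have "\<dots> = (LBINT t. (f t)\<^sup>2 * indicator {0..1::real} t) - m\<^sup>2"
    by (simp add: power2_eq_square)
  finally show ?thesis by (simp add: m_def)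
qed

text \<open>The increment is the integral of the directional derivative along a segment.
  Cauchy-Schwarz squares it; then Fubini and translation invariance move the points of the segment
  into the ball of radius r + s. The factor 2 comes from bounding the squared directional derivative
  by twice the squared gradient.\<close>

lemma translation_estimate:
  assumes u: "smooth_on UNIV u" and e: "norm e = 1" and "s \<ge> 0" "r \<ge> 0"
  shows "(LBINT x. indicator (ball 0 r) x * (u (x + s *\<^sub>R e) - u x)\<^sup>2)
    \<le> 2 * s\<^sup>2 * (LBINT x. indicator (ball 0 (r + s)) x * ((partial_deriv 1 u x)\<^sup>2 + (partial_deriv 2 u x)\<^sup>2))"
proof -
  define g where "g = (\<lambda>x. 2 * s\<^sup>2 * ((partial_deriv 1 u x)\<^sup>2 + (partial_deriv 2 u x)\<^sup>2))"
  have dc: "continuous_on S (partial_deriv i u)" for S i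
    using smooth_on_imp_continuous_on[OF smooth_on_partial_deriv[OF u]] continuous_on_subset by blast
  have gc: "continuous_on UNIV g" unfolding g_def by (intro continuous_intros dc)
  have uc: "continuous_on UNIV u" by (rule smooth_on_imp_continuous_on[OF u])
  have [measurable]: "g \<in> borel_measurable borel" "u \<in> borel_measurable borel"
    using gc uc by (auto intro: borel_measurable_continuous_onI)
  have g0: "g x \<ge> 0" for x by (simp add: g_def)
  have pt: "(u (x + s *\<^sub>R e) - u x)\<^sup>2 \<le> (LBINT t. g (x + (t * s) *\<^sub>R e) * indicator {0..1::real} t)" for x
  proof -
    define f where "f = (\<lambda>t. s * (e $ 1 * partial_deriv 1 u (x + (t * s) *\<^sub>R e) + e $ 2 * partial_deriv 2 u (x + (t * s) *\<^sub>R e)))"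
    have cp: "continuous_on UNIV (\<lambda>t::real. v (x + (t * s) *\<^sub>R e))" if "continuous_on UNIV v" for v :: "real^2 \<Rightarrow> real"
      by (rule continuous_on_compose2[OF that]) (auto intro!: continuous_intros)
    have fc: "continuous_on UNIV f" unfolding f_def by (intro continuous_intros cp dc)
    have D: "((\<lambda>t. u (x + (t * s) *\<^sub>R e)) has_real_derivative f t) (at t)" for t
    proof -
      have 1: "((\<lambda>t. x + (t * s) *\<^sub>R e) has_derivative (\<lambda>h. (h * s) *\<^sub>R e)) (at t)"
        by (auto intro!: derivative_eq_intros)
      show ?thesis
        by (rule has_derivative_imp_has_field_derivative[OF has_derivative_compose[OF 1
              has_derivative_partials[OF smooth_on_imp_differentiable[OF u UNIV_I]]]])
           (simp add: f_def algebra_simps)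
    qed
    have "u (x + s *\<^sub>R e) - u x = (LBINT t. f t * indicator {0..1::real} t)"
      using integral_FTC_Icc_real[of 0 1 "\<lambda>t. u (x + (t * s) *\<^sub>R e)" f] D fc
      by (simp add: continuous_on_eq_continuous_at)
    then have "(u (x + s *\<^sub>R e) - u x)\<^sup>2 \<le> (LBINT t. (f t)\<^sup>2 * indicator {0..1::real} t)"
      using square_integral_le[OF fc] by simp
    also have "\<dots> \<le> (LBINT t. g (x + (t * s) *\<^sub>R e) * indicator {0..1::real} t)"
    proof (rule integral_mono)
      note i = integrable_unit_interval
      show "integrable lborel (\<lambda>t. (f t)\<^sup>2 * indicator {0..1::real} t)" by (intro i continuous_intros fc)
      show "integrable lborel (\<lambda>t. g (x + (t * s) *\<^sub>R e) * indicator {0..1::real} t)" by (intro i cp gc)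
      fix t
      have e1: "(e $ i)\<^sup>2 \<le> 1" for i
        using component_le_norm_cart[of e i] e by (simp add: abs_square_le_1)
      have "(f t)\<^sup>2 \<le> g (x + (t * s) *\<^sub>R e)"
      proof -
        let ?a = "partial_deriv 1 u (x + (t * s) *\<^sub>R e)" and ?b = "partial_deriv 2 u (x + (t * s) *\<^sub>R e)"
        have "(e $ 1 * ?a + e $ 2 * ?b)\<^sup>2 \<le> 2 * (e $ 1 * ?a)\<^sup>2 + 2 * (e $ 2 * ?b)\<^sup>2" by (rule power2_sum_le)
        also have "\<dots> \<le> 2 * (1 * ?a\<^sup>2) + 2 * (1 * ?b\<^sup>2)"
          unfolding power_mult_distrib using e1 by (intro add_mono mult_left_mono mult_right_mono) auto
        finally have "s\<^sup>2 * (e $ 1 * ?a + e $ 2 * ?b)\<^sup>2 \<le> s\<^sup>2 * (2 * (1 * ?a\<^sup>2) + 2 * (1 * ?b\<^sup>2))"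
          by (intro mult_left_mono) auto
        then show ?thesis unfolding f_def g_def power_mult_distrib[of s] by (simp add: algebra_simps)
      qed
      then show "(f t)\<^sup>2 * indicator {0..1::real} t \<le> g (x + (t * s) *\<^sub>R e) * indicator {0..1::real} t"
        by (intro mult_right_mono) auto
    qed
    finally show ?thesis .
  qed
  have icont: "integrable lborel (\<lambda>x. indicator (ball 0 q) x * v x)" if "continuous_on UNIV v" for v :: "real^2 \<Rightarrow> real" and q
  proof (rule Bochner_Integration.integrable_bound)
    show "integrable lborel (\<lambda>x. indicator (cball 0 q) x *\<^sub>R v x)"
      using that by (intro borel_integrable_compact) (auto intro: continuous_on_subset)
    have "v \<in> borel_measurable borel" using that by (rule borel_measurable_continuous_onI)
    then show "(\<lambda>x. indicator (ball 0 q) x * v x) \<in> borel_measurable lborel"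
      by (intro borel_measurable_times borel_measurable_indicator; simp)
  qed (auto simp: indicator_def)
  have i1: "integrable lborel (\<lambda>x. indicator (ball 0 r) x * (u (x + s *\<^sub>R e) - u x)\<^sup>2)"
    by (intro icont continuous_intros continuous_on_compose2[OF uc] uc) auto
  have i2: "integrable lborel (\<lambda>x. indicator (ball 0 (r + s)) x * g x)" by (rule icont[OF gc])
  have "ennreal (LBINT x. indicator (ball 0 r) x * (u (x + s *\<^sub>R e) - u x)\<^sup>2)
      = (\<integral>\<^sup>+x. ennreal (indicator (ball 0 r) x * (u (x + s *\<^sub>R e) - u x)\<^sup>2) \<partial>lborel)"
    by (rule nn_integral_eq_integral[symmetric, OF i1]) auto
  also have "\<dots> \<le> (\<integral>\<^sup>+x. (\<integral>\<^sup>+t. ennreal (indicator (ball 0 r) x * (g (x + (t * s) *\<^sub>R e) * indicator {0..1::real} t)) \<partial>lborel) \<partial>lborel)"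
  proof (rule nn_integral_mono)
    fix x
    have i: "integrable lborel (\<lambda>t. g (x + (t * s) *\<^sub>R e) * indicator {0..1::real} t)"
    proof -
      have "integrable lborel (\<lambda>t. indicator {0..1::real} t *\<^sub>R g (x + (t * s) *\<^sub>R e))"
        by (intro borel_integrable_compact continuous_on_compose2[OF gc]) (auto intro!: continuous_intros)
      then show ?thesis by (simp add: mult.commute)
    qed
    have "(\<integral>\<^sup>+t. ennreal (indicator (ball 0 r) x * (g (x + (t * s) *\<^sub>R e) * indicator {0..1::real} t)) \<partial>lborel)
        = ennreal (LBINT t. indicator (ball 0 r) x * (g (x + (t * s) *\<^sub>R e) * indicator {0..1::real} t))"
      using i g0 by (intro nn_integral_eq_integral) auto
    moreover have "indicator (ball 0 r) x * (u (x + s *\<^sub>R e) - u x)\<^sup>2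
        \<le> (LBINT t. indicator (ball 0 r) x * (g (x + (t * s) *\<^sub>R e) * indicator {0..1::real} t))"
      using mult_left_mono[OF pt[of x], of "indicator (ball 0 r) x"] by simp
    ultimately show "ennreal (indicator (ball 0 r) x * (u (x + s *\<^sub>R e) - u x)\<^sup>2)
        \<le> (\<integral>\<^sup>+t. ennreal (indicator (ball 0 r) x * (g (x + (t * s) *\<^sub>R e) * indicator {0..1::real} t)) \<partial>lborel)"
      by (simp add: ennreal_leI)
  qed
  also have "\<dots> = (\<integral>\<^sup>+t. (\<integral>\<^sup>+x. ennreal (indicator (ball 0 r) x * (g (x + (t * s) *\<^sub>R e) * indicator {0..1::real} t)) \<partial>lborel) \<partial>lborel)"
  proof (rule lborel_pair.Fubini'[symmetric])
    have [measurable]: "ball (0::real^2) r \<in> sets borel" by simp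
    show "(\<lambda>(x, t). ennreal (indicator (ball 0 r) x * (g (x + (t * s) *\<^sub>R e) * indicator {0..1::real} t)))
        \<in> borel_measurable (lborel \<Otimes>\<^sub>M lborel)"
      by measurable
  qed
  also have "\<dots> \<le> (\<integral>\<^sup>+t. ennreal (indicator {0..1::real} t) * (\<integral>\<^sup>+x. ennreal (indicator (ball 0 (r + s)) x * g x) \<partial>lborel) \<partial>lborel)"
  proof (rule nn_integral_mono)
    fix t :: real
    show "(\<integral>\<^sup>+x. ennreal (indicator (ball 0 r) x * (g (x + (t * s) *\<^sub>R e) * indicator {0..1::real} t)) \<partial>lborel)
        \<le> ennreal (indicator {0..1::real} t) * (\<integral>\<^sup>+x. ennreal (indicator (ball 0 (r + s)) x * g x) \<partial>lborel)"
    proof (cases "t \<in> {0..1}")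
      case True
      let ?a = "(t * s) *\<^sub>R e"
      have ta: "norm ?a \<le> s" using True e \<open>s \<ge> 0\<close> by (simp add: mult_left_le_one_le)
      have "(\<integral>\<^sup>+x. ennreal (indicator (ball 0 r) x * (g (x + ?a) * indicator {0..1::real} t)) \<partial>lborel)
          \<le> (\<integral>\<^sup>+x. ennreal (indicator (ball 0 (r + s)) (?a + x) * g (?a + x)) \<partial>lborel)"
      proof (rule nn_integral_mono, rule ennreal_leI)
        fix x
        have "norm (?a + x) < r + s" if "norm x < r"
          using norm_triangle_ineq[of ?a x] ta that by linarith
        then show "indicator (ball 0 r) x * (g (x + ?a) * indicator {0..1::real} t)
            \<le> indicator (ball 0 (r + s)) (?a + x) * g (?a + x)"
          using g0 True by (auto simp: indicator_def add.commute)
      qed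
      also have "\<dots> = (\<integral>\<^sup>+x. ennreal (indicator (ball 0 (r + s)) x * g x) \<partial>distr lborel borel ((+) ?a))"
        by (rule nn_integral_distr[symmetric])
           (auto intro!: measurable_compose[OF _ measurable_ennreal] borel_measurable_times borel_measurable_indicator)
      also have "\<dots> = (\<integral>\<^sup>+x. ennreal (indicator (ball 0 (r + s)) x * g x) \<partial>lborel)"
        by (simp add: lborel_distr_plus)
      finally show ?thesis using True by simp
    qed simp
  qed
  also have "\<dots> = (\<integral>\<^sup>+t. ennreal (indicator {0..1::real} t) \<partial>lborel) * (\<integral>\<^sup>+x. ennreal (indicator (ball 0 (r + s)) x * g x) \<partial>lborel)"
    by (rule nn_integral_multc) auto
  also have "\<dots> = ennreal (LBINT x. indicator (ball 0 (r + s)) x * g x)"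
    using g0 by (simp add: nn_integral_eq_integral[OF i2] ennreal_indicator)
  finally have "(LBINT x. indicator (ball 0 r) x * (u (x + s *\<^sub>R e) - u x)\<^sup>2) \<le> (LBINT x. indicator (ball 0 (r + s)) x * g x)"
    using g0 by (subst (asm) ennreal_le_iff) (auto intro!: Bochner_Integration.integral_nonneg)
  also have "(LBINT x. indicator (ball 0 (r + s)) x * g x)
      = (LBINT x. 2 * s\<^sup>2 * (indicator (ball 0 (r + s)) x * ((partial_deriv 1 u x)\<^sup>2 + (partial_deriv 2 u x)\<^sup>2)))"
    by (rule Bochner_Integration.integral_cong) (auto simp: g_def)
  finally show ?thesis by simp
qed

lemma continuous_locally_L2:
  assumes "continuous_on UNIV f"
  shows "locally_L2 f"
  unfolding locally_L2_def set_integrable_def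
proof (intro conjI allI)
  show "integrable lborel (\<lambda>x. indicator (cball 0 r) x *\<^sub>R (f x)\<^sup>2)" for r
    using assms by (intro borel_integrable_compact continuous_intros) (auto intro: continuous_on_subset)
qed (rule borel_measurable_continuous_onI[OF assms])

lemma integral_ball_power2_le:
  assumes f: "locally_L2 f" and h: "locally_L2 h" and "t \<le> q"
    and i: "integrable lborel (\<lambda>x. indicator (cball 0 q) x * (h x - f x)\<^sup>2)"
    and le: "(LBINT x. indicator (cball 0 q) x * (h x - f x)\<^sup>2) < \<epsilon>"
  shows "(LBINT x. indicator (ball 0 t) x * (f x)\<^sup>2) \<le> 2 * (LBINT x. indicator (ball 0 t) x * (h x)\<^sup>2) + 2 * \<epsilon>"
proof -
  have set_int: "integrable lborel (\<lambda>x. indicator (ball 0 t) x * (g x)\<^sup>2)" if "locally_L2 g" for g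
    by (rule locally_L2_set_integrable[OF that, of _ t]) auto
  have "(LBINT x. indicator (ball 0 t) x * (f x)\<^sup>2)
      \<le> (LBINT x. 2 * (indicator (ball 0 t) x * (h x)\<^sup>2) + 2 * (indicator (cball 0 q) x * (h x - f x)\<^sup>2))"
  proof (rule integral_mono[OF set_int[OF f]])
    show "integrable lborel (\<lambda>x. 2 * (indicator (ball 0 t) x * (h x)\<^sup>2) + 2 * (indicator (cball 0 q) x * (h x - f x)\<^sup>2))"
      using set_int[OF h] i by auto
    show "indicator (ball 0 t) x * (f x)\<^sup>2 \<le> 2 * (indicator (ball 0 t) x * (h x)\<^sup>2) + 2 * (indicator (cball 0 q) x * (h x - f x)\<^sup>2)" for x
      using power2_sum_le[of "h x" "f x - h x"] \<open>t \<le> q\<close> by (auto simp: indicator_def power2_commute[of "h x"])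
  qed
  also have "\<dots> = 2 * (LBINT x. indicator (ball 0 t) x * (h x)\<^sup>2) + 2 * (LBINT x. indicator (cball 0 q) x * (h x - f x)\<^sup>2)"
    using set_int[OF h] i by simp
  finally show ?thesis using le by simp
qed

text \<open>Translation by s e carries the disc of radius r into the cone, where w is 0. So on the
  disc w is, up to sign, its own increment and is controlled by the gradient; both the shift and the
  enlarged disc scale with r. Mollification costs one further factor 2 for w and one for the
  gradient.\<close>

lemma cone_poincare:
  assumes w: "locally_L2 w" and G: "\<And>i. locally_L2 (G i)" "\<And>i. weak_partial i w (G i)"
    and e: "norm e = 1" and \<kappa>: "0 < \<kappa>" "\<kappa> \<le> 1"
    and w0: "AE x in lborel. x \<in> cone_sector e \<kappa> \<rho> \<longrightarrow> w x = 0"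
    and r: "r > 0" "16 / \<kappa> * r \<le> \<rho>"
  shows "(LBINT x. indicator (ball 0 r) x * (w x)\<^sup>2)
    \<le> 8 * (8 / \<kappa> * r)\<^sup>2 * (LBINT x. indicator (ball 0 (r + 8 / \<kappa> * r)) x * ((G 1 x)\<^sup>2 + (G 2 x)\<^sup>2))"
proof -
  \<comment> \<open>Then \<kappa> s / 4 = 2 r, which leaves room for the disc of radius r and for a
    mollifier of width at most r around s e; and 16 r / \<kappa> \<le> \<rho> gives 2 s \<le>
    \<rho>.\<close>
  define s where "s = 8 / \<kappa> * r"
  have s: "s > 0" "2 * s \<le> \<rho>" "\<kappa> / 4 * s = 2 * r" using r \<kappa> by (auto simp: s_def)
  define q where "q = r + s"
  have wl: "locally_integrable w" by (rule locally_L2_imp_locally_integrable[OF w])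
  have Gl: "locally_integrable (G i)" for i by (rule locally_L2_imp_locally_integrable[OF G(1)])
  have [measurable]: "w \<in> borel_measurable borel" "\<And>i. G i \<in> borel_measurable borel" using w G(1) by auto
  let ?W = "\<integral>x. indicator (ball 0 r) x * (w x)\<^sup>2 \<partial>lborel"
  let ?G = "\<integral>x. indicator (ball 0 q) x * ((G 1 x)\<^sup>2 + (G 2 x)\<^sup>2) \<partial>lborel"
  have set_int: "integrable lborel (\<lambda>x. indicator (ball 0 t) x * (f x)\<^sup>2)" if "locally_L2 f" for t f
    by (rule locally_L2_set_integrable[OF that, of _ t]) auto
  have key: "?W \<le> 8 * s\<^sup>2 * ?G + (2 + 16 * s\<^sup>2) * \<epsilon>" if "\<epsilon> > 0" for \<epsilon>
  proof -
    obtain d0 where d0: "d0 > 0" "d0 \<le> 1"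
      "\<And>\<eta>. is_mollifier \<eta> d0 \<Longrightarrow> (LBINT x. indicator (cball 0 q) x * (mollify w \<eta> x - w x)\<^sup>2) < \<epsilon>"
      "\<And>\<eta>. is_mollifier \<eta> d0 \<Longrightarrow> integrable lborel (\<lambda>x. indicator (cball 0 q) x * (mollify w \<eta> x - w x)\<^sup>2)"
      by (rule mollify_locally_L2_approx[OF w \<open>\<epsilon> > 0\<close>, of q], rule that; blast)
    define Q where "Q = (\<lambda>i d. d > 0 \<and> (\<forall>\<eta>. is_mollifier \<eta> d \<longrightarrow>
        (LBINT x. indicator (cball 0 q) x * (mollify (G i) \<eta> x - G i x)\<^sup>2) < \<epsilon> \<and>
        integrable lborel (\<lambda>x. indicator (cball 0 q) x * (mollify (G i) \<eta> x - G i x)\<^sup>2)))"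
    have "\<forall>i. \<exists>d. Q i d"
      unfolding Q_def
      by (rule allI, rule mollify_locally_L2_approx[OF G(1) \<open>\<epsilon> > 0\<close>, of q], intro exI conjI allI impI; blast)
    from choice[OF this] obtain dd where Q: "Q i (dd i)" for i by blast
    then have dd: "dd i > 0"
      "is_mollifier \<eta> (dd i) \<Longrightarrow> (LBINT x. indicator (cball 0 q) x * (mollify (G i) \<eta> x - G i x)\<^sup>2) < \<epsilon>"
      "is_mollifier \<eta> (dd i) \<Longrightarrow> integrable lborel (\<lambda>x. indicator (cball 0 q) x * (mollify (G i) \<eta> x - G i x)\<^sup>2)" for i \<eta>
      unfolding Q_def by blast+
    define d where "d = Min {d0, dd 1, dd 2, r}"
    have d: "d > 0" "d \<le> d0" "d \<le> dd 1" "d \<le> dd 2" "d \<le> r" using d0 dd r by (auto simp: d_def)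
    obtain \<eta> where \<eta>: "is_mollifier \<eta> d" using is_mollifier_exists[OF d(1)] by blast
    then have t: "test_function \<eta>" by (simp add: is_mollifier_def)
    have m0: "is_mollifier \<eta> d0" and mi: "is_mollifier \<eta> (dd i)" for i
      using is_mollifier_mono[OF \<eta>] d exhaust_2[of i] by auto
    define u where "u = mollify w \<eta>"
    have u: "smooth_on UNIV u" unfolding u_def by (rule smooth_on_mollify[OF wl t])
    have du: "partial_deriv i u = mollify (G i) \<eta>" for i
      unfolding u_def partial_deriv_mollify[OF wl t]
      using mollify_weak_partial_deriv[OF _ t, of w i "G i"] G(2)[of i] by (auto simp: weak_partial_def)
    have [measurable]: "u \<in> borel_measurable borel" "\<And>i. mollify (G i) \<eta> \<in> borel_measurable borel"
      unfolding u_def by (intro mollify_measurable wl Gl t)+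
    have u0: "u (x + s *\<^sub>R e) = 0" if x: "norm x < r" for x
    proof -
      have "u (x + s *\<^sub>R e) = mollify (\<lambda>x. 0) \<eta> (x + s *\<^sub>R e)"
        unfolding u_def
      proof (rule mollify_cong[OF \<eta>])
        show "AE y in lborel. norm (x + s *\<^sub>R e - y) < d \<longrightarrow> w y = 0"
          using w0
        proof eventually_elim
          case (elim y)
          show ?case
          proof
            assume y: "norm (x + s *\<^sub>R e - y) < d"
            have "norm (y - s *\<^sub>R e) \<le> norm x + norm (x + s *\<^sub>R e - y)"
              using norm_triangle_ineq4[of x "x + s *\<^sub>R e - y"] by (simp add: algebra_simps)
            then have "norm (y - s *\<^sub>R e) \<le> \<kappa> / 4 * s" using x y d s(3) by linarith
            then show "w y = 0" using elim cball_subset_cone_sector[OF e \<kappa> s(1,2)] by blast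
          qed
        qed
      qed auto
      then show ?thesis by (simp add: mollify_def)
    qed
    have uL: "locally_L2 u" "locally_L2 (mollify (G i) \<eta>)" for i
      unfolding u_def by (intro continuous_locally_L2 smooth_on_imp_continuous_on smooth_on_mollify wl Gl t)+
    have 1: "?W \<le> 2 * (LBINT x. indicator (ball 0 r) x * (u x)\<^sup>2) + 2 * \<epsilon>"
      using d0(3)[OF m0] d0(4)[OF m0] s(1)
      by (intro integral_ball_power2_le[OF w uL(1), of r q]) (auto simp: q_def u_def)
    have "(LBINT x. indicator (ball 0 r) x * (u x)\<^sup>2)
        = (LBINT x. indicator (ball 0 r) x * (u (x + s *\<^sub>R e) - u x)\<^sup>2)"
      by (rule Bochner_Integration.integral_cong) (auto simp: indicator_def u0)
    also have "\<dots> \<le> 2 * s\<^sup>2 * (LBINT x. indicator (ball 0 (r + s)) x * ((partial_deriv 1 u x)\<^sup>2 + (partial_deriv 2 u x)\<^sup>2))"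
      using s r by (intro translation_estimate[OF u e]) auto
    also have "(LBINT x. indicator (ball 0 (r + s)) x * ((partial_deriv 1 u x)\<^sup>2 + (partial_deriv 2 u x)\<^sup>2))
        = (LBINT x. indicator (ball 0 q) x * (mollify (G 1) \<eta> x)\<^sup>2)
        + (LBINT x. indicator (ball 0 q) x * (mollify (G 2) \<eta> x)\<^sup>2)"
      unfolding du q_def[symmetric] distrib_left by (intro Bochner_Integration.integral_add set_int uL)
    finally have 2: "(LBINT x. indicator (ball 0 r) x * (u x)\<^sup>2)
        \<le> 2 * s\<^sup>2 * ((LBINT x. indicator (ball 0 q) x * (mollify (G 1) \<eta> x)\<^sup>2)
        + (LBINT x. indicator (ball 0 q) x * (mollify (G 2) \<eta> x)\<^sup>2))" .
    have 3: "(LBINT x. indicator (ball 0 q) x * (mollify (G i) \<eta> x)\<^sup>2)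
        \<le> 2 * (LBINT x. indicator (ball 0 q) x * (G i x)\<^sup>2) + 2 * \<epsilon>" for i
      using dd(2)[OF mi] dd(3)[OF mi]
      by (intro integral_ball_power2_le[OF uL(2) G(1), of q q]) (auto simp: power2_commute[of "G i _"])
    have Gsum: "?G = (LBINT x. indicator (ball 0 q) x * (G 1 x)\<^sup>2) + (LBINT x. indicator (ball 0 q) x * (G 2 x)\<^sup>2)"
      unfolding distrib_left by (intro Bochner_Integration.integral_add set_int G)
    have "(LBINT x. indicator (ball 0 r) x * (u x)\<^sup>2) \<le> 2 * s\<^sup>2 * (2 * ?G + 4 * \<epsilon>)"
      by (rule order_trans[OF 2], rule mult_left_mono) (use 3[of 1] 3[of 2] Gsum in auto)
    then show ?thesis using 1 by (simp add: algebra_simps)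
  qed
  have "?W \<le> 8 * s\<^sup>2 * ?G"
  proof (rule field_le_epsilon)
    fix e' :: real assume "e' > 0"
    have p: "2 + 16 * s\<^sup>2 > 0" by (intro add_pos_nonneg) auto
    have "(2 + 16 * s\<^sup>2) * (e' / (2 + 16 * s\<^sup>2)) = e'" using p by simp
    moreover have "e' / (2 + 16 * s\<^sup>2) > 0" using p \<open>e' > 0\<close> by (rule divide_pos_pos[rotated])
    ultimately show "?W \<le> 8 * s\<^sup>2 * ?G + e'" using key[of "e' / (2 + 16 * s\<^sup>2)"] by (simp only:)
  qed
  then show ?thesis by (simp only: s_def q_def)
qed

text \<open>Absolute continuity of the integral: off the origin the integrands are eventually 0
  along any sequence of radii tending to 0.\<close>

lemma tendsto_integral_ball_0:
  fixes f :: "real^2 \<Rightarrow> real"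
  assumes [measurable]: "f \<in> borel_measurable borel" and i: "integrable lborel (\<lambda>x. indicator (ball 0 R) x * f x)"
    and "R > 0" "L > 0"
  shows "((\<lambda>r. \<integral>x. indicator (ball 0 (L * r)) x * f x \<partial>lborel) \<longlongrightarrow> 0) (at_right 0)"
proof (rule tendsto_at_right_sequentially[where b = "R / L"])
  show "0 < R / L" using assms by simp
  fix S :: "nat \<Rightarrow> real" assume S: "\<And>n. 0 < S n" "\<And>n. S n < R / L" "S \<longlonglongrightarrow> 0" "decseq S"
  have "(\<lambda>n. \<integral>x. indicator (ball 0 (L * S n)) x * f x \<partial>lborel) \<longlonglongrightarrow> (\<integral>x. 0 \<partial>(lborel :: (real^2) measure))"
  proof (rule integral_dominated_convergence[where w = "\<lambda>x. \<bar>indicator (ball 0 R) x * f x\<bar>"])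
    show "(\<lambda>x. indicator (ball 0 (L * S n)) x * f x) \<in> borel_measurable lborel" for n
      by (intro borel_measurable_times borel_measurable_indicator; simp)
    show "integrable lborel (\<lambda>x. \<bar>indicator (ball 0 R) x * f x\<bar>)" using i by (rule integrable_abs)
    have "L * S n < R" for n using S(2)[of n] assms by (simp add: field_simps)
    then show "AE x in lborel. norm (indicator (ball 0 (L * S n)) x * f x) \<le> \<bar>indicator (ball 0 R) x * f x\<bar>" for n
      using less_trans by (fastforce simp: indicator_def)
    show "AE x in lborel. (\<lambda>n. indicator (ball 0 (L * S n)) x * f x) \<longlonglongrightarrow> 0"
      using AE_lborel_singleton[of 0]
    proof eventually_elim
      case (elim x)
      have "(\<lambda>n. L * S n) \<longlonglongrightarrow> L * 0" by (intro tendsto_intros S)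
      then have "\<forall>\<^sub>F n in sequentially. L * S n < norm x"
        using elim by (intro order_tendstoD) auto
      then show ?case
        by (intro tendsto_eventually, elim eventually_mono) (auto simp: indicator_def)
    qed
  qed auto
  then show "(\<lambda>n. \<integral>x. indicator (ball 0 (L * S n)) x * f x \<partial>lborel) \<longlonglongrightarrow> 0" by simp
qed

lemma measure_ball_scale: "measure lborel (ball (0::real^2) r) = r\<^sup>2 * measure lborel (ball (0::real^2) 1)" if "r > 0"
proof -
  have "(LBINT x. indicator (ball (0::real^2) r) x) = r\<^sup>2 * (LBINT x. indicator (ball (0::real^2) r) (0 + r *\<^sub>R x))"
    using that by (intro lborel_integral_affine borel_measurable_indicator) auto
  moreover have "indicator (ball (0::real^2) r) (0 + r *\<^sub>R x) = (indicator (ball 0 1) x :: real)" for x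
    using that by (auto simp: indicator_def)
  ultimately show ?thesis by simp
qed

text \<open>A substitute for \<open>w(0) = 0\<close>, as \<open>w\<close> is not known to be continuous.\<close>

lemma cone_average_tendsto_0:
  assumes w: "locally_L2 w" and G: "\<And>i. locally_L2 (G i)" "\<And>i. weak_partial i w (G i)"
    and e: "norm e = 1" and \<kappa>: "0 < \<kappa>" "\<kappa> \<le> 1" and "\<rho> > 0"
    and w0: "AE x in lborel. x \<in> cone_sector e \<kappa> \<rho> \<longrightarrow> w x = 0"
  shows "((\<lambda>r. (LBINT x. indicator (ball 0 r) x * \<bar>w x\<bar>) / r\<^sup>2) \<longlongrightarrow> 0) (at_right 0)"
proof (rule tendstoI)
  fix \<epsilon> :: real assume "\<epsilon> > 0"
  define V where "V = measure lborel (ball (0::real^2) 1)"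
  have V: "V \<ge> 0" by (simp add: V_def)
  \<comment> \<open>The weight in |t| \<le> t^2 / \<tau> + \<tau>. The constant part contributes
    \<tau> V < \<epsilon> to the mean; the quadratic part is, by \<open>cone_poincare\<close>, r^2
    times a gradient integral that tends to 0 with r.\<close>
  define \<tau> where "\<tau> = \<epsilon> / (V + 1)"
  have \<tau>: "\<tau> > 0" "\<tau> * V < \<epsilon>" using \<open>\<epsilon> > 0\<close> V by (auto simp: \<tau>_def field_simps)
  define L where "L = 1 + 8 / \<kappa>"
  have L: "L > 0" using \<kappa> by (simp add: L_def add_pos_pos)
  have [measurable]: "w \<in> borel_measurable borel" "\<And>i. G i \<in> borel_measurable borel" using w G(1) by auto
  define Gam where "Gam = (\<lambda>r. \<integral>x. indicator (ball 0 (L * r)) x * ((G 1 x)\<^sup>2 + (G 2 x)\<^sup>2) \<partial>lborel)"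
  have "integrable lborel (\<lambda>x. indicator (ball 0 1) x * ((G 1 x)\<^sup>2 + (G 2 x)\<^sup>2))"
    unfolding distrib_left
    by (intro Bochner_Integration.integrable_add locally_L2_set_integrable[OF G(1), of _ 1]) auto
  then have "(Gam \<longlongrightarrow> 0) (at_right 0)"
    unfolding Gam_def by (intro tendsto_integral_ball_0[where R = 1] L) auto
  then have lim: "((\<lambda>r. 8 * (8 / \<kappa>)\<^sup>2 * Gam r / \<tau>) \<longlongrightarrow> 8 * (8 / \<kappa>)\<^sup>2 * 0 / \<tau>) (at_right 0)"
    by (intro tendsto_intros) (use \<tau> in auto)
  have "\<epsilon> - \<tau> * V > 0" using \<tau> by simp
  then have ev1: "\<forall>\<^sub>F r in at_right 0. 8 * (8 / \<kappa>)\<^sup>2 * Gam r / \<tau> < \<epsilon> - \<tau> * V"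
    using lim by (intro order_tendstoD(2)[OF lim]) simp
  have ev2: "\<forall>\<^sub>F r in at_right (0::real). 0 < r \<and> r < \<kappa> * \<rho> / 16"
    using \<kappa> \<open>\<rho> > 0\<close> by (auto simp: eventually_at_right_field intro!: exI[of _ "\<kappa> * \<rho> / 16"])
  show "\<forall>\<^sub>F r in at_right 0. dist ((LBINT x. indicator (ball 0 r) x * \<bar>w x\<bar>) / r\<^sup>2) 0 < \<epsilon>"
    using ev1 ev2
  proof eventually_elim
    case (elim r)
    have r: "r > 0" "16 / \<kappa> * r \<le> \<rho>" using elim(2) \<kappa> by (auto simp: field_simps)
    have iw: "integrable lborel (\<lambda>x. indicator (ball 0 r) x * (w x)\<^sup>2)"
      by (rule locally_L2_set_integrable[OF w, of _ r]) auto
    have "integrable lborel (\<lambda>x. indicator (ball 0 r) x * (\<bar>w x\<bar>)) "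
    proof (rule Bochner_Integration.integrable_bound)
      show "integrable lborel (\<lambda>x. indicator (cball 0 r) x *\<^sub>R w x)"
        using locally_L2_imp_locally_integrable[OF w] by (simp add: locally_integrable_def set_integrable_def)
      show "(\<lambda>x. indicator (ball 0 r) x * \<bar>w x\<bar>) \<in> borel_measurable lborel"
        by (intro borel_measurable_times borel_measurable_indicator; simp)
    qed (auto simp: indicator_def)
    note ia = this
    note ib = integrable_indicator_ball[of "0::real^2" r]
    have "(LBINT x. indicator (ball 0 r) x * \<bar>w x\<bar>)
        \<le> (LBINT x. (1 / \<tau>) * (indicator (ball 0 r) x * (w x)\<^sup>2) + \<tau> * indicator (ball 0 r) x)"
    proof (rule integral_mono[OF ia])
      show "integrable lborel (\<lambda>x. (1 / \<tau>) * (indicator (ball 0 r) x * (w x)\<^sup>2) + \<tau> * indicator (ball 0 r) x)"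
        using iw ib by (intro Bochner_Integration.integrable_add integrable_mult_right)
      have "\<tau> * \<bar>t\<bar> \<le> t\<^sup>2 + \<tau>\<^sup>2" for t
      proof -
        have "0 \<le> \<tau> * \<bar>t\<bar>" using \<tau>(1) by simp
        moreover have "2 * (\<tau> * \<bar>t\<bar>) \<le> t\<^sup>2 + \<tau>\<^sup>2"
          using sum_squares_bound[of "\<bar>t\<bar>" \<tau>] by (simp add: mult.commute mult.left_commute)
        ultimately show ?thesis by linarith
      qed
      then have "\<bar>t\<bar> \<le> (t\<^sup>2 + \<tau>\<^sup>2) / \<tau>" for t
        using \<tau>(1) by (simp add: pos_le_divide_eq mult.commute)
      then have "\<bar>t\<bar> \<le> 1 / \<tau> * t\<^sup>2 + \<tau>" for t
        using \<tau>(1) by (simp add: add_divide_distrib power2_eq_square)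
      then show "indicator (ball 0 r) x * \<bar>w x\<bar>
          \<le> (1 / \<tau>) * (indicator (ball 0 r) x * (w x)\<^sup>2) + \<tau> * indicator (ball 0 r) x" for x
        by (auto simp: indicator_def)
    qed
    also have "\<dots> = (1 / \<tau>) * (LBINT x. indicator (ball 0 r) x * (w x)\<^sup>2) + \<tau> * (r\<^sup>2 * V)"
      using iw ib measure_ball_scale[OF r(1)] by (simp add: V_def)
    also have "\<dots> \<le> (1 / \<tau>) * (8 * (8 / \<kappa> * r)\<^sup>2 * Gam r) + \<tau> * (r\<^sup>2 * V)"
    proof -
      have "r + 8 / \<kappa> * r = L * r" by (simp add: L_def algebra_simps)
      then show ?thesis
        using cone_poincare[OF w G e \<kappa> w0 r] \<tau> unfolding Gam_def by (intro add_mono mult_left_mono) auto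
    qed
    also have "\<dots> = r\<^sup>2 * (8 * (8 / \<kappa>)\<^sup>2 * Gam r / \<tau> + \<tau> * V)"
      by (simp add: power_mult_distrib power_divide algebra_simps)
    also have "\<dots> < r\<^sup>2 * \<epsilon>" using elim(1) r by (intro mult_strict_left_mono) auto
    finally have "(LBINT x. indicator (ball 0 r) x * \<bar>w x\<bar>) / r\<^sup>2 < \<epsilon>"
      using r by (simp add: field_simps)
    moreover have "(LBINT x. indicator (ball 0 r) x * \<bar>w x\<bar>) / r\<^sup>2 \<ge> 0"
      by (intro divide_nonneg_nonneg Bochner_Integration.integral_nonneg) auto
    ultimately show ?case by (simp add: dist_real_def)
  qed
qed

section \<open>The compatibility condition at a corner\<close>

definition cplx :: "real^2 \<Rightarrow> complex" where
  "cplx x = Complex (x $ 1) (x $ 2)"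

lemma cplx_linear: "cplx (x + y) = cplx x + cplx y" "cplx (x - y) = cplx x - cplx y"
  "cplx (t *\<^sub>R x) = of_real t * cplx x" "cplx 0 = 0"
  by (simp_all add: cplx_def complex_eq_iff)

lemma norm_cplx [simp]: "norm (cplx x) = norm x"
proof -
  have "(norm (cplx x))\<^sup>2 = (norm x)\<^sup>2"
    by (simp add: cplx_def cmod_power2 power2_norm_eq_nth)
  then show ?thesis by simp
qed

lemma cplx_eq_0_iff [simp]: "cplx x = 0 \<longleftrightarrow> x = 0"
  using norm_cplx[of x] by (metis norm_eq_zero)

lemma cplx_axis [simp]: "cplx (axis 1 1) = 1" "cplx (axis 2 1) = \<i>"
  by (simp_all add: cplx_def axis_def complex_eq_iff)

lemma bounded_linear_cplx: "bounded_linear cplx"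
  by (rule bounded_linear_intro[where K = 1]) (simp_all add: cplx_linear scaleR_conv_of_real[where 'a = complex])

text \<open>A family of harmonic functions closed under differentiation.\<close>

definition pole :: "real^2 \<Rightarrow> complex \<Rightarrow> nat \<Rightarrow> real^2 \<Rightarrow> real" where
  "pole a c n x = Re (c / cplx (x - a) ^ n)"

lemma deriv_const_divide_power:
  fixes c z :: complex
  assumes "z \<noteq> 0"
  shows "((\<lambda>z. c / z ^ n) has_field_derivative - (of_nat n * c) / z ^ Suc n) (at z)"
proof (cases n)
  case (Suc m)
  show ?thesis unfolding Suc
    by (rule DERIV_cong, rule DERIV_divide[OF DERIV_const DERIV_power[OF DERIV_ident]])
       (use assms in \<open>simp_all add: field_simps\<close>)
qed simp

lemma pole_has_derivative:
  assumes "x \<noteq> a"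
  shows "(pole a c n has_derivative (\<lambda>h. Re (- (of_nat n * c) / cplx (x - a) ^ Suc n * cplx h))) (at x)"
proof -
  let ?z = "cplx (x - a)"
  have z: "?z \<noteq> 0" using assms by simp
  have "((\<lambda>z. c / z ^ n) has_field_derivative - (of_nat n * c) / ?z ^ Suc n) (at ?z)"
    by (rule deriv_const_divide_power[OF z])
  then have f: "((\<lambda>z. c / z ^ n) has_derivative (\<lambda>h. - (of_nat n * c) / ?z ^ Suc n * h)) (at ?z)"
    unfolding has_field_derivative_def .
  have g: "((\<lambda>x. cplx (x - a)) has_derivative cplx) (at x)"
    by (rule bounded_linear.has_derivative[OF bounded_linear_cplx]) (auto intro!: derivative_eq_intros)
  show ?thesis
    unfolding pole_def[abs_def]
    by (rule bounded_linear.has_derivative[OF bounded_linear_Re has_derivative_compose[OF g f]])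
qed

lemma partial_deriv_pole:
  assumes "x \<noteq> a"
  shows "partial_deriv 1 (pole a c n) x = pole a (- (of_nat n * c)) (Suc n) x"
    "partial_deriv 2 (pole a c n) x = pole a (- (of_nat n * c * \<i>)) (Suc n) x"
  using partial_deriv_eqI[OF pole_has_derivative[OF assms]] by (simp_all add: pole_def)

lemma smooth_on_pole: "smooth_on (- {a}) (pole a c n)"
proof -
  have op: "open (- {a})" by auto
  have "Ck_on m (- {a}) (pole a c n)" for m
  proof (induction m arbitrary: c n)
    case 0
    show ?case
      by (auto intro!: continuous_at_imp_continuous_on has_derivative_continuous[OF pole_has_derivative])
  next
    case (Suc m)
    have "Ck_on m (- {a}) (partial_deriv i (pole a c n))" for i
    proof (cases "i = 1")
      case True
      then show ?thesis
        using Ck_on_cong[OF op, of "partial_deriv 1 (pole a c n)" "pole a (- (of_nat n * c)) (Suc n)" m]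
          partial_deriv_pole(1) Suc.IH by auto
    next
      case False
      then have "i = 2" using exhaust_2[of i] by auto
      then show ?thesis
        using Ck_on_cong[OF op, of "partial_deriv 2 (pole a c n)" "pole a (- (of_nat n * c * \<i>)) (Suc n)" m]
          partial_deriv_pole(2) Suc.IH by auto
    qed
    then show ?case
      by (auto intro: differentiableI[OF pole_has_derivative])
  qed
  then show ?thesis by (simp add: smooth_on_def)
qed

text \<open>Each \<partial>_2 produces one factor \<i> more than \<partial>_1, so the two second
  derivatives differ by \<i>^2 = -1.\<close>

lemma laplacian_pole:
  assumes "x \<noteq> a"
  shows "laplacian (pole a c n) x = 0"
proof -
  have op: "open (- {a})" and x: "x \<in> - {a}" using assms by auto
  have "partial_deriv 1 (partial_deriv 1 (pole a c n)) x = pole a (- (of_nat (Suc n) * - (of_nat n * c))) (Suc (Suc n)) x"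
    using partial_deriv_cong_open(1)[OF op x, of "partial_deriv 1 (pole a c n)" "pole a (- (of_nat n * c)) (Suc n)" 1]
      partial_deriv_pole assms by simp
  moreover have "partial_deriv 2 (partial_deriv 2 (pole a c n)) x
      = pole a (- (of_nat (Suc n) * - (of_nat n * c * \<i>) * \<i>)) (Suc (Suc n)) x"
    using partial_deriv_cong_open(1)[OF op x, of "partial_deriv 2 (pole a c n)" "pole a (- (of_nat n * c * \<i>)) (Suc n)" 2]
      partial_deriv_pole assms by simp
  moreover have "- (of_nat (Suc n) * - (of_nat n * c * \<i>) * \<i>) = - (- (of_nat (Suc n) * - (of_nat n * c)))"
    by (simp add: mult.assoc)
  ultimately show ?thesis by (simp add: laplacian_def pole_def)
qed

lemma abs_pole_le: "\<bar>pole a c n x\<bar> \<le> norm c / norm (x - a) ^ n"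
  using abs_Re_le_cmod[of "c / cplx (x - a) ^ n"] by (simp add: pole_def norm_divide norm_power)

lemma pole_scale: "t > 0 \<Longrightarrow> pole 0 c 2 (t *\<^sub>R x) = pole 0 c 2 x / t\<^sup>2"
proof -
  assume "t > 0"
  have "c / cplx (t *\<^sub>R x) ^ 2 = (c / cplx x ^ 2) / of_real (t\<^sup>2)"
    by (simp add: cplx_linear power_mult_distrib mult.commute)
  then show ?thesis unfolding pole_def by (simp only: diff_0_right Re_divide_of_real)
qed

lemma pole_measurable [measurable]: "pole a c n \<in> borel_measurable borel"
proof -
  have [measurable]: "cplx \<in> borel_measurable borel"
    using bounded_linear.continuous_on[OF bounded_linear_cplx continuous_on_id]
    by (rule borel_measurable_continuous_onI)
  show ?thesis unfolding pole_def[abs_def] by measurable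
qed

text \<open>Moving the pole by a gains a factor |a| / |x| over the size |x|^-2 of the kernel. Over
  dyadic annuli these gains form a geometric series, so the displacement costs only a bounded amount
  in total.\<close>

lemma pole_difference:
  assumes "norm c = 1" "norm a \<le> norm x" "\<kappa> > 0" "\<kappa> * norm x \<le> norm (x - a)" "x \<noteq> 0"
  shows "\<bar>pole a c 2 x - pole 0 c 2 x\<bar> \<le> 3 * norm a / (\<kappa>\<^sup>2 * norm x ^ 3)"
proof -
  let ?z = "cplx x" and ?a = "cplx a"
  have nx: "norm x > 0" using assms by simp
  have "norm (x - a) > 0" using assms(3,4) nx by (metis mult_pos_pos less_le_trans)
  then have za: "?z - ?a \<noteq> 0" by (simp add: cplx_linear(2)[symmetric])
  have z: "?z \<noteq> 0" using assms by simp
  have "pole a c 2 x - pole 0 c 2 x = Re (c / (?z - ?a)\<^sup>2 - c / ?z\<^sup>2)"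
    by (simp add: pole_def cplx_linear)
  also have "c / (?z - ?a)\<^sup>2 - c / ?z\<^sup>2 = c * (?a * (2 * ?z - ?a)) / (?z\<^sup>2 * (?z - ?a)\<^sup>2)"
  proof -
    have "c * ?z\<^sup>2 - c * (?z - ?a)\<^sup>2 = c * (?a * (2 * ?z - ?a))"
      by (simp add: power2_eq_square algebra_simps)
    then show ?thesis using z za by (subst diff_frac_eq) (simp_all add: mult.commute)
  qed
  finally have "\<bar>pole a c 2 x - pole 0 c 2 x\<bar> \<le> norm (c * (?a * (2 * ?z - ?a)) / (?z\<^sup>2 * (?z - ?a)\<^sup>2))"
    using abs_Re_le_cmod by simp
  also have "\<dots> = norm a * norm (2 * ?z - ?a) / ((norm x)\<^sup>2 * (norm (x - a))\<^sup>2)"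
    using assms(1) by (simp add: norm_mult norm_divide norm_power cplx_linear(2)[symmetric])
  also have "\<dots> \<le> norm a * (3 * norm x) / ((norm x)\<^sup>2 * (\<kappa> * norm x)\<^sup>2)"
  proof (intro frac_le mult_left_mono power_mono)
    have "norm (2 * ?z - ?a) \<le> norm (2 * ?z) + norm ?a" by (rule norm_triangle_ineq4)
    then show "norm (2 * ?z - ?a) \<le> 3 * norm x" using assms(2) by (simp add: norm_mult)
  qed (use assms nx in auto)
  also have "\<dots> = 3 * norm a / (\<kappa>\<^sup>2 * norm x ^ 3)"
    using nx assms(3) by (simp add: field_simps power2_eq_square power3_eq_cube)
  finally show ?thesis .
qed

lemma abs_combination_le:
  fixes p1 p2 p3 q1 q2 q3 :: real
  assumes "\<bar>p1\<bar> \<le> q1" "\<bar>p2\<bar> \<le> q2" "\<bar>p3\<bar> \<le> q3"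
  shows "\<bar>2 * (p1 + p2) + p3\<bar> \<le> 2 * (q1 + q2) + q3"
  using assms by (smt (verit))

lemma laplacian_cong_open:
  assumes "open U" "x \<in> U" "\<And>y. y \<in> U \<Longrightarrow> f y = g y"
  shows "laplacian f x = laplacian g x"
proof -
  have "partial_deriv i f y = partial_deriv i g y" if "y \<in> U" for i y
    by (rule partial_deriv_cong_open(1)[OF assms(1) that assms(3)])
  then have "partial_deriv i (partial_deriv i f) x = partial_deriv i (partial_deriv i g) x" for i
    by (intro partial_deriv_cong_open(1)[OF assms(1,2)]) auto
  then show ?thesis by (simp add: laplacian_def)
qed

lemma laplacian_mult:
  assumes "open U" "x \<in> U" and f: "smooth_on U f" and g: "smooth_on U g"
  shows "laplacian (\<lambda>x. f x * g x) x = laplacian f x * g x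
    + 2 * (partial_deriv 1 f x * partial_deriv 1 g x + partial_deriv 2 f x * partial_deriv 2 g x) + f x * laplacian g x"
proof -
  have df: "f differentiable (at y)" "g differentiable (at y)" "partial_deriv i f differentiable (at y)"
    "partial_deriv i g differentiable (at y)" if "y \<in> U" for y i
    using that f g smooth_on_imp_differentiable smooth_on_partial_deriv by blast+
  have "partial_deriv i (partial_deriv i (\<lambda>x. f x * g x)) x = partial_deriv i (partial_deriv i f) x * g x
      + 2 * (partial_deriv i f x * partial_deriv i g x) + f x * partial_deriv i (partial_deriv i g) x" for i
  proof -
    have "partial_deriv i (partial_deriv i (\<lambda>x. f x * g x)) x
        = partial_deriv i (\<lambda>x. partial_deriv i f x * g x + f x * partial_deriv i g x) x"
      by (intro partial_deriv_cong_open(1)[OF assms(1,2)] partial_deriv_mult df)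
    also have "\<dots> = partial_deriv i (\<lambda>x. partial_deriv i f x * g x) x + partial_deriv i (\<lambda>x. f x * partial_deriv i g x) x"
      by (intro partial_deriv_add differentiable_mult df assms(2))
    finally show ?thesis
      using partial_deriv_mult[OF df(3)[OF assms(2)] df(2)[OF assms(2)], of i i]
        partial_deriv_mult[OF df(1)[OF assms(2)] df(4)[OF assms(2)], of i i] by simp
  qed
  then show ?thesis by (simp add: laplacian_def algebra_simps)
qed

section \<open>Dyadic annuli and the logarithmic divergence\<close>

definition dyadic_annulus :: "real \<Rightarrow> nat \<Rightarrow> (real^2) set" where
  "dyadic_annulus \<delta> j = {x. \<delta> / 2 ^ Suc j \<le> norm x \<and> norm x < \<delta> / 2 ^ j}"

lemma sum_indicator_dyadic_annulus:
  assumes "\<delta> > 0"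
  shows "(\<Sum>j<n. indicator (dyadic_annulus \<delta> j) x) = (if \<delta> / 2 ^ n \<le> norm x \<and> norm x < \<delta> then 1 else 0 :: real)"
proof (induction n)
  case (Suc n)
  have "\<delta> / 2 ^ Suc n \<le> \<delta> / 2 ^ n" "\<delta> / 2 ^ n \<le> \<delta>" using assms by (auto simp: field_simps)
  then show ?case using Suc by (auto simp: dyadic_annulus_def indicator_def)
qed auto

lemma exists_dyadic_annulus:
  assumes "\<delta> > 0" "\<delta> / 2 ^ n \<le> norm x" "norm x < \<delta>"
  shows "\<exists>j<n. x \<in> dyadic_annulus \<delta> j"
proof (rule ccontr)
  assume "\<not> ?thesis"
  then have "(\<Sum>j<n. indicator (dyadic_annulus \<delta> j) x) = (0::real)" by (intro sum.neutral) (auto simp: indicator_def)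
  then show False using sum_indicator_dyadic_annulus[OF assms(1), where n = n and x = x] assms by simp
qed

lemma dyadic_annulus_measurable [measurable]: "dyadic_annulus \<delta> j \<in> sets borel"
proof -
  have "dyadic_annulus \<delta> j = ball 0 (\<delta> / 2 ^ j) - ball 0 (\<delta> / 2 ^ Suc j)"
    by (auto simp: dyadic_annulus_def)
  then show ?thesis by simp
qed

text \<open>Division by n leaves, up to O(1 / n), a multiple of the Cesaro means of a null sequence
  on the right, and these tend to 0.\<close>

lemma zero_of_cesaro_bound:
  fixes m :: "nat \<Rightarrow> real"
  assumes bound: "\<And>n. n \<ge> 3 \<Longrightarrow> real n * \<bar>I\<bar> \<le> C + D * (\<Sum>j\<le>n. m j)" and "D \<ge> 0"
    and m: "m \<longlonglongrightarrow> 0" "\<And>j. m j \<ge> 0"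
  shows "I = 0"
proof (rule ccontr)
  assume "I \<noteq> 0"
  define h where "h = \<bar>I\<bar> / (2 * (D + 1))"
  have h: "h > 0" "D * h \<le> \<bar>I\<bar> / 2" using \<open>I \<noteq> 0\<close> \<open>D \<ge> 0\<close> by (auto simp: h_def field_simps)
  have "\<forall>\<^sub>F j in sequentially. m j < h" using m(1) h(1) by (rule order_tendstoD)
  then obtain N where N: "\<And>j. j \<ge> N \<Longrightarrow> m j < h" by (auto simp: eventually_sequentially)
  define A where "A = (\<Sum>j<N. m j)"
  have sum: "(\<Sum>j\<le>n. m j) \<le> A + real (Suc n) * h" for n
  proof -
    have "(\<Sum>j\<le>n. m j) \<le> (\<Sum>j\<le>n. (if j < N then m j else 0) + h)"
      using N m(2) h(1) by (intro sum_mono) (auto simp: not_less less_imp_le)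
    also have "\<dots> = (\<Sum>j\<le>n. if j < N then m j else 0) + real (Suc n) * h"
      by (simp add: sum.distrib)
    also have "(\<Sum>j\<le>n. if j < N then m j else 0) = (\<Sum>j\<in>{..n} \<inter> {..<N}. m j)"
      by (auto simp: sum.If_cases intro!: sum.cong)
    also have "\<dots> \<le> A" unfolding A_def using m(2) by (intro sum_mono2) auto
    finally show ?thesis by simp
  qed
  obtain n :: nat where n: "real n * (\<bar>I\<bar> / 2) > C + D * A + \<bar>I\<bar> / 2" "n \<ge> 3"
  proof -
    obtain n0 :: nat where "real n0 > (C + D * A + \<bar>I\<bar> / 2) / (\<bar>I\<bar> / 2)" using reals_Archimedean2 by blast
    then have "real n0 * (\<bar>I\<bar> / 2) > C + D * A + \<bar>I\<bar> / 2" using \<open>I \<noteq> 0\<close> by (simp add: field_simps)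
    moreover have "real n0 * (\<bar>I\<bar> / 2) \<le> real (max n0 3) * (\<bar>I\<bar> / 2)" by (intro mult_right_mono) auto
    ultimately show ?thesis by (intro that[of "max n0 3"]) auto
  qed
  have "real n * \<bar>I\<bar> \<le> C + D * (A + real (Suc n) * h)"
    using bound[OF n(2)] mult_left_mono[OF sum[of n] \<open>D \<ge> 0\<close>] by linarith
  also have "\<dots> = C + D * A + real (Suc n) * (D * h)" by (simp add: algebra_simps)
  also have "\<dots> \<le> C + D * A + real (Suc n) * (\<bar>I\<bar> / 2)" using h(2) by (intro add_left_mono mult_left_mono) auto
  also have "\<dots> = C + D * A + real n * (\<bar>I\<bar> / 2) + \<bar>I\<bar> / 2" by (simp add: algebra_simps add_divide_distrib)
  finally show False using n(1) by simp
qed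

lemma four_power_eq: "(4::real) ^ j = (2 ^ j)\<^sup>2"
  by (simp add: power_mult[symmetric] power_even_eq power2_eq_square power_mult_distrib[symmetric])

text \<open>The test functions are truncations of \<open>1 / (z - \<epsilon> e)\<^sup>2\<close>: the pole lies in the cone where
  \<open>w\<close> vanishes, so the weak equation gives a bound independent of \<open>\<epsilon>\<close>, while the integral against a
  source that is homogeneous of degree zero grows like its mean \<open>I\<close> over an annulus times
  \<open>ln (1 / \<epsilon>)\<close>.\<close>

lemma corner_orthogonality:
  fixes H F w :: "real^2 \<Rightarrow> real"
  assumes w: "locally_L2 w" and F: "locally_L2 F" "weak_laplacian w F"
    and e: "norm e = 1" and \<kappa>: "0 < \<kappa>" "\<kappa> \<le> 1" and "\<rho> > 0"
    and w0: "AE x in lborel. x \<in> cone_sector e \<kappa> \<rho> \<longrightarrow> w x = 0"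
    and Hm [measurable]: "H \<in> borel_measurable borel" and HB: "\<And>x. \<bar>H x\<bar> \<le> B"
    and Hhom: "\<And>t x. t > 0 \<Longrightarrow> H (t *\<^sub>R x) = H x"
    and H0: "\<And>x. norm (x - norm x *\<^sub>R e) < \<kappa> * norm x \<Longrightarrow> H x = 0"
    and avg: "((\<lambda>r. (LBINT x. indicator (ball 0 r) x * \<bar>F x - H x\<bar>) / r\<^sup>2) \<longlongrightarrow> 0) (at_right 0)"
    and c: "norm c = 1"
  shows "(LBINT x. indicator (dyadic_annulus 1 0) x * (H x * pole 0 c 2 x)) = 0"
proof -
  define \<delta> where "\<delta> = \<rho> / 2"
  have \<delta>: "\<delta> > 0" "2 * \<delta> \<le> \<rho>" using \<open>\<rho> > 0\<close> by (auto simp: \<delta>_def)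
  have B0: "B \<ge> 0" using HB[of 0] by linarith
  have [measurable]: "w \<in> borel_measurable borel" "F \<in> borel_measurable borel" using w F by auto
  define I where "I = (LBINT x. indicator (dyadic_annulus 1 0) x * (H x * pole 0 c 2 x))"
  obtain h :: "real^2 \<Rightarrow> real" where h: "test_function h" "\<And>x. 0 \<le> h x \<and> h x \<le> 1"
    "\<And>x. x \<in> cball 0 \<delta> \<Longrightarrow> h x = 1" "\<And>x. x \<notin> ball 0 (2 * \<delta>) \<Longrightarrow> h x = 0"
    by (rule cutoff_exists[of \<delta> "2 * \<delta>" 0]) (use \<delta> in \<open>auto intro: that\<close>)
  obtain B1 where B1: "B1 \<ge> 0" "\<And>x. \<bar>partial_deriv 1 h x\<bar> \<le> B1"
    using test_function_bounded_value[OF test_function_partial_deriv[OF h(1)]] by metis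
  obtain B2 where B2: "B2 \<ge> 0" "\<And>x. \<bar>partial_deriv 2 h x\<bar> \<le> B2"
    using test_function_bounded_value[OF test_function_partial_deriv[OF h(1)]] by metis
  obtain B3 where B3: "B3 \<ge> 0" "\<And>x. \<bar>laplacian h x\<bar> \<le> B3"
    using test_function_bounded_value[OF test_function_laplacian[OF h(1)]] by metis
  \<comment> \<open>A bound for the Laplacian of the test function on \<delta> \<le> |x| \<le> 2
    \<delta>, where only derivatives of the cutoff h contribute. The pole stays at distance at least
    \<delta> / 4 from there, so K does not depend on n.\<close>
  define K where "K = 2 * (2 * (4 / \<delta>) ^ 3 * B1 + 2 * (4 / \<delta>) ^ 3 * B2) + (4 / \<delta>)\<^sup>2 * B3"
  have K0: "K \<ge> 0" using \<delta> B1 B2 B3 by (auto simp: K_def)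
  \<comment> \<open>Off the disc of radius \<kappa> \<epsilon> / 8 about the pole a one has |x - a|
    \<ge> \<mu> |x|: for |x| < 2 \<epsilon> because \<kappa> \<epsilon> / 8 = 2 \<mu> \<epsilon>,
    otherwise because |x - a| \<ge> |x| / 2.\<close>
  define \<mu> where "\<mu> = \<kappa> / 16"
  have \<mu>: "\<mu> > 0" "\<mu> \<le> 1 / 16" using \<kappa> by (auto simp: \<mu>_def)
  define V where "V = measure lborel (ball (0::real^2) 1)"
  define D1 where "D1 = 1 / (\<mu> * \<delta>)\<^sup>2"
  define D2 where "D2 = 4 / (\<mu>\<^sup>2 * \<delta>\<^sup>2)"
  define D3 where "D3 = 24 * B / (\<mu>\<^sup>2 * \<delta>\<^sup>2)"
  have D0: "D1 \<ge> 0" "D2 \<ge> 0" "D3 \<ge> 0" using B0 by (auto simp: D1_def D2_def D3_def)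
  define rad where "rad = (\<lambda>j::nat. \<delta> / 2 ^ j)"
  have rad: "rad j > 0" for j using \<delta> by (simp add: rad_def)
  define m where "m = (\<lambda>j. (LBINT x. indicator (ball 0 (rad j)) x * \<bar>F x - H x\<bar>) / (rad j)\<^sup>2)"
  have iF: "integrable lborel (\<lambda>x. indicator (cball 0 r) x * \<bar>F x\<bar>)" for r
    using locally_L2_imp_locally_integrable[OF F(1)] integrable_abs
    unfolding locally_integrable_def set_integrable_def by (fastforce simp: abs_mult)
  have iball: "integrable lborel (\<lambda>x. indicator (ball (0::real^2) r) x :: real)" for r
    using emeasure_lborel_ball_finite[of "0::real^2" r] by (intro integrable_real_indicator) auto
  have iFH: "integrable lborel (\<lambda>x. indicator (ball 0 r) x * \<bar>F x - H x\<bar>)" for r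
  proof (rule Bochner_Integration.integrable_bound)
    show "integrable lborel (\<lambda>x. indicator (cball 0 r) x * \<bar>F x\<bar> + B * indicator (ball 0 r) x)"
      using iF iball by (intro Bochner_Integration.integrable_add integrable_mult_right)
    show "(\<lambda>x. indicator (ball 0 r) x * \<bar>F x - H x\<bar>) \<in> borel_measurable lborel"
      by (intro borel_measurable_times borel_measurable_indicator; simp)
    have "\<bar>F x - H x\<bar> \<le> \<bar>F x\<bar> + B" for x using HB[of x] by linarith
    then show "AE x in lborel. norm (indicator (ball 0 r) x * \<bar>F x - H x\<bar>)
        \<le> norm (indicator (cball 0 r) x * \<bar>F x\<bar> + B * indicator (ball 0 r) x)"
      using B0 by (auto simp: indicator_def)
  qed
  have main: "real n * \<bar>I\<bar> \<le> (K * (LBINT x. indicator (cball 0 (2 * \<delta>)) x * \<bar>w x\<bar>)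
      + D1 * (LBINT x. indicator (cball 0 (2 * \<delta>)) x * \<bar>F x\<bar>) + 2 * (D3 * (\<delta>\<^sup>2 * V))) + D2 * \<delta>\<^sup>2 * (\<Sum>j\<le>n. m j)"
    if n: "n \<ge> 3" for n
  proof -
    \<comment> \<open>With the pole at distance \<open>rad n\<close> exactly n dyadic annuli lie
      between it and radius \<delta>; n \<ge> 3 keeps it away from the zone where h varies.\<close>
    define \<epsilon> where "\<epsilon> = rad n"
    have \<epsilon>: "\<epsilon> > 0" "\<epsilon> \<le> \<delta> / 8"
    proof -
      have "(2::real) ^ 3 \<le> 2 ^ n" using n by (intro power_increasing) auto
      then show "\<epsilon> \<le> \<delta> / 8" unfolding \<epsilon>_def rad_def using \<delta> by (intro frac_le) auto
    qed (simp add: \<epsilon>_def rad)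
    define a where "a = \<epsilon> *\<^sub>R e"
    have na: "norm a = \<epsilon>" using e \<epsilon> by (simp add: a_def)
    obtain b :: "real^2 \<Rightarrow> real" where b: "test_function b" "\<And>x. 0 \<le> b x \<and> b x \<le> 1"
      "\<And>x. x \<in> cball a (\<kappa> * \<epsilon> / 8) \<Longrightarrow> b x = 1" "\<And>x. x \<notin> ball a (\<kappa> * \<epsilon> / 4) \<Longrightarrow> b x = 0"
      by (rule cutoff_exists[of "\<kappa> * \<epsilon> / 8" "\<kappa> * \<epsilon> / 4" a]) (use \<kappa> \<epsilon> in \<open>auto intro: that\<close>)
    have in_cone: "x \<in> cone_sector e \<kappa> \<rho>" if "x \<in> cball a (\<kappa> * \<epsilon> / 4)" for x
      using cball_subset_cone_sector[OF e \<kappa> \<epsilon>(1), of \<rho> x] that \<epsilon> \<delta>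
      by (simp add: a_def dist_norm norm_minus_commute)
    define k where "k = pole a c 2"
    \<comment> \<open>h localises to the ball of radius 2 \<delta>, and 1 - b removes the pole. The
      zone where b varies lies in the cone where w is 0, so the derivatives of b never meet
      w.\<close>
    define \<phi> where "\<phi> = (\<lambda>x. k x * (h x * (1 - b x)))"
    have th: "test_function (\<lambda>x. h x * (1 - b x))"
      by (rule test_function_mult(2)[OF _ h(1)]) (intro smooth_on_diff smooth_on_const test_function_smooth b open_UNIV)
    have \<phi>: "test_function \<phi>"
      unfolding \<phi>_def k_def
      by (rule smooth_mult_vanishing[OF smooth_on_pole th, of "\<kappa> * \<epsilon> / 8"]) (use b(3) \<kappa> \<epsilon> in auto)
    have low: "\<mu> * norm x \<le> norm (x - a)" "\<mu> * \<epsilon> \<le> norm (x - a)" if "b x \<noteq> 1" for x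
    proof -
      have far: "norm (x - a) \<ge> \<kappa> * \<epsilon> / 8"
        using b(3)[of x] that by (force simp: dist_norm norm_minus_commute)
      have tri: "norm (x - a) \<ge> norm x - \<epsilon>" using norm_triangle_ineq2[of x a] na by simp
      show "\<mu> * \<epsilon> \<le> norm (x - a)" using far \<kappa> \<epsilon> by (simp add: \<mu>_def) (smt (verit) mult_nonneg_nonneg)
      show "\<mu> * norm x \<le> norm (x - a)"
      proof (cases "norm x \<ge> 2 * \<epsilon>")
        case True
        have "\<mu> * norm x \<le> 1 / 2 * norm x" using \<mu> by (intro mult_right_mono) auto
        then show ?thesis using tri True by linarith
      next
        case False
        have "\<mu> * norm x \<le> \<mu> * (2 * \<epsilon>)" using \<mu> False by (intro mult_left_mono) auto
        then show ?thesis using far unfolding \<mu>_def by linarith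
      qed
    qed
    have \<phi>_le: "\<bar>\<phi> x\<bar> \<le> 1 / s\<^sup>2" if "s > 0" "b x \<noteq> 1 \<Longrightarrow> s \<le> norm (x - a)" for x s
    proof (cases "b x = 1")
      case False
      have "\<bar>k x\<bar> \<le> 1 / s\<^sup>2"
        using abs_pole_le[of a c 2 x] that False c unfolding k_def
        by (elim order_trans) (intro frac_le power_mono; simp)
      moreover have "\<bar>h x * (1 - b x)\<bar> \<le> 1 * 1"
        unfolding abs_mult using h(2)[of x] b(2)[of x] by (intro mult_mono) auto
      ultimately have "\<bar>k x\<bar> * \<bar>h x * (1 - b x)\<bar> \<le> (1 / s\<^sup>2) * (1 * 1)" by (intro mult_mono) auto
      then show ?thesis by (simp add: \<phi>_def abs_mult)
    qed (simp add: \<phi>_def)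
    have "\<bar>\<integral>x. F x * \<phi> x \<partial>lborel\<bar> = \<bar>\<integral>x. w x * laplacian \<phi> x \<partial>lborel\<bar>"
      using F(2) \<phi> by (simp add: weak_laplacian_def)
    also have "\<dots> \<le> (LBINT x. \<bar>w x * laplacian \<phi> x\<bar>)" by (rule integral_abs_bound)
    also have "\<dots> \<le> (LBINT x. K * (indicator (cball 0 (2 * \<delta>)) x * \<bar>w x\<bar>))"
    proof (rule integral_mono_AE)
      show "integrable lborel (\<lambda>x. \<bar>w x * laplacian \<phi> x\<bar>)"
        by (intro integrable_abs integrable_mult_test_function locally_L2_imp_locally_integrable w test_function_laplacian \<phi>)
      have "integrable lborel (\<lambda>x. \<bar>indicator (cball 0 (2 * \<delta>)) x *\<^sub>R w x\<bar>)"
        using locally_L2_imp_locally_integrable[OF w] unfolding locally_integrable_def set_integrable_def by (intro integrable_abs) blast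
      then show "integrable lborel (\<lambda>x. K * (indicator (cball 0 (2 * \<delta>)) x * \<bar>w x\<bar>))" by (simp add: abs_mult)
      show "AE x in lborel. \<bar>w x * laplacian \<phi> x\<bar> \<le> K * (indicator (cball 0 (2 * \<delta>)) x * \<bar>w x\<bar>)"
        using w0
      proof eventually_elim
        case (elim x)
        \<comment> \<open>Inside radius \<delta> and off the cone the test function is the bare
          harmonic pole; on the next annulus K applies; beyond 2 \<delta> it is 0.\<close>
        consider "w x = 0" | "norm x < \<delta>" "x \<notin> cone_sector e \<kappa> \<rho>" | "\<delta> \<le> norm x" "norm x \<le> 2 * \<delta>" | "norm x > 2 * \<delta>"
          using elim by fastforce
        then show ?case
        proof cases
          case 2
          have U: "open (ball 0 \<delta> - cball a (\<kappa> * \<epsilon> / 4))" by auto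
          have x: "x \<in> ball 0 \<delta> - cball a (\<kappa> * \<epsilon> / 4)" using 2 in_cone[of x] by auto
          have "laplacian \<phi> x = laplacian k x"
            by (rule laplacian_cong_open[OF U x]) (use b(4) h(3) in \<open>auto simp: \<phi>_def\<close>)
          moreover have "x \<noteq> a" using x \<kappa> \<epsilon> by auto
          ultimately show ?thesis using K0 by (simp add: k_def laplacian_pole)
        next
          case 3
          define U where "U = - cball (0::real^2) (\<delta> / 2)"
          have U: "open U" "x \<in> U" using 3 \<delta> by (auto simp: U_def)
          have b0: "b y = 0" if "y \<in> U" for y
          proof (rule b(4))
            have "norm y \<le> norm (y - a) + \<epsilon>" using norm_triangle_ineq[of "y - a" a] na by simp
            moreover have "norm y > \<delta> / 2" using that by (simp add: U_def)
            ultimately have "norm (y - a) > \<epsilon>" using \<epsilon> by linarith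
            moreover have "\<kappa> * \<epsilon> \<le> 1 * \<epsilon>" using \<kappa> \<epsilon> by (intro mult_right_mono) auto
            ultimately have "\<kappa> * \<epsilon> / 4 \<le> norm (y - a)" using \<epsilon> by linarith
            then show "y \<notin> ball a (\<kappa> * \<epsilon> / 4)"
              by (simp add: dist_norm norm_minus_commute)
          qed
          have aU: "a \<notin> U" using na \<epsilon> by (simp add: U_def)
          then have sk: "smooth_on U k" unfolding k_def by (intro smooth_on_subset[OF smooth_on_pole]) auto
          have sh: "smooth_on U h" using smooth_on_subset[OF test_function_smooth[OF h(1)]] by simp
          have xa: "x \<noteq> a" using U aU by auto
          have "laplacian \<phi> x = laplacian (\<lambda>x. k x * h x) x"
            by (rule laplacian_cong_open[OF U]) (simp add: \<phi>_def b0)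
          also have "\<dots> = 2 * (partial_deriv 1 k x * partial_deriv 1 h x + partial_deriv 2 k x * partial_deriv 2 h x)
              + k x * laplacian h x"
            using laplacian_mult[OF U sk sh] laplacian_pole[OF xa] by (simp add: k_def)
          finally have lap: "laplacian \<phi> x = \<dots>" .
          have dist: "\<delta> / 4 \<le> norm (x - a)" using norm_triangle_ineq2[of x a] na 3 \<epsilon> by linarith
          have kb: "\<bar>pole a c' p x\<bar> \<le> norm c' * (4 / \<delta>) ^ p" for c' p
          proof -
            have "norm c' / norm (x - a) ^ p \<le> norm c' / (\<delta> / 4) ^ p"
              using dist \<delta> by (intro frac_le power_mono) auto
            also have "\<dots> = norm c' * (4 / \<delta>) ^ p" by (simp add: power_divide)
            finally show ?thesis using abs_pole_le[of a c' p x] by linarith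
          qed
          have k0: "\<bar>k x\<bar> \<le> (4 / \<delta>)\<^sup>2" using kb[of c 2] c by (simp add: k_def)
          have k1: "\<bar>partial_deriv 1 k x\<bar> \<le> 2 * (4 / \<delta>) ^ 3" "\<bar>partial_deriv 2 k x\<bar> \<le> 2 * (4 / \<delta>) ^ 3"
            using kb[of "- (of_nat 2 * c)" 3] kb[of "- (of_nat 2 * c * \<i>)" 3] c
            unfolding k_def partial_deriv_pole[OF xa] by (simp_all add: norm_mult numeral_3_eq_3)
          have "\<bar>partial_deriv 1 k x * partial_deriv 1 h x\<bar> \<le> 2 * (4 / \<delta>) ^ 3 * B1"
            "\<bar>partial_deriv 2 k x * partial_deriv 2 h x\<bar> \<le> 2 * (4 / \<delta>) ^ 3 * B2"
            "\<bar>k x * laplacian h x\<bar> \<le> (4 / \<delta>)\<^sup>2 * B3"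
            unfolding abs_mult[of "partial_deriv _ k x"] abs_mult[of "k x"]
            using k0 k1 B1 B2 B3 \<delta> by (intro mult_mono; simp)+
          then have "\<bar>laplacian \<phi> x\<bar> \<le> K" unfolding lap K_def by (rule abs_combination_le)
          then have "\<bar>w x\<bar> * \<bar>laplacian \<phi> x\<bar> \<le> \<bar>w x\<bar> * K" by (intro mult_left_mono) auto
          then show ?thesis using 3 by (simp add: abs_mult mult.commute)
        next
          case 4
          have "laplacian \<phi> x = laplacian (\<lambda>x. 0) x"
            by (rule laplacian_cong_open[of "- cball 0 (2 * \<delta>)"]) (use 4 h(4) in \<open>auto simp: \<phi>_def\<close>)
          then show ?thesis using K0 by (simp add: laplacian_def)
        qed (use K0 in simp)
      qed
    qed
    finally have lhs: "\<bar>\<integral>x. F x * \<phi> x \<partial>lborel\<bar> \<le> K * (LBINT x. indicator (cball 0 (2 * \<delta>)) x * \<bar>w x\<bar>)" by simp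
    \<comment> \<open>A majorant with three kinds of error: F away from the corner, the deviation F
      - H at each scale, and the displacement of the pole. The innermost ball |x| < \<epsilon>,
      which belongs to none of the annuli, is charged to the terms j = n.\<close>
    define T where "T = (\<lambda>x. D1 * (indicator (cball 0 (2 * \<delta>)) x * \<bar>F x\<bar>)
      + (\<Sum>j\<le>n. D2 * 4 ^ j * (indicator (ball 0 (rad j)) x * \<bar>F x - H x\<bar>))
      + (\<Sum>j\<le>n. D3 * (2 ^ j / 2 ^ n * 4 ^ j) * indicator (ball 0 (rad j)) x))"
    define M where "M = (\<lambda>x. \<Sum>j<n. indicator (dyadic_annulus \<delta> j) x * (H x * pole 0 c 2 x))"
    have pt: "\<bar>M x - F x * \<phi> x\<bar> \<le> T x" if "x \<noteq> 0" for x
    proof -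
      have nn: "0 \<le> D1 * (indicator (cball 0 (2 * \<delta>)) x * \<bar>F x\<bar>)"
        "0 \<le> (\<Sum>j\<le>n. D2 * 4 ^ j * (indicator (ball 0 (rad j)) x * \<bar>F x - H x\<bar>))"
        "0 \<le> (\<Sum>j\<le>n. D3 * (2 ^ j / 2 ^ n * 4 ^ j) * indicator (ball 0 (rad j)) x)"
        using D0 by (auto intro!: sum_nonneg)
      have Meq: "M x = (if \<epsilon> \<le> norm x \<and> norm x < \<delta> then H x * pole 0 c 2 x else 0)"
        unfolding M_def sum_distrib_right[symmetric] sum_indicator_dyadic_annulus[OF \<delta>(1)] by (simp add: \<epsilon>_def rad_def)
      have split: "T x \<ge> D2 * 4 ^ j * \<bar>F x - H x\<bar> + D3 * (2 ^ j / 2 ^ n * 4 ^ j)" if "j \<le> n" "norm x < rad j" for j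
      proof -
        have "D2 * 4 ^ j * (indicator (ball 0 (rad j)) x * \<bar>F x - H x\<bar>)
            \<le> (\<Sum>j\<le>n. D2 * 4 ^ j * (indicator (ball 0 (rad j)) x * \<bar>F x - H x\<bar>))"
          using that D0 by (intro member_le_sum) auto
        moreover have "D3 * (2 ^ j / 2 ^ n * 4 ^ j) * indicator (ball 0 (rad j)) x
            \<le> (\<Sum>j\<le>n. D3 * (2 ^ j / 2 ^ n * 4 ^ j) * indicator (ball 0 (rad j)) x)"
          using that D0 by (intro member_le_sum) auto
        ultimately show ?thesis using nn(1) that(2) unfolding T_def by simp
      qed
      consider "norm x \<ge> \<delta>" | "norm x < \<epsilon>" | "\<epsilon> \<le> norm x" "norm x < \<delta>" by linarith
      then show ?thesis
      proof cases
        case 1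
        have "\<bar>F x * \<phi> x\<bar> \<le> D1 * (indicator (cball 0 (2 * \<delta>)) x * \<bar>F x\<bar>)"
        proof (cases "norm x \<le> 2 * \<delta>")
          case True
          have "\<bar>\<phi> x\<bar> \<le> 1 / (\<mu> * \<delta>)\<^sup>2"
          proof (rule \<phi>_le)
            show "\<mu> * \<delta> \<le> norm (x - a)" if "b x \<noteq> 1"
              using low(1)[OF that] mult_left_mono[OF 1, of \<mu>] \<mu> by linarith
          qed (use \<mu> \<delta> in auto)
          then have "\<bar>F x\<bar> * \<bar>\<phi> x\<bar> \<le> \<bar>F x\<bar> * D1" unfolding D1_def by (intro mult_left_mono) auto
          then show ?thesis using True by (simp add: abs_mult mult.commute)
        next
          case False
          then have "\<phi> x = 0" using h(4)[of x] by (simp add: \<phi>_def)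
          then show ?thesis using False by simp
        qed
        then show ?thesis using nn 1 unfolding Meq T_def by simp
      next
        case 2
        have "\<bar>\<phi> x\<bar> \<le> 1 / (\<mu> * \<epsilon>)\<^sup>2" by (rule \<phi>_le) (use low \<mu> \<epsilon> in auto)
        also have "\<dots> = 4 ^ n / (\<mu>\<^sup>2 * \<delta>\<^sup>2)"
        proof -
          have "(4::real) ^ n = (2 ^ n)\<^sup>2" by (rule four_power_eq)
          then show ?thesis by (simp add: \<epsilon>_def rad_def power_mult_distrib power_divide)
        qed
        finally have \<phi>b: "\<bar>\<phi> x\<bar> \<le> 4 ^ n / (\<mu>\<^sup>2 * \<delta>\<^sup>2)" .
        have "\<bar>F x * \<phi> x\<bar> \<le> (\<bar>F x - H x\<bar> + B) * (4 ^ n / (\<mu>\<^sup>2 * \<delta>\<^sup>2))"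
          unfolding abs_mult using \<phi>b HB[of x] B0 by (intro mult_mono) auto
        also have "\<dots> \<le> D2 * 4 ^ n * \<bar>F x - H x\<bar> + D3 * (2 ^ n / 2 ^ n * 4 ^ n)"
        proof -
          have "4 ^ n / (\<mu>\<^sup>2 * \<delta>\<^sup>2) * \<bar>F x - H x\<bar> \<le> D2 * 4 ^ n * \<bar>F x - H x\<bar>"
            unfolding D2_def using \<mu> \<delta> by (intro mult_right_mono) (auto simp: field_simps)
          moreover have "B * (4 ^ n / (\<mu>\<^sup>2 * \<delta>\<^sup>2)) \<le> D3 * (2 ^ n / 2 ^ n * 4 ^ n)"
            unfolding D3_def using \<mu> \<delta> B0 by (auto simp: field_simps)
          ultimately show ?thesis
            unfolding distrib_right mult.commute[of "\<bar>F x - H x\<bar>" "4 ^ n / (\<mu>\<^sup>2 * \<delta>\<^sup>2)"] by linarith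
        qed
        also have "\<dots> \<le> T x" using 2 by (intro split) (auto simp: \<epsilon>_def)
        finally show ?thesis using 2 unfolding Meq by simp
      next
        case 3
        obtain j where j: "j < n" "x \<in> dyadic_annulus \<delta> j"
          using exists_dyadic_annulus[OF \<delta>(1), of n x] 3 by (auto simp: \<epsilon>_def rad_def)
        have xj: "rad j / 2 \<le> norm x" "norm x < rad j" using j(2) by (auto simp: dyadic_annulus_def rad_def)
        have radsq: "(rad j)\<^sup>2 = \<delta>\<^sup>2 / 4 ^ j"
        proof -
          have "(4::real) ^ j = (2 ^ j)\<^sup>2" by (rule four_power_eq)
          then show ?thesis by (simp add: rad_def power_divide)
        qed
        have nx: "norm x > 0" using that by simp
        have "\<bar>\<phi> x\<bar> \<le> 1 / (\<mu> * (rad j / 2))\<^sup>2"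
        proof (rule \<phi>_le)
          show "\<mu> * (rad j / 2) \<le> norm (x - a)" if "b x \<noteq> 1"
            using low(1)[OF that] mult_left_mono[OF xj(1), of \<mu>] \<mu> by linarith
        qed (use \<mu> rad in auto)
        also have "\<dots> = D2 * 4 ^ j"
          unfolding power_mult_distrib power_divide radsq D2_def by simp
        finally have \<phi>b: "\<bar>\<phi> x\<bar> \<le> D2 * 4 ^ j" .
        have "\<bar>(F x - H x) * \<phi> x\<bar> \<le> \<bar>F x - H x\<bar> * (D2 * 4 ^ j)"
          unfolding abs_mult using \<phi>b by (intro mult_left_mono) auto
        moreover have "\<bar>H x * pole 0 c 2 x - H x * \<phi> x\<bar> \<le> D3 * (2 ^ j / 2 ^ n * 4 ^ j)"
        proof (cases "H x = 0")
          case False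
          have "x \<notin> cone_sector e \<kappa> \<rho>" using H0[of x] False by (auto simp: cone_sector_def)
          then have b0: "b x = 0" using b(4)[of x] in_cone[of x] by (meson ball_subset_cball subsetD)
          have "\<phi> x = pole a c 2 x" using b0 h(3)[of x] 3 by (simp add: \<phi>_def k_def)
          moreover have "\<bar>pole a c 2 x - pole 0 c 2 x\<bar> \<le> 3 * norm a / (\<mu>\<^sup>2 * norm x ^ 3)"
            by (rule pole_difference[OF c]) (use 3 na \<mu> low(1)[of x] b0 nx in auto)
          moreover have "3 * norm a / (\<mu>\<^sup>2 * norm x ^ 3) \<le> 3 * \<epsilon> / (\<mu>\<^sup>2 * (rad j / 2) ^ 3)"
            unfolding na using xj(1) \<mu> \<epsilon> rad[of j] by (intro frac_le mult_left_mono power_mono mult_pos_pos) auto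
          ultimately have d: "\<bar>pole 0 c 2 x - \<phi> x\<bar> \<le> 3 * \<epsilon> / (\<mu>\<^sup>2 * (rad j / 2) ^ 3)" by linarith
          have "\<bar>H x * pole 0 c 2 x - H x * \<phi> x\<bar> = \<bar>H x\<bar> * \<bar>pole 0 c 2 x - \<phi> x\<bar>"
            by (simp add: abs_mult[symmetric] right_diff_distrib)
          also have "\<dots> \<le> B * (3 * \<epsilon> / (\<mu>\<^sup>2 * (rad j / 2) ^ 3))"
            using d HB[of x] B0 by (intro mult_mono) auto
          also have "\<dots> = D3 * (2 ^ j / 2 ^ n * 4 ^ j)"
          proof -
            have r3: "rad j ^ 3 = (rad j)\<^sup>2 * rad j" by (simp add: power2_eq_square power3_eq_cube)
            have "(rad j / 2) ^ 3 = \<delta>\<^sup>2 / 4 ^ j * (\<delta> / 2 ^ j) / 8"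
              unfolding power_divide r3 radsq by (simp add: rad_def)
            then show ?thesis
              using \<delta> \<mu> by (simp add: D3_def \<epsilon>_def rad_def field_simps)
          qed
          finally show ?thesis .
        qed (use D0 in simp)
        moreover have "M x - F x * \<phi> x = (H x * pole 0 c 2 x - H x * \<phi> x) - (F x - H x) * \<phi> x"
          using 3 unfolding Meq by (simp add: algebra_simps)
        moreover have "D2 * 4 ^ j * \<bar>F x - H x\<bar> + D3 * (2 ^ j / 2 ^ n * 4 ^ j) \<le> T x"
          using j(1) xj(2) by (intro split) auto
        ultimately show ?thesis by (simp add: mult.commute)
      qed
    qed
    have iA: "integrable lborel (\<lambda>x. indicator (dyadic_annulus \<delta> j) x * (H x * pole 0 c 2 x))" for j
    proof (rule Bochner_Integration.integrable_bound)
      show "integrable lborel (\<lambda>x. (B * (4 / (rad j)\<^sup>2)) * indicator (ball (0::real^2) (rad j)) x)"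
        by (intro integrable_mult_right iball)
      show "(\<lambda>x. indicator (dyadic_annulus \<delta> j) x * (H x * pole 0 c 2 x)) \<in> borel_measurable lborel"
        by (intro borel_measurable_times borel_measurable_indicator; simp)
      have "\<bar>H x * pole 0 c 2 x\<bar> \<le> B * (4 / (rad j)\<^sup>2)" "x \<in> ball 0 (rad j)" if "x \<in> dyadic_annulus \<delta> j" for x
      proof -
        have xj: "rad j / 2 \<le> norm x" "norm x < rad j" using that by (auto simp: dyadic_annulus_def rad_def)
        have "\<bar>pole 0 c 2 x\<bar> \<le> 1 / (norm x)\<^sup>2" using abs_pole_le[of 0 c 2 x] c by simp
        also have "\<dots> \<le> 1 / (rad j / 2)\<^sup>2" using xj rad[of j] by (intro frac_le power_mono) auto
        also have "\<dots> = 4 / (rad j)\<^sup>2" by (simp add: power_divide)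
        finally show "\<bar>H x * pole 0 c 2 x\<bar> \<le> B * (4 / (rad j)\<^sup>2)"
          unfolding abs_mult using HB[of x] B0 by (intro mult_mono) auto
        show "x \<in> ball 0 (rad j)" using xj by simp
      qed
      then show "AE x in lborel. norm (indicator (dyadic_annulus \<delta> j) x * (H x * pole 0 c 2 x))
          \<le> norm ((B * (4 / (rad j)\<^sup>2)) * indicator (ball 0 (rad j)) x)"
        using B0 by (auto simp: indicator_def)
    qed
    \<comment> \<open>Scale invariance: area scales by (rad j)^2, the kernel by the inverse of that,
      and H not at all.\<close>
    have intA: "(LBINT x. indicator (dyadic_annulus \<delta> j) x * (H x * pole 0 c 2 x)) = I" for j
    proof -
      have "(LBINT x. indicator (dyadic_annulus \<delta> j) x * (H x * pole 0 c 2 x))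
          = (rad j)\<^sup>2 * (LBINT x. indicator (dyadic_annulus \<delta> j) (0 + rad j *\<^sub>R x) * (H (0 + rad j *\<^sub>R x) * pole 0 c 2 (0 + rad j *\<^sub>R x)))"
        using rad[of j]
        by (intro lborel_integral_affine borel_measurable_times borel_measurable_indicator) auto
      also have "(LBINT x. indicator (dyadic_annulus \<delta> j) (0 + rad j *\<^sub>R x) * (H (0 + rad j *\<^sub>R x) * pole 0 c 2 (0 + rad j *\<^sub>R x)))
          = (LBINT x. (indicator (dyadic_annulus 1 0) x * (H x * pole 0 c 2 x)) / (rad j)\<^sup>2)"
      proof (rule Bochner_Integration.integral_cong)
        fix x :: "real^2"
        have "0 + rad j *\<^sub>R x \<in> dyadic_annulus \<delta> j \<longleftrightarrow> x \<in> dyadic_annulus 1 0"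
          using \<delta> by (auto simp: dyadic_annulus_def rad_def field_simps)
        then show "indicator (dyadic_annulus \<delta> j) (0 + rad j *\<^sub>R x) * (H (0 + rad j *\<^sub>R x) * pole 0 c 2 (0 + rad j *\<^sub>R x))
            = (indicator (dyadic_annulus 1 0) x * (H x * pole 0 c 2 x)) / (rad j)\<^sup>2"
          using rad[of j] Hhom[of "rad j" x] pole_scale[of "rad j" c x] by (simp add: indicator_def)
      qed simp
      finally show ?thesis using rad[of j] by (simp add: I_def)
    qed
    have iM: "integrable lborel M"
      unfolding M_def by (intro Bochner_Integration.integrable_sum iA)
    have intM: "(LBINT x. M x) = real n * I"
      unfolding M_def by (subst Bochner_Integration.integral_sum[OF iA]) (simp only: intA sum_constant card_lessThan)
    have iFp: "integrable lborel (\<lambda>x. F x * \<phi> x)"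
      by (intro integrable_mult_test_function locally_L2_imp_locally_integrable F \<phi>)
    have iT: "integrable lborel T"
      unfolding T_def
      by (intro Bochner_Integration.integrable_add Bochner_Integration.integrable_sum integrable_mult_right iF iFH iball)
    have "\<bar>(LBINT x. M x) - (LBINT x. F x * \<phi> x)\<bar> = \<bar>\<integral>x. M x - F x * \<phi> x \<partial>lborel\<bar>"
      using iM iFp by simp
    also have "\<dots> \<le> (LBINT x. \<bar>M x - F x * \<phi> x\<bar>)" by (rule integral_abs_bound)
    also have "\<dots> \<le> (LBINT x. T x)"
    proof (rule integral_mono_AE[OF _ iT])
      show "integrable lborel (\<lambda>x. \<bar>M x - F x * \<phi> x\<bar>)" using iM iFp by (intro integrable_abs Bochner_Integration.integrable_diff)
      show "AE x in lborel. \<bar>M x - F x * \<phi> x\<bar> \<le> T x"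
        using AE_lborel_singleton[of 0] by eventually_elim (rule pt)
    qed
    also have "\<dots> = D1 * (LBINT x. indicator (cball 0 (2 * \<delta>)) x * \<bar>F x\<bar>)
        + (\<Sum>j\<le>n. D2 * 4 ^ j * (LBINT x. indicator (ball 0 (rad j)) x * \<bar>F x - H x\<bar>))
        + (\<Sum>j\<le>n. D3 * (2 ^ j / 2 ^ n * 4 ^ j) * measure lborel (ball (0::real^2) (rad j)))"
      unfolding T_def using iF iFH iball by simp
    also have "(\<Sum>j\<le>n. D2 * 4 ^ j * (LBINT x. indicator (ball 0 (rad j)) x * \<bar>F x - H x\<bar>)) = D2 * \<delta>\<^sup>2 * (\<Sum>j\<le>n. m j)"
      unfolding sum_distrib_left
    proof (rule sum.cong)
      fix j
      have "(4::real) ^ j = (2 ^ j)\<^sup>2" by (rule four_power_eq)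
      then have "\<delta>\<^sup>2 = 4 ^ j * (rad j)\<^sup>2" by (simp add: rad_def power_divide)
      then show "D2 * 4 ^ j * (LBINT x. indicator (ball 0 (rad j)) x * \<bar>F x - H x\<bar>) = D2 * \<delta>\<^sup>2 * m j"
        using rad[of j] by (simp add: m_def)
    qed simp
    \<comment> \<open>The factor 4^j cancels the area of the ball of radius \<open>rad j\<close>;
      the geometric sum of 2^j / 2^n that remains is below 2 for every n.\<close>
    also have "(\<Sum>j\<le>n. D3 * (2 ^ j / 2 ^ n * 4 ^ j) * measure lborel (ball (0::real^2) (rad j))) \<le> 2 * (D3 * (\<delta>\<^sup>2 * V))"
    proof -
      have "D3 * (2 ^ j / 2 ^ n * 4 ^ j) * measure lborel (ball (0::real^2) (rad j)) = D3 * (\<delta>\<^sup>2 * V) / 2 ^ n * 2 ^ j" for j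
      proof -
        have "(4::real) ^ j = (2 ^ j)\<^sup>2" by (rule four_power_eq)
        then show ?thesis using measure_ball_scale[OF rad, of j] by (simp add: V_def rad_def power_divide)
      qed
      then have "(\<Sum>j\<le>n. D3 * (2 ^ j / 2 ^ n * 4 ^ j) * measure lborel (ball (0::real^2) (rad j)))
          = D3 * (\<delta>\<^sup>2 * V) / 2 ^ n * (\<Sum>j\<le>n. 2 ^ j)" by (simp only: sum_distrib_left)
      also have "(\<Sum>j\<le>n. (2::real) ^ j) = 2 ^ Suc n - 1"
        using geometric_sum[of "2::real" "Suc n"] by (simp add: lessThan_Suc_atMost)
      also have "D3 * (\<delta>\<^sup>2 * V) / 2 ^ n * (2 ^ Suc n - 1) \<le> D3 * (\<delta>\<^sup>2 * V) / 2 ^ n * 2 ^ Suc n"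
        using D0 by (intro mult_left_mono) (auto simp: V_def)
      also have "\<dots> = 2 * (D3 * (\<delta>\<^sup>2 * V))" by simp
      finally show ?thesis .
    qed
    finally have "\<bar>real n * I - (LBINT x. F x * \<phi> x)\<bar>
        \<le> D1 * (LBINT x. indicator (cball 0 (2 * \<delta>)) x * \<bar>F x\<bar>) + D2 * \<delta>\<^sup>2 * (\<Sum>j\<le>n. m j) + 2 * (D3 * (\<delta>\<^sup>2 * V))"
      unfolding intM by simp
    moreover have "real n * \<bar>I\<bar> = \<bar>real n * I\<bar>" by (simp add: abs_mult)
    ultimately show ?thesis using lhs by linarith
  qed
  have "I = 0"
  proof (rule zero_of_cesaro_bound[OF main])
    show "0 \<le> D2 * \<delta>\<^sup>2" using D0 by simp
    have "filterlim rad (at_right 0) sequentially"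
    proof -
      have "rad \<longlonglongrightarrow> 0" unfolding rad_def by real_asymp
      moreover have "rad j \<noteq> 0" for j using rad[of j] by simp
      ultimately show ?thesis using rad by (simp add: filterlim_at)
    qed
    then show "m \<longlonglongrightarrow> 0"
      unfolding m_def by (rule filterlim_compose[OF avg])
    show "0 \<le> m j" for j
      unfolding m_def by (intro divide_nonneg_nonneg Bochner_Integration.integral_nonneg) auto
  qed
  then show ?thesis by (simp add: I_def)
qed

section \<open>Moments of sectors\<close>

definition sector :: "real \<Rightarrow> real \<Rightarrow> (real^2) set" where
  "sector a b = {r *\<^sub>R circle_point \<theta> | r \<theta>. a < \<theta> \<and> \<theta> < b \<and> 0 < r}"

definition rotate :: "real \<Rightarrow> real^2 \<Rightarrow> real^2" where
  "rotate t x = vector [cos t * x $ 1 - sin t * x $ 2, sin t * x $ 1 + cos t * x $ 2]"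

lemma sectorI: "a < \<theta> \<Longrightarrow> \<theta> < b \<Longrightarrow> 0 < r \<Longrightarrow> r *\<^sub>R circle_point \<theta> \<in> sector a b"
  unfolding sector_def by blast

lemma sectorE:
  assumes "x \<in> sector a b"
  obtains r \<theta> where "x = r *\<^sub>R circle_point \<theta>" "a < \<theta>" "\<theta> < b" "0 < r"
  using assms unfolding sector_def by blast

lemma cplx_inject: "cplx x = cplx y \<longleftrightarrow> x = y"
  by (auto simp: cplx_def vec_eq_iff forall_2)

lemma cplx_circle_point: "cplx (circle_point \<theta>) = cis \<theta>"
  by (simp add: cplx_def complex_eq_iff)

lemma cplx_rotate: "cplx (rotate t x) = cis t * cplx x"
  by (simp add: cplx_def rotate_def vector_2 complex_eq_iff)

lemma rotate_linear: "linear (rotate t)"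
  by (rule linearI) (simp_all add: cplx_inject[symmetric] cplx_rotate cplx_linear algebra_simps)

lemma norm_rotate [simp]: "norm (rotate t x) = norm x"
  using norm_cplx[of "rotate t x"] by (simp add: cplx_rotate norm_mult del: norm_cplx) simp

lemma rotate_rotate: "rotate s (rotate t x) = rotate (s + t) x"
  by (simp add: cplx_inject[symmetric] cplx_rotate cis_mult[symmetric] mult.assoc)

lemma rotate_0 [simp]: "rotate 0 x = x"
  by (simp add: cplx_inject[symmetric] cplx_rotate)

lemma rotate_scaleR_circle_point: "rotate t (r *\<^sub>R circle_point \<theta>) = r *\<^sub>R circle_point (\<theta> + t)"
  by (simp add: cplx_inject[symmetric] cplx_rotate cplx_linear cplx_circle_point cis_mult[symmetric] mult_ac)

lemma rotate_measurable [measurable]: "rotate t \<in> borel_measurable borel"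
  using rotate_linear linear_continuous_on linear_conv_bounded_linear
  by (intro borel_measurable_continuous_onI) blast

text \<open>Checked on boxes, where it is the invariance of Lebesgue measure under orthogonal
  maps.\<close>

lemma lborel_distr_rotate: "distr lborel borel (rotate t) = (lborel :: (real^2) measure)"
proof (rule sym, rule lborel_eqI)
  fix l u :: "real^2" assume le: "\<And>b. b \<in> Basis \<Longrightarrow> l \<bullet> b \<le> u \<bullet> b"
  have vim: "rotate t -` box l u = rotate (- t) ` box l u"
  proof
    show "rotate t -` box l u \<subseteq> rotate (- t) ` box l u"
      by (rule subsetI, rule image_eqI[where x = "rotate t _"]) (auto simp: rotate_rotate)
    show "rotate (- t) ` box l u \<subseteq> rotate t -` box l u"
      by (auto simp: rotate_rotate)
  qed
  have orth: "orthogonal_transformation (rotate (- t))"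
    using rotate_linear by (simp add: orthogonal_transformation)
  have "rotate (- t) ` box l u \<in> lmeasurable"
    by (rule measurable_linear_image[OF rotate_linear]) simp
  then have fin: "emeasure lebesgue (rotate (- t) ` box l u) \<noteq> \<infinity>"
    using emeasure_eq_measure2 fmeasurableD2 by force
  have bm: "rotate t -` box l u \<in> sets borel"
    using measurable_sets[OF rotate_measurable, of "box l u" t] by simp
  have "emeasure (distr lborel borel (rotate t)) (box l u) = emeasure lborel (rotate (- t) ` box l u)"
    by (subst emeasure_distr) (auto simp: vim)
  also have "\<dots> = emeasure lebesgue (rotate (- t) ` box l u)"
    using bm by (simp add: vim)
  also have "\<dots> = ennreal (measure lebesgue (rotate (- t) ` box l u))"
    using fin by (simp add: emeasure_eq_ennreal_measure)
  also have "measure lebesgue (rotate (- t) ` box l u) = measure lebesgue (box l u)"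
    using measure_linear_image[OF rotate_linear, of "box l u" "- t"] orth by simp
  also have "\<dots> = (\<Prod>b\<in>Basis. (u - l) \<bullet> b)"
    using le by (simp add: measure_lborel_box_eq)
  finally show "emeasure (distr lborel borel (rotate t)) (box l u) = ennreal (\<Prod>b\<in>Basis. (u - l) \<bullet> b)" .
qed simp

lemma integral_rotate:
  fixes f :: "real^2 \<Rightarrow> real"
  assumes [measurable]: "f \<in> borel_measurable borel"
  shows "(LBINT x. f (rotate t x)) = (LBINT x. f x)"
proof -
  have "(LBINT x. f (rotate t x)) = (\<integral>x. f x \<partial>distr lborel borel (rotate t))"
    by (rule integral_distr[symmetric]) auto
  then show ?thesis by (simp add: lborel_distr_rotate)
qed

text \<open>An open sector is a countable union of compact images of polar rectangles.\<close>

lemma sector_measurable [measurable]: "sector a b \<in> sets borel"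
proof -
  let ?Q = "\<lambda>n::nat. {1 / real (Suc n)..real (Suc n)} \<times> {a + 1 / real (Suc n)..b - 1 / real (Suc n)}"
  let ?p = "\<lambda>(r, \<theta>). r *\<^sub>R circle_point \<theta>"
  have eq: "sector a b = (\<Union>n. ?p ` ?Q n)"
  proof
    show "sector a b \<subseteq> (\<Union>n. ?p ` ?Q n)"
    proof
      fix x assume "x \<in> sector a b"
      then obtain r \<theta> where x: "x = r *\<^sub>R circle_point \<theta>" "a < \<theta>" "\<theta> < b" "0 < r"
        by (auto simp: sector_def)
      define m where "m = Min {r, \<theta> - a, b - \<theta>}"
      have m: "m > 0" "m \<le> r" "m \<le> \<theta> - a" "m \<le> b - \<theta>" using x by (auto simp: m_def)
      obtain n where n: "1 / m < real (Suc n)" "r < real (Suc n)"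
        using reals_Archimedean2[of "max (1 / m) r"] by (metis less_SucI max_less_iff_conj of_nat_less_iff order_less_trans lessI)
      then have "1 / real (Suc n) < m" using m(1) by (simp add: field_simps)
      then have "(r, \<theta>) \<in> ?Q n" using m n by auto
      then show "x \<in> (\<Union>n. ?p ` ?Q n)" using x(1) by force
    qed
    show "(\<Union>n. ?p ` ?Q n) \<subseteq> sector a b"
    proof
      fix x assume "x \<in> (\<Union>n. ?p ` ?Q n)"
      then obtain n r \<theta> where *: "x = r *\<^sub>R circle_point \<theta>" "1 / real (Suc n) \<le> r" "a + 1 / real (Suc n) \<le> \<theta>" "\<theta> \<le> b - 1 / real (Suc n)"
        by auto
      have "1 / real (Suc n) > 0" by simp
      then have "a < \<theta>" "\<theta> < b" "0 < r" using * by linarith+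
      then show "x \<in> sector a b" using *(1) by (auto simp: sector_def)
    qed
  qed
  have "compact (?p ` ?Q n)" for n
    unfolding case_prod_beta
    by (intro compact_continuous_image compact_Times continuous_intros continuous_on_circle_point) auto
  then have "?p ` ?Q n \<in> sets borel" for n
    by (rule borel_closed[OF compact_imp_closed])
  then show ?thesis
    unfolding eq by (intro sets.countable_UN image_subsetI)
qed

lemma sector_scaleR: "t > 0 \<Longrightarrow> t *\<^sub>R x \<in> sector a b \<longleftrightarrow> x \<in> sector a b"
proof -
  have *: "t *\<^sub>R x \<in> sector a b" if "x \<in> sector a b" "t > 0" for t x
    using that unfolding sector_def by (force simp: scaleR_scaleR)
  assume "t > 0"
  then show ?thesis using *[of x t] *[of "t *\<^sub>R x" "inverse t"] by auto
qed

lemma sector_rotate: "rotate t x \<in> sector (a + t) (b + t) \<longleftrightarrow> x \<in> sector a b"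
proof -
  have *: "rotate t x \<in> sector (a + t) (b + t)" if x: "x \<in> sector a b" for t x a b
  proof -
    obtain r \<theta> where r: "x = r *\<^sub>R circle_point \<theta>" "a < \<theta>" "\<theta> < b" "0 < r"
      using x unfolding sector_def by blast
    have "r *\<^sub>R circle_point (\<theta> + t) \<in> sector (a + t) (b + t)"
      using r by (intro sectorI) auto
    then show ?thesis by (simp only: r(1) rotate_scaleR_circle_point)
  qed
  show ?thesis using *[of x a b t] *[of "rotate t x" "a + t" "b + t" "- t"] by (auto simp: rotate_rotate)
qed

lemma circle_point_eq_imp:
  assumes "r *\<^sub>R circle_point s = r' *\<^sub>R circle_point t" "0 < r" "0 < r'"
  shows "r = r'" "\<exists>n::int. s = t + 2 * pi * of_int n"
proof -
  show "r = r'" using arg_cong[OF assms(1), of norm] assms(2,3) by (simp add: norm_circle_point)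
  then have "circle_point s = circle_point t" using assms by simp
  then have "sin s = sin t \<and> cos s = cos t" by (metis circle_point_nth)
  then show "\<exists>n::int. s = t + 2 * pi * of_int n" using sin_cos_eq_iff[of s t] by auto
qed

text \<open>The separating ray lies on a line through the origin and is null. The two pieces are
  disjoint because their angles differ by a positive amount below 2 \<pi>, so they cannot give the
  same direction.\<close>

lemma AE_sector_split:
  assumes "a < b" "b < c" "c \<le> a + 2 * pi"
  shows "AE x in lborel. (indicator (sector a c) x :: real) = indicator (sector a b) x + indicator (sector b c) x"
proof -
  define n :: "real^2" where "n = vector [- sin b, cos b]"
  have "n \<noteq> 0"
  proof
    assume "n = 0"
    then have "n $ 1 = 0" "n $ 2 = 0" by simp_all
    then have "sin b = 0" "cos b = 0" by (simp_all add: n_def vector_2)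
    then show False using sin_cos_squared_add[of b] by simp
  qed
  then have "negligible {x. n \<bullet> x = 0}" by (intro negligible_hyperplane) simp
  then have "AE x in lborel. x \<notin> {x. n \<bullet> x = 0}"
    using AE_not_in[of "{x. n \<bullet> x = 0}" lebesgue] by (simp add: negligible_iff_null_sets AE_completion_iff)
  then show ?thesis
  proof eventually_elim
    case (elim x)
    have ray: "x \<noteq> r *\<^sub>R circle_point b" for r
    proof
      assume "x = r *\<^sub>R circle_point b"
      then have "n \<bullet> x = 0" by (simp add: n_def inner_vec_def UNIV_2 vector_2)
      with elim show False by simp
    qed
    have "x \<in> sector a c \<longleftrightarrow> x \<in> sector a b \<or> x \<in> sector b c"
    proof
      assume "x \<in> sector a c"
      then obtain r \<theta> where *: "x = r *\<^sub>R circle_point \<theta>" "a < \<theta>" "\<theta> < c" "0 < r" by (rule sectorE)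
      have "\<theta> \<noteq> b" using ray *(1) by blast
      then show "x \<in> sector a b \<or> x \<in> sector b c"
        unfolding *(1) using sectorI[of a \<theta> b r] sectorI[of b \<theta> c r] *(2-4) by linarith
    qed (use assms in \<open>force simp: sector_def\<close>)
    moreover have "\<not> (x \<in> sector a b \<and> x \<in> sector b c)"
    proof
      assume "x \<in> sector a b \<and> x \<in> sector b c"
      then have xs: "x \<in> sector a b" "x \<in> sector b c" by blast+
      obtain r \<theta> where *: "x = r *\<^sub>R circle_point \<theta>" "a < \<theta>" "\<theta> < b" "0 < r" using xs(1) by (rule sectorE)
      obtain r' \<theta>' where **: "x = r' *\<^sub>R circle_point \<theta>'" "b < \<theta>'" "\<theta>' < c" "0 < r'" using xs(2) by (rule sectorE)
      obtain m :: int where m: "\<theta>' = \<theta> + 2 * pi * of_int m"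
        using circle_point_eq_imp(2)[of r' \<theta>' r \<theta>, OF trans[OF **(1)[symmetric] *(1)] **(4) *(4)] by blast
      have "0 < 2 * pi * of_int m" "2 * pi * of_int m < 2 * pi * 1" using m *(2,3) **(2,3) assms by linarith+
      then have "0 < (of_int m :: real)" "(of_int m :: real) < 1" by (simp_all add: zero_less_mult_iff)
      then show False by simp
    qed
    ultimately show ?case by (auto simp: indicator_def)
  qed
qed

text \<open>In polar coordinates this is ln 2 times the integral of Re (c exp (- 2 \<i> \<theta>))
  from a to b, for sectors of at most a full turn. It is never evaluated: its behaviour under
  rotation and splitting is enough.\<close>

definition sector_moment :: "complex \<Rightarrow> real \<Rightarrow> real \<Rightarrow> real" where
  "sector_moment c a b = (LBINT x. indicator (dyadic_annulus 1 0) x * (indicator (sector a b) x * pole 0 c 2 x))"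

lemma integrable_sector_moment:
  "integrable lborel (\<lambda>x. indicator (dyadic_annulus 1 0) x * (indicator (sector a b) x * pole 0 c 2 x))"
proof (rule Bochner_Integration.integrable_bound)
  show "integrable lborel (\<lambda>x. (4 * norm c) * indicator (ball (0::real^2) 1) x)"
    by (intro integrable_mult_right integrable_indicator_ball)
  show "(\<lambda>x. indicator (dyadic_annulus 1 0) x * (indicator (sector a b) x * pole 0 c 2 x)) \<in> borel_measurable lborel"
    by (intro borel_measurable_times borel_measurable_indicator; simp)
  have "\<bar>pole 0 c 2 x\<bar> \<le> 4 * norm c" "x \<in> ball 0 1" if "x \<in> dyadic_annulus 1 0" for x
  proof -
    have x: "1 / 2 \<le> norm x" "norm x < 1" using that by (auto simp: dyadic_annulus_def)
    have "\<bar>pole 0 c 2 x\<bar> \<le> norm c / (norm x)\<^sup>2" using abs_pole_le[of 0 c 2 x] by simp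
    also have "\<dots> \<le> norm c / (1 / 2)\<^sup>2" using x by (intro frac_le power_mono) auto
    finally show "\<bar>pole 0 c 2 x\<bar> \<le> 4 * norm c" by (simp add: power2_eq_square)
    show "x \<in> ball 0 1" using x by simp
  qed
  then show "AE x in lborel. norm (indicator (dyadic_annulus 1 0) x * (indicator (sector a b) x * pole 0 c 2 x))
      \<le> norm ((4 * norm c) * indicator (ball (0::real^2) 1) x)"
    by (auto simp: indicator_def)
qed

lemma sector_moment_add:
  assumes "a < b" "b < d" "d \<le> a + 2 * pi"
  shows "sector_moment c a d = sector_moment c a b + sector_moment c b d"
proof -
  have "sector_moment c a d = (LBINT x. indicator (dyadic_annulus 1 0) x * (indicator (sector a b) x * pole 0 c 2 x)
      + indicator (dyadic_annulus 1 0) x * (indicator (sector b d) x * pole 0 c 2 x))"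
    unfolding sector_moment_def
  proof (rule integral_cong_AE)
    show "AE x in lborel. indicator (dyadic_annulus 1 0) x * (indicator (sector a d) x * pole 0 c 2 x)
        = indicator (dyadic_annulus 1 0) x * (indicator (sector a b) x * pole 0 c 2 x)
        + indicator (dyadic_annulus 1 0) x * (indicator (sector b d) x * pole 0 c 2 x)"
      using AE_sector_split[OF assms] by eventually_elim (simp add: algebra_simps)
  qed (intro borel_measurable_add borel_measurable_integrable integrable_sector_moment)+
  also have "\<dots> = sector_moment c a b + sector_moment c b d"
    unfolding sector_moment_def by (intro Bochner_Integration.integral_add integrable_sector_moment)
  finally show ?thesis .
qed

lemma sector_moment_rotate: "sector_moment c (a + t) (b + t) = sector_moment (c * cis (- 2 * t)) a b"
proof -
  let ?f = "\<lambda>x. indicator (dyadic_annulus 1 0) x * (indicator (sector (a + t) (b + t)) x * pole 0 c 2 x)"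
  have m: "?f \<in> borel_measurable borel"
    by (intro borel_measurable_times borel_measurable_indicator; simp)
  have "pole 0 c 2 (rotate t x) = pole 0 (c * cis (- 2 * t)) 2 x" for x
  proof -
    have "(cis t)\<^sup>2 = inverse (cis (- 2 * t))" by (simp add: power2_eq_square cis_mult)
    then have "c / cplx (rotate t x) ^ 2 = c * cis (- 2 * t) / cplx x ^ 2"
      by (simp add: cplx_rotate power_mult_distrib divide_inverse mult_ac)
    then show ?thesis by (simp add: pole_def)
  qed
  moreover have "indicator (dyadic_annulus 1 0) (rotate t x) = (indicator (dyadic_annulus 1 0) x :: real)" for x
    by (simp add: indicator_def dyadic_annulus_def)
  moreover have "indicator (sector (a + t) (b + t)) (rotate t x) = (indicator (sector a b) x :: real)" for x
    by (simp add: indicator_def sector_rotate)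
  ultimately show ?thesis
    unfolding sector_moment_def using integral_rotate[OF m, of t] by simp
qed

text \<open>The complex number z with \<open>sector_moment c a b = Re (c * z)\<close> for all c; Re
  (\<i> z) = - Im z explains the sign.\<close>

definition sector_moment_cplx :: "real \<Rightarrow> real \<Rightarrow> complex" where
  "sector_moment_cplx a b = Complex (sector_moment 1 a b) (- sector_moment \<i> a b)"

lemma sector_moment_eq: "sector_moment c a b = Re (c * sector_moment_cplx a b)"
proof -
  have "pole 0 c 2 x = Re c * pole 0 1 2 x + Im c * pole 0 \<i> 2 x" for x
  proof -
    have "c = of_real (Re c) + of_real (Im c) * \<i>" by (simp add: complex_eq_iff)
    then have "c / cplx x ^ 2 = of_real (Re c) * (1 / cplx x ^ 2) + of_real (Im c) * (\<i> / cplx x ^ 2)"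
      by (metis (no_types, lifting) add_divide_distrib mult.right_neutral times_divide_eq_right)
    then have "Re (c / cplx x ^ 2) = Re (of_real (Re c) * (1 / cplx x ^ 2)) + Re (of_real (Im c) * (\<i> / cplx x ^ 2))"
      by (simp only: plus_complex.simps)
    then show ?thesis
      unfolding pole_def by (simp only: times_complex.simps Re_complex_of_real Im_complex_of_real) simp
  qed
  then have "sector_moment c a b = (LBINT x. Re c * (indicator (dyadic_annulus 1 0) x * (indicator (sector a b) x * pole 0 1 2 x))
      + Im c * (indicator (dyadic_annulus 1 0) x * (indicator (sector a b) x * pole 0 \<i> 2 x)))"
    unfolding sector_moment_def by (simp add: algebra_simps)
  also have "\<dots> = Re c * sector_moment 1 a b + Im c * sector_moment \<i> a b"
    using integrable_sector_moment by (simp add: sector_moment_def)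
  finally show ?thesis by (simp add: sector_moment_cplx_def)
qed

lemma complex_eq_of_Re_mult: "(\<And>c. Re (c * z) = Re (c * w)) \<Longrightarrow> z = w"
proof -
  assume *: "\<And>c. Re (c * z) = Re (c * w)"
  show "z = w" using *[of 1] *[of \<i>] by (simp add: complex_eq_iff)
qed

lemma sector_moment_cplx_rotate: "sector_moment_cplx (a + t) (b + t) = cis (- 2 * t) * sector_moment_cplx a b"
  by (rule complex_eq_of_Re_mult)
    (simp only: sector_moment_eq[symmetric] sector_moment_rotate mult.assoc[symmetric])

lemma sector_moment_cplx_add:
  "a < b \<Longrightarrow> b < d \<Longrightarrow> d \<le> a + 2 * pi \<Longrightarrow> sector_moment_cplx a d = sector_moment_cplx a b + sector_moment_cplx b d"
  by (simp add: sector_moment_cplx_def sector_moment_add complex_eq_iff)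

text \<open>Rotation covariance and additivity make \<open>t \<mapsto> sector_moment_cplx 0 t\<close> a cocycle, which
  determines it up to a constant factor.\<close>

lemma sector_moment_cplx_formula:
  assumes "0 < b - a" "b - a < 2 * pi"
  shows "sector_moment_cplx a b = \<i> * sector_moment_cplx 0 (pi / 2) * sin (b - a) * cis (- (a + b))"
proof -
  define \<Psi> where "\<Psi> = sector_moment_cplx 0"
  have split: "\<Psi> (s + t) = \<Psi> s + cis (- 2 * s) * \<Psi> t" if "0 < s" "0 < t" "s + t < 2 * pi" for s t
    using sector_moment_cplx_add[of 0 s "s + t"] sector_moment_cplx_rotate[of 0 s t] that
    by (simp add: \<Psi>_def add.commute)
  have cis_pi: "cis (- 2 * (pi / 2)) = -1" by (simp add: complex_eq_iff)
  \<comment> \<open>Expanding \<Psi> at t + \<pi> / 2 in both orders gives a linear equation for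
    \<Psi> t, provided t + \<pi> / 2 stays below a full turn.\<close>
  have small: "\<Psi> t = \<Psi> (pi / 2) / 2 * (1 - cis (- 2 * t))" if t: "0 < t" "t < 3 * pi / 2" for t
  proof -
    have "\<Psi> t + cis (- 2 * t) * \<Psi> (pi / 2) = \<Psi> (pi / 2) + cis (- 2 * (pi / 2)) * \<Psi> t"
      using split[of t "pi / 2"] split[of "pi / 2" t] t by (simp add: add.commute)
    then have "2 * \<Psi> t = \<Psi> (pi / 2) * (1 - cis (- 2 * t))"
      unfolding cis_pi by (simp add: algebra_simps)
    then show ?thesis by (simp add: field_simps)
  qed
  \<comment> \<open>Halving the angle and using the cocycle once more removes the restriction to t <
    3 \<pi> / 2.\<close>
  have all: "\<Psi> t = \<Psi> (pi / 2) / 2 * (1 - cis (- 2 * t))" if t: "0 < t" "t < 2 * pi" for t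
  proof -
    have h: "0 < t / 2" "t / 2 < 3 * pi / 2" using t pi_gt_zero by linarith+
    have "\<Psi> t = \<Psi> (t / 2) + cis (- 2 * (t / 2)) * \<Psi> (t / 2)"
      using split[of "t / 2" "t / 2"] t by simp
    also have "\<dots> = \<Psi> (pi / 2) / 2 * (1 - cis (- t) * cis (- t))"
    proof -
      have "\<Psi> (t / 2) = \<Psi> (pi / 2) / 2 * (1 - cis (- t))" using small[OF h] by simp
      moreover have "cis (- 2 * (t / 2)) = cis (- t)" by simp
      moreover have "z / 2 * (1 - c) + c * (z / 2 * (1 - c)) = z / 2 * (1 - c * c)" for z c :: complex
        by (simp add: field_simps)
      ultimately show ?thesis by metis
    qed
    also have "cis (- t) * cis (- t) = cis (- 2 * t)" by (simp add: cis_mult)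
    finally show ?thesis .
  qed
  define t where "t = b - a"
  have "sector_moment_cplx a b = cis (- 2 * a) * \<Psi> t"
    using sector_moment_cplx_rotate[of 0 a t] by (simp add: \<Psi>_def t_def)
  also have "\<dots> = \<Psi> (pi / 2) / 2 * (cis (- 2 * a) * (1 - cis (- 2 * t)))"
    using all[of t] assms by (simp add: t_def)
  also have "1 - cis (- 2 * t) = cis (- t) * (2 * \<i> * sin t)"
  proof -
    have "cis (- t) * (cis t - cis (- t)) = 1 - cis (- 2 * t)"
      by (simp add: right_diff_distrib cis_mult)
    moreover have "cis t - cis (- t) = 2 * \<i> * sin t" by (simp add: complex_eq_iff)
    ultimately show ?thesis by simp
  qed
  also have "cis (- 2 * a) * (cis (- t) * (2 * \<i> * sin t)) = 2 * \<i> * sin t * cis (- (a + b))"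
    by (simp add: mult.assoc[symmetric] cis_mult) (simp add: t_def algebra_simps)
  finally show ?thesis by (simp add: \<Psi>_def t_def mult_ac)
qed

text \<open>For c = \<i> the kernel is sin (2 \<theta>) / r^2, positive on the open quadrant, so its
  integral over the annular quadrant cannot vanish.\<close>

lemma sector_moment_cplx_quadrant_nonzero: "sector_moment_cplx 0 (pi / 2) \<noteq> 0"
proof
  assume "sector_moment_cplx 0 (pi / 2) = 0"
  then have z: "sector_moment \<i> 0 (pi / 2) = 0" by (simp add: sector_moment_eq)
  let ?f = "\<lambda>x. indicator (dyadic_annulus 1 0) x * (indicator (sector 0 (pi / 2)) x * pole 0 \<i> 2 x)"
  have pos: "pole 0 \<i> 2 x > 0" if xs: "x \<in> sector 0 (pi / 2)" for x
  proof -
    obtain r \<theta> where x: "x = r *\<^sub>R circle_point \<theta>" "0 < \<theta>" "\<theta> < pi / 2" "0 < r"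
      using xs by (rule sectorE)
    have "inverse ((cis \<theta>)\<^sup>2) = cis (- (2 * \<theta>))"
      by (simp add: power2_eq_square cis_mult)
    then have "\<i> / cplx x ^ 2 = of_real (inverse (r\<^sup>2)) * (\<i> * cis (- (2 * \<theta>)))"
      unfolding x(1) by (simp add: cplx_linear cplx_circle_point power_mult_distrib divide_inverse)
    then have "Re (\<i> / cplx x ^ 2) = inverse (r\<^sup>2) * sin (2 * \<theta>)"
      by (simp only: times_complex.simps Re_complex_of_real Im_complex_of_real) simp
    then have "pole 0 \<i> 2 x = inverse (r\<^sup>2) * sin (2 * \<theta>)"
      by (simp add: pole_def)
    then show ?thesis using x by (simp add: sin_gt_zero)
  qed
  have nn: "?f x \<ge> 0" for x using pos[of x] by (auto simp: indicator_def less_imp_le)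
  have "AE x in lborel. ?f x = 0"
    using z integral_nonneg_eq_0_iff_AE[OF integrable_sector_moment[of 0 "pi / 2" \<i>]] nn
    by (simp add: sector_moment_def)
  then have ae: "AE x in lborel. x \<notin> dyadic_annulus 1 0 \<inter> sector 0 (pi / 2)"
    by eventually_elim (use pos in \<open>force simp: indicator_def split: if_splits\<close>)
  \<comment> \<open>A nonempty open part of the annular quadrant, which would have to be
    null.\<close>
  define U where "U = {x::real^2. 1 / 2 < norm x \<and> norm x < 1 \<and> 0 < x $ 1 \<and> 0 < x $ 2}"
  have "open U"
    unfolding U_def by (intro open_Collect_conj open_Collect_less continuous_intros)
  have "U \<subseteq> dyadic_annulus 1 0 \<inter> sector 0 (pi / 2)"
  proof
    fix x assume x: "x \<in> U"
    then have n: "norm x > 0" by (auto simp: U_def)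
    obtain \<theta> where t: "\<theta> \<in> {0..2*pi}" "x = norm x *\<^sub>R circle_point \<theta>" using polar_decomposition by blast
    have "x $ 1 = norm x * cos \<theta>" "x $ 2 = norm x * sin \<theta>"
      using arg_cong[OF t(2), of "\<lambda>v. v $ 1"] arg_cong[OF t(2), of "\<lambda>v. v $ 2"] by simp_all
    then have cs: "cos \<theta> > 0" "sin \<theta> > 0" using x n by (auto simp: U_def zero_less_mult_iff)
    have "\<theta> < pi" using cs(2) t(1) sin_le_zero[of \<theta>] by (cases "\<theta> < pi") (auto simp: not_less le_less)
    moreover have "\<theta> > 0" using cs(2) t(1) by (cases "\<theta> = 0") auto
    moreover have "\<theta> < pi / 2"
    proof (rule ccontr)
      assume "\<not> \<theta> < pi / 2"
      then have "cos \<theta> \<le> cos (pi / 2)" using \<open>\<theta> < pi\<close> by (intro cos_monotone_0_pi_le) auto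
      then show False using cs(1) by simp
    qed
    ultimately have "x \<in> sector 0 (pi / 2)" using sectorI[of 0 \<theta> "pi / 2" "norm x"] t(2) n by simp
    then show "x \<in> dyadic_annulus 1 0 \<inter> sector 0 (pi / 2)" using x by (auto simp: U_def dyadic_annulus_def)
  qed
  then have "AE x in lebesgue. x \<notin> U" using ae by (intro AE_completion) (auto elim!: eventually_mono)
  then have "negligible U"
    using \<open>open U\<close> by (simp add: negligible_iff_null_sets AE_iff_null_sets[symmetric] borel_open)
  moreover have "vector [1 / 2, 1 / 2] \<in> U"
  proof -
    let ?v = "vector [1 / 2, 1 / 2] :: real^2"
    have n: "(norm ?v)\<^sup>2 = 1 / 2" 
      unfolding power2_norm_eq_nth vector_2 by (simp add: power2_eq_square)
    have "(1 / 2)\<^sup>2 < (norm ?v)\<^sup>2" "(norm ?v)\<^sup>2 < 1\<^sup>2" unfolding n by (simp_all add: power2_eq_square)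
    then have "1 / 2 < norm ?v" "norm ?v < 1"
      using power2_less_imp_less[of "1 / 2" "norm ?v"] power2_less_imp_less[of "norm ?v" 1] by auto
    then show ?thesis by (simp add: U_def vector_2)
  qed
  ultimately show False using open_not_negligible[OF \<open>open U\<close>] by blast
qed

text \<open>\<open>H\<close> is the homogeneous leading part of F. The remainder is at most a power
  of |x| plus a multiple of |w|; both have mean o(1) over small discs, the second by
  \<open>cone_average_tendsto_0\<close>. So \<open>corner_orthogonality\<close> applies to H; c = 1
  and c = \<i> together give a complex identity, from which the nonzero quadrant moment is
  cancelled.\<close>

theorem sector_moments_equal:
  fixes w :: "bool \<Rightarrow> real^2 \<Rightarrow> real"
  assumes w: "\<And>j. locally_L2 (w j)" and G: "\<And>j i. locally_L2 (G j i)" "\<And>j i. weak_partial i (w j) (G j i)"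
    and F: "locally_L2 F" "weak_laplacian (w True) F"
    and e: "norm e = 1" and \<kappa>: "0 < \<kappa>" "\<kappa> \<le> 1" and "\<rho> > 0"
    and w0: "\<And>j. AE x in lborel. x \<in> cone_sector e \<kappa> \<rho> \<longrightarrow> w j x = 0"
    and ab: "0 < b - a" "b - a < 2 * pi" "0 < b' - a'" "b' - a' < 2 * pi"
    and disj: "\<And>x. norm (x - norm x *\<^sub>R e) < \<kappa> * norm x \<Longrightarrow> x \<notin> sector a b \<and> x \<notin> sector a' b'"
    and close: "AE x in lborel. norm x < \<rho> \<longrightarrow>
      \<bar>F x - (p * indicator (sector a b) x - p' * indicator (sector a' b') x)\<bar>
        \<le> C * norm x powr \<alpha> + M * (\<bar>w True x\<bar> + \<bar>w False x\<bar>)"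
    and "C \<ge> 0" "\<alpha> > 0" "M \<ge> 0"
  shows "complex_of_real (p * sin (b - a)) * cis (- (a + b)) = complex_of_real (p' * sin (b' - a')) * cis (- (a' + b'))"
proof -
  define H where "H = (\<lambda>x. p * indicator (sector a b) x - p' * indicator (sector a' b') x)"
  have Hm: "H \<in> borel_measurable borel"
    unfolding H_def
    by (intro borel_measurable_diff borel_measurable_times borel_measurable_const borel_measurable_indicator sector_measurable)
  have [measurable]: "F \<in> borel_measurable borel" "\<And>j. w j \<in> borel_measurable borel" using F w by auto
  define V where "V = measure lborel (ball (0::real^2) 1)"
  have avg: "((\<lambda>r. (LBINT x. indicator (ball 0 r) x * \<bar>F x - H x\<bar>) / r\<^sup>2) \<longlongrightarrow> 0) (at_right 0)"
  proof -
    let ?m = "\<lambda>j r. (LBINT x. indicator (ball 0 r) x * \<bar>w j x\<bar>) / r\<^sup>2"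
    have 1: "((\<lambda>r. C * (r powr \<alpha> * V) + M * (?m True r + ?m False r)) \<longlongrightarrow> 0) (at_right 0)"
    proof -
      have "((\<lambda>r. r powr \<alpha>) \<longlongrightarrow> 0) (at_right (0::real))"
        using \<open>\<alpha> > 0\<close> by real_asymp
      then have "((\<lambda>r. C * (r powr \<alpha> * V) + M * (?m True r + ?m False r)) \<longlongrightarrow> C * (0 * V) + M * (0 + 0)) (at_right 0)"
        by (intro tendsto_intros cone_average_tendsto_0[OF w G e \<kappa> \<open>\<rho> > 0\<close> w0])
      then show ?thesis by simp
    qed
    have 2: "\<forall>\<^sub>F r in at_right 0. 0 \<le> (LBINT x. indicator (ball 0 r) x * \<bar>F x - H x\<bar>) / r\<^sup>2"
      by (intro always_eventually allI divide_nonneg_nonneg Bochner_Integration.integral_nonneg) auto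
    have ev: "\<forall>\<^sub>F r in at_right (0::real). 0 < r \<and> r < \<rho>"
      using \<open>\<rho> > 0\<close> by (auto simp: eventually_at_right_field intro!: exI[of _ \<rho>])
    have 3: "\<forall>\<^sub>F r in at_right 0. (LBINT x. indicator (ball 0 r) x * \<bar>F x - H x\<bar>) / r\<^sup>2
        \<le> C * (r powr \<alpha> * V) + M * (?m True r + ?m False r)"
      using ev
    proof eventually_elim
      case (elim r)
      have iw: "integrable lborel (\<lambda>x. indicator (ball 0 r) x * \<bar>w j x\<bar>)" for j
      proof (rule Bochner_Integration.integrable_bound)
        show "integrable lborel (\<lambda>x. indicator (cball 0 r) x *\<^sub>R w j x)"
          using locally_L2_imp_locally_integrable[OF w] by (simp add: locally_integrable_def set_integrable_def)
        show "(\<lambda>x. indicator (ball 0 r) x * \<bar>w j x\<bar>) \<in> borel_measurable lborel"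
          by (intro borel_measurable_times borel_measurable_indicator; simp)
      qed (auto simp: indicator_def)
      note ib = integrable_indicator_ball[of "0::real^2" r]
      let ?T = "\<lambda>x. C * r powr \<alpha> * indicator (ball 0 r) x
        + M * (indicator (ball 0 r) x * \<bar>w True x\<bar> + indicator (ball 0 r) x * \<bar>w False x\<bar>)"
      have iT: "integrable lborel ?T"
        by (intro Bochner_Integration.integrable_add integrable_mult_right ib iw)
      have le: "AE x in lborel. indicator (ball 0 r) x * \<bar>F x - H x\<bar> \<le> ?T x"
        using close
      proof eventually_elim
        case (elim x)
        show ?case
        proof (cases "norm x < r")
          case True
          have "C * norm x powr \<alpha> \<le> C * r powr \<alpha>"
            using True \<open>C \<ge> 0\<close> \<open>\<alpha> > 0\<close> by (intro mult_left_mono powr_mono2) auto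
          then show ?thesis using elim True \<open>0 < r \<and> r < \<rho>\<close> by (simp add: H_def)
        qed simp
      qed
      have "(LBINT x. indicator (ball 0 r) x * \<bar>F x - H x\<bar>) \<le> (LBINT x. ?T x)"
      proof (rule integral_mono_AE[OF _ iT le])
        have "(\<lambda>x. indicator (ball 0 r) x * \<bar>F x - H x\<bar>) \<in> borel_measurable lborel"
          using Hm by (intro borel_measurable_times borel_measurable_indicator; simp)
        then show "integrable lborel (\<lambda>x. indicator (ball 0 r) x * \<bar>F x - H x\<bar>)"
          using le by (intro Bochner_Integration.integrable_bound[OF iT]) (auto elim!: eventually_mono)
      qed
      also have "\<dots> = C * r powr \<alpha> * (r\<^sup>2 * V) + M * ((LBINT x. indicator (ball 0 r) x * \<bar>w True x\<bar>)
          + (LBINT x. indicator (ball 0 r) x * \<bar>w False x\<bar>))"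
        using ib iw measure_ball_scale[of r] elim by (simp add: V_def)
      finally have "(LBINT x. indicator (ball 0 r) x * \<bar>F x - H x\<bar>) / r\<^sup>2 \<le> \<dots> / r\<^sup>2"
        by (rule divide_right_mono) simp
      also have "\<dots> = C * (r powr \<alpha> * V) + M * (?m True r + ?m False r)"
        using elim by (simp add: field_simps)
      finally show ?case .
    qed
    show ?thesis by (rule tendsto_sandwich[OF 2 3 tendsto_const 1])
  qed
  have orth: "(LBINT x. indicator (dyadic_annulus 1 0) x * (H x * pole 0 c 2 x)) = 0" if "norm c = 1" for c
  proof (rule corner_orthogonality[OF w F e \<kappa> \<open>\<rho> > 0\<close> w0 Hm _ _ _ avg that])
    show "\<bar>H x\<bar> \<le> \<bar>p\<bar> + \<bar>p'\<bar>" for x by (auto simp: H_def indicator_def)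
    show "H (t *\<^sub>R x) = H x" if "t > 0" for t x
      using sector_scaleR[OF that] by (simp add: H_def indicator_def)
    show "H x = 0" if "norm (x - norm x *\<^sub>R e) < \<kappa> * norm x" for x
      using disj[OF that] by (simp add: H_def)
  qed
  have "p * sector_moment c a b = p' * sector_moment c a' b'" if "norm c = 1" for c
  proof -
    have "0 = (LBINT x. p * (indicator (dyadic_annulus 1 0) x * (indicator (sector a b) x * pole 0 c 2 x))
        - p' * (indicator (dyadic_annulus 1 0) x * (indicator (sector a' b') x * pole 0 c 2 x)))"
    proof -
      have "indicator (dyadic_annulus 1 0) x * (H x * pole 0 c 2 x)
        = p * (indicator (dyadic_annulus 1 0) x * (indicator (sector a b) x * pole 0 c 2 x))
        - p' * (indicator (dyadic_annulus 1 0) x * (indicator (sector a' b') x * pole 0 c 2 x))" for x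
        unfolding H_def by (simp only: left_diff_distrib right_diff_distrib mult_ac)
      then show ?thesis using orth[OF that] by simp
    qed
    also have "\<dots> = p * sector_moment c a b - p' * sector_moment c a' b'"
      using integrable_sector_moment by (simp add: sector_moment_def)
    finally show ?thesis by simp
  qed
  from this[of 1] this[of \<i>]
  have "of_real p * sector_moment_cplx a b = of_real p' * sector_moment_cplx a' b'"
    by (simp add: complex_eq_iff sector_moment_cplx_def)
  then have "(\<i> * sector_moment_cplx 0 (pi / 2)) * (complex_of_real p * complex_of_real (sin (b - a)) * cis (- (a + b)))
      = (\<i> * sector_moment_cplx 0 (pi / 2)) * (complex_of_real p' * complex_of_real (sin (b' - a')) * cis (- (a' + b')))"
    unfolding sector_moment_cplx_formula[OF ab(1,2)] sector_moment_cplx_formula[OF ab(3,4)] by (simp only: mult_ac)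
  then show ?thesis using sector_moment_cplx_quadrant_nonzero by (simp only: mult_cancel_left of_real_mult) simp
qed

section \<open>Polygons and corners\<close>

text \<open>Simplicity passes to the tail, and the first edge meets the tail only at its own end
  points: the induction step for the local description of a polygon away from its vertices.\<close>

lemma simple_path_polygonal_path_ConsD:
  assumes "simple_path (polygonal_path (a # b # c # vs))"
  shows "simple_path (polygonal_path (b # c # vs))"
    "closed_segment a b \<inter> path_image (polygonal_path (b # c # vs)) \<subseteq> {a, b}"
proof -
  have start: "pathstart (polygonal_path (b # us)) = b" for us
    by (cases us rule: remdups_adj.cases) auto
  have eq: "pathfinish (linepath a b) = pathstart (polygonal_path (b # c # vs))" by (simp only: start pathfinish_linepath)
  have s: "simple_path (linepath a b +++ polygonal_path (b # c # vs))" using assms by simp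
  show "simple_path (polygonal_path (b # c # vs))"
    using simple_path_joinE[OF s eq] arc_imp_simple_path by blast
  show "closed_segment a b \<inter> path_image (polygonal_path (b # c # vs)) \<subseteq> {a, b}"
    using simple_path_joinE[OF s eq] by (simp only: start path_image_linepath pathstart_linepath) blast
qed

lemma path_image_polygonal_path_Cons:
  "path_image (polygonal_path (a # b # c # vs)) = closed_segment a b \<union> path_image (polygonal_path (b # c # vs))"
proof -
  have start: "pathstart (polygonal_path (b # us)) = b" for us
    by (cases us rule: remdups_adj.cases) auto
  then have "pathfinish (linepath a b) = pathstart (polygonal_path (b # c # vs))" by (simp only: start pathfinish_linepath)
  from path_image_join[OF this] show ?thesis by (simp only: polygonal_path.simps path_image_linepath)
qed

lemma set_subset_path_image_polygonal_path: "vs \<noteq> [] \<Longrightarrow> set vs \<subseteq> path_image (polygonal_path vs)"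
proof (induction vs rule: polygonal_path.induct)
  case (4 a b c vs)
  then show ?case unfolding path_image_polygonal_path_Cons by auto
qed auto

lemma closed_path_image_polygonal_path: "closed (path_image (polygonal_path vs))"
proof (induction vs rule: polygonal_path.induct)
  case (4 a b c vs)
  then show ?case unfolding path_image_polygonal_path_Cons by (intro closed_Un closed_segment) auto
qed auto

lemma negligible_closed_segment: "negligible (closed_segment a (b :: real^2))"
proof (cases "a = b")
  case False
  define n :: "real^2" where "n = vector [- (b - a) $ 2, (b - a) $ 1]"
  have "n \<noteq> 0" using False by (auto simp: n_def vec_eq_iff forall_2 vector_2)
  have "n \<bullet> (b - a) = 0" by (simp add: n_def inner_vec_def UNIV_2 vector_2 algebra_simps)
  have "closed_segment a b \<subseteq> {z. n \<bullet> z = n \<bullet> a}"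
  proof
    fix z assume "z \<in> closed_segment a b"
    then obtain u where "z = (1 - u) *\<^sub>R a + u *\<^sub>R b" by (auto simp: in_segment)
    then have "z = a + u *\<^sub>R (b - a)" by (simp add: algebra_simps)
    then show "z \<in> {z. n \<bullet> z = n \<bullet> a}" using \<open>n \<bullet> (b - a) = 0\<close> by (simp add: inner_add_right)
  qed
  then show ?thesis using negligible_hyperplane[of n "n \<bullet> a"] \<open>n \<noteq> 0\<close> negligible_subset by blast
qed simp

lemma negligible_path_image_polygonal_path: "negligible (path_image (polygonal_path vs))"
proof (induction vs rule: polygonal_path.induct)
  case (4 a b c vs)
  then show ?case unfolding path_image_polygonal_path_Cons by (intro negligible_Un negligible_closed_segment) auto
qed (auto simp: negligible_closed_segment)

text \<open>By simplicity, only one edge passes through a point that is not a vertex.\<close>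

lemma polygonal_path_locally_line:
  assumes "simple_path (polygonal_path vs)" "x \<notin> set vs"
  shows "\<exists>v \<epsilon>. \<epsilon> > 0 \<and> path_image (polygonal_path vs) \<inter> ball x \<epsilon> \<subseteq> {x + t *\<^sub>R v | t. True}"
  using assms
proof (induction vs rule: polygonal_path.induct)
  have seg: "\<exists>\<epsilon>>0. closed_segment a b \<inter> ball x \<epsilon> \<subseteq> {x + t *\<^sub>R (b - a) | t. True}" for a b :: "real^2"
  proof (cases "x \<in> closed_segment a b")
    case True
    then obtain u where u: "x = (1 - u) *\<^sub>R a + u *\<^sub>R b" by (auto simp: in_segment)
    have "z \<in> {x + t *\<^sub>R (b - a) | t. True}" if "z \<in> closed_segment a b" for z
    proof -
      obtain u' where "z = (1 - u') *\<^sub>R a + u' *\<^sub>R b" using \<open>z \<in> closed_segment a b\<close> by (auto simp: in_segment)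
      then have "z = x + (u' - u) *\<^sub>R (b - a)" unfolding u by (simp add: algebra_simps)
      then show ?thesis by blast
    qed
    then show ?thesis using zero_less_one by blast
  next
    case False
    then obtain \<epsilon> where "\<epsilon> > 0" "ball x \<epsilon> \<subseteq> - closed_segment a b"
      using open_contains_ball[of "- closed_segment a b"] closed_segment[of a b] by (auto simp: open_Compl)
    then show ?thesis by blast
  qed
  {
    case 1
    then show ?case using seg[of 0 0] by (simp only: polygonal_path.simps path_image_linepath) blast
  next
    case (2 a)
    then show ?case using seg[of a a] by (simp only: polygonal_path.simps path_image_linepath) blast
  next
    case (3 a b)
    then show ?case using seg[of a b] by (simp only: polygonal_path.simps path_image_linepath) blast
  next
    case (4 a b c vs)
    let ?L = "path_image (polygonal_path (b # c # vs))"
    note D = simple_path_polygonal_path_ConsD[OF 4(2)]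
    have "x \<notin> set (b # c # vs)" using 4(3) by simp
    from 4(1)[OF D(1) this] obtain v \<epsilon> where v: "\<epsilon> > 0" "?L \<inter> ball x \<epsilon> \<subseteq> {x + t *\<^sub>R v | t. True}" by blast
    obtain \<epsilon>' where \<epsilon>': "\<epsilon>' > 0" "closed_segment a b \<inter> ball x \<epsilon>' \<subseteq> {x + t *\<^sub>R (b - a) | t. True}" using seg by blast
    have "x \<notin> closed_segment a b \<or> x \<notin> ?L" using D(2) 4(3) by auto
    then show ?case
    proof
      assume "x \<notin> closed_segment a b"
      then obtain \<delta> where "\<delta> > 0" "ball x \<delta> \<subseteq> - closed_segment a b"
        using open_contains_ball[of "- closed_segment a b"] closed_segment[of a b] by (auto simp: open_Compl)
      then show ?thesis unfolding path_image_polygonal_path_Cons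
        using v by (intro exI[of _ v] exI[of _ "min \<delta> \<epsilon>"]) auto
    next
      assume "x \<notin> ?L"
      then obtain \<delta> where "\<delta> > 0" "ball x \<delta> \<subseteq> - ?L"
        using open_contains_ball[of "- ?L"] closed_path_image_polygonal_path[of "b # c # vs"] by (auto simp: open_Compl)
      then show ?thesis unfolding path_image_polygonal_path_Cons
        using \<epsilon>' by (intro exI[of _ "b - a"] exI[of _ "min \<delta> \<epsilon>'"]) auto
    qed
  }
qed

lemma frontier_polygon_region_subset: "frontier (polygon_region vs) \<subseteq> polygon_boundary vs"
proof -
  have cl: "closed (polygon_boundary vs)" by (simp add: polygon_boundary_def closed_path_image_polygonal_path)
  have "closure (polygon_region vs) \<subseteq> polygon_boundary vs \<union> inside (polygon_boundary vs)"
    unfolding polygon_region_def closure_Un using closure_inside_subset[OF cl] cl by auto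
  moreover have "inside (polygon_boundary vs) \<subseteq> interior (polygon_region vs)"
    using open_inside[OF cl] by (intro interior_maximal) (auto simp: polygon_region_def)
  ultimately show ?thesis by (auto simp: frontier_def)
qed

lemma frontier_polygon_decomposition_subset:
  assumes "polygon_decomposition S P"
  shows "frontier S \<subseteq> (\<Union>vs\<in>P. polygon_boundary vs)"
proof -
  have S: "S = \<Union>(polygon_region ` P)" "finite P" using assms by (auto simp: polygon_decomposition_def)
  have "frontier S \<subseteq> (\<Union>t\<in>polygon_region ` P. frontier t)"
    unfolding S(1) using S(2) by (intro frontier_Union_subset) simp
  then show ?thesis using frontier_polygon_region_subset by blast
qed

text \<open>A corner is described through the interior of the support. As the frontier is null, this
  determines almost everywhere where f vanishes near the corner.\<close>

lemma negligible_frontier_polygonal: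
  assumes "polygonal S" shows "negligible (frontier S)"
proof -
  obtain P where P: "polygon_decomposition S P" using assms by (auto simp: polygonal_def)
  have "negligible (\<Union>vs\<in>P. polygon_boundary vs)"
    using P by (intro negligible_Union) (auto simp: polygon_decomposition_def polygon_boundary_def negligible_path_image_polygonal_path)
  then show ?thesis using frontier_polygon_decomposition_subset[OF P] negligible_subset by blast
qed

lemma is_vertex_imp_mem: "is_vertex S x \<Longrightarrow> x \<in> S"
proof -
  assume "is_vertex S x"
  then obtain P vs where P: "polygon_decomposition S P" "vs \<in> P" "x \<in> set vs" by (auto simp: is_vertex_def)
  have "x \<in> polygon_boundary vs"
    using P(3) set_subset_path_image_polygonal_path[of "vs @ [hd vs]"] by (auto simp: polygon_boundary_def)
  then show ?thesis using P by (auto simp: polygon_decomposition_def polygon_region_def)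
qed

text \<open>The polygons are disjoint, so a boundary point lies on one of them only; not being a
  vertex, it has a single edge of that polygon near it.\<close>

lemma frontier_polygonal_locally_line:
  assumes "polygonal S" "\<not> is_vertex S x"
  shows "\<exists>v \<epsilon>. \<epsilon> > 0 \<and> frontier S \<inter> ball x \<epsilon> \<subseteq> {x + t *\<^sub>R v | t. True}"
proof -
  obtain P where P: "polygon_decomposition S P" using assms by (auto simp: polygonal_def)
  have P': "finite P" "\<And>vs. vs \<in> P \<Longrightarrow> is_polygon vs" "disjoint_family_on polygon_region P"
    using P by (auto simp: polygon_decomposition_def)
  have nv: "x \<notin> set vs" if "vs \<in> P" for vs using assms(2) P that by (auto simp: is_vertex_def)
  let ?B = "\<lambda>Q. \<Union>vs\<in>Q. polygon_boundary vs"
  have cl: "closed (?B Q)" if "Q \<subseteq> P" for Q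
    using that P'(1) finite_subset by (intro closed_UN) (auto simp: polygon_boundary_def closed_path_image_polygonal_path)
  have far: "\<exists>\<epsilon>>0. ball x \<epsilon> \<inter> ?B Q = {}" if "x \<notin> ?B Q" "Q \<subseteq> P" for Q
  proof -
    have "open (- ?B Q)" using cl[OF that(2)] by (rule open_Compl)
    moreover have "x \<in> - ?B Q" using that(1) by blast
    ultimately obtain \<epsilon> where "\<epsilon> > 0" "ball x \<epsilon> \<subseteq> - ?B Q" by (rule openE)
    then show ?thesis by blast
  qed
  show ?thesis
  proof (cases "x \<in> ?B P")
    case False
    then obtain \<epsilon> where e: "\<epsilon> > 0" "ball x \<epsilon> \<inter> ?B P = {}" using far[OF False subset_refl] by blast
    have "frontier S \<inter> ball x \<epsilon> = {}"
      using frontier_polygon_decomposition_subset[OF P] e(2) by blast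
    then show ?thesis using e(1) by (intro exI[of _ 0] exI[of _ \<epsilon>]) simp
  next
    case True
    then obtain vs where vs: "vs \<in> P" "x \<in> polygon_boundary vs" by blast
    have "x \<notin> ?B (P - {vs})"
    proof
      assume "x \<in> ?B (P - {vs})"
      then obtain us where us: "us \<in> P" "us \<noteq> vs" "x \<in> polygon_boundary us" by blast
      have "polygon_region us \<inter> polygon_region vs = {}"
        using P'(3) us(1,2) vs(1) by (simp add: disjoint_family_on_def)
      then show False using us(3) vs(2) by (auto simp: polygon_region_def)
    qed
    then obtain \<epsilon> where e: "\<epsilon> > 0" "ball x \<epsilon> \<inter> ?B (P - {vs}) = {}" using far[of "P - {vs}"] by blast
    have s: "simple_path (polygonal_path (vs @ [hd vs]))" "vs \<noteq> []"
      using P'(2)[OF vs(1)] by (auto simp: is_polygon_def)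
    have "x \<notin> set (vs @ [hd vs])" using nv[OF vs(1)] s(2) by auto
    from polygonal_path_locally_line[OF s(1) this] obtain v \<delta>
      where v: "\<delta> > 0" "polygon_boundary vs \<inter> ball x \<delta> \<subseteq> {x + t *\<^sub>R v | t. True}"
      unfolding polygon_boundary_def by blast
    have "frontier S \<inter> ball x (min \<epsilon> \<delta>) \<subseteq> {x + t *\<^sub>R v | t. True}"
    proof
      fix z assume z: "z \<in> frontier S \<inter> ball x (min \<epsilon> \<delta>)"
      then have "z \<in> ?B P" using frontier_polygon_decomposition_subset[OF P] by blast
      moreover have "z \<notin> ?B (P - {vs})" using e(2) z by auto
      ultimately have "z \<in> polygon_boundary vs" by blast
      then show "z \<in> {x + t *\<^sub>R v | t. True}" using v(2) z by auto
    qed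
    then show ?thesis using e(1) v(1) by (intro exI[of _ v] exI[of _ "min \<epsilon> \<delta>"]) simp
  qed
qed

section \<open>Corners of polygonal sets\<close>

lemma circular_wedge_iff: "y \<in> circular_wedge x a b R \<longleftrightarrow> y - x \<in> sector a b \<and> norm (y - x) < R"
proof
  assume "y \<in> circular_wedge x a b R"
  then obtain r \<theta> where "y = x + r *\<^sub>R circle_point \<theta>" "a < \<theta>" "\<theta> < b" "0 < r" "r < R"
    unfolding circular_wedge_def circle_point_def by blast
  then show "y - x \<in> sector a b \<and> norm (y - x) < R" using sectorI[of a \<theta> b r] by (simp add: norm_circle_point)
next
  assume *: "y - x \<in> sector a b \<and> norm (y - x) < R"
  then obtain r \<theta> where r: "y - x = r *\<^sub>R circle_point \<theta>" "a < \<theta>" "\<theta> < b" "0 < r" using sectorE by blast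
  then have "r < R" using * by (simp add: norm_circle_point)
  moreover have "y = x + r *\<^sub>R circle_point \<theta>" using r(1) by (simp add: algebra_simps)
  ultimately show "y \<in> circular_wedge x a b R" using r(2-4) unfolding circular_wedge_def circle_point_def by blast
qed

text \<open>Two angles of the same point differ by a multiple of 2 \<pi>, but an angle inside the
  sector differs from an edge angle by a nonzero amount below 2 \<pi>.\<close>

lemma edge_not_in_sector:
  assumes "r > 0" "b - a < 2 * pi" "\<theta> = a \<or> \<theta> = b"
  shows "r *\<^sub>R circle_point \<theta> \<notin> sector a b"
proof
  assume "r *\<^sub>R circle_point \<theta> \<in> sector a b"
  then obtain r' \<theta>' where *: "r *\<^sub>R circle_point \<theta> = r' *\<^sub>R circle_point \<theta>'" "a < \<theta>'" "\<theta>' < b" "0 < r'" by (rule sectorE)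
  obtain n :: int where n: "\<theta>' = \<theta> + 2 * pi * of_int n" using circle_point_eq_imp(2)[OF *(1)[symmetric] *(4) assms(1)] by blast
  have "- (2 * pi) < \<theta>' - \<theta>" "\<theta>' - \<theta> < 2 * pi" "\<theta>' - \<theta> \<noteq> 0"
    using *(2,3) assms(2,3) by (cases "\<theta> = a"; auto)+
  then have "- (2 * pi) < 2 * pi * of_int n" "2 * pi * of_int n < 2 * pi" "of_int n \<noteq> (0::real)"
    using n by auto
  then have "2 * pi * (- 1) < 2 * pi * of_int n" "2 * pi * of_int n < 2 * pi * 1" by simp_all
  then have "- 1 < (of_int n :: real)" "(of_int n :: real) < 1"
    by (simp_all only: mult_less_cancel_left_pos pi_gt_zero zero_less_mult_iff zero_less_numeral simp_thms)
  then show False using \<open>of_int n \<noteq> (0::real)\<close> by simp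
qed

lemma corner_edge_in_frontier:
  assumes c: "is_corner S x a b R" and r: "0 < r" "r < R" and \<theta>: "\<theta> = a \<or> \<theta> = b"
  shows "x + r *\<^sub>R circle_point \<theta> \<in> frontier S"
proof -
  have ab: "0 < b - a" "b - a < 2 * pi" and W: "ball x R \<inter> interior S = circular_wedge x a b R"
    using c by (auto simp: is_corner_def)
  let ?y = "\<lambda>t. x + r *\<^sub>R circle_point t"
  have in_ball: "?y t \<in> ball x R" for t using r by (simp add: dist_norm norm_circle_point)
  have int: "?y t \<in> interior S" if "a < t" "t < b" for t
  proof -
    have "?y t \<in> circular_wedge x a b R"
      using sectorI[OF that r(1)] r by (simp add: circular_wedge_iff norm_circle_point)
    then show ?thesis using W by blast
  qed
  have "?y \<theta> \<notin> circular_wedge x a b R"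
    using edge_not_in_sector[OF r(1) ab(2) \<theta>] by (simp add: circular_wedge_iff)
  then have "?y \<theta> \<notin> interior S" using W in_ball by blast
  moreover have "?y \<theta> \<in> closure S"
  proof -
    \<comment> \<open>Angles inside the sector that approach the edge; \<open>+ 2\<close> keeps the
      step strictly below b - a already for n = 0.\<close>
    define s where "s = (\<lambda>n::nat. \<theta> + (if \<theta> = a then 1 else - 1) * (b - a) / (real n + 2))"
    have "(\<lambda>n. \<theta> + (if \<theta> = a then 1 else - 1) * (b - a) / (real n + 2)) \<longlonglongrightarrow> \<theta>"
      by real_asymp
    then have "s \<longlonglongrightarrow> \<theta>" by (simp add: s_def)
    moreover have "isCont ?y \<theta>"
      by (intro continuous_intros continuous_on_interior[OF continuous_on_circle_point[of UNIV]]) auto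
    ultimately have lim: "(\<lambda>n. ?y (s n)) \<longlonglongrightarrow> ?y \<theta>" by (rule isCont_tendsto_compose[rotated])
    have s: "a < s n \<and> s n < b" for n
    proof -
      define q where "q = (b - a) / (real n + 2)"
      have "0 < q" using ab by (simp add: q_def)
      have "q < (b - a) / 1" unfolding q_def using ab by (intro divide_strict_left_mono) auto
      have "s n = (if \<theta> = a then a + q else b - q)"
        using \<theta> by (auto simp: s_def q_def minus_divide_left)
      then show ?thesis using \<open>0 < q\<close> \<open>q < (b - a) / 1\<close> by auto
    qed
    have "?y (s n) \<in> S" for n
      using int[of "s n"] s[of n] interior_subset[of S] by (meson subsetD)
    then show ?thesis
      unfolding closure_sequential using lim by (intro exI[of _ "\<lambda>n. ?y (s n)"]) simp
  qed
  ultimately show ?thesis by (simp add: frontier_def)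
qed

text \<open>At a point that is no vertex the frontier lies locally on a line. Both edges of the
  corner would lie on it, and the cross product sin (b - a) of their directions would be 0.\<close>

lemma corner_is_vertex:
  assumes "polygonal S" "is_corner S x a b R" "sin (b - a) \<noteq> 0"
  shows "is_vertex S x"
proof (rule ccontr)
  assume "\<not> is_vertex S x"
  then obtain v \<epsilon> where v: "\<epsilon> > 0" "frontier S \<inter> ball x \<epsilon> \<subseteq> {x + t *\<^sub>R v | t. True}"
    using frontier_polygonal_locally_line[OF assms(1)] by blast
  define r where "r = min \<epsilon> R / 2"
  have "R > 0" using assms(2) by (simp add: is_corner_def)
  then have r: "0 < r" "r < R" "r < \<epsilon>" using v(1) by (auto simp: r_def)
  have "\<exists>t. r *\<^sub>R circle_point \<theta> = t *\<^sub>R v" if "\<theta> = a \<or> \<theta> = b" for \<theta>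
  proof -
    have "x + r *\<^sub>R circle_point \<theta> \<in> frontier S \<inter> ball x \<epsilon>"
      using corner_edge_in_frontier[OF assms(2) r(1,2) that] r by (simp add: dist_norm norm_circle_point)
    then show ?thesis using v(2) by auto
  qed
  then obtain s t where st: "r *\<^sub>R circle_point a = s *\<^sub>R v" "r *\<^sub>R circle_point b = t *\<^sub>R v" by blast
  have "r * cos a = s * v $ 1" "r * sin a = s * v $ 2" "r * cos b = t * v $ 1" "r * sin b = t * v $ 2"
    using arg_cong[OF st(1), of "\<lambda>z. z $ 1"] arg_cong[OF st(1), of "\<lambda>z. z $ 2"]
      arg_cong[OF st(2), of "\<lambda>z. z $ 1"] arg_cong[OF st(2), of "\<lambda>z. z $ 2"] by simp_all
  moreover have "r\<^sup>2 * sin (b - a) = (r * sin b) * (r * cos a) - (r * cos b) * (r * sin a)"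
    unfolding sin_diff by (simp add: power2_eq_square algebra_simps)
  ultimately have "r\<^sup>2 * sin (b - a) = 0" by simp
  then show False using r(1) assms(3) by simp
qed

text \<open>Both supports are locally cones, so a small ball in the outer region stays in it when it is
  contracted towards \<open>x\<close>.\<close>

lemma outside_contains_cone:
  fixes S K :: "bool \<Rightarrow> (real^2) set"
  assumes x: "x \<in> frontier (outside (\<Union>j. S j))" and cl: "\<And>j. closure (interior (S j)) = S j"
    and R: "R > 0" "\<And>j. ball x R \<inter> interior (S j) = {y. y - x \<in> K j \<and> norm (y - x) < R}"
    and K: "\<And>j t z. t > 0 \<Longrightarrow> z \<in> K j \<Longrightarrow> t *\<^sub>R z \<in> K j"
  shows "\<exists>e \<kappa> \<rho>. norm e = 1 \<and> 0 < \<kappa> \<and> \<kappa> \<le> 1 \<and> 0 < \<rho> \<and> \<rho> \<le> R \<and>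
    (\<forall>z. z \<in> cone_sector e \<kappa> \<rho> \<longrightarrow> x + z \<in> outside (\<Union>j. S j)) \<and>
    (\<forall>z j. norm (z - norm z *\<^sub>R e) < \<kappa> * norm z \<longrightarrow> z \<notin> K j)"
proof -
  define U where "U = (\<Union>j. S j)"
  have clS: "closed (S j)" for j using cl[of j] closed_closure by metis
  then have "closed U" unfolding U_def by (intro closed_UN) auto
  then have oO: "open (outside U)" by (rule open_outside)
  have nO: "outside U \<inter> S j = {}" for j
  proof -
    have "outside U \<inter> U = {}" by (rule outside_no_overlap)
    moreover have "S j \<subseteq> U" by (auto simp: U_def)
    ultimately show ?thesis by blast
  qed
  have "x \<in> closure (outside U)" "x \<notin> outside U" using x oO by (auto simp: frontier_def interior_open U_def)
  then obtain y where y: "y \<in> outside U" "dist y x < R" using R(1) by (auto simp: closure_approachable)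
  define d where "d = norm (y - x)"
  have "y \<noteq> x" using y \<open>x \<notin> outside U\<close> by blast
  then have d: "d > 0" "d < R" using y by (simp_all add: d_def dist_norm)
  have "open (outside U \<inter> ball x R)" using oO by (intro open_Int) auto
  moreover have "y \<in> outside U \<inter> ball x R" using y by (simp add: dist_commute)
  ultimately obtain \<delta> where \<delta>: "\<delta> > 0" "ball y \<delta> \<subseteq> outside U \<inter> ball x R" unfolding open_contains_ball by blast
  define e where "e = (1 / d) *\<^sub>R (y - x)"
  \<comment> \<open>Directions within \<kappa> of e lead, at distance d from x, to points within
    \<kappa> d \<le> \<delta> of y.\<close>
  define \<kappa> where "\<kappa> = min 1 (\<delta> / d)"
  have e: "norm e = 1" "y = x + d *\<^sub>R e" using d by (auto simp: e_def d_def)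
  have \<kappa>: "0 < \<kappa>" "\<kappa> \<le> 1" "\<kappa> * d \<le> \<delta>" using d \<delta>(1) by (auto simp: \<kappa>_def min_def field_simps)
  have scaled: "x + (d / norm z) *\<^sub>R z \<in> ball y \<delta>" "norm z > 0" if z: "norm (z - norm z *\<^sub>R e) < \<kappa> * norm z" for z
  proof -
    show n: "norm z > 0" using z by (cases "z = 0") auto
    have "x + (d / norm z) *\<^sub>R z - y = (d / norm z) *\<^sub>R (z - norm z *\<^sub>R e)"
      using n by (simp add: e(2) algebra_simps)
    then have "norm (x + (d / norm z) *\<^sub>R z - y) = (d / norm z) * norm (z - norm z *\<^sub>R e)" using d n by simp
    also have "\<dots> < (d / norm z) * (\<kappa> * norm z)" using z d n by (intro mult_strict_left_mono) auto
    also have "\<dots> = \<kappa> * d" using n by simp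
    finally show "x + (d / norm z) *\<^sub>R z \<in> ball y \<delta>" using \<kappa>(3) by (simp add: dist_norm norm_minus_commute)
  qed
  have notK: "z \<notin> K j" if "x + z \<in> ball y \<delta>" for z j
  proof
    assume "z \<in> K j"
    moreover have "x + z \<in> ball x R" using that \<delta>(2) by blast
    ultimately have "x + z \<in> {y. y - x \<in> K j \<and> norm (y - x) < R}" by (simp add: dist_norm)
    then have "x + z \<in> S j" unfolding R(2)[symmetric] using interior_subset[of "S j"] by (meson IntD2 subsetD)
    moreover have "x + z \<in> outside U" using that \<delta>(2) by blast
    ultimately show False using nO[of j] by blast
  qed
  \<comment> \<open>The union of all contractions towards x of the ball about y.\<close>
  define T where "T = (\<Union>t\<in>{0<..1}. (\<lambda>z. x + t *\<^sub>R (z - x)) ` ball y \<delta>)"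
  have "open T"
    unfolding T_def
  proof (intro open_UN ballI)
    fix t :: real assume "t \<in> {0<..1}"
    have "(\<lambda>z. x + t *\<^sub>R (z - x)) ` ball y \<delta> = ((+) (x - t *\<^sub>R x)) ` ((*\<^sub>R) t ` ball y \<delta>)"
      by (auto simp: image_image algebra_simps)
    then show "open ((\<lambda>z. x + t *\<^sub>R (z - x)) ` ball y \<delta>)"
      using open_translation[OF open_scaling[of t "ball y \<delta>"]] \<open>t \<in> {0<..1}\<close> by simp
  qed
  have T_int: "T \<inter> interior (S j) = {}" for j
  proof (rule ccontr)
    assume "T \<inter> interior (S j) \<noteq> {}"
    then obtain t z where t: "0 < t" "t \<le> 1" "z \<in> ball y \<delta>" "x + t *\<^sub>R (z - x) \<in> interior (S j)" by (auto simp: T_def)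
    have "norm (t *\<^sub>R (z - x)) \<le> norm (z - x)" using t(1,2) by (simp add: mult_left_le_one_le)
    also have "\<dots> < R" using t(3) \<delta>(2) by (auto simp: dist_norm norm_minus_commute)
    finally have "x + t *\<^sub>R (z - x) \<in> ball x R \<inter> interior (S j)" using t(4) by (simp add: dist_norm)
    then have "t *\<^sub>R (z - x) \<in> K j" unfolding R(2) by simp
    then have "(1 / t) *\<^sub>R (t *\<^sub>R (z - x)) \<in> K j" using t(1) by (intro K[OF _ \<open>t *\<^sub>R (z - x) \<in> K j\<close>]) simp
    then have "z - x \<in> K j" using t(1) by simp
    then show False using notK[of "z - x" j] t(3) by simp
  qed
  \<comment> \<open>An open set missing the interior of \<open>S j\<close> misses its closure too,
    and that is \<open>S j\<close> by the regularity assumed of sources.\<close>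
  have "T \<inter> S j = {}" for j
    using open_Int_closure_eq_empty[OF \<open>open T\<close>, of "interior (S j)"] T_int[of j] cl[of j] by simp
  then have TU: "T \<subseteq> - U" by (auto simp: U_def)
  \<comment> \<open>The segment from z to its contraction stays in T, hence in the complement of U,
    so both ends lie in the same component of that complement.\<close>
  have T_out: "x + t *\<^sub>R (z - x) \<in> outside U" if "0 < t" "t \<le> 1" "z \<in> ball y \<delta>" for t z
  proof (rule outside_same_component)
    show "z \<in> outside U" using that \<delta>(2) by blast
    have "closed_segment z (x + t *\<^sub>R (z - x)) \<subseteq> T"
    proof
      fix q assume "q \<in> closed_segment z (x + t *\<^sub>R (z - x))"
      then obtain u where u: "0 \<le> u" "u \<le> 1" "q = (1 - u) *\<^sub>R z + u *\<^sub>R (x + t *\<^sub>R (z - x))" by (auto simp: in_segment)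
      define s where "s = 1 - u * (1 - t)"
      have q: "q = x + s *\<^sub>R (z - x)" unfolding u(3) s_def by (simp add: algebra_simps)
      have "u * (1 - t) \<le> 1 * (1 - t)" "0 \<le> u * (1 - t)"
        using mult_right_mono[of u 1 "1 - t"] u(1,2) that(1,2) by simp_all
      then have "s \<in> {0<..1}" using that(1) by (auto simp: s_def)
      then show "q \<in> T" unfolding T_def q using that(3) by blast
    qed
    then have "closed_segment z (x + t *\<^sub>R (z - x)) \<subseteq> - U" using TU by blast
    then show "connected_component (- U) z (x + t *\<^sub>R (z - x))"
      unfolding connected_component_def using connected_segment ends_in_segment by blast
  qed
  show ?thesis
  proof (rule exI[of _ e], rule exI[of _ \<kappa>], rule exI[of _ d], intro conjI allI impI)
    show "x + z \<in> outside (\<Union>j. S j)" if z: "z \<in> cone_sector e \<kappa> d" for z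
    proof -
      have z': "norm z < d" "norm (z - norm z *\<^sub>R e) < \<kappa> * norm z" using z by (auto simp: cone_sector_def)
      have n: "norm z > 0" using scaled(2)[OF z'(2)] .
      have "x + (norm z / d) *\<^sub>R ((x + (d / norm z) *\<^sub>R z) - x) \<in> outside U"
        using n d z'(1) scaled(1)[OF z'(2)] by (intro T_out) auto
      then show ?thesis using n d by (simp add: U_def)
    qed
    show "z \<notin> K j" if z: "norm (z - norm z *\<^sub>R e) < \<kappa> * norm z" for z j
    proof
      assume "z \<in> K j"
      then have "(d / norm z) *\<^sub>R z \<in> K j" using scaled(2)[OF z] d by (intro K) auto
      then show False using notK scaled(1)[OF z] by blast
    qed
  qed (use e \<kappa> d in auto)
qed

section \<open>The difference of two scattered fields\<close>

text \<open>Indexing by \<open>bool\<close> turns a complex function into a pair of real ones, the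
  form in which unique continuation is stated.\<close>

definition part :: "bool \<Rightarrow> complex \<Rightarrow> real" where
  "part j z = (if j then Re z else Im z)"

lemma part_linear: "part j (z + z') = part j z + part j z'" "part j (z - z') = part j z - part j z'"
    "part j (- z) = - part j z" "part j (of_real c * z) = c * part j z" "part j (z * of_real c) = part j z * c"
  by (simp_all add: part_def)

lemma abs_part_le: "\<bar>part j z\<bar> \<le> norm z"
  using abs_Re_le_cmod abs_Im_le_cmod by (simp add: part_def)

lemma part_measurable [measurable]: "part j \<in> borel_measurable borel"
  by (cases j) (simp_all add: part_def[abs_def])

lemma norm_le_part: "norm z \<le> \<bar>part True z\<bar> + \<bar>part False z\<bar>"
  using cmod_le by (simp add: part_def)

lemma norm_power2_part: "(norm z)\<^sup>2 = (part True z)\<^sup>2 + (part False z)\<^sup>2"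
  by (simp add: part_def cmod_power2)

lemma integral_part:
  assumes "integrable M f" shows "part j (\<integral>x. f x \<partial>M) = (\<integral>x. part j (f x) \<partial>M)"
  using assms by (simp add: part_def)

text \<open>The data of the problem is only Lebesgue measurable; a Borel representative makes the
  preceding results over \<open>lborel\<close> applicable.\<close>

definition borel_version :: "(real^2 \<Rightarrow> real) \<Rightarrow> real^2 \<Rightarrow> real" where
  "borel_version f = (SOME g. g \<in> borel_measurable borel \<and> (AE x in lborel. f x = g x))"

lemma borel_version:
  assumes "f \<in> borel_measurable lebesgue"
  shows "borel_version f \<in> borel_measurable borel" "AE x in lborel. f x = borel_version f x"
proof -
  have "\<exists>g. g \<in> borel_measurable borel \<and> (AE x in lborel. f x = g x)"
    using completion_ex_borel_measurable_real[OF assms] by auto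
  then have "borel_version f \<in> borel_measurable borel \<and> (AE x in lborel. f x = borel_version f x)"
    unfolding borel_version_def by (rule someI_ex)
  then show "borel_version f \<in> borel_measurable borel" "AE x in lborel. f x = borel_version f x" by auto
qed

lemma borel_measurable_lebesgue: "f \<in> borel_measurable borel \<Longrightarrow> f \<in> borel_measurable lebesgue"
  by (rule measurable_completion) simp

lemma integral_borel_version_mult:
  fixes f g :: "real^2 \<Rightarrow> real"
  assumes f: "f \<in> borel_measurable lebesgue" and g: "g \<in> borel_measurable borel"
  shows "integrable lebesgue (\<lambda>x. f x * g x) \<longleftrightarrow> integrable lborel (\<lambda>x. borel_version f x * g x)"
    "(\<integral>x. f x * g x \<partial>lebesgue) = (LBINT x. borel_version f x * g x)"
proof -
  have m: "(\<lambda>x. borel_version f x * g x) \<in> borel_measurable borel"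
    using borel_version(1)[OF f] g by (rule borel_measurable_times)
  have m': "(\<lambda>x. f x * g x) \<in> borel_measurable lebesgue"
    using f borel_measurable_lebesgue[OF g] by (rule borel_measurable_times)
  have ae: "AE x in lebesgue. f x * g x = borel_version f x * g x"
    unfolding AE_completion_iff using borel_version(2)[OF f] by eventually_elim simp
  have "integrable lebesgue (\<lambda>x. f x * g x) \<longleftrightarrow> integrable lebesgue (\<lambda>x. borel_version f x * g x)"
    using m' borel_measurable_lebesgue[OF m] ae by (rule integrable_cong_AE)
  then show "integrable lebesgue (\<lambda>x. f x * g x) \<longleftrightarrow> integrable lborel (\<lambda>x. borel_version f x * g x)"
    using integrable_completion[of "\<lambda>x. borel_version f x * g x" lborel] m by simp
  have "(\<integral>x. f x * g x \<partial>lebesgue) = (\<integral>x. borel_version f x * g x \<partial>lebesgue)"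
    using m' borel_measurable_lebesgue[OF m] ae by (rule integral_cong_AE)
  then show "(\<integral>x. f x * g x \<partial>lebesgue) = (LBINT x. borel_version f x * g x)"
    using integral_completion[of "\<lambda>x. borel_version f x * g x" lborel] m by simp
qed

definition part_version :: "bool \<Rightarrow> (real^2 \<Rightarrow> complex) \<Rightarrow> real^2 \<Rightarrow> real" where
  "part_version j u = borel_version (\<lambda>x. part j (u x))"

lemma L2_loc_part_measurable:
  assumes "L2_loc u" shows "(\<lambda>x. part j (u x)) \<in> borel_measurable lebesgue"
  using assms part_measurable unfolding L2_loc_def by (auto intro: measurable_compose)

lemma AE_part_version:
  assumes "L2_loc u" shows "AE x in lborel. part j (u x) = part_version j u x"
  unfolding part_version_def by (rule borel_version(2)[OF L2_loc_part_measurable[OF assms]])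

lemma locally_L2_part_version:
  assumes u: "L2_loc u" shows "locally_L2 (part_version j u)"
  unfolding locally_L2_def
proof (intro conjI allI)
  show m: "part_version j u \<in> borel_measurable borel"
    unfolding part_version_def by (rule borel_version(1)[OF L2_loc_part_measurable[OF u]])
  fix r
  have mc: "(\<lambda>x. indicator (cball 0 r) x *\<^sub>R (part_version j u x)\<^sup>2) \<in> borel_measurable borel"
    using m by (intro borel_measurable_scaleR borel_measurable_power borel_measurable_indicator; simp)
  have "integrable lebesgue (\<lambda>x. indicator (cball 0 r) x *\<^sub>R (part_version j u x)\<^sup>2)"
  proof (rule Bochner_Integration.integrable_bound)
    show "integrable lebesgue (\<lambda>x. indicator (cball 0 r) x *\<^sub>R (norm (u x))\<^sup>2)"
      using u compact_cball unfolding L2_loc_def set_integrable_def by blast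
    show "(\<lambda>x. indicator (cball 0 r) x *\<^sub>R (part_version j u x)\<^sup>2) \<in> borel_measurable lebesgue"
      by (rule borel_measurable_lebesgue[OF mc])
    show "AE x in lebesgue. norm (indicator (cball 0 r) x *\<^sub>R (part_version j u x)\<^sup>2)
        \<le> norm (indicator (cball 0 r) x *\<^sub>R (norm (u x))\<^sup>2)"
      unfolding AE_completion_iff using AE_part_version[OF u, of j]
    proof eventually_elim
      case (elim x)
      have "(part_version j u x)\<^sup>2 \<le> (norm (u x))\<^sup>2"
        using abs_part_le[of j "u x"] elim by (simp add: abs_le_square_iff[symmetric])
      then show ?case by (simp add: indicator_def)
    qed
  qed
  then show "set_integrable lborel (cball 0 r) (\<lambda>x. (part_version j u x)\<^sup>2)"
    unfolding set_integrable_def integrable_completion[OF mc[folded measurable_lborel2]] .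
qed

lemma integral_L2_loc_test:
  assumes u: "L2_loc u" and \<phi>: "test_function \<phi>"
  shows "integrable lebesgue (\<lambda>x. u x * of_real (\<phi> x))"
    "part j (\<integral>x. u x * of_real (\<phi> x) \<partial>lebesgue) = (LBINT x. part_version j u x * \<phi> x)"
proof -
  note V = integral_borel_version_mult[OF L2_loc_part_measurable[OF u] test_function_measurable[OF \<phi>], folded part_version_def]
  have i: "integrable lebesgue (\<lambda>x. part j (u x) * \<phi> x)" for j
    unfolding V
    by (rule integrable_mult_test_function[OF locally_L2_imp_locally_integrable[OF locally_L2_part_version[OF u]] \<phi>])
  have "u x * of_real (\<phi> x) = of_real (part True (u x) * \<phi> x) + \<i> * of_real (part False (u x) * \<phi> x)" for x
    by (simp add: part_def complex_eq_iff)
  then show int: "integrable lebesgue (\<lambda>x. u x * of_real (\<phi> x))"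
    using i by (simp only:) (intro Bochner_Integration.integrable_add integrable_mult_right integrable_of_real i)
  show "part j (\<integral>x. u x * of_real (\<phi> x) \<partial>lebesgue) = (LBINT x. part_version j u x * \<phi> x)"
    unfolding integral_part[OF int] part_linear by (rule V(2))
qed

lemma L2_imp_L2_loc: "L2 f \<Longrightarrow> L2_loc (\<lambda>x. of_real (f x))"
  unfolding L2_loc_def L2_def set_integrable_def
  by (auto intro!: integrable_mult_indicator[where 'b = real, unfolded real_scaleR_def] lmeasurable_compact[THEN fmeasurableD])

lemma L2_loc_mult_Linfty:
  assumes \<rho>: "Linfty \<rho>" and u: "L2_loc u" shows "L2_loc (\<lambda>x. \<rho> x * u x)"
  unfolding L2_loc_def
proof (intro conjI allI impI)
  obtain M where M: "AE x in lebesgue. norm (\<rho> x) \<le> M" using \<rho> by (auto simp: Linfty_def)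
  show m: "(\<lambda>x. \<rho> x * u x) \<in> borel_measurable lebesgue"
    using \<rho> u by (auto simp: Linfty_def L2_loc_def)
  fix K :: "(real^2) set" assume K: "compact K"
  show "set_integrable lebesgue K (\<lambda>x. (norm (\<rho> x * u x))\<^sup>2)"
    unfolding set_integrable_def
  proof (rule Bochner_Integration.integrable_bound)
    show "integrable lebesgue (\<lambda>x. M\<^sup>2 * (indicator K x *\<^sub>R (norm (u x))\<^sup>2))"
      using u K unfolding L2_loc_def set_integrable_def by (intro integrable_mult_right) blast
    show "(\<lambda>x. indicator K x *\<^sub>R (norm (\<rho> x * u x))\<^sup>2) \<in> borel_measurable lebesgue"
      using measurable_compose[OF m borel_measurable_norm] lmeasurable_compact[OF K, THEN fmeasurableD]
      by (intro borel_measurable_scaleR borel_measurable_power borel_measurable_indicator)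
    show "AE x in lebesgue. norm (indicator K x *\<^sub>R (norm (\<rho> x * u x))\<^sup>2)
        \<le> norm (M\<^sup>2 * (indicator K x *\<^sub>R (norm (u x))\<^sup>2))"
      using M
    proof eventually_elim
      case (elim x)
      have "(norm (\<rho> x))\<^sup>2 * (norm (u x))\<^sup>2 \<le> M\<^sup>2 * (norm (u x))\<^sup>2"
        using elim by (intro mult_right_mono power_mono) auto
      then show ?case by (simp add: indicator_def norm_mult power_mult_distrib)
    qed
  qed
qed

lemma locally_L2_cmult: "locally_L2 f \<Longrightarrow> locally_L2 (\<lambda>x. c * f x)"
  by (rule locally_L2_mult[where B = "\<bar>c\<bar>"]) auto

lemma locally_L2_diff: "locally_L2 f \<Longrightarrow> locally_L2 g \<Longrightarrow> locally_L2 (\<lambda>x. f x - g x)"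
  using locally_L2_add[of f "\<lambda>x. (- 1) * g x"] locally_L2_cmult[of g "- 1"] by simp

lemma integral_diff_test:
  assumes f: "locally_L2 f" and g: "locally_L2 g" and \<phi>: "test_function \<phi>"
  shows "(LBINT x. (f x - g x) * \<phi> x) = (LBINT x. f x * \<phi> x) - (LBINT x. g x * \<phi> x)"
  using integrable_mult_test_function[OF locally_L2_imp_locally_integrable[OF f] \<phi>]
    integrable_mult_test_function[OF locally_L2_imp_locally_integrable[OF g] \<phi>]
  by (simp add: left_diff_distrib)

lemma laplacian_eq_sum: "laplacian \<phi> x = (\<Sum>i\<in>UNIV. partial_deriv i (partial_deriv i \<phi>) x)"
  by (simp add: laplacian_def UNIV_2)

lemma weak_laplacian_diff:
  assumes "locally_L2 w" "locally_L2 F" "weak_laplacian w F" "locally_L2 w'" "locally_L2 F'" "weak_laplacian w' F'"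
  shows "weak_laplacian (\<lambda>x. w x - w' x) (\<lambda>x. F x - F' x)"
  using assms by (simp add: weak_laplacian_def integral_diff_test test_function_laplacian)

lemma weak_partial_diff:
  assumes "locally_L2 w" "locally_L2 g" "weak_partial i w g" "locally_L2 w'" "locally_L2 g'" "weak_partial i w' g'"
  shows "weak_partial i (\<lambda>x. w x - w' x) (\<lambda>x. g x - g' x)"
  using assms by (simp add: weak_partial_def integral_diff_test test_function_partial_deriv)

text \<open>The term k^2 \<rho> u is moved to the right-hand side, so each part satisfies \<Delta>w
  = F with \<open>F\<close> merely locally square integrable. How \<open>F\<close> depends on u is
  recorded almost everywhere and used only through pointwise bounds and, far out, the Helmholtz
  equation.\<close>

lemma weak_solution_parts:
  assumes sol: "weak_solution k \<rho> f u" and \<rho>: "Linfty \<rho>" and f: "L2 f"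
  shows "\<exists>(w :: bool \<Rightarrow> real^2 \<Rightarrow> real) F G.
    (\<forall>j. locally_L2 (w j)) \<and> (\<forall>j. locally_L2 (F j)) \<and> (\<forall>j i. locally_L2 (G j i)) \<and>
    (\<forall>j i. weak_partial i (w j) (G j i)) \<and> (\<forall>j. weak_laplacian (w j) (F j)) \<and>
    (\<forall>j. AE x in lborel. w j x = part j (u x)) \<and>
    (\<forall>j. AE x in lborel. F j x = part j (of_real (f x) - of_real (k\<^sup>2) * (\<rho> x * u x)))"
proof -
  obtain G where u: "L2_loc u" and G: "\<And>i. L2_loc (\<lambda>x. G x $ i)" and wg: "weak_gradient u G"
    and eq: "\<And>\<phi>. test_function \<phi> \<Longrightarrow>
        - (\<integral>x. (\<Sum>i\<in>UNIV. G x $ i * of_real (partial_deriv i \<phi> x)) \<partial>lebesgue)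
        + of_real (k\<^sup>2) * (\<integral>x. \<rho> x * u x * of_real (\<phi> x) \<partial>lebesgue)
        = of_real (\<integral>x. f x * \<phi> x \<partial>lebesgue)"
    using sol unfolding weak_solution_def H1_loc_gradient_def by blast
  note \<rho>u = L2_loc_mult_Linfty[OF \<rho> u] and fL = L2_imp_L2_loc[OF f]
  define w where "w = (\<lambda>j. part_version j u)"
  define H where "H = (\<lambda>j i. part_version j (\<lambda>x. G x $ i))"
  define F where "F = (\<lambda>j x. part_version j (\<lambda>x. of_real (f x)) x - k\<^sup>2 * part_version j (\<lambda>x. \<rho> x * u x) x)"
  have wL: "locally_L2 (w j)" for j unfolding w_def by (rule locally_L2_part_version[OF u])
  have L2a: "locally_L2 (part_version j (\<lambda>x. of_real (f x)))" for j by (rule locally_L2_part_version[OF fL])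
  have L2b: "locally_L2 (\<lambda>x. k\<^sup>2 * part_version j (\<lambda>x. \<rho> x * u x) x)" for j
    by (rule locally_L2_cmult[OF locally_L2_part_version[OF \<rho>u]])
  have FL: "locally_L2 (F j)" for j unfolding F_def by (rule locally_L2_diff[OF L2a L2b])
  have HL: "locally_L2 (H j i)" for j i unfolding H_def by (rule locally_L2_part_version[OF G])
  have wp: "weak_partial i (w j) (H j i)" for j i
    unfolding weak_partial_def
  proof (intro allI impI)
    fix \<phi> :: "real^2 \<Rightarrow> real" assume \<phi>: "test_function \<phi>"
    have "part j (\<integral>x. u x * of_real (partial_deriv i \<phi> x) \<partial>lebesgue)
        = part j (- (\<integral>x. G x $ i * of_real (\<phi> x) \<partial>lebesgue))"
      using wg \<phi> unfolding weak_gradient_def by simp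
    then show "(LBINT x. w j x * partial_deriv i \<phi> x) = - (LBINT x. H j i x * \<phi> x)"
      unfolding part_linear w_def H_def
      by (simp only: integral_L2_loc_test(2)[OF u test_function_partial_deriv[OF \<phi>]] integral_L2_loc_test(2)[OF G \<phi>])
  qed
  have lap: "weak_laplacian (w j) (F j)" for j
    unfolding weak_laplacian_def
  proof (intro allI impI)
    fix \<phi> :: "real^2 \<Rightarrow> real" assume \<phi>: "test_function \<phi>"
    note d\<phi> = test_function_partial_deriv[OF \<phi>]
    have "(\<integral>x. (\<Sum>i\<in>UNIV. G x $ i * of_real (partial_deriv i \<phi> x)) \<partial>lebesgue)
        = (\<Sum>i\<in>UNIV. \<integral>x. G x $ i * of_real (partial_deriv i \<phi> x) \<partial>lebesgue)"
      by (intro Bochner_Integration.integral_sum integral_L2_loc_test(1)[OF G d\<phi>])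
    \<comment> \<open>The weak gradient identity, with \<partial>_i \<phi> as test function.\<close>
    also have "\<dots> = (\<Sum>i\<in>UNIV. - (\<integral>x. u x * of_real (partial_deriv i (partial_deriv i \<phi>) x) \<partial>lebesgue))"
      using wg d\<phi> unfolding weak_gradient_def by simp
    also have "\<dots> = - (\<integral>x. (\<Sum>i\<in>UNIV. u x * of_real (partial_deriv i (partial_deriv i \<phi>) x)) \<partial>lebesgue)"
      unfolding sum_negf
      by (intro arg_cong[of _ _ uminus] Bochner_Integration.integral_sum[symmetric]
          integral_L2_loc_test(1)[OF u test_function_partial_deriv[OF d\<phi>]])
    also have "\<dots> = - (\<integral>x. u x * of_real (laplacian \<phi> x) \<partial>lebesgue)"
      by (simp add: laplacian_eq_sum sum_distrib_left)
    finally have "(\<integral>x. u x * of_real (laplacian \<phi> x) \<partial>lebesgue)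
        + of_real (k\<^sup>2) * (\<integral>x. \<rho> x * u x * of_real (\<phi> x) \<partial>lebesgue) = (\<integral>x. of_real (f x) * of_real (\<phi> x) \<partial>lebesgue)"
      using eq[OF \<phi>] by (simp flip: of_real_mult)
    then have "part j (\<integral>x. u x * of_real (laplacian \<phi> x) \<partial>lebesgue)
        + k\<^sup>2 * part j (\<integral>x. \<rho> x * u x * of_real (\<phi> x) \<partial>lebesgue) = part j (\<integral>x. of_real (f x) * of_real (\<phi> x) \<partial>lebesgue)"
      unfolding part_linear[symmetric] by (rule arg_cong)
    then have "(LBINT x. w j x * laplacian \<phi> x) + k\<^sup>2 * (LBINT x. part_version j (\<lambda>x. \<rho> x * u x) x * \<phi> x)
        = (LBINT x. part_version j (\<lambda>x. of_real (f x)) x * \<phi> x)"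
      unfolding w_def
      by (simp only: integral_L2_loc_test(2)[OF u test_function_laplacian[OF \<phi>]]
          integral_L2_loc_test(2)[OF \<rho>u \<phi>] integral_L2_loc_test(2)[OF fL \<phi>])
    then show "(LBINT x. w j x * laplacian \<phi> x) = (LBINT x. F j x * \<phi> x)"
      unfolding F_def integral_diff_test[OF L2a L2b \<phi>] by (simp add: mult.assoc)
  qed
  have aew: "AE x in lborel. w j x = part j (u x)" for j
    using AE_part_version[OF u, of j] unfolding w_def by eventually_elim simp
  have aeF: "AE x in lborel. F j x = part j (of_real (f x) - of_real (k\<^sup>2) * (\<rho> x * u x))" for j
    using AE_part_version[OF fL, of j] AE_part_version[OF \<rho>u, of j] unfolding F_def
    by eventually_elim (simp only: part_linear)
  show ?thesis
    by (intro exI[of _ w] exI[of _ F] exI[of _ H] conjI allI wL FL HL wp lap aew aeF)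
qed

text \<open>The common pattern cancels and only the two remainders are left. The prefactor
  |x|^(-1/2) is bounded by 1, which leaves the rate O(1 / |x|) that enters
  \<open>rellich\<close>.\<close>

lemma far_field_difference_decay:
  assumes "far_field_pattern k u g" "far_field_pattern k u' g"
  shows "\<exists>C R. \<forall>x. norm x > R \<longrightarrow> norm (u x - u' x) \<le> C / norm x"
proof -
  obtain h where h: "h \<in> O[at_infinity](\<lambda>x. of_real (1 / norm x))"
    "\<forall>\<^sub>F x in at_infinity. u x = of_real (norm x powr (-1/2)) * exp (\<i> * of_real (k * norm x)) * (g (x /\<^sub>R norm x) + h x)"
    using assms(1) unfolding far_field_pattern_def by blast
  obtain h' where h': "h' \<in> O[at_infinity](\<lambda>x. of_real (1 / norm x))"
    "\<forall>\<^sub>F x in at_infinity. u' x = of_real (norm x powr (-1/2)) * exp (\<i> * of_real (k * norm x)) * (g (x /\<^sub>R norm x) + h' x)"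
    using assms(2) unfolding far_field_pattern_def by blast
  obtain c where c: "\<forall>\<^sub>F x in at_infinity. norm (h x) \<le> c * norm (of_real (1 / norm x) :: complex)"
    using h(1) by (auto simp: bigo_def)
  obtain c' where c': "\<forall>\<^sub>F x in at_infinity. norm (h' x) \<le> c' * norm (of_real (1 / norm x) :: complex)"
    using h'(1) by (auto simp: bigo_def)
  have "\<forall>\<^sub>F x::real^2 in at_infinity. 1 \<le> norm x" unfolding eventually_at_infinity by blast
  with h(2) h'(2) c c' have "\<forall>\<^sub>F x in at_infinity. norm (u x - u' x) \<le> (c + c') / norm x"
  proof eventually_elim
    case (elim x)
    let ?A = "complex_of_real (norm x powr (-1/2)) * exp (\<i> * of_real (k * norm x))"
    have "norm x powr (-1/2) \<le> norm x powr 0" using elim(5) by (intro powr_mono) auto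
    moreover have "x \<noteq> 0" using elim(5) by auto
    ultimately have A: "norm ?A \<le> 1" by (simp add: norm_mult)
    have "u x - u' x = ?A * (h x - h' x)" unfolding elim(1,2) by (simp only: right_diff_distrib distrib_left) simp
    then have "norm (u x - u' x) = norm ?A * norm (h x - h' x)" by (simp only: norm_mult)
    also have "\<dots> \<le> 1 * (norm (h x) + norm (h' x))" using A by (intro mult_mono norm_triangle_ineq4) auto
    also have "\<dots> \<le> c / norm x + c' / norm x" using elim(3,4) by (simp add: norm_divide)
    finally show ?case by (simp add: add_divide_distrib)
  qed
  then obtain b where b: "\<And>x. norm x \<ge> b \<Longrightarrow> norm (u x - u' x) \<le> (c + c') / norm x"
    unfolding eventually_at_infinity by blast
  show ?thesis by (intro exI[of _ "c + c'"] exI[of _ b]) (use b in simp)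
qed

section \<open>Sources near a point of the boundary of the exterior\<close>

lemma AE_outside_ess_support: "AE x in lborel. x \<notin> ess_support f \<longrightarrow> f x = 0"
proof -
  have "AE x in lebesgue. x \<in> - ess_support f \<longrightarrow> f x = 0"
    by (rule AE_locally) (auto simp: ess_support_def)
  then show ?thesis by (simp add: AE_completion_iff)
qed

lemma AE_outside_total_support: "AE x in lborel. x \<notin> total_support f \<longrightarrow> f x = 0"
  using AE_outside_ess_support[of f]
proof eventually_elim
  case (elim x)
  have "ess_support f \<subseteq> total_support f"
    using outside_no_overlap[of "ess_support f"] unfolding total_support_def by blast
  then show ?case using elim by blast
qed

lemma total_support_closed_bounded:
  assumes "is_source f" shows "closed (total_support f)" "bounded (total_support f)"
  using assms compact_imp_closed compact_imp_bounded unfolding is_source_def total_support_def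
  by (auto intro!: open_outside cobounded_outside)

text \<open>Off the null frontier a point of the disc outside the wedge lies outside the support,
  where f is 0. So the approximation by p times the indicator of the sector holds on the whole disc.
  The shape of the support is given for all smaller radii, so that two sources can share one
  radius.\<close>

lemma one_split_corner_local_form:
  assumes f: "is_source f" "polygonal (total_support f)" and c: "one_split_corner f x a b p"
  shows "\<exists>R C \<alpha>. R > 0 \<and> C > 0 \<and> \<alpha> > 0 \<and> 0 < b - a \<and> b - a < 2 * pi \<and>
    (\<forall>r\<le>R. ball x r \<inter> interior (total_support f) = {y. y - x \<in> sector a b \<and> norm (y - x) < r}) \<and>
    (AE y in lborel. norm (y - x) < R \<longrightarrow> \<bar>f y - p * indicator (sector a b) (y - x)\<bar> \<le> C * norm (y - x) powr \<alpha>)"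
proof -
  let ?S = "total_support f"
  obtain R C \<alpha> where R: "is_corner ?S x a b R" and C: "0 < C" "0 < \<alpha>"
    and ae: "AE y in lebesgue. y \<in> circular_wedge x a b R \<longrightarrow> \<bar>f y - p\<bar> \<le> C * norm (y - x) powr \<alpha>"
    using c unfolding one_split_corner_def by blast
  have ab: "0 < R" "0 < b - a" "b - a < 2 * pi" and W: "ball x R \<inter> interior ?S = circular_wedge x a b R"
    using R by (auto simp: is_corner_def)
  have loc: "ball x r \<inter> interior ?S = {y. y - x \<in> sector a b \<and> norm (y - x) < r}" if "r \<le> R" for r
  proof -
    have "ball x r \<inter> interior ?S = ball x r \<inter> (ball x R \<inter> interior ?S)" using subset_ball[OF that, of x] by blast
    also have "\<dots> = ball x r \<inter> circular_wedge x a b R" unfolding W ..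
    also have "\<dots> = {y. y - x \<in> sector a b \<and> norm (y - x) < r}"
      using that by (auto simp: circular_wedge_iff dist_norm norm_minus_commute)
    finally show ?thesis .
  qed
  have "frontier ?S \<in> null_sets lebesgue"
    using negligible_frontier_polygonal[OF f(2)] by (simp add: negligible_iff_null_sets)
  then have "AE y in lebesgue. y \<notin> frontier ?S" by (rule AE_not_in)
  then have "AE y in lborel. y \<notin> frontier ?S" by (simp add: AE_completion_iff)
  moreover have "AE y in lborel. y \<in> circular_wedge x a b R \<longrightarrow> \<bar>f y - p\<bar> \<le> C * norm (y - x) powr \<alpha>"
    using ae by (simp add: AE_completion_iff)
  ultimately have close: "AE y in lborel. norm (y - x) < R \<longrightarrow> \<bar>f y - p * indicator (sector a b) (y - x)\<bar> \<le> C * norm (y - x) powr \<alpha>"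
    using AE_outside_total_support[of f]
  proof eventually_elim
    case (elim y)
    show ?case
    proof
      assume n: "norm (y - x) < R"
      show "\<bar>f y - p * indicator (sector a b) (y - x)\<bar> \<le> C * norm (y - x) powr \<alpha>"
      proof (cases "y - x \<in> sector a b")
        case True
        then show ?thesis using elim(2) n by (simp add: circular_wedge_iff)
      next
        case False
        then have "y \<notin> circular_wedge x a b R" by (simp add: circular_wedge_iff)
        moreover have "y \<in> ball x R" using n by (simp add: dist_norm norm_minus_commute)
        ultimately have "y \<notin> interior ?S" using W by blast
        then have "y \<notin> ?S" using elim(1) total_support_closed_bounded(1)[OF f(1)] by (simp add: frontier_def)
        then show ?thesis using elim(3) False C by simp
      qed
    qed
  qed
  show ?thesis
    by (rule exI[of _ R], rule exI[of _ C], rule exI[of _ \<alpha>]) (intro conjI allI impI ab C loc close)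
qed

lemma no_corner_local_form:
  assumes f: "is_source f" and x: "x \<notin> total_support f"
  shows "\<exists>R>0. (\<forall>r\<le>R. ball x r \<inter> interior (total_support f) = {}) \<and>
    (AE y in lborel. norm (y - x) < R \<longrightarrow> f y = 0)"
proof -
  have "open (- total_support f)" using total_support_closed_bounded(1)[OF f] by (rule open_Compl)
  moreover have "x \<in> - total_support f" using x by blast
  ultimately obtain R where R: "R > 0" "ball x R \<subseteq> - total_support f" by (rule openE)
  have "ball x r \<inter> interior (total_support f) = {}" if "r \<le> R" for r
    using R(2) interior_subset[of "total_support f"] subset_ball[OF that, of x] by blast
  moreover have "AE y in lborel. norm (y - x) < R \<longrightarrow> f y = 0"
    using AE_outside_total_support[of f]
  proof eventually_elim
    case (elim y)
    then show ?case using R(2) by (auto simp: dist_norm norm_minus_commute subset_eq)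
  qed
  ultimately show ?thesis using R(1) by (intro exI[of _ R]) simp
qed

text \<open>The case in which one support misses the point is included, with \<open>K j = {}\<close> and \<open>p j = 0\<close>.\<close>

lemma corner_moments_equal:
  fixes f :: "bool \<Rightarrow> real^2 \<Rightarrow> real" and p a b :: "bool \<Rightarrow> real"
  assumes "0 < k" and \<rho>: "Linfty \<rho>" "compact (ess_support (\<lambda>x. \<rho> x - 1))"
    and src: "\<And>j. is_source (f j)" and far: "\<And>j. produces_far_field k \<rho> (f j) g"
    and x: "x \<in> frontier (outside (\<Union>j. total_support (f j)))"
    and ab: "\<And>j. 0 < b j - a j" "\<And>j. b j - a j < 2 * pi"
    and sec: "\<And>j. sector (a j) (b j) \<subseteq> K True \<union> K False"
    and K: "\<And>j t z. t > 0 \<Longrightarrow> z \<in> K j \<Longrightarrow> t *\<^sub>R z \<in> K j"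
    and R: "R > 0" "\<And>j. ball x R \<inter> interior (total_support (f j)) = {y. y - x \<in> K j \<and> norm (y - x) < R}"
    and C: "C \<ge> 0" "\<alpha> > 0"
    and close: "\<And>j. AE y in lborel. norm (y - x) < R \<longrightarrow>
      \<bar>f j y - p j * indicator (sector (a j) (b j)) (y - x)\<bar> \<le> C * norm (y - x) powr \<alpha>"
  shows "complex_of_real (p True * sin (b True - a True)) * cis (- (a True + b True))
       = complex_of_real (p False * sin (b False - a False)) * cis (- (a False + b False))"
proof -
  define U where "U = (\<Union>j. total_support (f j))"
  obtain u where u: "\<And>j. weak_solution k \<rho> (f j) (u j)" "\<And>j. far_field_pattern k (u j) g"
    using far unfolding produces_far_field_def by metis
  have L2f: "L2 (f j)" for j using src[of j] by (simp add: is_source_def)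
  from weak_solution_parts[OF u(1)[of True] \<rho>(1) L2f[of True]]
  obtain w1 F1 G1 where 1: "\<forall>j. locally_L2 (w1 j)" "\<forall>j. locally_L2 (F1 j)" "\<forall>j i. locally_L2 (G1 j i)"
    "\<forall>j i. weak_partial i (w1 j) (G1 j i)" "\<forall>j. weak_laplacian (w1 j) (F1 j)"
    "\<forall>j. AE x in lborel. w1 j x = part j (u True x)"
    "\<forall>j. AE x in lborel. F1 j x = part j (of_real (f True x) - of_real (k\<^sup>2) * (\<rho> x * u True x))"
    by (elim exE conjE) (rule that)
  note 1 = 1[rule_format]
  from weak_solution_parts[OF u(1)[of False] \<rho>(1) L2f[of False]]
  obtain w2 F2 G2 where 2: "\<forall>j. locally_L2 (w2 j)" "\<forall>j. locally_L2 (F2 j)" "\<forall>j i. locally_L2 (G2 j i)"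
    "\<forall>j i. weak_partial i (w2 j) (G2 j i)" "\<forall>j. weak_laplacian (w2 j) (F2 j)"
    "\<forall>j. AE x in lborel. w2 j x = part j (u False x)"
    "\<forall>j. AE x in lborel. F2 j x = part j (of_real (f False x) - of_real (k\<^sup>2) * (\<rho> x * u False x))"
    by (elim exE conjE) (rule that)
  note 2 = 2[rule_format]
  define w where "w = (\<lambda>j x. w1 j x - w2 j x)"
  define F where "F = (\<lambda>j x. F1 j x - F2 j x)"
  define G where "G = (\<lambda>j i x. G1 j i x - G2 j i x)"
  define z where "z = (\<lambda>x. u True x - u False x)"
  have wL: "locally_L2 (w j)" and FL: "locally_L2 (F j)" and GL: "locally_L2 (G j i)" for j i
    unfolding w_def F_def G_def by (intro locally_L2_diff 1(1-3) 2(1-3))+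
  have wF: "weak_laplacian (w j) (F j)" for j
    unfolding w_def F_def by (intro weak_laplacian_diff 1 2)
  have wG: "weak_partial i (w j) (G j i)" for i j
    unfolding w_def G_def by (intro weak_partial_diff 1 2)
  have aw: "AE x in lborel. w j x = part j (z x)" for j
    using 1(6)[of j] 2(6)[of j] unfolding w_def z_def by eventually_elim (simp only: part_linear)
  have aF: "AE x in lborel. F j x = part j (of_real (f True x - f False x) - of_real (k\<^sup>2) * (\<rho> x * z x))" for j
    using 1(7)[of j] 2(7)[of j] unfolding F_def z_def
  proof eventually_elim
    case (elim x)
    have "of_real (f True x - f False x) - of_real (k\<^sup>2) * (\<rho> x * (u True x - u False x))
      = (of_real (f True x) - of_real (k\<^sup>2) * (\<rho> x * u True x)) - (of_real (f False x) - of_real (k\<^sup>2) * (\<rho> x * u False x))"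
      by (simp add: algebra_simps)
    then show ?case unfolding elim by (simp only: part_linear)
  qed
  obtain M0 where M0: "AE x in lebesgue. norm (\<rho> x) \<le> M0" using \<rho>(1) by (auto simp: Linfty_def)
  define M where "M = max 0 M0"
  have M: "M \<ge> 0" "AE x in lborel. norm (\<rho> x) \<le> M"
    using M0 by (auto simp: M_def AE_completion_iff)
  have f0: "AE x in lborel. x \<notin> U \<longrightarrow> f j x = 0" for j
    using AE_outside_total_support[of "f j"] by eventually_elim (auto simp: U_def)
  have Uc: "closed U" "bounded U"
    using total_support_closed_bounded[OF src] unfolding U_def by (auto intro!: closed_UN bounded_UN)
  have "bounded (U \<union> ess_support (\<lambda>x. \<rho> x - 1))"
    using Uc(2) compact_imp_bounded[OF \<rho>(2)] by simp
  then obtain B where B: "\<And>x. x \<in> U \<union> ess_support (\<lambda>x. \<rho> x - 1) \<Longrightarrow> norm x \<le> B" unfolding bounded_iff by blast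
  obtain D R1 where D: "\<And>x. norm x > R1 \<Longrightarrow> norm (z x) \<le> D / norm x"
    using far_field_difference_decay[OF u(2)[of True] u(2)[of False]] unfolding z_def by blast
  define R2 where "R2 = max B R1"
  have helm: "AE x in lborel. norm x > R2 \<longrightarrow> F j x = - (k\<^sup>2 * w j x)" for j
    using aw[of j] aF[of j] f0[of True] f0[of False] AE_outside_ess_support[of "\<lambda>x. \<rho> x - 1"]
  proof eventually_elim
    case (elim x)
    show ?case
    proof
      assume "norm x > R2"
      then have "x \<notin> U \<union> ess_support (\<lambda>x. \<rho> x - 1)" using B[of x] by (auto simp: R2_def)
      then have "f True x = 0" "f False x = 0" "\<rho> x = 1" using elim by auto
      then show "F j x = - (k\<^sup>2 * w j x)" unfolding elim(1,2) by (simp add: part_linear del: of_real_power)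
    qed
  qed
  have decay: "AE x in lborel. norm x > R2 \<longrightarrow> \<bar>w j x\<bar> \<le> D / norm x" for j
    using aw[of j]
  proof eventually_elim
    case (elim x)
    show ?case using D[of x] abs_part_le[of j "z x"] unfolding elim R2_def by auto
  qed
  have "\<exists>R'. AE x in lborel. norm x > R' \<longrightarrow> w j x = 0" for j
    by (rule rellich[OF wL FL wF \<open>0 < k\<close> helm decay]) (rule exI)
  then have "\<forall>j. \<exists>R'. AE x in lborel. norm x > R' \<longrightarrow> w j x = 0" by blast
  from choice[OF this] obtain R3 where R3: "\<And>j. AE x in lborel. norm x > R3 j \<longrightarrow> w j x = 0" by blast
  define \<Omega> where "\<Omega> = outside U"
  define V where "V = {x::real^2. max (R3 True) (R3 False) < norm x}"
  have \<Omega>: "open \<Omega>" "connected \<Omega>"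
    unfolding \<Omega>_def using open_outside[OF Uc(1)] connected_outside[OF Uc(2)] by auto
  have V: "open V" unfolding V_def by (intro open_Collect_less continuous_intros)
  have "V \<inter> \<Omega> \<noteq> {}"
  proof -
    obtain B' where B': "\<And>x. x \<in> - \<Omega> \<Longrightarrow> norm x \<le> B'"
      using cobounded_outside[OF Uc(2)] unfolding \<Omega>_def bounded_iff by blast
    obtain v :: "real^2" where v: "norm v = \<bar>max (R3 True) (R3 False)\<bar> + \<bar>B'\<bar> + 1"
      using vector_choose_size[of "\<bar>max (R3 True) (R3 False)\<bar> + \<bar>B'\<bar> + 1"] by auto
    have "v \<in> \<Omega>" using B'[of v] v by (cases "v \<in> \<Omega>") auto
    moreover have "max (R3 True) (R3 False) < norm v" unfolding v by linarith
    then have "v \<in> V" by (simp only: V_def mem_Collect_eq)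
    ultimately show ?thesis by blast
  qed
  have wV: "AE x in lborel. x \<in> V \<longrightarrow> w j x = 0" for j
    using R3[of j] by eventually_elim (cases j; simp add: V_def)
  \<comment> \<open>Off both supports the equation reads \<Delta>w = - k^2 \<rho> w; this is the
    pointwise bound for unique continuation, with both parts together because \<rho> is
    complex.\<close>
  have bound: "AE x in lborel. x \<in> \<Omega> \<longrightarrow> (F True x)\<^sup>2 + (F False x)\<^sup>2 \<le> (k\<^sup>2 * M)\<^sup>2 * ((w True x)\<^sup>2 + (w False x)\<^sup>2)"
    using aw[of True] aw[of False] aF[of True] aF[of False] f0[of True] f0[of False] M(2)
  proof eventually_elim
    case (elim x)
    show ?case
    proof
      assume "x \<in> \<Omega>"
      then have "x \<notin> U" using outside_no_overlap[of U] unfolding \<Omega>_def by blast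
      then have f: "f True x = 0" "f False x = 0" using elim by auto
      let ?h = "of_real (f True x - f False x) - of_real (k\<^sup>2) * (\<rho> x * z x)"
      have "norm ?h = k\<^sup>2 * (norm (\<rho> x) * norm (z x))"
        unfolding f by (simp add: norm_mult norm_power)
      also have "\<dots> \<le> k\<^sup>2 * (M * norm (z x))" using elim(7) by (intro mult_left_mono mult_right_mono) auto
      finally have "(norm ?h)\<^sup>2 \<le> (k\<^sup>2 * M * norm (z x))\<^sup>2" by (intro power_mono) (simp_all add: mult.assoc)
      then show "(F True x)\<^sup>2 + (F False x)\<^sup>2 \<le> (k\<^sup>2 * M)\<^sup>2 * ((w True x)\<^sup>2 + (w False x)\<^sup>2)"
        unfolding elim(1-4) norm_power2_part[symmetric] power_mult_distrib .
    qed
  qed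
  have w0: "AE x in lborel. x \<in> \<Omega> \<longrightarrow> w j x = 0" for j
    using unique_continuation[OF wL FL wF GL wG \<Omega> bound _ V \<open>V \<inter> \<Omega> \<noteq> {}\<close> wV, of j] by simp
  have cl: "closure (interior (total_support (f j))) = total_support (f j)" for j using src[of j] by (simp add: is_source_def)
  have "\<exists>e \<kappa> \<delta>. norm e = 1 \<and> 0 < \<kappa> \<and> \<kappa> \<le> 1 \<and> 0 < \<delta> \<and> \<delta> \<le> R \<and>
      (\<forall>z. z \<in> cone_sector e \<kappa> \<delta> \<longrightarrow> x + z \<in> outside (\<Union>j. total_support (f j))) \<and>
      (\<forall>z j. norm (z - norm z *\<^sub>R e) < \<kappa> * norm z \<longrightarrow> z \<notin> K j)"
    by (rule outside_contains_cone[OF x cl R K])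
  then obtain e \<kappa> \<delta> where e: "norm e = 1" "0 < \<kappa>" "\<kappa> \<le> 1" "0 < \<delta>" "\<delta> \<le> R"
    and cone: "\<forall>z. z \<in> cone_sector e \<kappa> \<delta> \<longrightarrow> x + z \<in> \<Omega>"
    and notK: "\<forall>z j. norm (z - norm z *\<^sub>R e) < \<kappa> * norm z \<longrightarrow> z \<notin> K j"
    unfolding \<Omega>_def U_def by blast
  note cone = cone[rule_format] and notK = notK[rule_format]
  define \<epsilon> where "\<epsilon> = min \<delta> 1"
  \<comment> \<open>The origin is moved to x. The power terms of the two sources add up to
    \<open>2 * C\<close>, and k^2 M bounds the potential term.\<close>
  show ?thesis
  proof (rule sector_moments_equal[where w = "\<lambda>j y. w j (x + y)" and G = "\<lambda>j i y. G j i (x + y)"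
        and F = "\<lambda>y. F True (x + y)" and e = e and \<kappa> = \<kappa> and \<rho> = \<epsilon> and C = "2 * C" and \<alpha> = \<alpha> and M = "k\<^sup>2 * M"])
    show "locally_L2 (\<lambda>y. w j (x + y))" for j by (rule locally_L2_translate[OF wL])
    show "locally_L2 (\<lambda>y. G j i (x + y))" for j i by (rule locally_L2_translate[OF GL])
    show "weak_partial i (\<lambda>y. w j (x + y)) (\<lambda>y. G j i (x + y))" for j i by (rule weak_partial_translate[OF wL GL wG])
    show "locally_L2 (\<lambda>y. F True (x + y))" by (rule locally_L2_translate[OF FL])
    show "weak_laplacian (\<lambda>y. w True (x + y)) (\<lambda>y. F True (x + y))" by (rule weak_laplacian_translate[OF wL FL wF])
    show "AE y in lborel. y \<in> cone_sector e \<kappa> \<epsilon> \<longrightarrow> w j (x + y) = 0" for j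
      using AE_lborel_translate[OF w0[of j], of x]
    proof eventually_elim
      case (elim y)
      show ?case using elim cone[of y] by (auto simp: cone_sector_def \<epsilon>_def)
    qed
    show "y \<notin> sector (a True) (b True) \<and> y \<notin> sector (a False) (b False)" if "norm (y - norm y *\<^sub>R e) < \<kappa> * norm y" for y
      using notK[OF that] sec by blast
    show "AE y in lborel. norm y < \<epsilon> \<longrightarrow>
      \<bar>F True (x + y) - (p True * indicator (sector (a True) (b True)) y - p False * indicator (sector (a False) (b False)) y)\<bar>
      \<le> 2 * C * norm y powr \<alpha> + k\<^sup>2 * M * (\<bar>w True (x + y)\<bar> + \<bar>w False (x + y)\<bar>)"
      using AE_lborel_translate[OF close[of True], of x] AE_lborel_translate[OF close[of False], of x]
        AE_lborel_translate[OF aw[of True], of x] AE_lborel_translate[OF aw[of False], of x]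
        AE_lborel_translate[OF aF[of True], of x] AE_lborel_translate[OF M(2), of x]
    proof eventually_elim
      case (elim y)
      show ?case
      proof
        assume "norm y < \<epsilon>"
        then have n: "norm (x + y - x) < R" using e(5) by (simp add: \<epsilon>_def)
        let ?i = "\<lambda>j. p j * indicator (sector (a j) (b j)) y"
        let ?q = "part True (\<rho> (x + y) * z (x + y))"
        have c: "\<bar>f True (x + y) - ?i True\<bar> \<le> C * norm y powr \<alpha>" "\<bar>f False (x + y) - ?i False\<bar> \<le> C * norm y powr \<alpha>"
          using elim(1,2) n by simp_all
        have "\<bar>?q\<bar> \<le> norm (\<rho> (x + y)) * norm (z (x + y))" using abs_part_le by (simp add: norm_mult[symmetric])
        also have "\<dots> \<le> M * (\<bar>w True (x + y)\<bar> + \<bar>w False (x + y)\<bar>)"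
          unfolding elim(3,4) using elim(6) M(1) norm_le_part by (intro mult_mono) auto
        finally have q: "\<bar>k\<^sup>2 * ?q\<bar> \<le> k\<^sup>2 * M * (\<bar>w True (x + y)\<bar> + \<bar>w False (x + y)\<bar>)"
          by (simp add: abs_mult mult.assoc mult_left_mono)
        have "F True (x + y) = f True (x + y) - f False (x + y) - k\<^sup>2 * ?q"
          unfolding elim(5) part_linear by (simp add: part_def)
        then show "\<bar>F True (x + y) - (?i True - ?i False)\<bar>
          \<le> 2 * C * norm y powr \<alpha> + k\<^sup>2 * M * (\<bar>w True (x + y)\<bar> + \<bar>w False (x + y)\<bar>)"
          using c q unfolding abs_le_iff by linarith
      qed
    qed
  qed (use e ab C M \<epsilon>_def in auto)
qed

section \<open>From equal moments to vertices, apertures and bisectors\<close>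

definition corner_moment :: "real \<Rightarrow> real \<Rightarrow> real \<Rightarrow> complex" where
  "corner_moment a b p = complex_of_real (p * sin (b - a)) * cis (- (a + b))"

text \<open>As a + b = 2 \<beta>, the moment is a real number times the phase exp (- 2 \<i>
  \<beta>). Two such nonzero numbers agree only if the phases agree up to sign, so 2 (\<beta> -
  \<beta>') = m \<pi>, and the real factors then differ by that same sign.\<close>

lemma corner_moment_eq_imp:
  assumes "corner_moment a b p = corner_moment a' b' p'" "corner_moment a b p \<noteq> 0"
  shows "\<exists>m::int. bisector_angle a b = bisector_angle a' b' + of_int m * pi / 2 \<and>
    p * sin (aperture a b) = (-1) powi m * p' * sin (aperture a' b')"
proof -
  define q q' s where "q = p * sin (b - a)" and "q' = p' * sin (b' - a')" and "s = (a + b) - (a' + b')"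
  have "of_real q * cis (- (a + b)) * cis (a + b) = of_real q' * cis (- (a' + b')) * cis (a + b)"
    using assms(1) by (simp add: corner_moment_def q_def q'_def)
  then have eq: "of_real q = of_real q' * cis s" by (simp add: mult.assoc cis_mult s_def algebra_simps)
  have "q \<noteq> 0" using assms(2) by (auto simp: corner_moment_def q_def)
  have "q' \<noteq> 0" using eq \<open>q \<noteq> 0\<close> by auto
  have "q' * sin s = 0" using arg_cong[OF eq, of Im] by simp
  then have "sin s = 0" using \<open>q' \<noteq> 0\<close> by simp
  then obtain m :: int where m: "s = of_int m * pi" by (auto simp: sin_zero_iff_int2)
  have "cos s = (-1) powi m"
    unfolding m mult.commute[of _ pi] cos_npi_int by (simp add: power_int_minus_left)
  then have "q = (-1) powi m * q'" using arg_cong[OF eq, of Re] by simp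
  moreover have "(a + b) / 2 = (a' + b') / 2 + of_int m * pi / 2" using m by (simp add: s_def field_simps)
  ultimately show ?thesis
    unfolding bisector_angle_def aperture_def q_def q'_def by (intro exI[of _ m]) (simp add: mult.assoc)
qed

text \<open>In the open interval from 0 to 2 \<pi> the sine vanishes only at \<pi>.\<close>

lemma corner_moment_admissible:
  assumes "one_split_corner f x a b p" "p \<noteq> 0" "aperture a b \<noteq> pi"
  shows "corner_moment a b p \<noteq> 0"
proof -
  have ab: "0 < b - a" "b - a < 2 * pi" using assms(1) by (auto simp: one_split_corner_def is_corner_def)
  have "sin (b - a) \<noteq> 0"
  proof
    assume "sin (b - a) = 0"
    then obtain m :: int where m: "b - a = of_int m * pi" by (auto simp: sin_zero_iff_int2)
    then have "0 * pi < of_int m * pi" "of_int m * pi < 2 * pi" using ab by simp_all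
    then have "0 < (of_int m :: real)" "(of_int m :: real) < 2"
      by (simp_all only: mult_less_cancel_right_pos pi_gt_zero)
    then have "m = 1" by linarith
    then show False using m assms(3) by (simp add: aperture_def)
  qed
  then show ?thesis using assms(2) by (simp add: corner_moment_def)
qed

text \<open>The situation is symmetric in the two sources; \<open>swap\<close> provides the mirror
  image of every one-sided result.\<close>

locale two_sources =
  fixes k :: real and \<rho> :: "real^2 \<Rightarrow> complex" and f f' :: "real^2 \<Rightarrow> real" and g :: "real^2 \<Rightarrow> complex" and x :: "real^2"
  assumes k: "0 < k" and \<rho>: "Linfty \<rho>" "compact (ess_support (\<lambda>x. \<rho> x - 1))"
    and f: "is_source f" "polygonal (total_support f)" "boundary_admissible_one_split f" "produces_far_field k \<rho> f g"
    and f': "is_source f'" "polygonal (total_support f')" "boundary_admissible_one_split f'" "produces_far_field k \<rho> f' g"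
    and x: "x \<in> frontier (outside (total_support f \<union> total_support f'))"
begin

lemma swap: "two_sources k \<rho> f' f g x"
  using k \<rho> f f' x by unfold_locales (simp_all add: Un_commute)

lemma moments_equal:
  assumes c: "one_split_corner f x a b p" and c': "one_split_corner f' x a' b' p'"
  shows "corner_moment a b p = corner_moment a' b' p'"
proof -
  obtain R C \<alpha> where 1: "R > 0" "C > 0" "\<alpha> > 0" "0 < b - a" "b - a < 2 * pi"
    "\<forall>r\<le>R. ball x r \<inter> interior (total_support f) = {y. y - x \<in> sector a b \<and> norm (y - x) < r}"
    "AE y in lborel. norm (y - x) < R \<longrightarrow> \<bar>f y - p * indicator (sector a b) (y - x)\<bar> \<le> C * norm (y - x) powr \<alpha>"
    using one_split_corner_local_form[OF f(1,2) c] by (elim exE conjE) (rule that; blast)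
  note 1 = 1[rule_format]
  obtain R' C' \<alpha>' where 2: "R' > 0" "C' > 0" "\<alpha>' > 0" "0 < b' - a'" "b' - a' < 2 * pi"
    "\<forall>r\<le>R'. ball x r \<inter> interior (total_support f') = {y. y - x \<in> sector a' b' \<and> norm (y - x) < r}"
    "AE y in lborel. norm (y - x) < R' \<longrightarrow> \<bar>f' y - p' * indicator (sector a' b') (y - x)\<bar> \<le> C' * norm (y - x) powr \<alpha>'"
    using one_split_corner_local_form[OF f'(1,2) c'] by (elim exE conjE) (rule that; blast)
  note 2 = 2[rule_format]
  \<comment> \<open>At distances below 1 a higher power is smaller, so both errors fit the smaller
    exponent and the larger constant.\<close>
  define r where "r = min 1 (min R R')"
  have r: "0 < r" "r \<le> R" "r \<le> R'" "r \<le> 1" using 1(1) 2(1) by (auto simp: r_def)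
  let ?C = "max C C'" and ?\<alpha> = "min \<alpha> \<alpha>'"
  have weaken: "c * n powr \<beta> \<le> ?C * n powr ?\<alpha>" if "c \<le> ?C" "?\<alpha> \<le> \<beta>" "0 \<le> n" "n \<le> 1" for c n \<beta>
  proof -
    have "n powr \<beta> \<le> n powr ?\<alpha>" using that by (intro powr_mono') auto
    then show ?thesis using that 1(2) by (intro mult_mono) auto
  qed
  let ?f = "\<lambda>j. if j then f else f'" and ?a = "\<lambda>j. if j then a else a'" and ?b = "\<lambda>j. if j then b else b'"
    and ?p = "\<lambda>j. if j then p else p'"
  have "complex_of_real (?p True * sin (?b True - ?a True)) * cis (- (?a True + ?b True))
       = complex_of_real (?p False * sin (?b False - ?a False)) * cis (- (?a False + ?b False))"
  proof (rule corner_moments_equal[where f = ?f and K = "\<lambda>j. sector (?a j) (?b j)" and R = r and C = ?C and \<alpha> = ?\<alpha> and k = k and \<rho> = \<rho> and g = g and x = x])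
    show "x \<in> frontier (outside (\<Union>j. total_support (?f j)))" using x by (simp add: UNIV_bool Un_commute)
    show "ball x r \<inter> interior (total_support (?f j)) = {y. y - x \<in> sector (?a j) (?b j) \<and> norm (y - x) < r}" for j
      using 1(6)[OF r(2)] 2(6)[OF r(3)] by simp
    show "sector (?a j) (?b j) \<subseteq> sector (?a True) (?b True) \<union> sector (?a False) (?b False)" for j by simp
    show "t *\<^sub>R z \<in> sector (?a j) (?b j)" if "t > 0" "z \<in> sector (?a j) (?b j)" for j t z
      using sector_scaleR[OF that(1)] that(2) by blast
    show "AE y in lborel. norm (y - x) < r \<longrightarrow>
      \<bar>?f j y - ?p j * indicator (sector (?a j) (?b j)) (y - x)\<bar> \<le> ?C * norm (y - x) powr ?\<alpha>" for j
      using 1(7) 2(7)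
    proof eventually_elim
      case (elim y)
      show ?case
        using elim r weaken[of C \<alpha> "norm (y - x)"] weaken[of C' \<alpha>' "norm (y - x)"] by (cases j) (auto intro: order_trans)
    qed
  qed (use k \<rho> f f' 1 2 r in auto)
  then show ?thesis by (simp add: corner_moment_def)
qed

lemma moment_eq_0:
  assumes c: "one_split_corner f x a b p" and c': "x \<notin> total_support f'"
  shows "corner_moment a b p = 0"
proof -
  obtain R C \<alpha> where 1: "R > 0" "C > 0" "\<alpha> > 0" "0 < b - a" "b - a < 2 * pi"
    "\<forall>r\<le>R. ball x r \<inter> interior (total_support f) = {y. y - x \<in> sector a b \<and> norm (y - x) < r}"
    "AE y in lborel. norm (y - x) < R \<longrightarrow> \<bar>f y - p * indicator (sector a b) (y - x)\<bar> \<le> C * norm (y - x) powr \<alpha>"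
    using one_split_corner_local_form[OF f(1,2) c] by (elim exE conjE) (rule that; blast)
  note 1 = 1[rule_format]
  obtain R' where 2: "R' > 0" "\<forall>r\<le>R'. ball x r \<inter> interior (total_support f') = {}"
    "AE y in lborel. norm (y - x) < R' \<longrightarrow> f' y = 0"
    using no_corner_local_form[OF f'(1) c'] by blast
  note 2 = 2[rule_format]
  define r where "r = min R R'"
  have r: "0 < r" "r \<le> R" "r \<le> R'" using 1(1) 2(1) by (auto simp: r_def)
  \<comment> \<open>The source that misses x enters with limiting value 0 on the same sector, so its
    side of the identity is 0.\<close>
  let ?f = "\<lambda>j. if j then f else f'" and ?p = "\<lambda>j. if j then p else 0" and ?K = "\<lambda>j. if j then sector a b else {}"
  have "complex_of_real (?p True * sin (b - a)) * cis (- (a + b)) = complex_of_real (?p False * sin (b - a)) * cis (- (a + b))"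
  proof (rule corner_moments_equal[where f = ?f and K = ?K and R = r and C = C and \<alpha> = \<alpha> and k = k and \<rho> = \<rho> and g = g and x = x
        and a = "\<lambda>_. a" and b = "\<lambda>_. b"])
    show "x \<in> frontier (outside (\<Union>j. total_support (?f j)))" using x by (simp add: UNIV_bool Un_commute)
    show "ball x r \<inter> interior (total_support (?f j)) = {y. y - x \<in> ?K j \<and> norm (y - x) < r}" for j
      using 1(6)[OF r(2)] 2(2)[OF r(3)] by simp
    show "t *\<^sub>R z \<in> ?K j" if "t > 0" "z \<in> ?K j" for j t z
      using sector_scaleR[OF that(1)] that(2) by (cases j) auto
    show "AE y in lborel. norm (y - x) < r \<longrightarrow>
      \<bar>?f j y - ?p j * indicator (sector a b) (y - x)\<bar> \<le> C * norm (y - x) powr \<alpha>" for j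
      using 1(7) 2(3)
    proof eventually_elim
      case (elim y)
      show ?case using elim r 1(2) by (cases j) auto
    qed
  qed (use k \<rho> f f' 1 r in auto)
  then show ?thesis by (simp add: corner_moment_def)
qed

lemma x_frontier: "x \<in> total_support f \<Longrightarrow> x \<in> frontier (total_support f)"
proof -
  assume "x \<in> total_support f"
  moreover have "outside (total_support f \<union> total_support f') \<subseteq> - total_support f"
    using outside_no_overlap[of "total_support f \<union> total_support f'"] by blast
  then have "x \<in> closure (- total_support f)" using x closure_mono unfolding frontier_def by blast
  ultimately show ?thesis
    using closure_subset unfolding frontier_closures by blast
qed

lemma vertex_moment_nonzero:
  assumes v: "is_vertex (total_support f) x"
  obtains a b p where "one_split_corner f x a b p" "corner_moment a b p \<noteq> 0"
proof -
  have "admissible_one_split_point f x"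
    using f(3) v x_frontier[OF is_vertex_imp_mem[OF v]] unfolding boundary_admissible_one_split_def by blast
  then obtain a b p where "one_split_corner f x a b p" "p \<noteq> 0" "aperture a b \<noteq> pi"
    unfolding admissible_one_split_point_def by blast
  then show ?thesis using corner_moment_admissible that by blast
qed

text \<open>The nonzero moment must be matched by the other source. So x lies in its support, and
  the corner there has nonzero sin \<omega>', which is impossible at a boundary point that is no
  vertex.\<close>

lemma vertex_shared:
  assumes v: "is_vertex (total_support f) x"
  shows "is_vertex (total_support f') x"
proof -
  interpret s: two_sources k \<rho> f' f g x by (rule swap)
  obtain a b p where c: "one_split_corner f x a b p" "corner_moment a b p \<noteq> 0" using vertex_moment_nonzero[OF v] .
  have "x \<in> total_support f'" using moment_eq_0[OF c(1)] c(2) by blast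
  then have "one_split_point f' x"
    using f'(3) s.x_frontier unfolding boundary_admissible_one_split_def by blast
  then obtain a' b' p' where c': "one_split_corner f' x a' b' p'" unfolding one_split_point_def by blast
  then have "corner_moment a' b' p' \<noteq> 0" using moments_equal[OF c(1) c'] c(2) by simp
  then have "sin (b' - a') \<noteq> 0" by (auto simp: corner_moment_def)
  then show ?thesis using c' corner_is_vertex[OF f'(2)] unfolding one_split_corner_def by blast
qed

end

theorem proposition3:
  fixes k :: real
    and \<rho> :: "real^2 \<Rightarrow> complex"
    and f\<^sub>1 f\<^sub>2 :: "real^2 \<Rightarrow> real"
    and u_inf :: "real^2 \<Rightarrow> complex"
    and \<Sigma>\<^sub>1 \<Sigma>\<^sub>2 :: "(real^2) set"
  assumes "0 < k"
    and "Linfty \<rho>" and "compact (ess_support (\<lambda>x. \<rho> x - 1))"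
    and "is_source f\<^sub>1" and "is_source f\<^sub>2"
    and "\<Sigma>\<^sub>1 = total_support f\<^sub>1" and "\<Sigma>\<^sub>2 = total_support f\<^sub>2"
    and "polygonal \<Sigma>\<^sub>1" and "polygonal \<Sigma>\<^sub>2"
    and "boundary_admissible_one_split f\<^sub>1" and "boundary_admissible_one_split f\<^sub>2"
    and "produces_far_field k \<rho> f\<^sub>1 u_inf" and "produces_far_field k \<rho> f\<^sub>2 u_inf"
  shows "\<forall>x'. (is_vertex \<Sigma>\<^sub>1 x' \<or> is_vertex \<Sigma>\<^sub>2 x') \<and> x' \<in> frontier \<Sigma>\<^sub>1 \<union> frontier \<Sigma>\<^sub>2 \<and>
            connects_to_infinity x' (\<Sigma>\<^sub>1 \<union> \<Sigma>\<^sub>2) \<longrightarrow>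
          is_vertex \<Sigma>\<^sub>1 x' \<and> is_vertex \<Sigma>\<^sub>2 x' \<and>
          (\<forall>\<theta>\<^sub>1\<^sub>0 \<theta>\<^sub>1\<^sub>1 p\<^sub>1 \<theta>\<^sub>2\<^sub>0 \<theta>\<^sub>2\<^sub>1 p\<^sub>2.
             one_split_corner f\<^sub>1 x' \<theta>\<^sub>1\<^sub>0 \<theta>\<^sub>1\<^sub>1 p\<^sub>1 \<and> one_split_corner f\<^sub>2 x' \<theta>\<^sub>2\<^sub>0 \<theta>\<^sub>2\<^sub>1 p\<^sub>2 \<longrightarrow>
             (\<exists>m::int.
                bisector_angle \<theta>\<^sub>1\<^sub>0 \<theta>\<^sub>1\<^sub>1 = bisector_angle \<theta>\<^sub>2\<^sub>0 \<theta>\<^sub>2\<^sub>1 + of_int m * pi / 2 \<and>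
                p\<^sub>1 * sin (aperture \<theta>\<^sub>1\<^sub>0 \<theta>\<^sub>1\<^sub>1) = (-1) powi m * p\<^sub>2 * sin (aperture \<theta>\<^sub>2\<^sub>0 \<theta>\<^sub>2\<^sub>1)))"
proof (intro allI impI conjI)
  fix x assume *: "(is_vertex \<Sigma>\<^sub>1 x \<or> is_vertex \<Sigma>\<^sub>2 x) \<and> x \<in> frontier \<Sigma>\<^sub>1 \<union> frontier \<Sigma>\<^sub>2 \<and>
    connects_to_infinity x (\<Sigma>\<^sub>1 \<union> \<Sigma>\<^sub>2)"
  interpret s: two_sources k \<rho> f\<^sub>1 f\<^sub>2 u_inf x
    using assms * by unfold_locales (simp_all add: connects_to_infinity_def)
  interpret t: two_sources k \<rho> f\<^sub>2 f\<^sub>1 u_inf x by (rule s.swap)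
  have v: "is_vertex \<Sigma>\<^sub>1 x" "is_vertex \<Sigma>\<^sub>2 x"
    using * s.vertex_shared t.vertex_shared unfolding assms(6,7) by blast+
  \<comment> \<open>A witness with nonzero moment. The angles and limiting values describing a
    corner at x are arbitrary here, but \<open>moments_equal\<close> holds for every pair of
    descriptions, so the nonvanishing passes from the witness to the given pair.\<close>
  obtain a b p where c: "one_split_corner f\<^sub>2 x a b p" "corner_moment a b p \<noteq> 0"
    using t.vertex_moment_nonzero v(2) unfolding assms(7) by blast
  show "is_vertex \<Sigma>\<^sub>1 x" "is_vertex \<Sigma>\<^sub>2 x" by (rule v)+
  fix a1 b1 p1 a2 b2 p2
  assume c12: "one_split_corner f\<^sub>1 x a1 b1 p1 \<and> one_split_corner f\<^sub>2 x a2 b2 p2"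
  have "corner_moment a1 b1 p1 = corner_moment a2 b2 p2" using s.moments_equal c12 by blast
  moreover have "corner_moment a1 b1 p1 \<noteq> 0" using s.moments_equal[of a1 b1 p1 a b p] c c12 by simp
  ultimately show "\<exists>m::int. bisector_angle a1 b1 = bisector_angle a2 b2 + of_int m * pi / 2 \<and>
    p1 * sin (aperture a1 b1) = (-1) powi m * p2 * sin (aperture a2 b2)"
    by (rule corner_moment_eq_imp)
qed

end
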